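(* Let $D\subset\mathbb{C}^n$ be a strongly $\alpha$-regular domain, let $K\subset D$ be a compact set, and let $\psi:K\to\mathbb{R}$ be a Hölder continuous function with $\psi<0$ on $K$ which admits a negative $\alpha$-subharmonic extension to $D$ (some $\widetilde\psi\in\alpha\text{-}sh(D)$ with $\widetilde\psi<0$ on $D$ and $\widetilde\psi|_K=\psi$). Then $\omega_\alpha(\cdot,K,D,\psi)$ is Hölder continuous in $D$ if and only if there exist constants $C>0$ and $0<\lambda\le1$ and a neighborhood $V$ of $K$ such that \[ |\omega_\alpha(z,K,D,\psi)-\psi(w)|\le C\,(\operatorname{dist}(z,K))^{\lambda} \] for every $z\in V\cap D$ and every point $w\in K$ with $|z-w|=\operatorname{dist}(z,K)$.
   Context: Fix a closed, strictly positive differential form $\alpha$ of bidegree $(n-1,n-1)$ with $C^1$ coefficients on an open subset of $\mathbb{C}^n$ containing all sets considered. Let $d=\partial+\bar\partial$, $d^c=(\bar\partial-\partial)/(4i)$. For an open set $\Omega$, $u\in L^1_{loc}(\Omega)$ is $\alpha$-subharmonic ($u\in\alpha\text{-}sh(\Omega)$) if it is strongly upper semicontinuous (upper semicontinuous, and for every $z^0\in\Omega$ and every set $A$ of full Lebesgue measure near $z^0$, $\limsup_{z\to z^0,z\in A}u(z)=u(z^0)$) and $\int u\,\alpha\wedge dd^c\omega\ge0$ for every nonnegative test function $\omega$; $u\equiv-\infty$ is also allowed. $u$ is strictly $\alpha$-subharmonic in $\Omega$ if for every $G\Subset\Omega$ there is $\varepsilon>0$ with $u-\varepsilon|z|^2\in\alpha\text{-}sh(G)$.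 A bounded domain $D$ is strongly $\alpha$-regular if there exist a neighborhood $D^+$ of $\overline D$ and $\rho\in\alpha\text{-}sh(D^+)\cap C^2(D^+)$, strictly $\alpha$-subharmonic in $D^+$, with $\rho<0$ on $D$ and $\rho(z)\to0$ as $z\to\partial D$. For $E\subset D$ and bounded $\psi$ on $E$ with $\sup_E\psi<0$, $\mathcal U(E,D,\psi)$ is the class of $u\in\alpha\text{-}sh(D)$ with $u<0$ on $D$ and $u\le\psi$ on $E$, and $\omega_\alpha(z,E,D,\psi)=\sup\{u(z):u\in\mathcal U(E,D,\psi)\}$. *)

theory Defs
  imports "HOL-Analysis.Analysis" "HOL-Library.Liminf_Limsup"
begin

text \<open>Points of C^n are modelled as complex^'n (Euclidean norm). A (n-1,n-1)-form
  alpha is represented by its coefficient matrix a z (complex^'n^'n), normalised so that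
  alpha /\ dd^c u = c_n * (sum_{j,k} a_jk * d^2 u/(dz_j d conj z_k)) dV with c_n > 0.\<close>

type_synonym 'n cvec = "complex ^ 'n"
type_synonym 'n coefmat = "'n cvec \<Rightarrow> complex ^ 'n ^ 'n"

fun Ck :: "nat \<Rightarrow> ('a::real_normed_vector \<Rightarrow> 'b::real_normed_vector) \<Rightarrow> 'a set \<Rightarrow> bool" where
  "Ck 0 f S = continuous_on S f"
| "Ck (Suc k) f S = (f differentiable_on S \<and>
      (\<forall>v. Ck k (\<lambda>x. frechet_derivative f (at x) v) S))"

definition smooth_on :: "('a::real_normed_vector \<Rightarrow> 'b::real_normed_vector) \<Rightarrow> 'a set \<Rightarrow> bool" where
  "smooth_on f S = (\<forall>k. Ck k f S)"

definition ex :: "'n::finite \<Rightarrow> 'n cvec" where "ex j = axis j 1"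
definition ey :: "'n::finite \<Rightarrow> 'n cvec" where "ey j = axis j \<i>"

definition d1 :: "('n::finite cvec \<Rightarrow> 'b::real_normed_vector) \<Rightarrow> 'n cvec \<Rightarrow> 'n cvec \<Rightarrow> 'b" where
  "d1 f z v = frechet_derivative f (at z) v"

definition d2 :: "('n::finite cvec \<Rightarrow> 'b::real_normed_vector) \<Rightarrow> 'n cvec \<Rightarrow> 'n cvec \<Rightarrow> 'n cvec \<Rightarrow> 'b" where
  "d2 f z v w = frechet_derivative (\<lambda>y. frechet_derivative f (at y) v) (at z) w"

definition dz :: "('n::finite cvec \<Rightarrow> complex) \<Rightarrow> 'n \<Rightarrow> 'n cvec \<Rightarrow> complex" where
  "dz f j z = (d1 f z (ex j) - \<i> * d1 f z (ey j)) / 2"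
definition dzbar :: "('n::finite cvec \<Rightarrow> complex) \<Rightarrow> 'n \<Rightarrow> 'n cvec \<Rightarrow> complex" where
  "dzbar f j z = (d1 f z (ex j) + \<i> * d1 f z (ey j)) / 2"

definition ddbar :: "('n::finite cvec \<Rightarrow> real) \<Rightarrow> 'n \<Rightarrow> 'n \<Rightarrow> 'n cvec \<Rightarrow> complex" where
  "ddbar w j k z = (complex_of_real (d2 w z (ex j) (ex k) + d2 w z (ey j) (ey k))
       + \<i> * complex_of_real (d2 w z (ex j) (ey k) - d2 w z (ey j) (ex k))) / 4"

text \<open>density of alpha /\ dd^c w w.r.t. Lebesgue measure (up to the positive constant c_n)\<close>
definition Lop :: "'n::finite coefmat \<Rightarrow> ('n cvec \<Rightarrow> real) \<Rightarrow> 'n cvec \<Rightarrow> real" where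
  "Lop a w z = Re (\<Sum>j\<in>UNIV. \<Sum>k\<in>UNIV. a z $ j $ k * ddbar w j k z)"

text \<open>Standing assumption: alpha is a closed, strictly positive (n-1,n-1)-form with C^1
  coefficients on the open set U.  Strict positivity = coefficient matrix Hermitian positive
  definite; closedness d alpha = 0 (i.e. del alpha = 0 and delbar alpha = 0) in coefficients.\<close>
definition alpha_form :: "'n::finite coefmat \<Rightarrow> 'n cvec set \<Rightarrow> bool" where
  "alpha_form a U \<longleftrightarrow> open U \<and> Ck 1 a U \<and>
     (\<forall>z\<in>U. \<forall>j k. a z $ j $ k = cnj (a z $ k $ j)) \<and>
     (\<forall>z\<in>U. \<forall>v::'n cvec. v \<noteq> 0 \<longrightarrow>
         0 < Re (\<Sum>j\<in>UNIV. \<Sum>k\<in>UNIV. cnj (v $ j) * a z $ j $ k * v $ k)) \<and>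
     (\<forall>z\<in>U. \<forall>k. (\<Sum>j\<in>UNIV. dz (\<lambda>y. a y $ j $ k) j z) = 0) \<and>
     (\<forall>z\<in>U. \<forall>j. (\<Sum>k\<in>UNIV. dzbar (\<lambda>y. a y $ j $ k) k z) = 0)"

definition test_fun :: "'n::finite cvec set \<Rightarrow> ('n cvec \<Rightarrow> real) \<Rightarrow> bool" where
  "test_fun \<Omega> w \<longleftrightarrow> smooth_on w UNIV \<and> (\<forall>z. 0 \<le> w z) \<and>
     compact (closure {z. w z \<noteq> 0}) \<and> closure {z. w z \<noteq> 0} \<subseteq> \<Omega>"

definition strongly_usc :: "'n::finite cvec set \<Rightarrow> ('n cvec \<Rightarrow> ereal) \<Rightarrow> bool" where
  "strongly_usc \<Omega> u \<longleftrightarrow>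
     (\<forall>z0\<in>\<Omega>. Limsup (at z0 within \<Omega>) u \<le> u z0) \<and>
     (\<forall>z0\<in>\<Omega>. \<forall>A. (\<exists>r>0. ball z0 r - A \<in> null_sets lebesgue) \<longrightarrow>
         Limsup (at z0 within (A \<inter> \<Omega>)) u = u z0)"

definition loc_integrable :: "'n::finite cvec set \<Rightarrow> ('n cvec \<Rightarrow> ereal) \<Rightarrow> bool" where
  "loc_integrable \<Omega> u \<longleftrightarrow>
     (AE z in lebesgue. z \<in> \<Omega> \<longrightarrow> \<bar>u z\<bar> \<noteq> \<infinity>) \<and>
     (\<forall>K. compact K \<and> K \<subseteq> \<Omega> \<longrightarrow> set_integrable lebesgue K (\<lambda>z. real_of_ereal (u z)))"

definition alpha_sh :: "'n::finite coefmat \<Rightarrow> 'n cvec set \<Rightarrow> ('n cvec \<Rightarrow> ereal) \<Rightarrow> bool" where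
  "alpha_sh a \<Omega> u \<longleftrightarrow> (\<forall>z\<in>\<Omega>. u z = -\<infinity>) \<or>
     ((\<forall>z\<in>\<Omega>. u z \<noteq> \<infinity>) \<and> loc_integrable \<Omega> u \<and> strongly_usc \<Omega> u \<and>
      (\<forall>w. test_fun \<Omega> w \<longrightarrow>
          0 \<le> (\<integral>z. real_of_ereal (u z) * Lop a w z \<partial>lebesgue)))"

definition strictly_alpha_sh :: "'n::finite coefmat \<Rightarrow> 'n cvec set \<Rightarrow> ('n cvec \<Rightarrow> ereal) \<Rightarrow> bool" where
  "strictly_alpha_sh a \<Omega> u \<longleftrightarrow>
     (\<forall>G. open G \<and> compact (closure G) \<and> closure G \<subseteq> \<Omega> \<longrightarrow>
        (\<exists>\<epsilon>>0. alpha_sh a G (\<lambda>z. u z - ereal (\<epsilon> * (norm z)\<^sup>2))))"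

definition strongly_alpha_regular :: "'n::finite coefmat \<Rightarrow> 'n cvec set \<Rightarrow> 'n cvec set \<Rightarrow> bool" where
  "strongly_alpha_regular a U D \<longleftrightarrow> open D \<and> connected D \<and> D \<noteq> {} \<and> bounded D \<and>
     (\<exists>Dp \<rho>. open Dp \<and> closure D \<subseteq> Dp \<and> Dp \<subseteq> U \<and>
        alpha_sh a Dp (\<lambda>z. ereal (\<rho> z)) \<and> Ck 2 \<rho> Dp \<and>
        strictly_alpha_sh a Dp (\<lambda>z. ereal (\<rho> z)) \<and>
        (\<forall>z\<in>D. \<rho> z < 0) \<and>
        (\<forall>\<xi>\<in>frontier D. (\<rho> \<longlongrightarrow> 0) (at \<xi> within D)))"

definition U_class :: "'n::finite coefmat \<Rightarrow> 'n cvec set \<Rightarrow> 'n cvec set \<Rightarrow> ('n cvec \<Rightarrow> real)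
    \<Rightarrow> ('n cvec \<Rightarrow> ereal) set" where
  "U_class a E D \<psi> = {u. alpha_sh a D u \<and> (\<forall>z\<in>D. u z < 0) \<and> (\<forall>z\<in>E. u z \<le> ereal (\<psi> z))}"

definition omega_alpha :: "'n::finite coefmat \<Rightarrow> 'n cvec set \<Rightarrow> 'n cvec set \<Rightarrow> ('n cvec \<Rightarrow> real)
    \<Rightarrow> 'n cvec \<Rightarrow> ereal" where
  "omega_alpha a E D \<psi> z = (SUP u\<in>U_class a E D \<psi>. u z)"

definition hoelder_on :: "'a::metric_space set \<Rightarrow> ('a \<Rightarrow> real) \<Rightarrow> bool" where
  "hoelder_on S f \<longleftrightarrow> (\<exists>C \<gamma>. C > 0 \<and> 0 < \<gamma> \<and> \<gamma> \<le> 1 \<and>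
     (\<forall>z\<in>S. \<forall>w\<in>S. \<bar>f z - f w\<bar> \<le> C * (dist z w) powr \<gamma>))"

definition hoelder_on_ereal :: "'a::metric_space set \<Rightarrow> ('a \<Rightarrow> ereal) \<Rightarrow> bool" where
  "hoelder_on_ereal S f \<longleftrightarrow> (\<forall>z\<in>S. \<bar>f z\<bar> \<noteq> \<infinity>) \<and> hoelder_on S (\<lambda>z. real_of_ereal (f z))"

end

theory Submission
  imports Defs
begin

text \<open>The direct implication is immediate, because \<open>\<omega>\<close> equals \<open>\<psi>\<close> on \<open>K\<close>: the extension \<open>\<psi>t\<close> is a competitor.

For the converse, write \<open>\<alpha> \<and> dd\<^sup>c u = L u dV\<close>. Since \<open>\<alpha>\<close> is closed, \<open>L\<close> is a divergence-free, hence formally self-adjoint,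
elliptic operator with \<open>C\<^sup>1\<close> coefficients. A parametrix and a truncated Neumann series provide, at scale \<open>\<delta>\<close>, a positive,
almost symmetric operator \<open>S\<close> with a kernel of range \<open>R \<approx> N \<delta>\<close> that approximates the resolvent \<open>\<lambda> (\<lambda> - L)\<^sup>-\<^sup>1\<close>,
\<open>\<lambda> = 1 / \<delta>\<^sup>2\<close>, up to errors \<open>\<theta>\<^sup>N\<close> with \<open>\<theta> < 1\<close>. It sends bounded functions to Lipschitz functions with constant
\<open>C / \<delta>\<close>. Given a competitor \<open>u\<close>, let \<open>f\<close> be the maximum of \<open>u - c\<^sub>1\<close> and \<open>\<beta> \<rho> - c\<^sub>2\<close>. Testing the subsolutions against \<open>S \<phi>\<close>
and using symmetry gives \<open>S f \<ge> f - C \<theta>\<^sup>N\<close> and \<open>L S f \<ge> - C \<theta>\<^sup>N / \<delta>\<^sup>2\<close>, so \<open>S f + \<eta> \<rho> - c\<^sub>3\<close> is again a competitor, where the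
estimate near \<open>K\<close> controls \<open>c\<^sub>3\<close>. Comparing values at \<open>z\<close> and \<open>w\<close> yields
\<open>\<omega>(z) - \<omega>(w) \<le> C (|z - w| / \<delta> + R\<^sup>\<gamma> + \<theta>\<^sup>N / \<delta>\<^sup>2)\<close>, and \<open>\<delta> = |z - w|\<^sup>1\<^sup>/\<^sup>2\<close>, \<open>N \<approx> \<delta>\<^sup>-\<^sup>1\<^sup>/\<^sup>2\<close> gives a Hoelder estimate.\<close>

section \<open>Calculus of compactly supported functions\<close>

text \<open>With variable coefficients a translate of a competitor is in general no competitor, so
  equicontinuity cannot be had by translation; smoothing replaces it, and its Lipschitz gain has to
  beat its losses. Competitors are merely locally integrable and known through test functions, so a
  competitor is compared with its smoothing by putting \<open>S\<close> on the test function. This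
  is why symmetry of \<open>S\<close> matters as much as ellipticity. Smoothing near the boundary of
  D would need values outside D. There the competitor is overtaken by a shifted multiple of \<rho>,
  which lives on a neighbourhood of the closure. Each of the two functions is tested on its own
  piece, so no statement about maxima of subsolutions is invoked. The bound \<theta> < 1 has a
  simple source: with coefficients frozen at the pole, the Laplacian part of the parametrix has mass
  exactly 1, the zero-order term 1 / \<delta>^2 removes a fixed share \<open>b0\<close> of it, and
  the variation of the coefficients puts back only O(\<delta>).\<close>

definition Dd :: "('a::real_normed_vector \<Rightarrow> 'b::real_normed_vector) \<Rightarrow> 'a \<Rightarrow> 'a \<Rightarrow> 'b" where
  "Dd f v = (\<lambda>x. frechet_derivative f (at x) v)"

lemma Ck_Suc_iff: "Ck (Suc k) f S \<longleftrightarrow> f differentiable_on S \<and> (\<forall>v. Ck k (Dd f v) S)"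
  by (simp add: Dd_def)

declare Ck.simps(2) [simp del]

lemma has_derivative_Dd:
  assumes "f differentiable_on S" "open S" "x \<in> S"
  shows "(f has_derivative (\<lambda>v. Dd f v x)) (at x)"
  using assms unfolding Dd_def
  by (simp add: differentiable_on_eq_differentiable_at flip: frechet_derivative_works)

lemma Dd_unique:
  assumes "(f has_derivative f') (at x)"
  shows "Dd f v x = f' v"
  using frechet_derivative_at[OF assms] by (simp add: Dd_def)

text \<open>\<open>frechet_derivative\<close> is taken \<open>at x\<close>, so the derivatives of f
  and g at a point of S agree because S contains a ball around it.\<close>

lemma Ck_cong:
  assumes "open S" "\<And>x. x \<in> S \<Longrightarrow> f x = g x" "Ck k f S"
  shows "Ck k g S"
  using assms(2,3)
proof (induction k arbitrary: f g)
  case 0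
  then show ?case by (simp cong: continuous_on_cong)
next
  case (Suc k)
  have der: "(g has_derivative (\<lambda>v. Dd f v x)) (at x)" if "x \<in> S" for x
    using has_derivative_transform_within_open[OF has_derivative_Dd[of f S x] assms(1) that]
      Suc.prems that assms(1) unfolding Ck_Suc_iff by blast
  then have "g differentiable_on S"
    by (meson assms(1) differentiable_def differentiable_on_eq_differentiable_at)
  moreover have "Ck k (Dd g v) S" for v
    using Suc.IH[of "Dd f v" "Dd g v"] Suc.prems(2) Dd_unique[OF der] by (simp add: Ck_Suc_iff)
  ultimately show ?case by (simp add: Ck_Suc_iff)
qed

lemma Ck_SucD: "Ck (Suc k) f S \<Longrightarrow> Ck k f S"
proof (induction k arbitrary: f)
  case 0 then show ?case by (simp add: Ck_Suc_iff differentiable_imp_continuous_on)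
next
  case (Suc k) then show ?case by (subst Ck_Suc_iff) (metis Ck_Suc_iff)
qed

lemma Ck_continuous: "Ck k f S \<Longrightarrow> continuous_on S f"
  by (induction k) (auto dest: Ck_SucD)

lemma Ck_subset:
  assumes "open S" "open T" "T \<subseteq> S" "Ck k f S"
  shows "Ck k f T"
  using assms(4)
proof (induction k arbitrary: f)
  case 0 then show ?case using assms by (auto intro: continuous_on_subset)
next
  case (Suc k) then show ?case using assms
    by (auto simp: Ck_Suc_iff intro: differentiable_on_subset)
qed

lemma Ck_const [simp]:
  assumes "open S" shows "Ck k (\<lambda>x. c) S"
proof (induction k arbitrary: c)
  case (Suc k)
  have "Dd (\<lambda>x. c) v = (\<lambda>x. 0)" for v :: 'a by (simp add: Dd_def)
  then show ?case using Suc by (simp add: Ck_Suc_iff)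
qed simp

lemma Ck_add:
  assumes "open S" "Ck k f S" "Ck k g S"
  shows "Ck k (\<lambda>x. f x + g x) S"
  using assms(2,3)
proof (induction k arbitrary: f g)
  case 0 then show ?case by (simp add: continuous_on_add)
next
  case (Suc k)
  have der: "((\<lambda>x. f x + g x) has_derivative (\<lambda>v. Dd f v x + Dd g v x)) (at x)" if "x \<in> S" for x
    using Suc.prems that assms(1) by (auto simp: Ck_Suc_iff intro!: has_derivative_add has_derivative_Dd)
  have "Ck k (Dd (\<lambda>x. f x + g x) v) S" for v
    by (rule Ck_cong[OF assms(1), of "\<lambda>x. Dd f v x + Dd g v x"])
      (use Suc Dd_unique[OF der] in \<open>auto simp: Ck_Suc_iff\<close>)
  then show ?case using Suc.prems by (auto simp: Ck_Suc_iff intro: differentiable_on_add)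
qed

lemma Ck_mult:
  fixes f g :: "'a::real_normed_vector \<Rightarrow> real"
  assumes "open S" "Ck k f S" "Ck k g S"
  shows "Ck k (\<lambda>x. f x * g x) S"
  using assms(2,3)
proof (induction k arbitrary: f g)
  case 0 then show ?case by (simp add: continuous_on_mult)
next
  case (Suc k)
  have der: "((\<lambda>x. f x * g x) has_derivative (\<lambda>v. f x * Dd g v x + Dd f v x * g x)) (at x)" if "x \<in> S" for x
    using Suc.prems that assms(1) by (auto simp: Ck_Suc_iff intro!: has_derivative_mult has_derivative_Dd)
  have "Ck k (Dd (\<lambda>x. f x * g x) v) S" for v
  proof (rule Ck_cong[OF assms(1), where f="\<lambda>x. f x * Dd g v x + Dd f v x * g x"])
    show "Ck k (\<lambda>x. f x * Dd g v x + Dd f v x * g x) S"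
      using Suc.prems Ck_SucD[OF Suc.prems(1)] Ck_SucD[OF Suc.prems(2)]
      by (intro Ck_add assms(1) Suc.IH) (auto simp: Ck_Suc_iff[of k])
  qed (simp add: Dd_unique[OF der])
  moreover have "(\<lambda>x. f x * g x) differentiable_on S"
    using der assms(1) by (meson differentiable_def differentiable_on_eq_differentiable_at)
  ultimately show ?case by (auto simp: Ck_Suc_iff)
qed

lemma Ck2_iff: "Ck 2 f S \<longleftrightarrow> f differentiable_on S \<and> (\<forall>v. Dd f v differentiable_on S) \<and>
    (\<forall>v w. continuous_on S (Dd (Dd f v) w))"
  by (auto simp: numeral_2_eq_2 Ck_Suc_iff)

lemma Ck2I:
  assumes S: "open S"
    and 1: "\<And>x. x \<in> S \<Longrightarrow> (f has_derivative f' x) (at x)"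
    and 2: "\<And>x v. x \<in> S \<Longrightarrow> ((\<lambda>y. f' y v) has_derivative f'' x v) (at x)"
    and 3: "\<And>v w. continuous_on S (\<lambda>x. f'' x v w)"
  shows "Ck 2 f S" "x \<in> S \<Longrightarrow> Dd f v x = f' x v" "x \<in> S \<Longrightarrow> Dd (Dd f v) w x = f'' x v w"
proof -
  show D1: "Dd f v x = f' x v" if "x \<in> S" for x v by (rule Dd_unique[OF 1[OF that]])
  have der: "(Dd f v has_derivative f'' x v) (at x)" if "x \<in> S" for x v
    by (rule has_derivative_transform_within_open[OF 2[OF that] S that]) (simp add: D1)
  show D2: "Dd (Dd f v) w x = f'' x v w" if "x \<in> S" for x v w by (rule Dd_unique[OF der[OF that]])
  have "continuous_on S (Dd (Dd f v) w)" for v w using 3[of v w] by (simp add: D2 cong: continuous_on_cong)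
  moreover have "Dd f v differentiable_on S" for v using der S
    by (meson differentiable_def differentiable_on_eq_differentiable_at)
  moreover have "f differentiable_on S" using 1 S
    by (meson differentiable_def differentiable_on_eq_differentiable_at)
  ultimately show "Ck 2 f S" by (simp add: Ck2_iff)
qed

text \<open>Test functions of class C^2: the regularised parametrix is no smoother, since its weight
  \<open>wf\<close> has only one continuous derivative. The compact set is existential so that any
  convenient set containing the support may be supplied.\<close>

definition C2c :: "'a::euclidean_space set \<Rightarrow> ('a \<Rightarrow> real) \<Rightarrow> bool" where
  "C2c \<Omega> f \<longleftrightarrow> Ck 2 f UNIV \<and> (\<exists>K. compact K \<and> K \<subseteq> \<Omega> \<and> (\<forall>x. x \<notin> K \<longrightarrow> f x = 0))"

text \<open>Non-divergence form, without first-order terms; vanishing divergence of the coefficients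
  makes it coincide with the divergence form, which \<open>green\<close> exploits.\<close>

definition Lg :: "('a::euclidean_space \<Rightarrow> 'a \<Rightarrow> 'a) \<Rightarrow> ('a \<Rightarrow> real) \<Rightarrow> 'a \<Rightarrow> real" where
  "Lg A f z = (\<Sum>i\<in>Basis. \<Sum>j\<in>Basis. (A z i \<bullet> j) * Dd (Dd f i) j z)"

lemma Dd_zero_outside:
  assumes "closed K" "\<And>x. x \<notin> K \<Longrightarrow> f x = 0" "x \<notin> K"
  shows "Dd f v x = 0"
proof -
  have "(f has_derivative (\<lambda>_. 0)) (at x)"
    by (rule has_derivative_transform_within_open[of "\<lambda>_. 0" _ _ _ "- K"]) (use assms in auto)
  then show ?thesis by (rule Dd_unique)
qed

lemma Lg_zero_outside:
  assumes "closed K" "\<And>x. x \<notin> K \<Longrightarrow> f x = 0" "x \<notin> K"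
  shows "Lg A f x = 0"
  unfolding Lg_def
  by (intro sum.neutral ballI) (simp add: Dd_zero_outside[OF assms(1) Dd_zero_outside[OF assms(1,2)] assms(3)])

lemma integrable_continuous_compact_support:
  fixes f :: "'a::euclidean_space \<Rightarrow> real"
  assumes "compact K" "continuous_on K f" "\<And>x. x \<notin> K \<Longrightarrow> f x = 0"
  shows "integrable lborel f" "f \<in> borel_measurable borel" "\<exists>B. \<forall>x. \<bar>f x\<bar> \<le> B"
proof -
  have eq: "(\<lambda>x. indicator K x *\<^sub>R f x) = f" using assms(3) by (fastforce simp: indicator_def)
  show "integrable lborel f" using borel_integrable_compact[OF assms(1,2)] by (simp only: eq)
  then show "f \<in> borel_measurable borel" by (auto dest: borel_measurable_integrable)
  have "bounded (f ` K)" using assms by (intro compact_imp_bounded compact_continuous_image)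
  then obtain B where "\<forall>x\<in>K. \<bar>f x\<bar> \<le> B" by (auto simp: bounded_iff)
  then have "\<bar>f x\<bar> \<le> max B 0" for x using assms(3)[of x] by (cases "x \<in> K") (auto simp: le_max_iff_disj)
  then show "\<exists>B. \<forall>x. \<bar>f x\<bar> \<le> B" by blast
qed

text \<open>Dominated convergence of the difference quotients along sequences. Convexity of S turns
  the bound on \<open>k'\<close> into a Lipschitz bound by the mean value inequality, and this
  supplies the majorant.\<close>

lemma has_derivative_integral:
  fixes k :: "'a::{real_normed_vector,perfect_space} \<Rightarrow> 'b \<Rightarrow> real"
  assumes S: "open S" "convex S" "z \<in> S"
    and int: "\<And>z. z \<in> S \<Longrightarrow> integrable M (k z)"
    and der: "\<And>z y. z \<in> S \<Longrightarrow> ((\<lambda>z. k z y) has_derivative k' z y) (at z)"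
    and meas: "\<And>v. (\<lambda>y. k' z y v) \<in> borel_measurable M"
    and bd: "\<And>z y v. z \<in> S \<Longrightarrow> \<bar>k' z y v\<bar> \<le> G y * norm v"
    and G: "integrable M G"
  shows "((\<lambda>z. \<integral>y. k z y \<partial>M) has_derivative (\<lambda>v. \<integral>y. k' z y v \<partial>M)) (at z)"
proof -
  have lin: "bounded_linear (k' z y)" for y using der[OF S(3)] has_derivative_bounded_linear by blast
  have int': "integrable M (\<lambda>y. k' z y v)" for v
    by (rule Bochner_Integration.integrable_bound[of _ "\<lambda>y. G y * norm v"])
      (use G meas in \<open>auto intro!: AE_I2 simp: order_trans[OF bd[OF S(3)] abs_ge_self]\<close>)
  have mv: "\<bar>k z1 y - k z2 y\<bar> \<le> G y * norm (z1 - z2)" if "z1 \<in> S" "z2 \<in> S" for z1 z2 y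
  proof -
    have "norm (k z1 y - k z2 y) \<le> G y * norm (z1 - z2)"
    proof (rule differentiable_bound[OF S(2) _ _ that])
      show "((\<lambda>z. k z y) has_derivative k' x y) (at x within S)" if "x \<in> S" for x
        using der[OF that] has_derivative_at_withinI by blast
      show "onorm (k' x y) \<le> G y" if "x \<in> S" for x
        by (rule onorm_le) (simp add: bd[OF that])
    qed
    then show ?thesis by simp
  qed
  show ?thesis
    unfolding has_derivative_at
  proof
    have lin: "linear (k' z y)" for y using lin bounded_linear.linear by blast
    have L: "linear (\<lambda>v. \<integral>y. k' z y v \<partial>M)"
      by (rule linearI) (simp_all add: linear_add[OF lin] linear_scale[OF lin] int')
    have "\<bar>\<integral>y. k' z y v \<partial>M\<bar> \<le> norm v * (\<integral>y. G y \<partial>M)" for v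
    proof -
      have "\<bar>\<integral>y. k' z y v \<partial>M\<bar> \<le> (\<integral>y. G y * norm v \<partial>M)"
        by (rule order_trans[OF integral_abs_bound], rule integral_mono) (use int' G bd[OF S(3)] in auto)
      then show ?thesis by (simp add: mult.commute)
    qed
    then show "bounded_linear (\<lambda>v. \<integral>y. k' z y v \<partial>M)"
      by (intro bounded_linear_intro[where K="\<integral>y. G y \<partial>M"])
        (auto simp: linear_add[OF L] linear_scale[OF L])
    show "(\<lambda>h. norm ((\<integral>y. k (z + h) y \<partial>M) - (\<integral>y. k z y \<partial>M) - (\<integral>y. k' z y h \<partial>M)) / norm h) \<midarrow>0\<rightarrow> 0"
      unfolding tendsto_at_iff_sequentially
    proof (intro allI impI)
      fix h :: "nat \<Rightarrow> 'a" assume h0: "\<forall>i. h i \<in> UNIV - {0}" and hl: "h \<longlonglongrightarrow> 0"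
      have "(\<lambda>i. z + h i) \<longlonglongrightarrow> z" using tendsto_add[OF tendsto_const[of z] hl] by simp
      then have "\<forall>\<^sub>F i in sequentially. z + h i \<in> S" using S(1,3) topological_tendstoD by blast
      then obtain n0 where n0: "\<And>i. z + h (i + n0) \<in> S"
        unfolding eventually_sequentially using le_add2 by blast
      define g where "g i = h (i + n0)" for i
      have g: "g i \<noteq> 0" "z + g i \<in> S" for i using h0 n0 by (auto simp: g_def)
      have gl: "filterlim g (at 0) sequentially" unfolding filterlim_at
        using LIMSEQ_ignore_initial_segment[OF hl, of n0] g by (simp add: g_def[abs_def])
      define F where "F i y = (k (z + g i) y - k z y - k' z y (g i)) / norm (g i)" for i y
      have "(\<lambda>i. \<integral>y. F i y \<partial>M) \<longlonglongrightarrow> (\<integral>y. 0 \<partial>M)"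
      proof (rule integral_dominated_convergence[where w="\<lambda>y. 2 * G y"])
        show "F i \<in> borel_measurable M" for i
          unfolding F_def[abs_def] using int[OF g(2), of i] int[OF S(3)] meas
          by (intro borel_measurable_divide borel_measurable_diff) auto
        show "integrable M (\<lambda>y. 2 * G y)" using G by simp
        show "AE x in M. (\<lambda>i. F i x) \<longlonglongrightarrow> 0"
        proof (rule AE_I2)
          fix y
          have "(\<lambda>h. norm (k (z + h) y - k z y - k' z y h) / norm h) \<midarrow>0\<rightarrow> 0"
            using der[OF S(3), of y] unfolding has_derivative_at by simp
          from filterlim_compose[OF this gl] have "(\<lambda>i. norm (F i y)) \<longlonglongrightarrow> 0"
            by (simp add: F_def)
          then show "(\<lambda>i. F i y) \<longlonglongrightarrow> 0" by (rule tendsto_norm_zero_cancel)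
        qed
        \<comment> \<open>One G comes from the increment of \<open>k\<close>, the other from its
          linear part.\<close>
        show "AE x in M. norm (F i x) \<le> 2 * G x" for i
        proof (rule AE_I2)
          fix y
          have "\<bar>k (z + g i) y - k z y - k' z y (g i)\<bar> \<le> 2 * G y * norm (g i)"
            using mv[OF g(2)[of i] S(3), of y] bd[OF S(3), of y "g i"] by auto
          then show "norm (F i y) \<le> 2 * G y" using g by (simp add: F_def divide_simps)
        qed
      qed simp
      then have "(\<lambda>i. norm (\<integral>y. F i y \<partial>M)) \<longlonglongrightarrow> 0" using tendsto_norm_zero by fastforce
      moreover have "(\<integral>y. F i y \<partial>M) = ((\<integral>y. k (z + g i) y \<partial>M) - (\<integral>y. k z y \<partial>M) - (\<integral>y. k' z y (g i) \<partial>M)) / norm (g i)" for i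
        unfolding F_def using int[OF g(2), of i] int[OF S(3)] int' by simp
      ultimately have "(\<lambda>i. norm ((\<integral>y. k (z + g i) y \<partial>M) - (\<integral>y. k z y \<partial>M) - (\<integral>y. k' z y (g i) \<partial>M)) / norm (g i)) \<longlonglongrightarrow> 0"
        by simp
      then show "((\<lambda>h. norm ((\<integral>y. k (z + h) y \<partial>M) - (\<integral>y. k z y \<partial>M) - (\<integral>y. k' z y h \<partial>M)) / norm h) \<circ> h) \<longlonglongrightarrow> 0"
        unfolding g_def o_def by (rule LIMSEQ_offset)
    qed
  qed
qed

lemma integral_lborel_translate:
  fixes f :: "'a::euclidean_space \<Rightarrow> real"
  assumes "f \<in> borel_measurable borel"
  shows "(\<integral>x. f (c + x) \<partial>lborel) = (\<integral>x. f x \<partial>lborel)"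
  using integral_distr[of "(+) c" lborel borel f] assms by (simp add: lborel_distr_plus)

lemma integrable_lborel_translate:
  fixes f :: "'a::euclidean_space \<Rightarrow> real"
  assumes "integrable lborel f"
  shows "integrable lborel (\<lambda>x. f (c + x))"
  using integrable_distr[of "(+) c" lborel borel f] assms by (simp add: lborel_distr_plus)

text \<open>The integral of a translate of F does not depend on the translation; differentiating it
  in the direction v under the integral sign gives zero.\<close>

lemma integral_Dd_eq_0:
  fixes F :: "'a::euclidean_space \<Rightarrow> real"
  assumes der: "\<And>x. (F has_derivative F' x) (at x)" and c: "continuous_on UNIV (\<lambda>x. F' x v)"
    and K: "compact K" "\<And>x. x \<notin> K \<Longrightarrow> F x = 0"
  shows "integrable lborel (\<lambda>x. F' x v)" "(\<integral>x. F' x v \<partial>lborel) = 0"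
proof -
  have z: "F' x v = 0" if "x \<notin> K" for x
    using Dd_unique[OF der[of x], where v=v] Dd_zero_outside[OF compact_imp_closed[OF K(1)] K(2) that, where v=v] by simp
  have cF: "continuous_on K F"
    using has_derivative_continuous[OF der] by (simp add: continuous_at_imp_continuous_on)
  note F = integrable_continuous_compact_support[OF K(1) cF K(2)]
  note F' = integrable_continuous_compact_support[OF K(1) continuous_on_subset[OF c] z]
  show "integrable lborel (\<lambda>x. F' x v)" using F' by simp
  obtain B where B: "\<And>x. \<bar>F' x v\<bar> \<le> B" using F'(3) by auto
  obtain \<rho> where \<rho>: "\<And>x. x \<in> K \<Longrightarrow> norm x \<le> \<rho>" using compact_imp_bounded[OF K(1)] by (auto simp: bounded_iff)
  have d: "((\<lambda>t. \<integral>x. F (t *\<^sub>R v + x) \<partial>lborel) has_derivative (\<lambda>s. \<integral>x. s * F' (0 *\<^sub>R v + x) v \<partial>lborel)) (at 0)"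
  proof (rule has_derivative_integral[of "ball 0 1" 0 lborel _ "\<lambda>t x s. s * F' (t *\<^sub>R v + x) v"
        "\<lambda>x. B * indicator (cball 0 (\<rho> + norm v)) x"])
    show "integrable lborel (\<lambda>x. F (z *\<^sub>R v + x))" for z by (rule integrable_lborel_translate[OF F(1)]) 
    show "((\<lambda>z. F (z *\<^sub>R v + y)) has_derivative (\<lambda>s. s * F' (z *\<^sub>R v + y) v)) (at z)" for z y
    proof -
      have "((\<lambda>z. z *\<^sub>R v + y) has_derivative (\<lambda>s. s *\<^sub>R v)) (at z)" by (auto intro!: derivative_eq_intros)
      from has_derivative_compose[OF this der] show ?thesis
        using linear_scale[OF has_derivative_linear[OF der]] by simp
    qed
    show "(\<lambda>y. s * F' (z *\<^sub>R v + y) v) \<in> borel_measurable lborel" for z s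
      using F'(2) by measurable
    show "\<bar>s * F' (t *\<^sub>R v + x) v\<bar> \<le> B * indicator (cball 0 (\<rho> + norm v)) x * norm s" if "t \<in> ball 0 1" for t x s
    proof (cases "t *\<^sub>R v + x \<in> K")
      case True
      have "norm x \<le> norm (t *\<^sub>R v + x) + norm (t *\<^sub>R v)"
        using norm_triangle_ineq4[of "t *\<^sub>R v + x" "t *\<^sub>R v"] by simp
      also have "norm (t *\<^sub>R v) \<le> norm v" using that by (simp add: mult_left_le_one_le)
      finally have "x \<in> cball 0 (\<rho> + norm v)" using \<rho>[OF True] by simp
      then show ?thesis using mult_right_mono[OF B[of "t *\<^sub>R v + x"] abs_ge_zero[of s]]
        by (simp add: abs_mult mult.commute)
    next
      case False
      have "0 \<le> B" using B[of 0] by linarith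
      then show ?thesis using z[OF False] by simp
    qed
    show "integrable lborel (\<lambda>x. B * indicator (cball 0 (\<rho> + norm v)) x)"
      using emeasure_bounded_finite[of "cball 0 (\<rho> + norm v)"] by auto
  qed auto
  have "(\<lambda>t. \<integral>x. F (t *\<^sub>R v + x) \<partial>lborel) = (\<lambda>t. \<integral>x. F x \<partial>lborel)"
    using integral_lborel_translate[OF F(2)] by auto
  then have "((\<lambda>t::real. \<integral>x. F (t *\<^sub>R v + x) \<partial>lborel) has_derivative (\<lambda>s. 0)) (at 0)" by simp
  from fun_cong[OF has_derivative_unique[OF d this], of 1] show "(\<integral>x. F' x v \<partial>lborel) = 0" by simp
qed

lemma C2cD:
  assumes "C2c \<Omega> f"
  shows "Ck 2 f UNIV" "(f has_derivative (\<lambda>v. Dd f v x)) (at x)"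
    "(Dd f v has_derivative (\<lambda>w. Dd (Dd f v) w x)) (at x)"
    "continuous_on S (Dd (Dd f v) w)" "continuous_on S (Dd f v)" "continuous_on S f"
proof -
  show 1: "Ck 2 f UNIV" using assms by (simp add: C2c_def)
  show "(f has_derivative (\<lambda>v. Dd f v x)) (at x)" "(Dd f v has_derivative (\<lambda>w. Dd (Dd f v) w x)) (at x)"
    using 1 by (auto intro: has_derivative_Dd simp: Ck2_iff)
  show "continuous_on S (Dd (Dd f v) w)" "continuous_on S (Dd f v)" "continuous_on S f"
    using 1 differentiable_imp_continuous_on by (auto simp: Ck2_iff intro: continuous_on_subset[of UNIV])
qed

lemma C2_open_D:
  assumes "Ck 2 f \<Omega>" "open \<Omega>" 
  shows "x \<in> \<Omega> \<Longrightarrow> (f has_derivative (\<lambda>v. Dd f v x)) (at x)"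
    "x \<in> \<Omega> \<Longrightarrow> (Dd f v has_derivative (\<lambda>w. Dd (Dd f v) w x)) (at x)"
    "continuous_on \<Omega> (Dd (Dd f v) w)" "continuous_on \<Omega> (Dd f v)" "continuous_on \<Omega> f"
  using assms differentiable_imp_continuous_on by (auto simp: Ck2_iff intro: has_derivative_Dd)

section \<open>Green's identity for divergence-free coefficients\<close>

locale divfree =
  fixes A :: "'a::euclidean_space \<Rightarrow> 'a \<Rightarrow> 'a" and \<Omega> :: "'a set"
  assumes open_dom: "open \<Omega>"
    and sym: "\<And>z i j. z \<in> \<Omega> \<Longrightarrow> i \<in> Basis \<Longrightarrow> j \<in> Basis \<Longrightarrow> A z i \<bullet> j = A z j \<bullet> i"
    and diff: "\<And>i j. i \<in> Basis \<Longrightarrow> j \<in> Basis \<Longrightarrow> (\<lambda>z. A z i \<bullet> j) differentiable_on \<Omega>"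
    and cont: "\<And>i j. i \<in> Basis \<Longrightarrow> j \<in> Basis \<Longrightarrow> continuous_on \<Omega> (Dd (\<lambda>z. A z i \<bullet> j) j)"
    and div0: "\<And>z i. z \<in> \<Omega> \<Longrightarrow> i \<in> Basis \<Longrightarrow> (\<Sum>j\<in>Basis. Dd (\<lambda>z. A z i \<bullet> j) j z) = 0"
begin

lemma contA: "i \<in> Basis \<Longrightarrow> j \<in> Basis \<Longrightarrow> continuous_on \<Omega> (\<lambda>z. A z i \<bullet> j)"
  using diff differentiable_imp_continuous_on by blast

lemma cont_Lg: "Ck 2 f S \<Longrightarrow> open S \<Longrightarrow> S \<subseteq> \<Omega> \<Longrightarrow> continuous_on S (Lg A f)"
  unfolding Lg_def[abs_def]
  by (intro continuous_on_sum continuous_on_mult C2_open_D(3) continuous_on_subset[OF contA]) auto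

text \<open>The flux whose component j is the sum over i of A_ij (f d_i \<phi> - \<phi> d_i f) has
  divergence f L \<phi> - \<phi> L f: the derivatives of the coefficients cancel by
  \<open>div0\<close>, the products of two gradients by symmetry. The divergence of a compactly
  supported field integrates to zero.\<close>

theorem green:
  assumes f: "Ck 2 f \<Omega>" and \<phi>: "C2c \<Omega> \<phi>"
  shows "(\<integral>x. f x * Lg A \<phi> x \<partial>lborel) = (\<integral>x. \<phi> x * Lg A f x \<partial>lborel)"
    "integrable lborel (\<lambda>x. f x * Lg A \<phi> x)"
proof -
  obtain K where K: "compact K" "K \<subseteq> \<Omega>" "\<And>x. x \<notin> K \<Longrightarrow> \<phi> x = 0" using \<phi> by (auto simp: C2c_def)
  have clK: "closed K" using K compact_imp_closed by blast
  have z1: "Dd \<phi> v x = 0" if "x \<notin> K" for v x by (rule Dd_zero_outside[OF clK K(3) that])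
  define F where "F j z = (\<Sum>i\<in>Basis. (A z i \<bullet> j) * (f z * Dd \<phi> i z - \<phi> z * Dd f i z))" for j z
  define F' where "F' j z v = (\<Sum>i\<in>Basis. Dd (\<lambda>z. A z i \<bullet> j) v z * (f z * Dd \<phi> i z - \<phi> z * Dd f i z) +
     (A z i \<bullet> j) * ((Dd f v z * Dd \<phi> i z + f z * Dd (Dd \<phi> i) v z) - (Dd \<phi> v z * Dd f i z + \<phi> z * Dd (Dd f i) v z)))" for j z v
  \<comment> \<open>Nothing is assumed of f and A outside \<Omega>. Extended by zero, the derivative
    of the flux is continuous on the whole space because \<phi> vanishes off K.\<close>
  define G where "G j z v = (if z \<in> \<Omega> then F' j z v else 0)" for j z v
  have z2: "G j x v = 0" "F j x = 0" if "x \<notin> K" for j x v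
    using Dd_zero_outside[OF clK z1 that] z1[OF that] K(3)[OF that] by (auto simp: G_def F'_def F_def)
  have derG: "(F j has_derivative G j z) (at z)" if j: "j \<in> Basis" for j z
  proof (cases "z \<in> \<Omega>")
    case True
    note d = C2_open_D(1,2)[OF f open_dom True] C2cD(2,3)[OF \<phi>]
    have dA: "((\<lambda>z. A z i \<bullet> j) has_derivative (\<lambda>v. Dd (\<lambda>z. A z i \<bullet> j) v z)) (at z)" if "i \<in> Basis" for i
      using has_derivative_Dd[OF diff[OF that j] open_dom True] .
    have "(F j has_derivative F' j z) (at z)"
      unfolding F_def[abs_def] F'_def[abs_def]
    proof (rule has_derivative_sum)
      fix i :: 'a assume i: "i \<in> Basis"
      have "((\<lambda>z. f z * Dd \<phi> i z - \<phi> z * Dd f i z) has_derivative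
        (\<lambda>v. (f z * Dd (Dd \<phi> i) v z + Dd f v z * Dd \<phi> i z) - (\<phi> z * Dd (Dd f i) v z + Dd \<phi> v z * Dd f i z))) (at z)"
        by (intro has_derivative_diff has_derivative_mult d)
      from has_derivative_mult[OF dA[OF i] this]
      show "((\<lambda>x. A x i \<bullet> j * (f x * Dd \<phi> i x - \<phi> x * Dd f i x)) has_derivative
         (\<lambda>x. Dd (\<lambda>z. A z i \<bullet> j) x z * (f z * Dd \<phi> i z - \<phi> z * Dd f i z) +
               A z i \<bullet> j * (Dd f x z * Dd \<phi> i z + f z * Dd (Dd \<phi> i) x z -
                (Dd \<phi> x z * Dd f i z + \<phi> z * Dd (Dd f i) x z)))) (at z)"
        by (rule has_derivative_eq_rhs) (simp add: algebra_simps)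
    qed
    then show ?thesis using True by (simp add: G_def[abs_def])
  next
    case False
    then have "z \<notin> K" using K by auto
    have "(F j has_derivative (\<lambda>_. 0)) (at z)"
      by (rule has_derivative_transform_within_open[of "\<lambda>_. 0" _ _ _ "- K"])
        (use clK \<open>z \<notin> K\<close> z2(2)[of _ j] in auto)
    then show ?thesis using False by (simp add: G_def[abs_def])
  qed
  have contF': "continuous_on \<Omega> (\<lambda>z. F' j z j)" if "j \<in> Basis" for j
    unfolding F'_def
    using that \<phi> f open_dom
    by (intro continuous_intros contA cont C2_open_D(3,4,5)[OF f open_dom] C2cD(4,5,6)[OF \<phi>]) auto
  have contG: "continuous_on UNIV (\<lambda>z. G j z j)" if "j \<in> Basis" for j
  proof -
    have "continuous_on (\<Omega> \<union> - K) (\<lambda>z. G j z j)"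
    proof (rule continuous_on_open_Un)
      show "continuous_on \<Omega> (\<lambda>z. G j z j)" using contF'[OF that] by (simp add: G_def cong: continuous_on_cong)
      show "continuous_on (- K) (\<lambda>z. G j z j)" 
        by (rule continuous_on_eq[OF continuous_on_const[of _ 0]]) (simp add: z2(1))
    qed (use clK open_dom in auto)
    moreover have "\<Omega> \<union> - K = UNIV" using K by auto
    ultimately show ?thesis by simp
  qed
  note I = integral_Dd_eq_0[OF derG contG K(1) z2(2)]
  have *: "f z * Lg A \<phi> z - \<phi> z * Lg A f z = (\<Sum>j\<in>Basis. G j z j)" for z
  proof (cases "z \<in> \<Omega>")
    case True
    let ?g = "\<lambda>i. f z * Dd \<phi> i z - \<phi> z * Dd f i z"
    have s: "(\<Sum>j\<in>Basis. \<Sum>i\<in>Basis. (A z i \<bullet> j) * (Dd f j z * Dd \<phi> i z)) =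
          (\<Sum>j\<in>Basis. \<Sum>i\<in>Basis. (A z i \<bullet> j) * (Dd \<phi> j z * Dd f i z))"
      by (subst sum.swap) (intro sum.cong refl, simp add: sym[OF True] mult.commute)
    have "(\<Sum>j\<in>Basis. G j z j) = (\<Sum>j\<in>Basis. \<Sum>i\<in>Basis. Dd (\<lambda>z. A z i \<bullet> j) j z * ?g i)
        + ((\<Sum>j\<in>Basis. \<Sum>i\<in>Basis. (A z i \<bullet> j) * (Dd f j z * Dd \<phi> i z)) - (\<Sum>j\<in>Basis. \<Sum>i\<in>Basis. (A z i \<bullet> j) * (Dd \<phi> j z * Dd f i z)))
        + ((\<Sum>j\<in>Basis. \<Sum>i\<in>Basis. (A z i \<bullet> j) * (f z * Dd (Dd \<phi> i) j z)) - (\<Sum>j\<in>Basis. \<Sum>i\<in>Basis. (A z i \<bullet> j) * (\<phi> z * Dd (Dd f i) j z)))"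
      using True by (simp add: G_def F'_def sum.distrib sum_subtractf algebra_simps)
    also have "(\<Sum>j\<in>Basis. \<Sum>i\<in>Basis. Dd (\<lambda>z. A z i \<bullet> j) j z * ?g i) = (\<Sum>i\<in>Basis. (\<Sum>j\<in>Basis. Dd (\<lambda>z. A z i \<bullet> j) j z) * ?g i)"
      by (subst sum.swap) (simp add: sum_distrib_right)
    also have "\<dots> = 0" using div0[OF True] by simp
    also have "(\<Sum>j\<in>Basis. \<Sum>i\<in>Basis. (A z i \<bullet> j) * (f z * Dd (Dd \<phi> i) j z)) = f z * Lg A \<phi> z"
      unfolding Lg_def by (subst sum.swap) (simp add: sum_distrib_left mult.left_commute)
    also have "(\<Sum>j\<in>Basis. \<Sum>i\<in>Basis. (A z i \<bullet> j) * (\<phi> z * Dd (Dd f i) j z)) = \<phi> z * Lg A f z"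
      unfolding Lg_def by (subst sum.swap) (simp add: sum_distrib_left mult.left_commute)
    finally show ?thesis unfolding s by simp
  next
    case False
    then have "z \<notin> K" using K by auto
    then show ?thesis using False K(3) Lg_zero_outside[OF clK K(3)] by (simp add: G_def)
  qed
  have "(\<integral>x. f x * Lg A \<phi> x - \<phi> x * Lg A f x \<partial>lborel) = 0" unfolding * using I by simp
  moreover have 1: "integrable lborel (\<lambda>x. f x * Lg A \<phi> x)"
  proof (rule integrable_continuous_compact_support(1)[OF K(1)])
    have "continuous_on \<Omega> (\<lambda>x. f x * Lg A \<phi> x)"
      using cont_Lg[of \<phi> \<Omega>] Ck_subset[OF open_UNIV open_dom _ C2cD(1)[OF \<phi>]] open_dom C2_open_D(5)[OF f]
      by (intro continuous_intros) auto
    then show "continuous_on K (\<lambda>x. f x * Lg A \<phi> x)" using K continuous_on_subset by blast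
  qed (use Lg_zero_outside[OF clK K(3)] in auto)
  moreover have 2: "integrable lborel (\<lambda>x. \<phi> x * Lg A f x)"
  proof (rule integrable_continuous_compact_support(1)[OF K(1)])
    have "continuous_on \<Omega> (\<lambda>x. \<phi> x * Lg A f x)"
      using cont_Lg[OF f] open_dom C2cD(6)[OF \<phi>] by (intro continuous_intros) auto
    then show "continuous_on K (\<lambda>x. \<phi> x * Lg A f x)" using K continuous_on_subset by blast
  qed (use K(3) in auto)
  ultimately show "(\<integral>x. f x * Lg A \<phi> x \<partial>lborel) = (\<integral>x. \<phi> x * Lg A f x \<partial>lborel)" "integrable lborel (\<lambda>x. f x * Lg A \<phi> x)"
    by auto
qed

end

section \<open>Mollification of test functions\<close>

text \<open>Polynomials in 1/s times exp (- 1/s), extended by zero: a family closed under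
  differentiation, so that smoothness of the bump function follows by induction with p
  arbitrary.\<close>

definition expi :: "real poly \<Rightarrow> real \<Rightarrow> real" where
  "expi p s = (if s > 0 then poly p (inverse s) * exp (- inverse s) else 0)"

lemma poly_times_exp_tendsto_0: "((\<lambda>x. poly p x * exp (- x)) \<longlongrightarrow> (0::real)) at_top"
proof -
  have "((\<lambda>x. \<Sum>i\<le>degree p. coeff p i * (x ^ i / exp x)) \<longlongrightarrow> (\<Sum>i\<le>degree p. coeff p i * 0)) at_top"
    by (intro tendsto_sum tendsto_mult tendsto_const tendsto_power_div_exp_0)
  then show ?thesis by (simp add: poly_altdef exp_minus divide_inverse sum_distrib_right mult.assoc)
qed

text \<open>The factor \<open>[:0, 0, 1:]\<close> is the square of the variable; it comes from the
  derivative - 1/s^2 of the inner function.\<close>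

lemma expi_has_derivative:
  "(expi p has_real_derivative expi ([:0, 0, 1:] * (p - pderiv p)) s) (at s)"
proof -
  consider "s > 0" | "s < 0" | "s = 0" by linarith
  then show ?thesis
  proof cases
    case 1
    have "((\<lambda>s. poly p (inverse s) * exp (- inverse s)) has_real_derivative
       expi ([:0, 0, 1:] * (p - pderiv p)) s) (at s)"
      using 1 by (auto intro!: derivative_eq_intros simp: expi_def power2_eq_square field_simps)
    then show ?thesis
      by (rule has_field_derivative_transform_within_open[of _ _ _ "{0<..}"]) (use 1 in \<open>auto simp: expi_def\<close>)
  next
    case 2
    have "((\<lambda>s. 0::real) has_real_derivative expi ([:0, 0, 1:] * (p - pderiv p)) s) (at s)"
      using 2 by (simp add: expi_def)
    then show ?thesis
      by (rule has_field_derivative_transform_within_open[of _ _ _ "{..<0}"]) (use 2 in \<open>auto simp: expi_def\<close>)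
  next
    case 3
    have "((\<lambda>h. expi p h / h) \<longlongrightarrow> 0) (at_right 0)"
    proof -
      have "((\<lambda>x. poly ([:0,1:] * p) (inverse x) * exp (- inverse x)) \<longlongrightarrow> 0) (at_right 0)"
        by (rule filterlim_compose[OF poly_times_exp_tendsto_0 filterlim_inverse_at_top_right])
      then show ?thesis
        by (rule Lim_transform_eventually)
          (auto simp: eventually_at_right_less expi_def divide_inverse intro!: eventually_at_rightI[of 0 1])
    qed
    moreover have "((\<lambda>h. expi p h / h) \<longlongrightarrow> 0) (at_left 0)"
      by (rule Lim_transform_eventually[OF tendsto_const])
        (auto simp: expi_def intro!: eventually_at_leftI[of "-1" 0])
    ultimately have "((\<lambda>h. expi p h / h) \<longlongrightarrow> 0) (at 0)" by (simp add: filterlim_split_at)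
    then show ?thesis using 3 by (simp add: DERIV_def expi_def)
  qed
qed

lemma Ck_linear:
  assumes "bounded_linear f" shows "Ck k f UNIV"
proof (cases k)
  case 0 then show ?thesis using assms by (simp add: linear_continuous_on)
next
  case (Suc n)
  have "Dd f v = (\<lambda>x. f v)" for v
    using Dd_unique[OF bounded_linear_imp_has_derivative[OF assms]] by blast
  then show ?thesis using Suc assms bounded_linear_imp_differentiable_on by (auto simp: Ck_Suc_iff)
qed

lemma Ck_expi_quadratic:
  fixes c :: real
  shows "Ck k (\<lambda>x::'a::euclidean_space. expi p (1 - c * (x \<bullet> x))) UNIV"
proof (induction k arbitrary: p)
  have der: "((\<lambda>x::'a. expi p (1 - c * (x \<bullet> x))) has_derivative
     (\<lambda>v. expi ([:0, 0, 1:] * (p - pderiv p)) (1 - c * (x \<bullet> x)) * (- 2 * c * (x \<bullet> v)))) (at x)" for p x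
  proof -
    have "((\<lambda>x::'a. 1 - c * (x \<bullet> x)) has_derivative (\<lambda>v. - 2 * c * (x \<bullet> v))) (at x)"
      by (auto intro!: derivative_eq_intros simp: inner_commute algebra_simps)
    from has_derivative_compose[OF this expi_has_derivative[unfolded has_field_derivative_def]]
    show ?thesis by simp
  qed
  {
    case 0
    then show ?case using has_derivative_continuous[OF der] by (simp add: continuous_at_imp_continuous_on)
  next
    case (Suc k)
    have D: "Dd (\<lambda>x::'a. expi p (1 - c * (x \<bullet> x))) v =
      (\<lambda>x. expi ([:0, 0, 1:] * (p - pderiv p)) (1 - c * (x \<bullet> x)) * (- 2 * c * (x \<bullet> v)))" for v
      using Dd_unique[OF der] by (intro ext)
    have "Ck k (\<lambda>x::'a. - 2 * c * (x \<bullet> v)) UNIV" for v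
      by (rule Ck_linear) (intro bounded_linear_const_mult bounded_linear_inner_left)
    then have "Ck k (Dd (\<lambda>x::'a. expi p (1 - c * (x \<bullet> x))) v) UNIV" for v
      unfolding D by (rule Ck_mult[OF open_UNIV Suc.IH])
    moreover have "(\<lambda>x::'a. expi p (1 - c * (x \<bullet> x))) differentiable_on UNIV"
      using der unfolding differentiable_on_def differentiable_def by blast
    ultimately show ?case unfolding Ck_Suc_iff by blast
  }
qed

lemma Ck_compact_support:
  fixes f :: "'a::euclidean_space \<Rightarrow> real"
  assumes "Ck k f UNIV" "compact K" "\<And>x. x \<notin> K \<Longrightarrow> f x = 0"
  shows "integrable lborel f" "f \<in> borel_measurable borel" "\<exists>B. \<forall>x. \<bar>f x\<bar> \<le> B"
proof -
  have "continuous_on K f" using Ck_continuous[OF assms(1)] continuous_on_subset by blast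
  from integrable_continuous_compact_support[OF assms(2) this assms(3)]
  show "integrable lborel f" "f \<in> borel_measurable borel" "\<exists>B. \<forall>x. \<bar>f x\<bar> \<le> B" by auto
qed

lemma exists_mollifier:
  fixes e :: real assumes e: "e > 0"
  obtains \<eta> :: "'a::euclidean_space \<Rightarrow> real" where "\<And>k. Ck k \<eta> UNIV" "\<And>x. 0 \<le> \<eta> x"
    "\<And>x. x \<notin> cball 0 e \<Longrightarrow> \<eta> x = 0" "(\<integral>x. \<eta> x \<partial>lborel) = 1"
proof -
  define b where "b x = expi 1 (1 - (1/e^2) * (x \<bullet> x))" for x :: 'a
  have C: "Ck k b UNIV" for k unfolding b_def[abs_def] by (rule Ck_expi_quadratic)
  have nn: "0 \<le> b x" for x by (simp add: b_def expi_def)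
  have z: "b x = 0" if "x \<notin> cball 0 e" for x
  proof -
    have "e^2 \<le> (norm x)^2" using that e by (intro power_mono) auto
    then show ?thesis using e by (simp add: b_def expi_def power2_norm_eq_inner)
  qed
  have pos: "b x > 0" if "x \<in> ball 0 e" for x
  proof -
    have "(norm x)^2 < e^2" using that e by (intro power_strict_mono) auto
    then show ?thesis using e by (simp add: b_def expi_def power2_norm_eq_inner)
  qed
  have int: "integrable lborel b" and m: "b \<in> borel_measurable borel"
    using Ck_compact_support[OF C compact_cball[of 0 e] z] by blast+
  have "(\<integral>x. b x \<partial>lborel) \<noteq> 0"
  proof
    assume "(\<integral>x. b x \<partial>lborel) = 0"
    then have "AE x in lborel. b x = 0" using integral_nonneg_eq_0_iff_AE[OF int] nn by auto
    then have "AE x in lborel. x \<notin> ball (0::'a) e" by eventually_elim (metis less_irrefl pos)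
    then have "emeasure lborel (ball (0::'a) e) = 0" 
      by (subst (asm) AE_iff_null_sets[symmetric]) (auto simp: null_sets_def)
    then show False using content_ball_pos[OF e, of "0::'a"] by (simp add: measure_def)
  qed
  moreover have "(\<integral>x. b x \<partial>lborel) \<ge> 0" by (intro integral_nonneg_AE AE_I2 nn)
  ultimately have Z: "(\<integral>x. b x \<partial>lborel) > 0" by linarith
  define \<eta> where "\<eta> x = (1 / (\<integral>x. b x \<partial>lborel)) * b x" for x
  show thesis
  proof
    show "Ck k \<eta> UNIV" for k unfolding \<eta>_def[abs_def] by (intro Ck_mult C) auto
  qed (use nn z Z in \<open>auto simp: \<eta>_def\<close>)
qed

lemma integral_lborel_reflect:
  fixes f :: "'a::euclidean_space \<Rightarrow> real"
  assumes "f \<in> borel_measurable borel"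
  shows "(\<integral>x. f (c - x) \<partial>lborel) = (\<integral>x. f x \<partial>lborel)"
proof -
  have "lborel = distr lborel borel (\<lambda>x. c - x :: 'a)"
    by (subst lborel_affine[of "-1" c]) (auto simp: density_1)
  then have "(\<integral>x. f x \<partial>lborel) = (\<integral>x. f x \<partial>distr lborel borel (\<lambda>x. c - x))" by simp
  also have "\<dots> = (\<integral>x. f (c - x) \<partial>lborel)" using assms by (intro integral_distr) auto
  finally show ?thesis by simp
qed

lemma integrable_lborel_reflect:
  fixes f :: "'a::euclidean_space \<Rightarrow> real"
  assumes "integrable lborel f"
  shows "integrable lborel (\<lambda>x. f (c - x))"
proof -
  have "lborel = distr lborel borel (\<lambda>x. c - x :: 'a)"
    by (subst lborel_affine[of "-1" c]) (auto simp: density_1)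
  then have "integrable (distr lborel borel (\<lambda>x. c - x)) f" using assms by simp
  then show ?thesis using integrable_distr_eq[of "\<lambda>x. c - x" lborel borel f] assms by auto
qed

lemma Dd_linear:
  fixes f :: "'a::euclidean_space \<Rightarrow> real"
  assumes "(f has_derivative (\<lambda>v. Dd f v x)) (at x)"
  shows "Dd f v x = (\<Sum>i\<in>Basis. (v \<bullet> i) * Dd f i x)"
proof -
  have l: "linear (\<lambda>v. Dd f v x)" using has_derivative_linear[OF assms] .
  have "Dd f v x = Dd f (\<Sum>i\<in>Basis. (v \<bullet> i) *\<^sub>R i) x" by (simp add: euclidean_representation)
  also have "\<dots> = (\<Sum>i\<in>Basis. (v \<bullet> i) * Dd f i x)"
    using linear_sum[OF l, of "\<lambda>i. (v \<bullet> i) *\<^sub>R i" Basis] linear_scale[OF l] by simp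
  finally show ?thesis .
qed

lemma Dd_bound:
  fixes f :: "'a::euclidean_space \<Rightarrow> real"
  assumes "Ck 1 f UNIV" "compact K" "\<And>x. x \<notin> K \<Longrightarrow> f x = 0"
  shows "\<exists>B\<ge>0. \<forall>x v. \<bar>Dd f v x\<bar> \<le> B * norm v"
proof -
  have "\<exists>B. \<forall>x. \<bar>Dd f i x\<bar> \<le> B" for i
    by (rule integrable_continuous_compact_support(3)[OF assms(2)])
      (use assms Dd_zero_outside[OF compact_imp_closed[OF assms(2)] assms(3)] in
       \<open>auto simp: Ck_Suc_iff One_nat_def intro: continuous_on_subset\<close>)
  then obtain B where B: "\<And>i x. \<bar>Dd f i x\<bar> \<le> B i" by metis
  have "\<bar>Dd f v x\<bar> \<le> (\<Sum>i\<in>Basis. B i) * norm v" for v x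
  proof -
    have "(f has_derivative (\<lambda>v. Dd f v x)) (at x)"
      using assms(1) by (intro has_derivative_Dd[of f UNIV]) (auto simp: Ck_Suc_iff)
    from Dd_linear[OF this, of v] have "\<bar>Dd f v x\<bar> \<le> (\<Sum>i\<in>Basis. \<bar>(v \<bullet> i) * Dd f i x\<bar>)" by (simp add: sum_abs)
    also have "\<dots> \<le> (\<Sum>i\<in>Basis. norm v * B i)"
      by (rule sum_mono) (auto simp: abs_mult intro!: mult_mono Basis_le_norm B)
    finally show ?thesis by (simp add: sum_distrib_left mult.commute)
  qed
  moreover have "(\<Sum>i\<in>Basis. B i) \<ge> 0" by (rule sum_nonneg) (use B[of _ 0] in \<open>meson abs_ge_zero order_trans\<close>)
  ultimately show ?thesis by blast
qed

lemma has_derivative_convolution: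
  fixes \<eta> w :: "'a::euclidean_space \<Rightarrow> real"
  assumes "Ck 1 \<eta> UNIV" "compact K" "\<And>x. x \<notin> K \<Longrightarrow> \<eta> x = 0"
    and w: "integrable lborel w" "\<And>x. \<bar>w x\<bar> \<le> W"
  shows "((\<lambda>z. \<integral>y. \<eta> (z - y) * w y \<partial>lborel) has_derivative (\<lambda>v. \<integral>y. Dd \<eta> v (z - y) * w y \<partial>lborel)) (at z)"
proof -
  obtain B where B: "B \<ge> 0" "\<And>x v. \<bar>Dd \<eta> v x\<bar> \<le> B * norm v" using Dd_bound[OF assms(1-3)] by auto
  have d: "(\<eta> has_derivative (\<lambda>v. Dd \<eta> v x)) (at x)" for x
    using assms(1) by (intro has_derivative_Dd[of \<eta> UNIV]) (auto simp: Ck_Suc_iff)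
  note chi = Ck_compact_support[OF assms(1-3)]
  obtain C where C: "\<And>x. \<bar>\<eta> x\<bar> \<le> C" using chi(3) by auto
  have m[measurable]: "\<eta> \<in> borel_measurable borel" "w \<in> borel_measurable borel"
    using chi w by (auto dest: borel_measurable_integrable)
  have m2[measurable]: "Dd \<eta> v \<in> borel_measurable borel" for v
    using assms(1) by (auto simp: Ck_Suc_iff intro: borel_measurable_continuous_onI)
  show ?thesis
  proof (rule has_derivative_integral[where S=UNIV and G="\<lambda>y. B * \<bar>w y\<bar>"])
    show "integrable lborel (\<lambda>y. \<eta> (z - y) * w y)" for z
      by (rule Bochner_Integration.integrable_bound[OF integrable_mult_right[OF integrable_abs[OF w(1)], of C]])
        (auto simp: abs_mult intro!: mult_right_mono order_trans[OF C abs_ge_self])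
    show "((\<lambda>z. \<eta> (z - y) * w y) has_derivative (\<lambda>v. Dd \<eta> v (z - y) * w y)) (at z)" for z y
    proof -
      have "((\<lambda>z. z - y) has_derivative (\<lambda>v. v)) (at z)" by (auto intro!: derivative_eq_intros)
      from has_derivative_mult_left[OF has_derivative_compose[OF this d], of "w y"] show ?thesis by simp
    qed
    show "\<bar>Dd \<eta> v (z - y) * w y\<bar> \<le> B * \<bar>w y\<bar> * norm v" for z y v
      using mult_right_mono[OF B(2)[of v "z - y"] abs_ge_zero[of "w y"]] by (simp add: abs_mult mult_ac)
    show "(\<lambda>y. Dd \<eta> v (z - y) * w y) \<in> borel_measurable lborel" for z v by measurable
    show "integrable lborel (\<lambda>y. B * \<bar>w y\<bar>)" using w by simp
  qed auto
qed

lemma Ck_convolution: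
  fixes \<eta> w :: "'a::euclidean_space \<Rightarrow> real"
  assumes "\<And>k. Ck k \<eta> UNIV" "compact K" "\<And>x. x \<notin> K \<Longrightarrow> \<eta> x = 0"
    and w: "integrable lborel w" "\<And>x. \<bar>w x\<bar> \<le> W"
  shows "Ck k (\<lambda>z. \<integral>y. \<eta> (z - y) * w y \<partial>lborel) UNIV"
  using assms(1,3)
proof (induction k arbitrary: \<eta>)
  case 0
  then show ?case using has_derivative_continuous[OF has_derivative_convolution[OF 0(1) assms(2) 0(2) w]]
    by (simp add: continuous_at_imp_continuous_on)
next
  case (Suc k)
  note d = has_derivative_convolution[OF Suc.prems(1) assms(2) Suc.prems(2) w]
  have "Ck k (Dd \<eta> v) UNIV" for k v using Suc.prems(1)[of "Suc k"] by (simp add: Ck_Suc_iff)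
  moreover have "Dd \<eta> v x = 0" if "x \<notin> K" for x v
    by (rule Dd_zero_outside[OF compact_imp_closed[OF assms(2)] Suc.prems(2) that])
  moreover have "Dd (\<lambda>z. \<integral>y. \<eta> (z - y) * w y \<partial>lborel) v = (\<lambda>z. \<integral>y. Dd \<eta> v (z - y) * w y \<partial>lborel)" for v
    using Dd_unique[OF d] by (intro ext)
  ultimately have "Ck k (Dd (\<lambda>z. \<integral>y. \<eta> (z - y) * w y \<partial>lborel) v) UNIV" for v
    using Suc.IH by simp
  then show ?case using d unfolding Ck_Suc_iff differentiable_on_def differentiable_def by blast
qed

lemma convolution_commute:
  fixes \<eta> w :: "'a::euclidean_space \<Rightarrow> real"
  assumes [measurable]: "\<eta> \<in> borel_measurable borel" "w \<in> borel_measurable borel"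
  shows "(\<integral>y. \<eta> (z - y) * w y \<partial>lborel) = (\<integral>y. w (z - y) * \<eta> y \<partial>lborel)"
  using integral_lborel_reflect[of "\<lambda>y. \<eta> (z - y) * w y" z] by (simp add: mult.commute)

text \<open>Both derivatives are thrown on w rather than on the mollifier, so that they converge as
  the mollifier concentrates.\<close>

lemma Dd_convolution:
  fixes \<eta> w :: "'a::euclidean_space \<Rightarrow> real"
  assumes \<eta>: "\<And>k. Ck k \<eta> UNIV" "compact K" "\<And>x. x \<notin> K \<Longrightarrow> \<eta> x = 0"
    and w: "Ck 2 w UNIV" "compact K'" "\<And>x. x \<notin> K' \<Longrightarrow> w x = 0"
  shows "Dd (Dd (\<lambda>z. \<integral>y. \<eta> (z - y) * w y \<partial>lborel) v) v' z = (\<integral>y. Dd (Dd w v) v' (z - y) * \<eta> y \<partial>lborel)"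
proof -
  have w1: "Ck 1 w UNIV" "Ck 1 (Dd w v) UNIV" for v using w(1) differentiable_imp_continuous_on
    by (auto simp: numeral_2_eq_2 Ck_Suc_iff)
  have z: "Dd w v x = 0" if "x \<notin> K'" for x v
    by (rule Dd_zero_outside[OF compact_imp_closed[OF w(2)] w(3) that])
  note ch = Ck_compact_support[OF \<eta>]
  note wh = Ck_compact_support[OF w]
  obtain C where C: "\<And>x. \<bar>\<eta> x\<bar> \<le> C" using ch(3) by auto
  have *: "(\<lambda>z. \<integral>y. \<eta> (z - y) * w y \<partial>lborel) = (\<lambda>z. \<integral>y. w (z - y) * \<eta> y \<partial>lborel)"
    using convolution_commute[OF ch(2) wh(2)] by (intro ext) auto
  have 1: "Dd (\<lambda>z. \<integral>y. w (z - y) * \<eta> y \<partial>lborel) v = (\<lambda>z. \<integral>y. Dd w v (z - y) * \<eta> y \<partial>lborel)"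
    by (rule ext) (rule Dd_unique[OF has_derivative_convolution[OF w1(1) w(2,3) ch(1) C]])
  have 2: "Dd (\<lambda>z. \<integral>y. Dd w v (z - y) * \<eta> y \<partial>lborel) v' z = (\<integral>y. Dd (Dd w v) v' (z - y) * \<eta> y \<partial>lborel)"
    by (rule Dd_unique[OF has_derivative_convolution[OF w1(2) w(2) z ch(1) C]])
  show ?thesis unfolding * 1 2 ..
qed

text \<open>Subharmonicity is defined with smooth test functions, while those produced by the
  parametrix are C^2. Mollification preserves sign and compactness of the support, and the second
  derivatives converge pointwise and boundedly, which suffices against a locally integrable
  u.\<close>

theorem smooth_test_extend:
  fixes u :: "'a::euclidean_space \<Rightarrow> real"
  assumes \<Omega>: "open \<Omega>"
    and contA: "\<And>i j. i \<in> Basis \<Longrightarrow> j \<in> Basis \<Longrightarrow> continuous_on \<Omega> (\<lambda>z. A z i \<bullet> j)"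
    and u: "\<And>K. compact K \<Longrightarrow> K \<subseteq> \<Omega> \<Longrightarrow> set_integrable lebesgue K u"
    and test: "\<And>w. smooth_on w UNIV \<Longrightarrow> (\<forall>z. 0 \<le> w z) \<Longrightarrow> compact (closure {z. w z \<noteq> 0}) \<Longrightarrow>
       closure {z. w z \<noteq> 0} \<subseteq> \<Omega> \<Longrightarrow> 0 \<le> (\<integral>z. u z * Lg A w z \<partial>lebesgue)"
    and w: "C2c \<Omega> w" "\<And>z. 0 \<le> w z"
  shows "0 \<le> (\<integral>z. u z * Lg A w z \<partial>lebesgue)"
proof -
  obtain K where K: "compact K" "K \<subseteq> \<Omega>" "\<And>x. x \<notin> K \<Longrightarrow> w x = 0" using w(1) by (auto simp: C2c_def)
  obtain d where d: "d > 0" "(\<Union>x\<in>K. cball x d) \<subseteq> \<Omega>"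
    using compact_subset_open_imp_cball_epsilon_subset[OF K(1) \<Omega> K(2)] by auto
  \<comment> \<open>The d-neighbourhood of K carries every mollified function because
    \<open>e n\<close> is at most d; one compact set then dominates all integrals.\<close>
  define K1 where "K1 = {x + y | x y. x \<in> K \<and> y \<in> cball 0 d}"
  have K1: "compact K1" unfolding K1_def by (intro compact_sums K compact_cball)
  have K1\<Omega>: "K1 \<subseteq> \<Omega>" using d(2) by (fastforce simp: K1_def dist_norm)
  have KK1: "K \<subseteq> K1" using d(1) by (force simp: K1_def)
  define e where "e n = d / real (Suc n)" for n
  have e: "e n > 0" "e n \<le> d" for n using d(1) by (auto simp: e_def divide_simps)
  have "\<exists>\<eta> :: nat \<Rightarrow> 'a \<Rightarrow> real. \<forall>n. (\<forall>k. Ck k (\<eta> n) UNIV) \<and> (\<forall>x. 0 \<le> \<eta> n (x::'a)) \<and> (\<forall>x. x \<notin> cball 0 (e n) \<longrightarrow> \<eta> n x = 0)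
      \<and> (\<integral>x. \<eta> n x \<partial>lborel) = 1"
  proof (intro choice allI)
    fix n
    show "\<exists>\<eta> :: 'a \<Rightarrow> real. (\<forall>k. Ck k \<eta> UNIV) \<and> (\<forall>x. 0 \<le> \<eta> x) \<and>
        (\<forall>x. x \<notin> cball 0 (e n) \<longrightarrow> \<eta> x = 0) \<and> (\<integral>x. \<eta> x \<partial>lborel) = 1"
      by (rule exists_mollifier[OF e(1)[of n], where 'a='a]) blast
  qed
  then obtain \<eta> :: "nat \<Rightarrow> 'a \<Rightarrow> real" where \<eta>: "\<And>n k. Ck k (\<eta> n) UNIV" "\<And>n x. 0 \<le> \<eta> n (x::'a)"
     "\<And>n x. x \<notin> cball 0 (e n) \<Longrightarrow> \<eta> n x = 0" "\<And>n. (\<integral>x. \<eta> n x \<partial>lborel) = 1" by metis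
  have \<eta>c: "integrable lborel (\<eta> n)" "\<eta> n \<in> borel_measurable borel" for n
    using Ck_compact_support[OF \<eta>(1) compact_cball[of 0 "e n"] \<eta>(3)] by auto
  note wc = C2cD[OF w(1)]
  note wi = Ck_compact_support[OF wc(1) K(1,3)]
  obtain W where W: "\<And>x. \<bar>w x\<bar> \<le> W" using wi(3) by auto
  define v where "v n z = (\<integral>y. \<eta> n (z - y) * w y \<partial>lborel)" for n z
  have vz: "v n z = 0" if "z \<notin> K1" for n z
  proof -
    have "\<eta> n (z - y) * w y = 0" for y
    proof (rule ccontr)
      assume "\<eta> n (z - y) * w y \<noteq> 0"
      then have "z - y \<in> cball 0 (e n)" "y \<in> K" using \<eta>(3)[of "z - y" n] K(3)[of y] by auto
      then have "z = y + (z - y)" "z - y \<in> cball 0 d" "y \<in> K" using e(2)[of n] by auto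
      then show False using that unfolding K1_def by blast
    qed
    then have "(\<lambda>y. \<eta> n (z - y) * w y) = (\<lambda>_. 0)" by (intro ext)
    then show ?thesis unfolding v_def by (simp only: Bochner_Integration.integral_zero)
  qed
  have Cv: "Ck k (v n) UNIV" for k n
    unfolding v_def[abs_def] by (rule Ck_convolution[OF \<eta>(1) compact_cball[of 0 "e n"] \<eta>(3) wi(1) W])
  have v0: "0 \<le> v n z" for n z
    unfolding v_def by (intro integral_nonneg_AE AE_I2 mult_nonneg_nonneg \<eta> w)
  have D2v: "Dd (Dd (v n) i) j z = (\<integral>y. Dd (Dd w i) j (z - y) * \<eta> n y \<partial>lborel)" for n i j z
    unfolding v_def[abs_def] by (rule Dd_convolution[OF \<eta>(1) compact_cball[of 0 "e n"] \<eta>(3) wc(1) K(1,3)])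
  have D2z: "Dd (Dd w i) j x = 0" if "x \<notin> K" for i j x
    using K compact_imp_closed that by (intro Dd_zero_outside[of K]) (auto intro: Dd_zero_outside[of K])
  have "\<exists>B. \<forall>x. \<bar>Dd (Dd w i) j x\<bar> \<le> B" for i j
    using integrable_continuous_compact_support(3)[OF K(1) wc(4) D2z] by blast
  then obtain B where B: "\<And>i j x. \<bar>Dd (Dd w i) j x\<bar> \<le> B i j" by metis
  have Dm[measurable]: "Dd (Dd w i) j \<in> borel_measurable borel" for i j
    using wc(4) by (rule borel_measurable_continuous_onI)
  have intD: "integrable lborel (\<lambda>y. Dd (Dd w i) j (z - y) * \<eta> n y)" for i j z n
    by (rule Bochner_Integration.integrable_bound[OF integrable_mult_right[OF \<eta>c(1)[of n], of "B i j"]])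
      (use \<eta>c(2)[of n] \<eta>(2) in \<open>auto simp: abs_mult intro!: mult_right_mono order_trans[OF B abs_ge_self]\<close>)
  \<comment> \<open>Used twice: with c the value of the derivative at z for convergence, and with c
    = 0 for the uniform bound.\<close>
  have approx: "\<bar>Dd (Dd (v n) i) j z - c\<bar> \<le> b"
    if "\<And>y. y \<in> cball 0 (e n) \<Longrightarrow> \<bar>Dd (Dd w i) j (z - y) - c\<bar> \<le> b" for n i j z b c
  proof -
    have "Dd (Dd (v n) i) j z - c = (\<integral>y. Dd (Dd w i) j (z - y) * \<eta> n y \<partial>lborel) - (\<integral>y. c * \<eta> n y \<partial>lborel)"
      using \<eta>(4)[of n] by (simp add: D2v)
    also have "\<dots> = (\<integral>y. Dd (Dd w i) j (z - y) * \<eta> n y - c * \<eta> n y \<partial>lborel)"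
      using intD \<eta>c(1) by (subst Bochner_Integration.integral_diff) auto
    finally have "\<bar>Dd (Dd (v n) i) j z - c\<bar> = \<bar>\<integral>y. Dd (Dd w i) j (z - y) * \<eta> n y - c * \<eta> n y \<partial>lborel\<bar>" by simp
    also have "\<dots> \<le> (\<integral>y. \<bar>Dd (Dd w i) j (z - y) * \<eta> n y - c * \<eta> n y\<bar> \<partial>lborel)" by (rule integral_abs_bound)
    also have "\<dots> \<le> (\<integral>y. b * \<eta> n y \<partial>lborel)"
    proof (rule integral_mono)
      show "\<bar>Dd (Dd w i) j (z - y) * \<eta> n y - c * \<eta> n y\<bar> \<le> b * \<eta> n y" for y
      proof (cases "y \<in> cball 0 (e n)")
        case True
        have "\<bar>Dd (Dd w i) j (z - y) * \<eta> n y - c * \<eta> n y\<bar> = \<bar>Dd (Dd w i) j (z - y) - c\<bar> * \<eta> n y"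
          using \<eta>(2)[of n y] by (simp add: abs_mult flip: left_diff_distrib)
        then show ?thesis using mult_right_mono[OF that[OF True] \<eta>(2)[of n y]] by simp
      qed (use \<eta>(3)[of y n] in auto)
    qed (use intD \<eta>c(1) in auto)
    finally show ?thesis using \<eta>(4)[of n] by simp
  qed
  have lim: "(\<lambda>n. Dd (Dd (v n) i) j z) \<longlonglongrightarrow> Dd (Dd w i) j z" for i j z
  proof (rule LIMSEQ_I)
    fix r :: real assume r: "0 < r"
    have "isCont (Dd (Dd w i) j) z" using wc(4)[of UNIV] by (simp add: continuous_on_eq_continuous_at)
    then obtain s where s: "s > 0" "\<And>x. dist x z < s \<Longrightarrow> dist (Dd (Dd w i) j x) (Dd (Dd w i) j z) < r / 2"
      using r unfolding continuous_at_eps_delta dist_norm by (metis half_gt_zero)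
    obtain N where N: "d / s < real N" using reals_Archimedean2 by blast
    have "norm (Dd (Dd (v n) i) j z - Dd (Dd w i) j z) < r" if "n \<ge> N" for n
    proof -
      have "d / s < real (Suc n)" using N that by linarith
      then have "e n < s" using s(1) d(1) by (simp add: e_def field_simps)
      then have hh: "\<bar>Dd (Dd w i) j (z - y) - Dd (Dd w i) j z\<bar> \<le> r / 2" if "y \<in> cball 0 (e n)" for y
        using s(2)[of "z - y"] that by (simp add: dist_norm) 
      show ?thesis using approx[of n i j z "Dd (Dd w i) j z" "r/2", OF hh] r by simp
    qed
    then show "\<exists>N. \<forall>n\<ge>N. norm (Dd (Dd (v n) i) j z - Dd (Dd w i) j z) < r" by blast
  qed
  have Bv: "\<bar>Dd (Dd (v n) i) j z\<bar> \<le> B i j" for n i j z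
    using approx[of n i j z 0 "B i j"] B by simp
  have "\<exists>M. \<forall>z\<in>K1. \<bar>A z i \<bullet> j\<bar> \<le> M" if "i \<in> Basis" "j \<in> Basis" for i j
    using compact_imp_bounded[OF compact_continuous_image[OF continuous_on_subset[OF contA[OF that] K1\<Omega>] K1]]
    by (auto simp: bounded_iff)
  then obtain M where M: "\<And>i j z. i \<in> Basis \<Longrightarrow> j \<in> Basis \<Longrightarrow> z \<in> K1 \<Longrightarrow> \<bar>A z i \<bullet> j\<bar> \<le> M i j" by metis
  define C where "C = (\<Sum>i\<in>Basis. \<Sum>j\<in>Basis. M i j * B i j)"
  have Lz: "Lg A (v n) z = 0" "Lg A w z = 0" if "z \<notin> K1" for n z
  proof -
    show "Lg A (v n) z = 0" by (rule Lg_zero_outside[OF compact_imp_closed[OF K1] vz that])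
    show "Lg A w z = 0" by (rule Lg_zero_outside[OF compact_imp_closed[OF K(1)] K(3)]) (use that KK1 in auto)
  qed
  have LC: "\<bar>Lg A (v n) z\<bar> \<le> C" if "z \<in> K1" for n z
    unfolding Lg_def C_def
    by (intro order_trans[OF sum_abs] sum_mono) (auto simp: abs_mult intro!: mult_mono M that Bv order_trans[OF abs_ge_zero M])
  have meas: "(\<lambda>z. u z * Lg A f z) \<in> borel_measurable lebesgue"
    if "Ck 2 f UNIV" "\<And>z. z \<notin> K1 \<Longrightarrow> Lg A f z = 0" for f
  proof -
    have "continuous_on K1 (Lg A f)"
      unfolding Lg_def[abs_def] using that(1)
      by (intro continuous_on_sum continuous_on_mult continuous_on_subset[OF contA K1\<Omega>])
        (auto simp: Ck2_iff intro: continuous_on_subset)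
    from integrable_continuous_compact_support(2)[OF K1 this that(2)]
    have "Lg A f \<in> borel_measurable lebesgue" by (simp add: measurable_completion)
    moreover have "(\<lambda>z. indicator K1 z *\<^sub>R u z) \<in> borel_measurable lebesgue"
      using u[OF K1 K1\<Omega>] by (auto simp: set_integrable_def dest: borel_measurable_integrable)
    ultimately have "(\<lambda>z. (indicator K1 z *\<^sub>R u z) * Lg A f z) \<in> borel_measurable lebesgue" by simp
    moreover have "(\<lambda>z. (indicator K1 z *\<^sub>R u z) * Lg A f z) = (\<lambda>z. u z * Lg A f z)"
      using that(2) by (auto simp: indicator_def fun_eq_iff)
    ultimately show ?thesis by simp
  qed
  have "(\<lambda>n. \<integral>z. u z * Lg A (v n) z \<partial>lebesgue) \<longlonglongrightarrow> (\<integral>z. u z * Lg A w z \<partial>lebesgue)"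
  proof (rule integral_dominated_convergence[where w="\<lambda>z. \<bar>indicator K1 z *\<^sub>R u z\<bar> * C"])
    show "integrable lebesgue (\<lambda>z. \<bar>indicator K1 z *\<^sub>R u z\<bar> * C)"
      using u[OF K1 K1\<Omega>] unfolding set_integrable_def by (intro integrable_mult_left integrable_abs)
    show "AE z in lebesgue. (\<lambda>n. u z * Lg A (v n) z) \<longlonglongrightarrow> u z * Lg A w z"
      unfolding Lg_def by (intro AE_I2 tendsto_intros lim)
    show "AE z in lebesgue. norm (u z * Lg A (v n) z) \<le> \<bar>indicator K1 z *\<^sub>R u z\<bar> * C" for n
    proof (rule AE_I2)
      fix z show "norm (u z * Lg A (v n) z) \<le> \<bar>indicator K1 z *\<^sub>R u z\<bar> * C"
        using LC[of z n] Lz(1)[of z n] by (cases "z \<in> K1") (auto simp: abs_mult intro!: mult_left_mono)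
    qed
  qed (use meas[OF Cv Lz(1)] meas[OF wc(1) Lz(2)] in auto)
  moreover have "0 \<le> (\<integral>z. u z * Lg A (v n) z \<partial>lebesgue)" for n
  proof (rule test)
    have sub: "closure {z. v n z \<noteq> 0} \<subseteq> K1"
      by (rule closure_minimal) (use vz[of _ n] compact_imp_closed[OF K1] in auto)
    then show "closure {z. v n z \<noteq> 0} \<subseteq> \<Omega>" using K1\<Omega> by blast
    show "compact (closure {z. v n z \<noteq> 0})"
      using compact_Int_closed[OF K1 closed_closure, of "{z. v n z \<noteq> 0}"] sub by (metis Int_absorb1)
  qed (use Cv v0 in \<open>auto simp: smooth_on_def\<close>)
  ultimately show ?thesis by (intro LIMSEQ_le_const) auto
qed

section \<open>Radial profiles\<close>

text \<open>\<open>Ph\<close> is a fundamental solution truncated at radius \<open>\<delta>\<close>, as a function of the squared radius \<open>p\<close>; \<open>- gg\<close> and \<open>P2\<close> are its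
  first two derivatives. The weight \<open>wf\<close> is chosen so that \<open>4 p P2 - 2 m gg = N1 \<ge> 0\<close> in dimension \<open>m\<close>.\<close>

definition wf :: "real \<Rightarrow> real \<Rightarrow> real" where "wf \<delta> r = (max 0 (1 - r / \<delta>))\<^sup>2"
definition w1 :: "real \<Rightarrow> real \<Rightarrow> real" where "w1 \<delta> r = 2 / \<delta> * max 0 (1 - r / \<delta>)"
definition gg :: "nat \<Rightarrow> real \<Rightarrow> real \<Rightarrow> real" where "gg m \<delta> p = wf \<delta> (sqrt p) / (2 * sqrt p ^ m)"
definition Ph :: "nat \<Rightarrow> real \<Rightarrow> real \<Rightarrow> real" where
  "Ph m \<delta> p = (if p \<le> 0 then 0 else integral {p..\<delta>\<^sup>2} (gg m \<delta>))"
definition P2 :: "nat \<Rightarrow> real \<Rightarrow> real \<Rightarrow> real" where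
  "P2 m \<delta> p = m * wf \<delta> (sqrt p) / (4 * sqrt p ^ (m + 2)) + w1 \<delta> (sqrt p) / (4 * sqrt p ^ (m + 1))"
definition N1 :: "nat \<Rightarrow> real \<Rightarrow> real \<Rightarrow> real" where "N1 m \<delta> p = w1 \<delta> (sqrt p) / sqrt p ^ (m - 1)"

context
  fixes m :: nat and \<delta> :: real
  assumes m: "2 \<le> m" and \<delta>: "0 < \<delta>"
begin

lemma wf_nonneg: "0 \<le> wf \<delta> r" and w1_nonneg: "0 \<le> w1 \<delta> r"
  using \<delta> by (auto simp: wf_def w1_def)

text \<open>Expressing \<open>wf\<close> through \<open>w1\<close> gains a factor \<delta>; this is
  why the lower-order quantities below are small against \<open>N1\<close>.\<close>

lemma wf_le_w1: assumes "0 \<le> r" shows "wf \<delta> r \<le> \<delta> / 2 * w1 \<delta> r"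
proof -
  have "max 0 (1 - r / \<delta>) \<le> 1" "0 \<le> max 0 (1 - r / \<delta>)" using assms \<delta> by (auto simp: max_def)
  then have "max 0 (1 - r / \<delta>) * max 0 (1 - r / \<delta>) \<le> 1 * max 0 (1 - r / \<delta>)" by (intro mult_right_mono)
  then show ?thesis using \<delta> by (simp add: wf_def w1_def power2_eq_square)
qed

lemma wf_mono: "r \<le> s \<Longrightarrow> wf \<delta> s \<le> wf \<delta> r" and w1_mono: "r \<le> s \<Longrightarrow> w1 \<delta> s \<le> w1 \<delta> r"
  unfolding wf_def w1_def using \<delta>
  by (intro power_mono mult_left_mono max.mono diff_left_mono divide_right_mono; simp)+

text \<open>The square makes the positive part continuously differentiable across r = \<delta>, and
  thereby \<open>Ph\<close> twice continuously differentiable away from 0.\<close>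

lemma wf_has_derivative: "(wf \<delta> has_real_derivative - w1 \<delta> r) (at r)"
proof -
  have *: "((\<lambda>x::real. (max 0 x)\<^sup>2) has_real_derivative 2 * max 0 x) (at x)" for x
  proof -
    consider "x > 0" | "x < 0" | "x = 0" by linarith
    then show ?thesis
    proof cases
      case 1
      have "((\<lambda>x::real. x\<^sup>2) has_real_derivative 2 * max 0 x) (at x)"
        using 1 by (auto intro!: derivative_eq_intros)
      then show ?thesis by (rule has_field_derivative_transform_within_open[of _ _ _ "{0<..}"]) (use 1 in auto)
    next
      case 2
      have "((\<lambda>x::real. 0::real) has_real_derivative 2 * max 0 x) (at x)" using 2 by simp
      then show ?thesis by (rule has_field_derivative_transform_within_open[of _ _ _ "{..<0}"]) (use 2 in auto)
    next
      case 3
      have "((\<lambda>h::real. (max 0 h)\<^sup>2 / h) \<longlongrightarrow> 0) (at 0)"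
      proof (rule tendsto_rabs_zero_cancel, rule tendsto_sandwich[OF _ _ tendsto_const])
        show "\<forall>\<^sub>F h in at (0::real). \<bar>(max 0 h)\<^sup>2 / h\<bar> \<le> \<bar>h\<bar>"
          by (auto simp: max_def power2_eq_square abs_mult)
        show "((\<lambda>h::real. \<bar>h\<bar>) \<longlongrightarrow> 0) (at 0)" by (rule tendsto_rabs_zero) (rule tendsto_ident_at)
      qed auto
      then show ?thesis using 3 by (simp add: DERIV_def)
    qed
  qed
  have "((\<lambda>r. 1 - r / \<delta>) has_real_derivative (- 1 / \<delta>)) (at r)"
    using \<delta> by (auto intro!: derivative_eq_intros)
  from DERIV_chain2[OF *[of "1 - r / \<delta>"] this] show ?thesis
    by (simp add: wf_def[abs_def] w1_def mult.commute)
qed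

lemma gg_has_derivative:
  assumes p: "0 < p" shows "(gg m \<delta> has_real_derivative - P2 m \<delta> p) (at p)"
proof -
  define r where "r = sqrt p"
  have r: "r = sqrt p" "r > 0" "p = r\<^sup>2" using p by (simp_all add: r_def)
  have s: "(sqrt has_real_derivative inverse r / 2) (at p)" using DERIV_real_sqrt[OF p] by (simp add: r(1))
  have "((\<lambda>r. wf \<delta> r / (2 * r ^ m)) has_real_derivative
      (- w1 \<delta> r * (2 * r ^ m) - wf \<delta> r * (2 * (m * r ^ (m - 1)))) / (2 * r ^ m * (2 * r ^ m))) (at r)"
    using r by (auto intro!: derivative_eq_intros wf_has_derivative)
  from DERIV_chain2[OF this[unfolded r(1)] s[unfolded r(1)]]
  have d: "(gg m \<delta> has_real_derivative
      (- w1 \<delta> r * (2 * r ^ m) - wf \<delta> r * (2 * (m * r ^ (m - 1)))) / (2 * r ^ m * (2 * r ^ m)) * (inverse r / 2)) (at p)"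
    by (simp add: gg_def[abs_def] r(1))
  obtain n where n: "m = Suc n" using m by (cases m) auto
  have "(- w1 \<delta> r * (2 * r ^ m) - wf \<delta> r * (2 * (m * r ^ (m - 1)))) / (2 * r ^ m * (2 * r ^ m)) * (inverse r / 2) = - P2 m \<delta> p"
    unfolding P2_def r(1)[symmetric] using r(2) by (simp add: n field_simps)
  then show ?thesis using d by simp
qed

lemma gg_nonneg: "0 \<le> p \<Longrightarrow> 0 \<le> gg m \<delta> p" and P2_nonneg: "0 \<le> p \<Longrightarrow> 0 \<le> P2 m \<delta> p"
  and N1_nonneg: "0 \<le> p \<Longrightarrow> 0 \<le> N1 m \<delta> p"
  using wf_nonneg w1_nonneg by (auto simp: gg_def P2_def N1_def)

lemma profile_zero:
  assumes "\<delta>\<^sup>2 \<le> p" shows "gg m \<delta> p = 0" "P2 m \<delta> p = 0" "N1 m \<delta> p = 0" "Ph m \<delta> p = 0"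
proof -
  have "\<delta> \<le> sqrt p" using assms real_le_rsqrt by blast
  then have z: "max 0 (1 - sqrt p / \<delta>) = 0" using \<delta> by (simp add: max_def)
  show "gg m \<delta> p = 0" "P2 m \<delta> p = 0" "N1 m \<delta> p = 0" by (simp_all add: gg_def P2_def N1_def wf_def w1_def z)
  show "Ph m \<delta> p = 0" using assms by (cases "p = \<delta>\<^sup>2") (auto simp: Ph_def)
qed

lemma Ph_has_derivative:
  assumes p: "0 < p" shows "(Ph m \<delta> has_real_derivative - gg m \<delta> p) (at p)"
proof -
  have cg: "continuous_on {0<..} (gg m \<delta>)"
    using gg_has_derivative by (meson DERIV_continuous_on continuous_at_imp_continuous_on DERIV_isCont greaterThan_iff)
  \<comment> \<open>An upper limit beyond both p and \<delta>^2 gives one formula for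
    \<open>Ph\<close> near p, on either side of \<delta>^2, since \<open>gg\<close> vanishes from
    there on.\<close>
  define b where "b = max p (\<delta>\<^sup>2) + 1"
  have b: "p < b" "\<delta>\<^sup>2 < b" by (auto simp: b_def)
  have "Ph m \<delta> x = integral {x..b} (gg m \<delta>)" if x: "x \<in> {p/2<..<b}" for x
  proof -
    have x0: "0 < x" using x p by auto
    have ci: "gg m \<delta> integrable_on {x..b}"
      using x0 by (intro integrable_continuous_interval continuous_on_subset[OF cg]) auto
    have z: "integral {c..b} (gg m \<delta>) = 0" if "\<delta>\<^sup>2 \<le> c" for c
      using integral_cong[of "{c..b}" "gg m \<delta>" "\<lambda>_. 0"] profile_zero(1) that by auto
    show ?thesis
    proof (cases "x \<le> \<delta>\<^sup>2")
      case True
      then show ?thesis using Henstock_Kurzweil_Integration.integral_combine[OF True _ ci] b z[of "\<delta>\<^sup>2"] x0 by (simp add: Ph_def)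
    next
      case False
      then show ?thesis using z[of x] x0 by (simp add: Ph_def)
    qed
  qed
  moreover have "((\<lambda>x. integral {x..b} (gg m \<delta>)) has_real_derivative - gg m \<delta> p) (at p)"
  proof -
    have "((\<lambda>x. integral {x..b} (gg m \<delta>)) has_real_derivative - gg m \<delta> p) (at p within {p/2..b})"
      using p b by (intro integral_has_real_derivative' continuous_on_subset[OF cg]) auto
    then show ?thesis using at_within_interior[of p "{p/2..b}"] p b by (simp add: interior_atLeastAtMost_real)
  qed
  ultimately show ?thesis
    using has_field_derivative_transform_within_open[of "\<lambda>x. integral {x..b} (gg m \<delta>)" _ p "{p/2<..<b}" "Ph m \<delta>"] p b by auto
qed

lemma continuous_P2: "continuous_on {0<..} (P2 m \<delta>)"
  unfolding P2_def wf_def w1_def using \<delta> by (auto intro!: continuous_intros)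

text \<open>With u(x) = \<open>Ph\<close> (|x|^2) and r = |x| one has r^(m-1) u'(r) = -
  \<open>wf\<close>, so the Laplacian r^(1-m) (r^(m-1) u')' equals \<open>w1\<close> / r^(m-1). The
  left-hand side is this Laplacian in the variable p = r^2.\<close>

lemma profile_identity:
  assumes p: "0 < p" shows "4 * p * P2 m \<delta> p - 2 * m * gg m \<delta> p = N1 m \<delta> p"
proof -
  define r where "r = sqrt p"
  have r: "r = sqrt p" "r > 0" "p = r\<^sup>2" using p by (simp_all add: r_def)
  obtain n where n: "m = Suc n" using m by (cases m) auto
  show ?thesis unfolding P2_def gg_def N1_def r(1)[symmetric] using r(2)
    by (simp add: n r(3) field_simps power2_eq_square)
qed

lemma P2_antimono: assumes "0 < p" "p \<le> p'" shows "P2 m \<delta> p' \<le> P2 m \<delta> p"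
  unfolding P2_def using assms
  by (intro add_mono frac_le mult_left_mono mult_nonneg_nonneg wf_nonneg w1_nonneg wf_mono w1_mono power_mono real_sqrt_le_mono) auto

lemma N1_antimono: assumes "0 < p" "p \<le> p'" shows "N1 m \<delta> p' \<le> N1 m \<delta> p"
  unfolding N1_def using assms
  by (intro frac_le w1_nonneg w1_mono power_mono real_sqrt_le_mono) auto

lemma Ph_antimono: assumes "0 < p" "p \<le> p'" shows "Ph m \<delta> p' \<le> Ph m \<delta> p"
proof (rule DERIV_nonpos_imp_nonincreasing[OF assms(2)])
  fix x assume "p \<le> x"
  then have "0 < x" using assms by simp
  then show "\<exists>y. (Ph m \<delta> has_real_derivative y) (at x) \<and> y \<le> 0"
    using Ph_has_derivative[of x] gg_nonneg[of x] by (intro exI[of _ "- gg m \<delta> x"]) auto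
qed

lemma Ph_nonneg: "0 \<le> Ph m \<delta> p"
proof (cases "0 < p")
  case True
  show ?thesis using Ph_antimono[OF True, of "max p (\<delta>\<^sup>2)"] profile_zero(4)[of "max p (\<delta>\<^sup>2)"] by simp
qed (simp add: Ph_def)

text \<open>Between p and \<delta>^2, \<open>gg\<close> is at most the derivative of C * sqrt, with
  C frozen at p. The factor 1/2 leaves the room that the positivity of \<open>QQ\<close> needs for
  its error term.\<close>

lemma Ph_le: assumes "0 \<le> p" shows "Ph m \<delta> p \<le> \<delta>\<^sup>2 / 2 * N1 m \<delta> p"
proof -
  consider "p = 0" | "\<delta>\<^sup>2 \<le> p" | "0 < p" "p < \<delta>\<^sup>2" using assms by linarith
  then show ?thesis
  proof cases
    case 3
    obtain n where n: "m = Suc n" using m by (cases m) auto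
    define C where "C = wf \<delta> (sqrt p) / sqrt p ^ n"
    have "Ph m \<delta> p + C * sqrt p \<le> Ph m \<delta> (\<delta>\<^sup>2) + C * sqrt (\<delta>\<^sup>2)"
    proof (rule DERIV_nonneg_imp_nondecreasing[where f="\<lambda>s. Ph m \<delta> s + C * sqrt s" and a=p and b="\<delta>\<^sup>2"])
      fix s assume s: "p \<le> s" "s \<le> \<delta>\<^sup>2"
      then have s0: "0 < s" using 3 by simp
      have "gg m \<delta> s \<le> wf \<delta> (sqrt p) / (2 * (sqrt p ^ n * sqrt s))"
        unfolding gg_def n power_Suc2 using s 3 s0
        by (intro frac_le wf_nonneg wf_mono mult_mono power_mono real_sqrt_le_mono) auto
      also have "\<dots> = C * (inverse (sqrt s) / 2)" by (simp add: C_def field_simps)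
      finally show "\<exists>y. ((\<lambda>s. Ph m \<delta> s + C * sqrt s) has_real_derivative y) (at s) \<and> 0 \<le> y"
        by (intro exI[of _ "- gg m \<delta> s + C * (inverse (sqrt s) / 2)"] conjI DERIV_add DERIV_cmult
            Ph_has_derivative s0 DERIV_real_sqrt) auto
    qed (use 3 in simp)
    then have "Ph m \<delta> p \<le> C * \<delta> - C * sqrt p" using profile_zero(4)[of "\<delta>\<^sup>2"] \<delta> by simp
    also have "\<dots> \<le> C * \<delta>" using 3 wf_nonneg by (simp add: C_def)
    also have "\<dots> \<le> (\<delta> / 2 * w1 \<delta> (sqrt p)) / sqrt p ^ n * \<delta>"
      unfolding C_def using 3 \<delta> by (intro mult_right_mono divide_right_mono wf_le_w1) auto
    also have "\<dots> = \<delta>\<^sup>2 / 2 * N1 m \<delta> p" by (simp add: N1_def n power2_eq_square)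
    finally show ?thesis .
  next
    case 1
    have "Ph m \<delta> p = 0" using 1 by (simp add: Ph_def)
    then show ?thesis using N1_nonneg[OF assms] \<delta> by simp
  next
    case 2 then show ?thesis by (simp add: profile_zero)
  qed
qed

text \<open>\<open>gg\<close>, and p times \<open>P2\<close> in the next lemma, are the sizes of
  second derivatives of the parametrix; the additional \<open>sqrt p\<close> is the oscillation of
  Lipschitz coefficients. The product is at most a multiple of \<delta> times \<open>N1\<close>,
  hence a small relative error.\<close>

lemma gg_le: assumes "0 \<le> p" shows "gg m \<delta> p * sqrt p \<le> \<delta> / 4 * N1 m \<delta> p"
proof (cases "p = 0")
  case False
  obtain n where n: "m = Suc n" using m by (cases m) auto
  have r: "0 < sqrt p" using assms False by simp
  have "gg m \<delta> p * sqrt p = wf \<delta> (sqrt p) / (2 * sqrt p ^ n)" using r by (simp add: gg_def n field_simps)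
  also have "\<dots> \<le> (\<delta> / 2 * w1 \<delta> (sqrt p)) / (2 * sqrt p ^ n)"
    using r by (intro divide_right_mono wf_le_w1) auto
  also have "\<dots> = \<delta> / 4 * N1 m \<delta> p" by (simp add: N1_def n)
  finally show ?thesis .
qed (use m \<delta> w1_nonneg in \<open>simp add: N1_def\<close>)

lemma P2_le: assumes "0 \<le> p" shows "P2 m \<delta> p * (p * sqrt p) \<le> \<delta> * (m + 2) / 8 * N1 m \<delta> p"
proof (cases "p = 0")
  case False
  obtain n where n: "m = Suc n" using m by (cases m) auto
  define r where "r = sqrt p"
  have r: "r = sqrt p" "r > 0" "p = r\<^sup>2" using assms False by (simp_all add: r_def)
  have "r * w1 \<delta> r \<le> \<delta> * w1 \<delta> r"
  proof (cases "r \<le> \<delta>")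
    case True then show ?thesis using w1_nonneg by (intro mult_right_mono)
  next
    case False then show ?thesis using \<delta> by (simp add: w1_def max_def)
  qed
  moreover have "m * wf \<delta> r \<le> m * (\<delta> / 2 * w1 \<delta> r)" using r by (intro mult_left_mono wf_le_w1) auto
  ultimately have le: "m * wf \<delta> r + r * w1 \<delta> r \<le> \<delta> * (m + 2) / 2 * w1 \<delta> r" by (simp add: field_simps)
  have "P2 m \<delta> p * (p * sqrt p) = (m * wf \<delta> r + r * w1 \<delta> r) / (4 * r ^ n)"
    unfolding P2_def r(1)[symmetric] using r(2) by (simp add: n r(3) field_simps power2_eq_square)
  also have "\<dots> \<le> (\<delta> * (m + 2) / 2 * w1 \<delta> r) / (4 * r ^ n)" using le r(2) by (intro divide_right_mono) auto
  also have "\<dots> = \<delta> * (m + 2) / 8 * N1 m \<delta> p" by (simp add: N1_def n r(1))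
  finally show ?thesis .
qed (use m \<delta> w1_nonneg in \<open>simp add: N1_def\<close>)

text \<open>At scale \<delta> the profile is \<delta>^(-m) times the dilated unit profile, so its
  mass in dimension m does not depend on \<delta>.\<close>

lemma N1_scale: assumes "0 \<le> p" shows "N1 m \<delta> (\<delta>\<^sup>2 * p) = N1 m 1 p / \<delta> ^ m"
proof -
  obtain n where n: "m = Suc n" using m by (cases m) auto
  show ?thesis using \<delta> by (simp add: N1_def w1_def n real_sqrt_mult power_mult_distrib)
qed

text \<open>The mean value theorem on [\<delta>^2/16, \<delta>^2/4], of length 3 \<delta>^2/16, with
  \<open>gg\<close> at least 1/(8 \<delta>^m) there, yields 3/128. This lower bound is the origin of
  the contraction constant \<open>b0\<close>.\<close>

lemma Ph_lower: assumes "0 < p" "p \<le> \<delta>\<^sup>2 / 16" shows "3 / 128 * \<delta>\<^sup>2 / \<delta> ^ m \<le> Ph m \<delta> p"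
proof -
  have d2: "\<delta>\<^sup>2 / 16 < \<delta>\<^sup>2 / 4" using \<delta> by simp
  have "\<exists>z>\<delta>\<^sup>2 / 16. z < \<delta>\<^sup>2 / 4 \<and> Ph m \<delta> (\<delta>\<^sup>2 / 4) - Ph m \<delta> (\<delta>\<^sup>2 / 16) = (\<delta>\<^sup>2 / 4 - \<delta>\<^sup>2 / 16) * (- gg m \<delta> z)"
    using \<delta> by (intro MVT2[OF d2] Ph_has_derivative) (auto intro: less_le_trans[of 0 "\<delta>\<^sup>2/16"])
  then obtain z where z: "\<delta>\<^sup>2 / 16 < z" "z < \<delta>\<^sup>2 / 4"
    "Ph m \<delta> (\<delta>\<^sup>2 / 4) - Ph m \<delta> (\<delta>\<^sup>2 / 16) = (\<delta>\<^sup>2 / 4 - \<delta>\<^sup>2 / 16) * (- gg m \<delta> z)" by blast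
  have z0: "0 < z" using z(1) \<delta> by (auto intro: less_trans[of 0 "\<delta>\<^sup>2/16"])
  have sz: "sqrt z \<le> \<delta> / 2" using z(2) \<delta> by (intro real_le_lsqrt) (auto simp: power_divide)
  have "1 / 4 \<le> wf \<delta> (sqrt z)"
  proof -
    have h: "1 / 2 \<le> max 0 (1 - sqrt z / \<delta>)" using sz \<delta> by (simp add: max_def field_simps)
    then have "(1 / 2)\<^sup>2 \<le> (max 0 (1 - sqrt z / \<delta>))\<^sup>2" using power_mono[OF h, of 2] by simp
    then show ?thesis by (simp add: wf_def power_divide)
  qed
  moreover have "2 * sqrt z ^ m \<le> 2 * \<delta> ^ m"
    using sz z0 \<delta> by (intro mult_left_mono power_mono) (auto intro: order_trans)
  ultimately have "(1 / 4) / (2 * \<delta> ^ m) \<le> gg m \<delta> z"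
    unfolding gg_def using z0 wf_nonneg by (intro frac_le) auto
  then have "(\<delta>\<^sup>2 / 4 - \<delta>\<^sup>2 / 16) * ((1 / 4) / (2 * \<delta> ^ m)) \<le> (\<delta>\<^sup>2 / 4 - \<delta>\<^sup>2 / 16) * gg m \<delta> z"
    using d2 by (intro mult_left_mono) auto
  also have "\<dots> \<le> Ph m \<delta> (\<delta>\<^sup>2 / 16)" using z(3) Ph_nonneg[of "\<delta>\<^sup>2 / 4"] by simp
  also have "\<dots> \<le> Ph m \<delta> p" by (rule Ph_antimono[OF assms])
  finally show ?thesis by (simp add: field_simps)
qed

lemma profile_measurable [measurable]:
  "gg m \<delta> \<in> borel_measurable borel" "P2 m \<delta> \<in> borel_measurable borel"
  "N1 m \<delta> \<in> borel_measurable borel" "Ph m \<delta> \<in> borel_measurable borel"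
proof -
  show "gg m \<delta> \<in> borel_measurable borel" "P2 m \<delta> \<in> borel_measurable borel" "N1 m \<delta> \<in> borel_measurable borel"
    unfolding gg_def[abs_def] P2_def[abs_def] N1_def[abs_def] wf_def w1_def by measurable
  have "continuous_on {0<..} (Ph m \<delta>)"
    using Ph_has_derivative by (meson continuous_at_imp_continuous_on DERIV_isCont greaterThan_iff)
  then have "(\<lambda>p. indicator {0<..} p *\<^sub>R Ph m \<delta> p) \<in> borel_measurable borel"
    by (intro borel_measurable_continuous_on_indicator) auto
  moreover have "(\<lambda>p. indicator {0<..} p *\<^sub>R Ph m \<delta> p) = Ph m \<delta>"
    by (auto simp: Ph_def indicator_def fun_eq_iff)
  ultimately show "Ph m \<delta> \<in> borel_measurable borel" by simp
qed

end

section \<open>Integrals of the profiles\<close>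

lemma lborel_scale:
  fixes f :: "'a::euclidean_space \<Rightarrow> real"
  assumes c: "c > 0" and [measurable]: "f \<in> borel_measurable borel"
  shows "integrable lborel (\<lambda>x. f (c *\<^sub>R x)) \<longleftrightarrow> integrable lborel f"
    "(\<integral>x. f (c *\<^sub>R x) \<partial>lborel) = (\<integral>x. f x \<partial>lborel) / c ^ DIM('a)"
proof -
  have e: "lborel = density (distr lborel borel (\<lambda>x. c *\<^sub>R x :: 'a)) (\<lambda>_. ennreal (c ^ DIM('a)))"
    using lborel_affine[of c "0::'a"] c by simp
  have "integrable lborel f \<longleftrightarrow> integrable (density (distr lborel borel (\<lambda>x. c *\<^sub>R x :: 'a)) (\<lambda>_. ennreal (c ^ DIM('a)))) f"
    using e by simp
  also have "\<dots> \<longleftrightarrow> integrable lborel (\<lambda>x. c ^ DIM('a) * f (c *\<^sub>R x))"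
    using c by (subst integrable_density) (auto simp: integrable_distr_eq)
  also have "\<dots> \<longleftrightarrow> integrable lborel (\<lambda>x. f (c *\<^sub>R x))" using c by simp
  finally show "integrable lborel (\<lambda>x. f (c *\<^sub>R x)) \<longleftrightarrow> integrable lborel f" by simp
  have "(\<integral>x. f x \<partial>lborel) = (\<integral>x. f x \<partial>density (distr lborel borel (\<lambda>x. c *\<^sub>R x :: 'a)) (\<lambda>_. ennreal (c ^ DIM('a))))"
    using e by simp
  also have "\<dots> = (\<integral>x. c ^ DIM('a) * f (c *\<^sub>R x) \<partial>lborel)"
    using c by (subst integral_density) (auto simp: integral_distr)
  finally show "(\<integral>x. f (c *\<^sub>R x) \<partial>lborel) = (\<integral>x. f x \<partial>lborel) / c ^ DIM('a)" using c by simp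
qed

lemma N1_norm_integrable:
  assumes m: "2 \<le> DIM('a)"
  shows "integrable lborel (\<lambda>x::'a::euclidean_space. N1 DIM('a) 1 (x \<bullet> x))"
proof -
  let ?m = "DIM('a)"
  note [measurable] = profile_measurable[OF m zero_less_one]
  define V where "V = unit_ball_vol ?m"
  have V: "0 \<le> V" by (simp add: V_def)
  \<comment> \<open>\<open>T k\<close> bounds the profile on the shell 2^(-k-1) \<le> |x| < 2^(-k):
    there \<open>w1\<close> is at most 2 and |x|^(1-m) at most 2^((k+1)(m-1)). The volume of the
    ball, a multiple of 2^(-km), leaves a geometric series of ratio 1/2.\<close>
  define T :: "nat \<Rightarrow> real" where "T k = 2 * 2 ^ ((k + 1) * (?m - 1))" for k
  have pw: "ennreal (N1 ?m 1 (x \<bullet> x)) \<le> (\<Sum>k. ennreal (T k) * indicator (ball 0 (1 / 2 ^ k)) x)" for x :: 'a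
  proof (cases "N1 ?m 1 (x \<bullet> x) = 0")
    case False
    have nz: "x \<noteq> 0" using False m by (auto simp: N1_def)
    have l1: "norm x < 1" using False nz profile_zero(3)[OF m zero_less_one, of "x \<bullet> x"]
      by (metis not_less one_power2 power2_norm_eq_inner power_mono zero_le_one)
    define k where "k = (LEAST k. 1 / 2 ^ (k + 1) \<le> norm x)"
    obtain n where "(1 / 2) ^ n < norm x" using real_arch_pow_inv[of "norm x" "1/2"] nz by auto
    moreover have "(1 / 2 :: real) ^ (n + 1) \<le> (1 / 2) ^ n" by (intro power_decreasing) auto
    ultimately have "(1 / 2) ^ (n + 1) \<le> norm x" by linarith
    then have "1 / 2 ^ (n + 1) \<le> norm x" by (simp only: power_one_over)
    then have k: "1 / 2 ^ (k + 1) \<le> norm x" unfolding k_def by (rule LeastI)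
    have kb: "norm x < 1 / 2 ^ k"
    proof (cases k)
      case (Suc j)
      then have "\<not> 1 / 2 ^ (j + 1) \<le> norm x" unfolding k_def by (intro not_less_Least) simp
      then show ?thesis using Suc by simp
    qed (use l1 in simp)
    have "N1 ?m 1 (x \<bullet> x) \<le> 2 / norm x ^ (?m - 1)"
      unfolding N1_def norm_eq_sqrt_inner[symmetric] by (intro divide_right_mono) (auto simp: w1_def)
    also have "\<dots> \<le> 2 / (1 / 2 ^ (k + 1)) ^ (?m - 1)"
      using k nz by (intro divide_left_mono power_mono mult_pos_pos zero_less_power) auto
    also have "\<dots> = T k" unfolding T_def by (simp only: power_one_over power_mult[symmetric]) simp
    finally have "ennreal (N1 ?m 1 (x \<bullet> x)) \<le> ennreal (T k) * indicator (ball 0 (1 / 2 ^ k)) x"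
      using kb by (simp add: ennreal_leI)
    also have "\<dots> \<le> (\<Sum>k. ennreal (T k) * indicator (ball 0 (1 / 2 ^ k)) x)"
    proof -
      have "f k \<le> suminf f" for f :: "nat \<Rightarrow> ennreal"
        using sum_le_suminf[OF summableI, of "{k}" f] by simp
      then show ?thesis .
    qed
    finally show ?thesis .
  qed simp
  have "(\<integral>\<^sup>+x. ennreal (N1 ?m 1 ((x::'a) \<bullet> x)) \<partial>lborel) \<le> (\<integral>\<^sup>+x. (\<Sum>k. ennreal (T k) * indicator (ball (0::'a) (1 / 2 ^ k)) x) \<partial>lborel)"
    by (intro nn_integral_mono pw)
  also have "\<dots> = (\<Sum>k. ennreal (T k) * emeasure lborel (ball (0::'a) (1 / 2 ^ k)))"
  proof (subst nn_integral_suminf)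
    have [measurable]: "ball (0::'a) r \<in> sets borel" for r by simp
    show "(\<lambda>x. ennreal (T i) * indicator (ball (0::'a) (1 / 2 ^ i)) x) \<in> borel_measurable lborel" for i
      by measurable
  qed (simp add: nn_integral_cmult_indicator)
  also have "\<dots> = (\<Sum>k. ennreal (2 * 2 ^ (?m - 1) * V * (1 / 2) ^ k))"
  proof (intro suminf_cong)
    fix k
    have "emeasure lborel (ball (0::'a) (1 / 2 ^ k)) = ennreal (V * (1 / 2 ^ k) ^ ?m)"
      by (simp add: emeasure_ball V_def)
    then have "ennreal (T k) * emeasure lborel (ball (0::'a) (1 / 2 ^ k)) = ennreal (T k * (V * (1 / 2 ^ k) ^ ?m))"
      by (simp add: ennreal_mult T_def V)
    also have "T k * (V * (1 / 2 ^ k) ^ ?m) = 2 * 2 ^ (?m - 1) * V * (1 / 2) ^ k"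
    proof -
      obtain n where n: "?m = Suc n" using m by (cases ?m) auto
      have 1: "(2::real) ^ ((k + 1) * n) = 2 ^ (k * n) * 2 ^ n" by (simp add: distrib_right power_add)
      have 2: "(1 / 2 ^ k :: real) ^ Suc n = (1 / 2 ^ k) * (1 / 2 ^ (k * n))"
        by (simp only: power_Suc power_one_over power_mult[symmetric])
      show ?thesis unfolding T_def n diff_Suc_1 1 2 by (simp add: power_one_over)
    qed
    finally show "ennreal (T k) * emeasure lborel (ball (0::'a) (1 / 2 ^ k)) = ennreal (2 * 2 ^ (?m - 1) * V * (1 / 2) ^ k)" .
  qed
  also have "\<dots> = ennreal (\<Sum>k. 2 * 2 ^ (?m - 1) * V * (1 / 2) ^ k)"
    using V by (intro suminf_ennreal2) (auto intro!: summable_mult)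
  finally have "(\<integral>\<^sup>+x. ennreal (N1 ?m 1 ((x::'a) \<bullet> x)) \<partial>lborel) < \<infinity>"
    by (rule le_less_trans) simp
  then show ?thesis
    using N1_nonneg[OF m zero_less_one] by (intro integrableI_nonneg) auto
qed

text \<open>Dilation by \<open>sqrt \<kappa> / \<delta>\<close> absorbs both parameters. The scale
  \<delta> drops out of the integral, so one normalising constant will serve all scales.\<close>

lemma N1_quadratic:
  fixes Q :: "'a::euclidean_space \<Rightarrow> real"
  assumes m: "2 \<le> DIM('a)" and [measurable]: "Q \<in> borel_measurable borel" and Q0: "\<And>x. 0 \<le> Q x"
    and hom: "\<And>t x. Q (t *\<^sub>R x) = t\<^sup>2 * Q x"
    and int: "integrable lborel (\<lambda>x. N1 DIM('a) 1 (Q x))" and \<kappa>: "0 < \<kappa>" and \<delta>: "0 < \<delta>"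
  shows "integrable lborel (\<lambda>x. N1 DIM('a) \<delta> (\<kappa> * Q x))"
    "(\<integral>x. N1 DIM('a) \<delta> (\<kappa> * Q x) \<partial>lborel) = (\<integral>x. N1 DIM('a) 1 (Q x) \<partial>lborel) / sqrt \<kappa> ^ DIM('a)"
proof -
  note [measurable] = profile_measurable[OF m zero_less_one]
  define c where "c = sqrt \<kappa> / \<delta>"
  have c: "0 < c" using \<kappa> \<delta> by (simp add: c_def)
  have c2: "\<delta>\<^sup>2 * c\<^sup>2 = \<kappa>" using \<kappa> \<delta> by (simp add: c_def power_divide)
  have "N1 DIM('a) \<delta> (\<kappa> * Q x) = N1 DIM('a) 1 (Q (c *\<^sub>R x)) / \<delta> ^ DIM('a)" for x
  proof -
    have "\<kappa> * Q x = \<delta>\<^sup>2 * Q (c *\<^sub>R x)" by (simp only: hom c2[symmetric] mult.assoc)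
    then show ?thesis using N1_scale[OF m \<delta> Q0] by simp
  qed
  then have eq: "(\<lambda>x. N1 DIM('a) \<delta> (\<kappa> * Q x)) = (\<lambda>x. N1 DIM('a) 1 (Q (c *\<^sub>R x)) / \<delta> ^ DIM('a))" by auto
  note S = lborel_scale[OF c, of "\<lambda>x. N1 DIM('a) 1 (Q x)"]
  show "integrable lborel (\<lambda>x. N1 DIM('a) \<delta> (\<kappa> * Q x))" unfolding eq using S(1) int by simp
  show "(\<integral>x. N1 DIM('a) \<delta> (\<kappa> * Q x) \<partial>lborel) = (\<integral>x. N1 DIM('a) 1 (Q x) \<partial>lborel) / sqrt \<kappa> ^ DIM('a)"
    unfolding eq using S(2) \<delta> by (simp add: c_def power_divide)
qed

section \<open>The parametrix kernel\<close>

locale elliptic =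
  fixes A :: "'a::euclidean_space \<Rightarrow> 'a \<Rightarrow> 'a" and \<mu> \<Lambda> Lip :: real
  assumes dim: "2 \<le> DIM('a)"
    and linA: "\<And>z. linear (A z)"
    and symA: "\<And>z v w. A z v \<bullet> w = v \<bullet> A z w"
    and ell: "\<And>z v. \<mu> * (v \<bullet> v) \<le> A z v \<bullet> v"
    and bdd: "\<And>z v. norm (A z v) \<le> \<Lambda> * norm v"
    and lip: "\<And>z y v. norm (A z v - A y v) \<le> Lip * dist z y * norm v"
    and pos: "0 < \<mu>" "0 < \<Lambda>" "0 < Lip"
begin

definition Bi :: "'a \<Rightarrow> 'a \<Rightarrow> 'a" where "Bi y = inv (A y)"
text \<open>The quadratic form of the inverse of A at y: in this metric the operator with
  coefficients frozen at y is the Laplacian.\<close>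

definition q :: "'a \<Rightarrow> 'a \<Rightarrow> real" where "q y x = Bi y x \<bullet> x"
definition "b1 = \<mu> / \<Lambda>\<^sup>2"
text \<open>Lipschitz constant of the form in its base point, relative to the form itself; a
  relative error is what the scaling of the profiles can absorb.\<close>

definition "Lc = Lip / (\<mu>\<^sup>2 * b1)"

lemma b1_pos: "0 < b1" and Lc_pos: "0 < Lc" using pos by (simp_all add: b1_def Lc_def)

lemma bijA: "bij (A y)"
proof -
  have "inj (A y)"
  proof (subst linear_injective_0[OF linA], intro allI impI)
    fix v assume "A y v = 0"
    then have "\<mu> * (v \<bullet> v) \<le> 0" using ell[of v y] by simp
    then show "v = 0" using pos
      by (metis inner_gt_zero_iff mult_pos_pos not_less)
  qed
  then show ?thesis using linear_injective_imp_surjective[OF linA] by (simp add: bij_def)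
qed

lemma A_Bi [simp]: "A y (Bi y x) = x" and Bi_A [simp]: "Bi y (A y x) = x"
  using bijA[of y] by (simp_all add: Bi_def bij_def surj_f_inv_f)

lemma linB: "linear (Bi y)"
  using bijA linA unfolding Bi_def by (metis bij_def inj_linear_imp_inv_linear)

lemma symB: "Bi z v \<bullet> w = v \<bullet> Bi z w"
  using symA[of z "Bi z v" "Bi z w"] by simp

lemma normB: "norm (Bi y x) \<le> norm x / \<mu>"
proof -
  let ?v = "Bi y x"
  have "\<mu> * (norm ?v * norm ?v) \<le> x \<bullet> ?v" using ell[of ?v y] by (simp add: power2_norm_eq_inner flip: power2_eq_square)
  also have "\<dots> \<le> norm x * norm ?v" by (rule norm_cauchy_schwarz)
  finally have "(\<mu> * norm ?v) * norm ?v \<le> norm x * norm ?v" by (simp add: mult.assoc)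
  then have "\<mu> * norm ?v \<le> norm x \<or> norm ?v = 0" by (auto simp: mult_le_cancel_right)
  then show ?thesis using pos by (auto simp: field_simps)
qed

lemma q_upper: "q y x \<le> (x \<bullet> x) / \<mu>"
proof -
  have "q y x \<le> norm (Bi y x) * norm x" unfolding q_def by (rule norm_cauchy_schwarz)
  also have "\<dots> \<le> norm x / \<mu> * norm x" by (intro mult_right_mono normB) auto
  finally show ?thesis by (simp add: power2_norm_eq_inner[symmetric] power2_eq_square)
qed

lemma q_lower: "b1 * (x \<bullet> x) \<le> q y x"
proof -
  let ?v = "Bi y x"
  have "norm x \<le> \<Lambda> * norm ?v" using bdd[of y ?v] by simp
  then have "(norm x)\<^sup>2 \<le> \<Lambda>\<^sup>2 * (norm ?v)\<^sup>2" by (metis norm_ge_zero power_mono power_mult_distrib)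
  then have "b1 * (x \<bullet> x) \<le> \<mu> * (?v \<bullet> ?v)" using pos by (simp add: b1_def power2_norm_eq_inner field_simps)
  also have "\<dots> \<le> x \<bullet> ?v" using ell[of ?v y] by simp
  finally show ?thesis by (simp add: q_def inner_commute)
qed

lemma q_nonneg: "0 \<le> q y x" using q_lower[of x y] b1_pos by (meson inner_ge_zero mult_nonneg_nonneg less_imp_le order_trans)

lemma q_pos: "x \<noteq> 0 \<Longrightarrow> 0 < q y x"
  using q_lower[of x y] b1_pos by (meson inner_gt_zero_iff mult_pos_pos less_le_trans)

lemma q_scale: "q y (t *\<^sub>R x) = t\<^sup>2 * q y x"
  by (simp add: q_def linear_scale[OF linB] power2_eq_square)

lemma B_diff: "norm (Bi y x - Bi z x) \<le> Lip / \<mu>\<^sup>2 * dist y z * norm x"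
proof -
  have "Bi y x - Bi z x = Bi y (A z (Bi z x) - A y (Bi z x))" by (simp add: linear_diff[OF linB])
  also have "norm \<dots> \<le> norm (A z (Bi z x) - A y (Bi z x)) / \<mu>" by (rule normB)
  also have "\<dots> \<le> (Lip * dist z y * norm (Bi z x)) / \<mu>" using pos by (intro divide_right_mono lip) auto
  also have "\<dots> \<le> (Lip * dist z y * (norm x / \<mu>)) / \<mu>"
    using pos by (intro divide_right_mono mult_left_mono normB) auto
  finally show ?thesis by (simp add: power2_eq_square dist_commute mult_ac)
qed

lemma q_diff: "\<bar>q y x - q z x\<bar> \<le> Lc * dist y z * q z x"
proof -
  have "\<bar>q y x - q z x\<bar> = \<bar>(Bi y x - Bi z x) \<bullet> x\<bar>" by (simp add: q_def inner_diff_left)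
  also have "\<dots> \<le> norm (Bi y x - Bi z x) * norm x" by (rule Cauchy_Schwarz_ineq2)
  also have "\<dots> \<le> (Lip / \<mu>\<^sup>2 * dist y z * norm x) * norm x" by (intro mult_right_mono B_diff) auto
  also have "\<dots> = Lc * dist y z * (b1 * (x \<bullet> x))"
    using b1_pos by (simp add: Lc_def power2_norm_eq_inner[symmetric] power2_eq_square)
  also have "\<dots> \<le> Lc * dist y z * q z x" using Lc_pos by (intro mult_left_mono q_lower) auto
  finally show ?thesis .
qed

text \<open>Joint continuity in base point and argument, from the Lipschitz dependence of the
  inverse on the base point; measurability of the kernels in both variables rests on it.\<close>

lemma continuous_B: assumes "continuous_on S f" "continuous_on S g" shows "continuous_on S (\<lambda>t. Bi (f t) (g t))"
  unfolding continuous_on_def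
proof
  fix t assume t: "t \<in> S"
  have f: "(f \<longlongrightarrow> f t) (at t within S)" and g: "(g \<longlongrightarrow> g t) (at t within S)"
    using assms t by (auto simp: continuous_on_def)
  have "((\<lambda>s. norm (g s - g t) / \<mu> + Lip / \<mu>\<^sup>2 * dist (f s) (f t) * norm (g t)) \<longlongrightarrow> norm (g t - g t) / \<mu> + Lip / \<mu>\<^sup>2 * dist (f t) (f t) * norm (g t)) (at t within S)"
    using pos by (intro tendsto_intros f g) auto
  then have l: "((\<lambda>s. norm (g s - g t) / \<mu> + Lip / \<mu>\<^sup>2 * dist (f s) (f t) * norm (g t)) \<longlongrightarrow> 0) (at t within S)" by simp
  have "norm (Bi (f s) (g s) - Bi (f t) (g t)) \<le> norm (g s - g t) / \<mu> + Lip / \<mu>\<^sup>2 * dist (f s) (f t) * norm (g t)" for s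
  proof -
    have "Bi (f s) (g s) - Bi (f t) (g t) = Bi (f s) (g s - g t) + (Bi (f s) (g t) - Bi (f t) (g t))"
      by (simp add: linear_diff[OF linB])
    then show ?thesis by (simp only:) (intro norm_triangle_le add_mono normB B_diff)
  qed
  then have "((\<lambda>s. Bi (f s) (g s) - Bi (f t) (g t)) \<longlongrightarrow> 0) (at t within S)"
    by (intro Lim_null_comparison[OF _ l]) auto
  then show "((\<lambda>t. Bi (f t) (g t)) \<longlongrightarrow> Bi (f t) (g t)) (at t within S)" by (simp add: Lim_null[symmetric])
qed

lemma continuous_q: "continuous_on S f \<Longrightarrow> continuous_on S g \<Longrightarrow> continuous_on S (\<lambda>t. q (f t) (g t))"
  unfolding q_def by (intro continuous_intros continuous_B)

lemma q_measurable [measurable]: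
  assumes [measurable]: "f \<in> borel_measurable M" "g \<in> borel_measurable M"
  shows "(\<lambda>t. q (f t) (g t)) \<in> borel_measurable M"
proof -
  have "(\<lambda>p. q (fst p) (snd p)) \<in> borel_measurable borel"
    by (intro borel_measurable_continuous_onI continuous_q continuous_intros)
  from measurable_compose[OF _ this, of "\<lambda>t. (f t, g t)" M] show ?thesis by simp
qed

definition "J = (\<integral>(x::'a). N1 DIM('a) 1 (x \<bullet> x) \<partial>lborel)"
definition "cc y = 1 / (\<integral>x. N1 DIM('a) 1 (q y x) \<partial>lborel)"

text \<open>At p = 0 the profile takes the value 0, by division by a vanishing power, so
  monotonicity from that point needs p' = 0 as well.\<close>

lemma N1_mono0:
  assumes "0 < \<delta>" "0 \<le> p" "p \<le> p'" "p = 0 \<Longrightarrow> p' = 0" shows "N1 DIM('a) \<delta> p' \<le> N1 DIM('a) \<delta> p"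
  using N1_antimono[OF dim assms(1), of p p'] assms by (cases "p = 0") auto

lemma norm_N1_integrable: "0 < \<kappa> \<Longrightarrow> 0 < \<delta> \<Longrightarrow> integrable lborel (\<lambda>x::'a. N1 DIM('a) \<delta> (\<kappa> * (x \<bullet> x)))"
   "0 < \<kappa> \<Longrightarrow> 0 < \<delta> \<Longrightarrow> (\<integral>(x::'a). N1 DIM('a) \<delta> (\<kappa> * (x \<bullet> x)) \<partial>lborel) = J / sqrt \<kappa> ^ DIM('a)"
  using N1_quadratic[OF dim, of "\<lambda>x::'a. x \<bullet> x" \<kappa> \<delta>] N1_norm_integrable[OF dim]
  by (auto simp: J_def power2_eq_square)

lemma N1q_le: "0 < \<delta> \<Longrightarrow> N1 DIM('a) \<delta> (q y x) \<le> N1 DIM('a) \<delta> (b1 * (x \<bullet> x))"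
  using b1_pos q_lower[of x y] by (intro N1_mono0) (auto simp: q_def linear_0[OF linB])

lemma N1q_ge: "0 < \<delta> \<Longrightarrow> N1 DIM('a) \<delta> (1 / \<mu> * (x \<bullet> x)) \<le> N1 DIM('a) \<delta> (q y x)"
  using q_upper[of y x] q_nonneg[of y x] q_pos[of x y] by (intro N1_mono0) auto

lemma N1q_integrable1: "integrable lborel (\<lambda>x. N1 DIM('a) 1 (q y x))"
proof (rule Bochner_Integration.integrable_bound[OF norm_N1_integrable(1)[OF b1_pos zero_less_one]])
  show "(\<lambda>x. N1 DIM('a) 1 (q y x)) \<in> borel_measurable lborel"
    using measurable_compose[OF q_measurable profile_measurable(3)[OF dim zero_less_one]] by measurable
qed (auto intro!: AE_I2 simp: abs_of_nonneg N1_nonneg[OF dim zero_less_one] q_nonneg N1q_le b1_pos less_imp_le)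

lemma N1q_integrable: 
  assumes "0 < \<kappa>" "0 < \<delta>"
  shows "integrable lborel (\<lambda>x. N1 DIM('a) \<delta> (\<kappa> * q y x))"
   "(\<integral>x. N1 DIM('a) \<delta> (\<kappa> * q y x) \<partial>lborel) = (\<integral>x. N1 DIM('a) 1 (q y x) \<partial>lborel) / sqrt \<kappa> ^ DIM('a)"
proof -
  have [measurable]: "q y \<in> borel_measurable borel" by measurable
  note N1_quadratic[OF dim this q_nonneg q_scale N1q_integrable1 assms]
  then show "integrable lborel (\<lambda>x. N1 DIM('a) \<delta> (\<kappa> * q y x))"
   "(\<integral>x. N1 DIM('a) \<delta> (\<kappa> * q y x) \<partial>lborel) = (\<integral>x. N1 DIM('a) 1 (q y x) \<partial>lborel) / sqrt \<kappa> ^ DIM('a)" by auto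
qed

lemma J_pos: "0 < J"
proof -
  have "(\<integral>(x::'a). indicator (ball 0 (1/2)) x * (1::real) \<partial>lborel) \<le> J" unfolding J_def
  proof (rule integral_mono_AE)
    show "integrable lborel (\<lambda>x::'a. indicator (ball 0 (1/2)) x * 1 :: real)"
      using emeasure_bounded_finite[of "ball (0::'a) (1/2)"] by auto
    show "AE x in lborel. indicator (ball (0::'a) (1/2)) x * 1 \<le> N1 DIM('a) 1 (x \<bullet> x)"
      using AE_lborel_singleton[of "0::'a"]
    proof eventually_elim
      fix x :: 'a assume x: "x \<noteq> 0"
      show "indicator (ball (0::'a) (1/2)) x * 1 \<le> N1 DIM('a) 1 (x \<bullet> x)"
      proof (cases "x \<in> ball 0 (1/2)")
        case True
        then have "1 \<le> w1 1 (norm x)" by (simp add: w1_def)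
        moreover have "norm x ^ (DIM('a) - 1) \<le> 1" using True by (intro power_le_one) auto
        ultimately have "1 / 1 \<le> w1 1 (norm x) / norm x ^ (DIM('a) - 1)" using x by (intro frac_le) auto
        then show ?thesis using True by (simp add: N1_def norm_eq_sqrt_inner)
      qed (use N1_nonneg[OF dim zero_less_one] in simp)
    qed
  qed (use N1_norm_integrable[OF dim] in auto)
  moreover have "0 < (\<integral>(x::'a). indicator (ball 0 (1/2)) x * (1::real) \<partial>lborel)"
    using content_ball_pos[of "1/2" "0::'a"] by simp
  ultimately show ?thesis by linarith
qed

definition "cmin = sqrt b1 ^ DIM('a) / J"
definition "cmax = sqrt (1 / \<mu>) ^ DIM('a) / J"

lemma cc_bounds: "cmin \<le> cc y" "cc y \<le> cmax" and cmin_pos: "0 < cmin" and cmax_pos: "0 < cmax"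
proof -
  let ?I = "\<integral>x. N1 DIM('a) 1 (q y x) \<partial>lborel"
  have 1: "?I \<le> J / sqrt b1 ^ DIM('a)"
    unfolding norm_N1_integrable(2)[OF b1_pos zero_less_one, symmetric]
    by (intro integral_mono N1q_integrable1 norm_N1_integrable b1_pos N1q_le) auto
  have 2: "J / sqrt (1 / \<mu>) ^ DIM('a) \<le> ?I"
  proof -
    have p: "0 < 1 / \<mu>" using pos by simp
    show ?thesis unfolding norm_N1_integrable(2)[OF p zero_less_one, symmetric]
      by (intro integral_mono N1q_integrable1 norm_N1_integrable p N1q_ge) auto
  qed
  have 3: "0 < J / sqrt (1 / \<mu>) ^ DIM('a)" "0 < J / sqrt b1 ^ DIM('a)" using J_pos pos b1_pos by simp_all
  have I: "0 < ?I" using 2 3 by linarith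
  have "1 / (J / sqrt b1 ^ DIM('a)) \<le> 1 / ?I" by (rule divide_left_mono[OF 1 zero_le_one mult_pos_pos[OF 3(2) I]])
  then show "cmin \<le> cc y" by (simp add: cmin_def cc_def)
  have "1 / ?I \<le> 1 / (J / sqrt (1 / \<mu>) ^ DIM('a))" by (rule divide_left_mono[OF 2 zero_le_one mult_pos_pos[OF I 3(1)]])
  then show "cc y \<le> cmax" by (simp add: cmax_def cc_def)
  show "0 < cmin" "0 < cmax" using J_pos b1_pos pos by (auto simp: cmin_def cmax_def)
qed

lemma cc_pos: "0 < cc y" using cc_bounds(1)[of y] cmin_pos by linarith

text \<open>The forms at y and z agree up to factors 1 - e and 1 + e; the profile is antitone, and a
  factor in front of the form changes its mass by a power of the square root of that factor.
  Continuity of \<open>cc\<close> then follows by squeezing.\<close>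

lemma cc_compare:
  assumes e: "Lc * dist y z \<le> e" "e < 1"
  shows "cc y \<le> sqrt (1 + e) ^ DIM('a) * cc z" "sqrt (1 - e) ^ DIM('a) * cc z \<le> cc y"
proof -
  let ?I = "\<lambda>y. \<integral>x. N1 DIM('a) 1 (q y x) \<partial>lborel"
  have e0: "0 \<le> e" using e(1) Lc_pos by (meson mult_nonneg_nonneg less_imp_le order_trans zero_le_dist)
  have d: "\<bar>q y x - q z x\<bar> \<le> e * q z x" for x
    using q_diff[of y x z] mult_right_mono[OF e(1) q_nonneg[of z x]] by linarith
  have I: "0 < ?I y" for y using cc_pos[of y] by (simp add: cc_def)
  have "?I z / sqrt (1 + e) ^ DIM('a) = (\<integral>x. N1 DIM('a) 1 ((1 + e) * q z x) \<partial>lborel)"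
    using N1q_integrable(2)[of "1 + e" 1 z] e0 by simp
  also have "\<dots> \<le> ?I y"
  proof (intro integral_mono N1q_integrable1 N1q_integrable(1))
    fix x
    have "q y x \<le> (1 + e) * q z x" using d[of x] by (simp add: algebra_simps)
    moreover have "q y x = 0 \<Longrightarrow> (1 + e) * q z x = 0" using q_pos[of x y] by (cases "x = 0") (auto simp: q_def linear_0[OF linB])
    ultimately show "N1 DIM('a) 1 ((1 + e) * q z x) \<le> N1 DIM('a) 1 (q y x)" by (intro N1_mono0 q_nonneg) auto
  qed (use e0 in auto)
  finally have 1: "?I z / sqrt (1 + e) ^ DIM('a) \<le> ?I y" .
  have s: "0 < sqrt (1 + e) ^ DIM('a)" "0 < sqrt (1 - e) ^ DIM('a)" using e0 e by simp_all
  have "1 / ?I y \<le> 1 / (?I z / sqrt (1 + e) ^ DIM('a))" using 1 I s by (intro divide_left_mono) auto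
  then show "cc y \<le> sqrt (1 + e) ^ DIM('a) * cc z" by (simp add: cc_def mult.commute)
  have "?I y \<le> (\<integral>x. N1 DIM('a) 1 ((1 - e) * q z x) \<partial>lborel)"
  proof (intro integral_mono N1q_integrable1 N1q_integrable(1))
    fix x
    have "(1 - e) * q z x \<le> q y x" using d[of x] by (simp add: algebra_simps)
    moreover have "(1 - e) * q z x = 0 \<Longrightarrow> q y x = 0" using q_pos[of x z] e by (cases "x = 0") (auto simp: q_def linear_0[OF linB])
    ultimately show "N1 DIM('a) 1 (q y x) \<le> N1 DIM('a) 1 ((1 - e) * q z x)"
      using e q_nonneg by (intro N1_mono0) auto
  qed (use e in auto)
  also have "\<dots> = ?I z / sqrt (1 - e) ^ DIM('a)" using N1q_integrable(2)[of "1 - e" 1 z] e by simp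
  finally have 2: "?I y \<le> ?I z / sqrt (1 - e) ^ DIM('a)" .
  have "1 / (?I z / sqrt (1 - e) ^ DIM('a)) \<le> 1 / ?I y" using 2 I s by (intro divide_left_mono) auto
  then show "sqrt (1 - e) ^ DIM('a) * cc z \<le> cc y" by (simp add: cc_def mult.commute)
qed

lemma continuous_cc: "continuous_on S cc"
proof (rule continuous_on_subset[of UNIV], unfold continuous_on_def, intro ballI)
  fix z :: 'a
  let ?e = "\<lambda>y. Lc * dist y z"
  have "((\<lambda>y. sqrt (1 + ?e y) ^ DIM('a) * cc z) \<longlongrightarrow> sqrt (1 + Lc * dist z z) ^ DIM('a) * cc z) (at z within UNIV)" by (intro tendsto_intros)
  then have u: "((\<lambda>y. sqrt (1 + ?e y) ^ DIM('a) * cc z) \<longlongrightarrow> cc z) (at z)" by simp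
  have "((\<lambda>y. sqrt (1 - ?e y) ^ DIM('a) * cc z) \<longlongrightarrow> sqrt (1 - Lc * dist z z) ^ DIM('a) * cc z) (at z within UNIV)" by (intro tendsto_intros)
  then have l: "((\<lambda>y. sqrt (1 - ?e y) ^ DIM('a) * cc z) \<longlongrightarrow> cc z) (at z)" by simp
  have "((\<lambda>y. ?e y) \<longlongrightarrow> Lc * dist z z) (at z within UNIV)" by (intro tendsto_intros)
  then have ev: "\<forall>\<^sub>F y in at z. ?e y < 1" using order_tendstoD(2)[of ?e 0 "at z" 1] by simp
  have "(cc \<longlongrightarrow> cc z) (at z)"
    by (rule tendsto_sandwich[OF eventually_mono[OF ev] eventually_mono[OF ev] l u])
      (auto intro: cc_compare[OF order_refl])
  then show "(cc \<longlongrightarrow> cc z) (at z within UNIV)" by simp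
qed auto

lemma cc_measurable [measurable]: "cc \<in> borel_measurable borel"
  by (rule borel_measurable_continuous_onI[OF continuous_cc])

end

section \<open>The regularised parametrix and its error kernel\<close>

context elliptic begin

text \<open>\<open>a0 * \<delta>\<close> is the range of all kernels, because |x| is at most a0 sqrt
  q. \<open>CE\<close> collects the two terms of \<open>EE_bound\<close>. \<open>b0\<close> is the
  mass of the minorant \<open>PL\<close>: height cmin * 3/128 / \<delta>^m from
  \<open>Ph_lower\<close>, on a ball of radius \<delta> sqrt \<mu> / 4, where q is at most
  \<delta>^2/16. \<open>\<theta>\<close> keeps half of this gain and leaves the other half to the
  errors.\<close>

definition "a0 = 1 / sqrt b1"
definition "CE = Lip * (a0 ^ 3 * (DIM('a) + 2) / (2 * \<mu>\<^sup>2) + DIM('a) * a0 / (2 * \<mu>))"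
definition "b0 = cmin * (3 / 128) * unit_ball_vol DIM('a) * (sqrt \<mu> / 4) ^ DIM('a)"
definition "\<theta> = 1 - b0 / 2"
text \<open>After \<delta> > 0 come, in turn, what ensures positivity of \<open>QQ\<close>,
  comparability of the forms at any two points within range, and mass of \<open>QQ\<close> at most
  \<theta>. As \<delta> tends to 0 the last expression tends to 1 - b0.\<close>

definition good :: "real \<Rightarrow> bool" where
  "good \<delta> \<longleftrightarrow> 0 < \<delta> \<and> CE * \<delta> \<le> 1 / 2 \<and> Lc * (a0 * \<delta>) \<le> 1 / 2 \<and>
     (1 + CE * \<delta>) * (sqrt (1 + Lc * (a0 * \<delta>)) / sqrt (1 - Lc * (a0 * \<delta>))) ^ DIM('a) - b0 \<le> \<theta>"

text \<open>\<open>kk\<close> is the parametrix with coefficients frozen at \<open>y\<close>, regularised by \<open>\<epsilon>\<close>; \<open>k1\<close> and \<open>k2\<close> are its \<open>z\<close>-derivatives.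
  It satisfies \<open>(1 / \<delta>\<^sup>2 - L\<^sub>z) kk = hh - QQ\<close>, where \<open>hh\<close> tends to the Dirac measure as \<open>\<epsilon> \<rightarrow> 0\<close> and \<open>QQ\<close> is nonnegative
  with mass at most \<open>\<theta> < 1\<close>.\<close>

definition "kk \<delta> \<epsilon> z y = cc y * Ph DIM('a) \<delta> (q y (z - y) + \<epsilon>)"
definition "nn \<delta> \<epsilon> z y = cc y * N1 DIM('a) \<delta> (q y (z - y) + \<epsilon>)"
definition "hh \<delta> \<epsilon> z y = cc y * (4 * \<epsilon> * P2 DIM('a) \<delta> (q y (z - y) + \<epsilon>))"
definition "k1 \<delta> \<epsilon> z y v = - (2 * cc y * gg DIM('a) \<delta> (q y (z - y) + \<epsilon>) * (Bi y (z - y) \<bullet> v))"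
definition "k2 \<delta> \<epsilon> z y v w = cc y * (4 * P2 DIM('a) \<delta> (q y (z - y) + \<epsilon>) * ((Bi y (z - y) \<bullet> v) * (Bi y (z - y) \<bullet> w))
   - 2 * gg DIM('a) \<delta> (q y (z - y) + \<epsilon>) * (Bi y w \<bullet> v))"
definition "EE \<delta> \<epsilon> z y = (\<Sum>i\<in>Basis. \<Sum>j\<in>Basis. ((A z i - A y i) \<bullet> j) * k2 \<delta> \<epsilon> z y i j)"
definition "QQ \<delta> \<epsilon> z y = nn \<delta> \<epsilon> z y - kk \<delta> \<epsilon> z y / \<delta>\<^sup>2 + EE \<delta> \<epsilon> z y"
text \<open>A translation-invariant majorant for rows and columns alike, with an integral
  \<open>CM\<close> independent of \<delta>. It vanishes at 0 by the division convention, so it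
  dominates off the diagonal only.\<close>

definition "MM \<delta> (x::'a) = cmax * N1 DIM('a) \<delta> (b1 * (x \<bullet> x))"
definition "CM = cmax * (J / sqrt b1 ^ DIM('a))"

lemma a0_pos: "0 < a0" using b1_pos by (simp add: a0_def)
lemma CE_nonneg: "0 \<le> CE" unfolding CE_def using pos a0_pos by (intro mult_nonneg_nonneg add_nonneg_nonneg divide_nonneg_nonneg) auto
lemma b0_pos: "0 < b0" unfolding b0_def using cmin_pos pos by (intro mult_pos_pos zero_less_power) auto

lemma norm_le_q: "norm x \<le> a0 * sqrt (q y x)"
proof -
  have "sqrt (b1 * (x \<bullet> x)) \<le> sqrt (q y x)" by (intro real_sqrt_le_mono q_lower)
  then have "sqrt b1 * norm x \<le> sqrt (q y x)" by (simp add: real_sqrt_mult norm_eq_sqrt_inner)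
  then show ?thesis using b1_pos by (simp add: a0_def field_simps)
qed

lemma exists_good: "\<exists>\<delta>0>0. \<forall>\<delta>. 0 < \<delta> \<and> \<delta> < \<delta>0 \<longrightarrow> good \<delta>"
proof -
  have t: "((\<lambda>\<delta>. (1 + CE * \<delta>) * (sqrt (1 + Lc * (a0 * \<delta>)) / sqrt (1 - Lc * (a0 * \<delta>))) ^ DIM('a) - b0) \<longlongrightarrow>
      (1 + CE * 0) * (sqrt (1 + Lc * (a0 * 0)) / sqrt (1 - Lc * (a0 * 0))) ^ DIM('a) - b0) (at_right 0)"
    by (intro tendsto_intros) auto
  have 1: "\<forall>\<^sub>F \<delta> in at_right 0. (1 + CE * \<delta>) * (sqrt (1 + Lc * (a0 * \<delta>)) / sqrt (1 - Lc * (a0 * \<delta>))) ^ DIM('a) - b0 < \<theta>"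
    by (rule order_tendstoD(2)[OF t]) (use b0_pos in \<open>simp add: \<theta>_def\<close>)
  have 2: "\<forall>\<^sub>F \<delta> in at_right 0. CE * \<delta> < 1 / 2"
    by (rule order_tendstoD(2)[of _ "CE * 0"], intro tendsto_intros, simp)
  have 3: "\<forall>\<^sub>F \<delta> in at_right 0. Lc * (a0 * \<delta>) < 1 / 2"
    by (rule order_tendstoD(2)[of _ "Lc * (a0 * 0)"], intro tendsto_intros, simp)
  have "\<forall>\<^sub>F \<delta> in at_right 0. good \<delta>"
    using 1 2 3 eventually_at_right_less[of "0::real"] by eventually_elim (simp add: good_def)
  then show ?thesis by (auto simp: eventually_at_right_field)
qed

lemma continuous_A: "continuous_on S (\<lambda>z. A z i)"
proof (rule continuous_on_subset[of UNIV])
  show "continuous_on UNIV (\<lambda>z. A z i)"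
    by (rule lipschitz_on_continuous_on[where L="Lip * norm i"], rule lipschitz_onI)
      (use lip[where v=i] pos in \<open>auto simp: dist_norm mult_ac\<close>)
qed auto

lemma kernel_measurable [measurable]:
  assumes [measurable]: "f \<in> borel_measurable M" "g \<in> borel_measurable M" and \<delta>: "0 < \<delta>"
  shows "(\<lambda>t. kk \<delta> \<epsilon> (f t) (g t)) \<in> borel_measurable M" "(\<lambda>t. nn \<delta> \<epsilon> (f t) (g t)) \<in> borel_measurable M"
    "(\<lambda>t. hh \<delta> \<epsilon> (f t) (g t)) \<in> borel_measurable M" "(\<lambda>t. k1 \<delta> \<epsilon> (f t) (g t) v) \<in> borel_measurable M"
    "(\<lambda>t. k2 \<delta> \<epsilon> (f t) (g t) v w) \<in> borel_measurable M" "(\<lambda>t. QQ \<delta> \<epsilon> (f t) (g t)) \<in> borel_measurable M"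
proof -
  note [measurable] = profile_measurable[OF dim \<delta>]
  have [measurable]: "(\<lambda>t. Bi (f t) (h t) \<bullet> v) \<in> borel_measurable M" if [measurable]: "h \<in> borel_measurable M" for h v
  proof -
    have "(\<lambda>p. Bi (fst p) (snd p) \<bullet> v) \<in> borel_measurable borel"
      by (intro borel_measurable_continuous_onI continuous_intros continuous_B)
    from measurable_compose[OF _ this, of "\<lambda>t. (f t, h t)" M] show ?thesis by simp
  qed
  have B[measurable]: "(\<lambda>t. Bi (g t) (h t) \<bullet> v) \<in> borel_measurable M" if [measurable]: "h \<in> borel_measurable M" for h v
  proof -
    have "(\<lambda>p. Bi (fst p) (snd p) \<bullet> v) \<in> borel_measurable borel"
      by (intro borel_measurable_continuous_onI continuous_intros continuous_B)
    from measurable_compose[OF _ this, of "\<lambda>t. (g t, h t)" M] show ?thesis by simp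
  qed
  have [measurable]: "(\<lambda>t. A (h t) i \<bullet> j) \<in> borel_measurable M" if "h \<in> borel_measurable M" for h i j
    by (rule measurable_compose[OF that]) (intro borel_measurable_continuous_onI continuous_intros continuous_A)
  show kk: "(\<lambda>t. kk \<delta> \<epsilon> (f t) (g t)) \<in> borel_measurable M" and nn: "(\<lambda>t. nn \<delta> \<epsilon> (f t) (g t)) \<in> borel_measurable M"
    and "(\<lambda>t. hh \<delta> \<epsilon> (f t) (g t)) \<in> borel_measurable M" "(\<lambda>t. k1 \<delta> \<epsilon> (f t) (g t) v) \<in> borel_measurable M"
    and k2: "(\<lambda>t. k2 \<delta> \<epsilon> (f t) (g t) v w) \<in> borel_measurable M" for v w
    unfolding kk_def nn_def hh_def k1_def k2_def by measurable
  show "(\<lambda>t. QQ \<delta> \<epsilon> (f t) (g t)) \<in> borel_measurable M"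
    unfolding QQ_def EE_def inner_diff_left
    by (intro borel_measurable_add borel_measurable_diff borel_measurable_divide borel_measurable_const
         borel_measurable_sum borel_measurable_times kk nn k2) measurable
qed

lemma trace_k2:
  assumes "linear T"
  shows "(\<Sum>i\<in>Basis. \<Sum>j\<in>Basis. (T i \<bullet> j) * k2 \<delta> \<epsilon> z y i j) =
    cc y * (4 * P2 DIM('a) \<delta> (q y (z - y) + \<epsilon>) * (T (Bi y (z - y)) \<bullet> Bi y (z - y))
      - 2 * gg DIM('a) \<delta> (q y (z - y) + \<epsilon>) * (\<Sum>i\<in>Basis. T i \<bullet> Bi y i))"
proof -
  define b where "b = Bi y (z - y)"
  define P where "P = 4 * P2 DIM('a) \<delta> (q y (z - y) + \<epsilon>)"
  define G where "G = 2 * gg DIM('a) \<delta> (q y (z - y) + \<epsilon>)"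
  have 1: "(\<Sum>i\<in>Basis. \<Sum>j\<in>Basis. (T i \<bullet> j) * ((b \<bullet> i) * (b \<bullet> j))) = T b \<bullet> b"
  proof -
    have "T b = (\<Sum>i\<in>Basis. (b \<bullet> i) *\<^sub>R T i)"
      using linear_sum[OF assms, of "\<lambda>i. (b \<bullet> i) *\<^sub>R i" Basis] linear_scale[OF assms] by (simp add: euclidean_representation)
    then have "T b \<bullet> b = (\<Sum>i\<in>Basis. (b \<bullet> i) * (T i \<bullet> b))" by (simp add: inner_sum_left)
    also have "\<dots> = (\<Sum>i\<in>Basis. (b \<bullet> i) * (\<Sum>j\<in>Basis. (T i \<bullet> j) * (b \<bullet> j)))" by (simp add: euclidean_inner[of "T _" b])
    finally show ?thesis by (simp add: sum_distrib_left mult_ac)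
  qed
  have 2: "(\<Sum>i\<in>Basis. \<Sum>j\<in>Basis. (T i \<bullet> j) * (Bi y j \<bullet> i)) = (\<Sum>i\<in>Basis. T i \<bullet> Bi y i)"
  proof (intro sum.cong refl)
    fix i
    have "Bi y j \<bullet> i = Bi y i \<bullet> j" for j by (metis symB inner_commute)
    then show "(\<Sum>j\<in>Basis. (T i \<bullet> j) * (Bi y j \<bullet> i)) = T i \<bullet> Bi y i"
      by (simp add: euclidean_inner[of "T i" "Bi y i"])
  qed
  have "(\<Sum>i\<in>Basis. \<Sum>j\<in>Basis. (T i \<bullet> j) * k2 \<delta> \<epsilon> z y i j) =
     (\<Sum>i\<in>Basis. \<Sum>j\<in>Basis. cc y * P * ((T i \<bullet> j) * ((b \<bullet> i) * (b \<bullet> j))) - cc y * G * ((T i \<bullet> j) * (Bi y j \<bullet> i)))"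
    unfolding k2_def b_def[symmetric] P_def[symmetric] G_def[symmetric] by (intro sum.cong refl) (simp add: algebra_simps)
  also have "\<dots> = cc y * P * (T b \<bullet> b) - cc y * G * (\<Sum>i\<in>Basis. T i \<bullet> Bi y i)"
    unfolding 1[symmetric] 2[symmetric] by (simp add: sum_subtractf sum_distrib_left)
  finally show ?thesis unfolding b_def P_def G_def by (simp add: algebra_simps)
qed

text \<open>The profile identity at q + \<epsilon> carries 4 (q + \<epsilon>) \<open>P2\<close>,
  whereas two derivatives of the form produce only 4 q \<open>P2\<close>; the difference is
  \<open>hh\<close>.\<close>

lemma trace_k2_frozen:
  assumes "0 < \<delta>" "0 < q y (z - y) + \<epsilon>"
  shows "(\<Sum>i\<in>Basis. \<Sum>j\<in>Basis. (A y i \<bullet> j) * k2 \<delta> \<epsilon> z y i j) = nn \<delta> \<epsilon> z y - hh \<delta> \<epsilon> z y"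
proof -
  have 1: "A y (Bi y (z - y)) \<bullet> Bi y (z - y) = q y (z - y)" by (simp add: q_def inner_commute)
  have "A y i \<bullet> Bi y i = 1" if "i \<in> Basis" for i using symA[of y i "Bi y i"] that by simp
  then have 2: "(\<Sum>i\<in>Basis. A y i \<bullet> Bi y i) = DIM('a)" by simp
  show ?thesis unfolding trace_k2[OF linA] 1 2
    unfolding nn_def hh_def profile_identity[OF dim assms, symmetric] by (simp add: algebra_simps)
qed

lemma kernel_identity:
  assumes "0 < \<delta>" "0 < q y (z - y) + \<epsilon>"
  shows "kk \<delta> \<epsilon> z y / \<delta>\<^sup>2 - (\<Sum>i\<in>Basis. \<Sum>j\<in>Basis. (A z i \<bullet> j) * k2 \<delta> \<epsilon> z y i j) = hh \<delta> \<epsilon> z y - QQ \<delta> \<epsilon> z y"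
proof -
  have "(\<Sum>i\<in>Basis. \<Sum>j\<in>Basis. (A z i \<bullet> j) * k2 \<delta> \<epsilon> z y i j) =
    (\<Sum>i\<in>Basis. \<Sum>j\<in>Basis. (A y i \<bullet> j) * k2 \<delta> \<epsilon> z y i j) + EE \<delta> \<epsilon> z y"
    by (simp add: EE_def inner_diff_left left_diff_distrib sum_subtractf)
  then show ?thesis using trace_k2_frozen[OF assms] by (simp add: QQ_def)
qed

lemma abs_diff_mult_le:
  fixes a b s t :: real
  assumes "0 \<le> a" "0 \<le> b" "\<bar>s\<bar> \<le> S" "\<bar>t\<bar> \<le> T"
  shows "\<bar>a * s - b * t\<bar> \<le> a * S + b * T"
proof -
  have "\<bar>a * s\<bar> \<le> a * S" "\<bar>b * t\<bar> \<le> b * T" using assms by (auto simp: abs_mult intro: mult_left_mono)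
  then show ?thesis using abs_triangle_ineq4[of "a * s" "b * t"] by linarith
qed

text \<open>The coefficients vary by at most Lip |x|, and |x| is at most a0 sqrt p;
  \<open>P2_le\<close> and \<open>gg_le\<close> convert this into the factor \<delta>.\<close>

lemma EE_bound:
  assumes \<delta>: "0 < \<delta>" and \<epsilon>: "0 \<le> \<epsilon>"
  shows "\<bar>EE \<delta> \<epsilon> z y\<bar> \<le> CE * \<delta> * nn \<delta> \<epsilon> z y"
proof -
  define x where "x = z - y"
  define p where "p = q y x + \<epsilon>"
  have p: "0 \<le> p" "q y x \<le> p" using q_nonneg[of y x] \<epsilon> by (auto simp: p_def)
  define T where "T v = A z v - A y v" for v
  have T: "linear T" unfolding T_def[abs_def] by (intro linear_compose_sub linA)
  have nx: "norm x \<le> a0 * sqrt p"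
    using norm_le_q[of x y] a0_pos p by (meson mult_left_mono order_trans real_sqrt_le_mono less_imp_le)
  have nT: "norm (T v) \<le> Lip * norm x * norm v" for v using lip[of z v y] by (simp add: T_def x_def dist_norm)
  have i1: "\<bar>T (Bi y x) \<bullet> Bi y x\<bar> \<le> Lip / \<mu>\<^sup>2 * (a0 ^ 3 * (p * sqrt p))"
  proof -
    have "\<bar>T (Bi y x) \<bullet> Bi y x\<bar> \<le> norm (T (Bi y x)) * norm (Bi y x)" by (rule Cauchy_Schwarz_ineq2)
    also have "\<dots> \<le> (Lip * norm x * norm (Bi y x)) * norm (Bi y x)" by (intro mult_right_mono nT) auto
    also have "\<dots> \<le> (Lip * norm x * (norm x / \<mu>)) * (norm x / \<mu>)"
      using pos by (intro mult_mono mult_left_mono normB) auto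
    also have "\<dots> = Lip / \<mu>\<^sup>2 * norm x ^ 3" by (simp add: power2_eq_square power3_eq_cube)
    also have "\<dots> \<le> Lip / \<mu>\<^sup>2 * (a0 * sqrt p) ^ 3" using pos nx by (intro mult_left_mono power_mono) auto
    also have "(a0 * sqrt p) ^ 3 = a0 ^ 3 * (p * sqrt p)" using p by (simp add: power_mult_distrib power3_eq_cube)
    finally show ?thesis .
  qed
  have i2: "\<bar>\<Sum>i\<in>Basis. T i \<bullet> Bi y i\<bar> \<le> DIM('a) * (Lip / \<mu>) * (a0 * sqrt p)"
  proof -
    have "\<bar>\<Sum>i\<in>Basis. T i \<bullet> Bi y i\<bar> \<le> (\<Sum>i\<in>Basis. \<bar>T i \<bullet> Bi y i\<bar>)" by (rule sum_abs)
    also have "\<dots> \<le> (\<Sum>i\<in>(Basis::'a set). Lip / \<mu> * (a0 * sqrt p))"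
    proof (rule sum_mono)
      fix i :: 'a assume i: "i \<in> Basis"
      have "\<bar>T i \<bullet> Bi y i\<bar> \<le> norm (T i) * norm (Bi y i)" by (rule Cauchy_Schwarz_ineq2)
      also have "\<dots> \<le> (Lip * norm x * norm i) * (norm i / \<mu>)" using pos by (intro mult_mono nT normB) auto
      also have "\<dots> = Lip / \<mu> * norm x" using i by simp
      also have "\<dots> \<le> Lip / \<mu> * (a0 * sqrt p)" using nx pos by (intro mult_left_mono) auto
      finally show "\<bar>T i \<bullet> Bi y i\<bar> \<le> Lip / \<mu> * (a0 * sqrt p)" .
    qed
    finally show ?thesis by simp
  qed
  have e: "EE \<delta> \<epsilon> z y = cc y * (4 * P2 DIM('a) \<delta> p * (T (Bi y x) \<bullet> Bi y x) - 2 * gg DIM('a) \<delta> p * (\<Sum>i\<in>Basis. T i \<bullet> Bi y i))"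
    using trace_k2[OF T, of \<delta> \<epsilon> z y] by (simp add: EE_def T_def x_def p_def)
  have "\<bar>4 * P2 DIM('a) \<delta> p * (T (Bi y x) \<bullet> Bi y x) - 2 * gg DIM('a) \<delta> p * (\<Sum>i\<in>Basis. T i \<bullet> Bi y i)\<bar>
     \<le> 4 * P2 DIM('a) \<delta> p * (Lip / \<mu>\<^sup>2 * (a0 ^ 3 * (p * sqrt p))) + 2 * gg DIM('a) \<delta> p * (DIM('a) * (Lip / \<mu>) * (a0 * sqrt p))"
    by (intro abs_diff_mult_le i1 i2) (use P2_nonneg[OF dim \<delta> p(1)] gg_nonneg[OF dim \<delta> p(1)] in auto)
  also have "\<dots> = 4 * (Lip / \<mu>\<^sup>2 * a0 ^ 3) * (P2 DIM('a) \<delta> p * (p * sqrt p)) + 2 * (DIM('a) * (Lip / \<mu>) * a0) * (gg DIM('a) \<delta> p * sqrt p)"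
    by (simp add: algebra_simps)
  also have "\<dots> \<le> 4 * (Lip / \<mu>\<^sup>2 * a0 ^ 3) * (\<delta> * (DIM('a) + 2) / 8 * N1 DIM('a) \<delta> p) + 2 * (DIM('a) * (Lip / \<mu>) * a0) * (\<delta> / 4 * N1 DIM('a) \<delta> p)"
    using pos a0_pos by (intro add_mono mult_left_mono P2_le[OF dim \<delta> p(1)] gg_le[OF dim \<delta> p(1)]) auto
  also have "\<dots> = CE * \<delta> * N1 DIM('a) \<delta> p" by (simp add: CE_def algebra_simps add_divide_distrib)
  finally have "cc y * \<bar>4 * P2 DIM('a) \<delta> p * (T (Bi y x) \<bullet> Bi y x) - 2 * gg DIM('a) \<delta> p * (\<Sum>i\<in>Basis. T i \<bullet> Bi y i)\<bar>
    \<le> cc y * (CE * \<delta> * N1 DIM('a) \<delta> p)" using cc_pos[of y] by (intro mult_left_mono) auto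
  then show ?thesis using cc_pos[of y] by (simp add: e abs_mult nn_def p_def x_def mult_ac)
qed

lemma nn_nonneg: "0 < \<delta> \<Longrightarrow> 0 \<le> \<epsilon> \<Longrightarrow> 0 \<le> nn \<delta> \<epsilon> z y"
  and kk_nonneg: "0 < \<delta> \<Longrightarrow> 0 \<le> kk \<delta> \<epsilon> z y"
  and hh_nonneg: "0 < \<delta> \<Longrightarrow> 0 \<le> \<epsilon> \<Longrightarrow> 0 \<le> hh \<delta> \<epsilon> z y"
  using cc_pos[of y] q_nonneg[of y "z - y"] N1_nonneg[OF dim] Ph_nonneg[OF dim] P2_nonneg[OF dim]
  by (auto simp: nn_def kk_def hh_def less_imp_le)

lemma kk_le: "0 < \<delta> \<Longrightarrow> 0 \<le> \<epsilon> \<Longrightarrow> kk \<delta> \<epsilon> z y \<le> \<delta>\<^sup>2 / 2 * nn \<delta> \<epsilon> z y"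
  using mult_left_mono[OF Ph_le[OF dim, of \<delta> "q y (z - y) + \<epsilon>"], of "cc y"] cc_pos[of y] q_nonneg[of y "z - y"]
  by (simp add: kk_def nn_def mult_ac)

text \<open>\<open>kk\<close> / \<delta>^2 takes at most half of \<open>nn\<close>, and
  \<open>EE\<close> at most the other half once CE \<delta> is at most 1/2.\<close>

lemma QQ_bounds:
  assumes "good \<delta>" "0 \<le> \<epsilon>"
  shows "0 \<le> QQ \<delta> \<epsilon> z y" "QQ \<delta> \<epsilon> z y \<le> (1 + CE * \<delta>) * nn \<delta> \<epsilon> z y - kk \<delta> \<epsilon> z y / \<delta>\<^sup>2"
    "QQ \<delta> \<epsilon> z y \<le> 2 * nn \<delta> \<epsilon> z y"
proof -
  have \<delta>: "0 < \<delta>" "CE * \<delta> \<le> 1 / 2" using assms(1) by (auto simp: good_def)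
  have n: "0 \<le> nn \<delta> \<epsilon> z y" by (rule nn_nonneg[OF \<delta>(1) assms(2)])
  have k: "kk \<delta> \<epsilon> z y / \<delta>\<^sup>2 \<le> nn \<delta> \<epsilon> z y / 2" "0 \<le> kk \<delta> \<epsilon> z y / \<delta>\<^sup>2"
    using kk_le[OF \<delta>(1) assms(2), of z y] kk_nonneg[OF \<delta>(1)] \<delta>(1) by (auto simp: field_simps)
  have E: "\<bar>EE \<delta> \<epsilon> z y\<bar> \<le> CE * \<delta> * nn \<delta> \<epsilon> z y" by (rule EE_bound[OF \<delta>(1) assms(2)])
  have E2: "CE * \<delta> * nn \<delta> \<epsilon> z y \<le> 1 / 2 * nn \<delta> \<epsilon> z y" using n \<delta>(2) by (intro mult_right_mono)
  show "0 \<le> QQ \<delta> \<epsilon> z y" "QQ \<delta> \<epsilon> z y \<le> (1 + CE * \<delta>) * nn \<delta> \<epsilon> z y - kk \<delta> \<epsilon> z y / \<delta>\<^sup>2"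
    "QQ \<delta> \<epsilon> z y \<le> 2 * nn \<delta> \<epsilon> z y"
    using k E E2 n unfolding QQ_def by (auto simp: algebra_simps abs_le_iff)
qed

lemma nn_le_MM: assumes "0 < \<delta>" "0 \<le> \<epsilon>" "z \<noteq> y" shows "nn \<delta> \<epsilon> z y \<le> MM \<delta> (z - y)"
proof -
  let ?x = "z - y"
  have "0 < b1 * (?x \<bullet> ?x)" using assms b1_pos by simp
  then have "N1 DIM('a) \<delta> (q y ?x + \<epsilon>) \<le> N1 DIM('a) \<delta> (b1 * (?x \<bullet> ?x))"
    using q_lower[of ?x y] assms by (intro N1_antimono[OF dim]) auto
  then show ?thesis unfolding nn_def MM_def
    using cc_bounds(2)[of y] cc_pos[of y] cmax_pos N1_nonneg[OF dim assms(1)] b1_pos q_nonneg[of y ?x] assms(2)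
    by (intro mult_mono) auto
qed

lemma MM_facts:
  assumes "0 < \<delta>"
  shows "integrable lborel (MM \<delta>)" "(\<integral>x. MM \<delta> x \<partial>lborel) = CM" "0 \<le> MM \<delta> x"
    "a0 * \<delta> \<le> norm x \<Longrightarrow> MM \<delta> x = 0"
proof -
  show "integrable lborel (MM \<delta>)" "(\<integral>x. MM \<delta> x \<partial>lborel) = CM"
    unfolding MM_def[abs_def] CM_def using norm_N1_integrable[OF b1_pos assms] by auto
  show "0 \<le> MM \<delta> x" using cmax_pos N1_nonneg[OF dim assms] b1_pos by (simp add: MM_def)
  assume "a0 * \<delta> \<le> norm x"
  then have "\<delta> \<le> sqrt b1 * norm x" using b1_pos by (simp add: a0_def field_simps)
  then have "\<delta>\<^sup>2 \<le> (sqrt b1 * norm x)\<^sup>2" using assms by (intro power_mono) auto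
  then have "\<delta>\<^sup>2 \<le> b1 * (x \<bullet> x)" using b1_pos by (simp add: power_mult_distrib power2_norm_eq_inner)
  then show "MM \<delta> x = 0" using profile_zero(3)[OF dim assms] by (simp add: MM_def)
qed

lemma kernel_support:
  assumes "0 < \<delta>" "0 \<le> \<epsilon>" "a0 * \<delta> \<le> dist z y"
  shows "kk \<delta> \<epsilon> z y = 0" "nn \<delta> \<epsilon> z y = 0" "hh \<delta> \<epsilon> z y = 0" "k1 \<delta> \<epsilon> z y v = 0" "k2 \<delta> \<epsilon> z y v w = 0" "QQ \<delta> \<epsilon> z y = 0"
proof -
  have "\<delta> \<le> sqrt (q y (z - y))"
    using order_trans[OF assms(3)[unfolded dist_norm] norm_le_q[of "z - y" y]] a0_pos by simp
  then have "\<delta>\<^sup>2 \<le> q y (z - y) + \<epsilon>"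
    using assms q_nonneg[of y "z - y"] power_mono[of \<delta> "sqrt (q y (z - y))" 2] by simp
  note z = profile_zero[OF dim assms(1) this]
  show k2: "kk \<delta> \<epsilon> z y = 0" "nn \<delta> \<epsilon> z y = 0" "hh \<delta> \<epsilon> z y = 0" "k1 \<delta> \<epsilon> z y v = 0" "k2 \<delta> \<epsilon> z y v w = 0" for v w
    by (simp_all add: kk_def nn_def hh_def k1_def k2_def z)
  then show "QQ \<delta> \<epsilon> z y = 0" by (simp add: QQ_def EE_def)
qed

lemma has_derivative_kk:
  assumes "0 < \<delta>" "0 < \<epsilon>"
  shows "((\<lambda>z. kk \<delta> \<epsilon> z y) has_derivative k1 \<delta> \<epsilon> z y) (at z)"
    "((\<lambda>z. k1 \<delta> \<epsilon> z y v) has_derivative k2 \<delta> \<epsilon> z y v) (at z)"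
    "continuous_on UNIV (\<lambda>z. k2 \<delta> \<epsilon> z y v w)"
proof -
  have p: "0 < q y x + \<epsilon>" for x using q_nonneg[of y x] assms by simp
  have bl: "bounded_linear (Bi y)" using linB linear_conv_bounded_linear by blast
  have dB: "((\<lambda>z. Bi y (z - y)) has_derivative Bi y) (at z)" for z
    by (rule has_derivative_eq_rhs[OF bounded_linear.has_derivative[OF bl, of "\<lambda>z. z - y" "\<lambda>v. v"]])
      (auto intro!: derivative_eq_intros)
  have s: "(z - y) \<bullet> Bi y v = v \<bullet> Bi y (z - y)" for v z by (metis symB inner_commute)
  have dq: "((\<lambda>z. q y (z - y) + \<epsilon>) has_derivative (\<lambda>v. 2 * (Bi y (z - y) \<bullet> v))) (at z)" for z
    unfolding q_def
    by (rule has_derivative_eq_rhs, rule has_derivative_add[OF has_derivative_inner[OF dB] has_derivative_const],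
        rule has_derivative_diff[OF has_derivative_ident has_derivative_const])
      (simp add: s inner_commute)
  have dk: "((\<lambda>z. cc y * Ph DIM('a) \<delta> (q y (z - y) + \<epsilon>)) has_derivative
       (\<lambda>v. cc y * (- gg DIM('a) \<delta> (q y (z - y) + \<epsilon>) * (2 * (Bi y (z - y) \<bullet> v))))) (at z)"
    by (intro has_derivative_mult_right has_derivative_compose[OF dq]
        Ph_has_derivative[OF dim assms(1) p, unfolded has_field_derivative_def])
  show "((\<lambda>z. kk \<delta> \<epsilon> z y) has_derivative k1 \<delta> \<epsilon> z y) (at z)"
    unfolding kk_def k1_def[abs_def] by (rule has_derivative_eq_rhs[OF dk]) (simp add: algebra_simps)
  have dg: "((\<lambda>z. gg DIM('a) \<delta> (q y (z - y) + \<epsilon>)) has_derivative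
       (\<lambda>v. - P2 DIM('a) \<delta> (q y (z - y) + \<epsilon>) * (2 * (Bi y (z - y) \<bullet> v)))) (at z)"
    by (intro has_derivative_compose[OF dq] gg_has_derivative[OF dim assms(1) p, unfolded has_field_derivative_def])
  have dBv: "((\<lambda>z. Bi y (z - y) \<bullet> v) has_derivative (\<lambda>w. Bi y w \<bullet> v)) (at z)"
    by (rule has_derivative_eq_rhs[OF has_derivative_inner_left[OF dB]]) simp
  show "((\<lambda>z. k1 \<delta> \<epsilon> z y v) has_derivative k2 \<delta> \<epsilon> z y v) (at z)"
    unfolding k1_def k2_def[abs_def]
    by (rule has_derivative_eq_rhs[OF has_derivative_minus[OF has_derivative_mult[OF has_derivative_mult_right[OF dg] dBv]]])
      (simp add: algebra_simps)
  have cP: "continuous_on UNIV (\<lambda>z. P2 DIM('a) \<delta> (q y (z - y) + \<epsilon>))"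
    by (rule continuous_on_compose2[OF continuous_P2[OF dim assms(1)]])
      (use p in \<open>auto intro!: continuous_intros continuous_q\<close>)
  have cg: "continuous_on UNIV (\<lambda>z. gg DIM('a) \<delta> (q y (z - y) + \<epsilon>))"
    by (rule continuous_on_compose2[of "{0<..}" "gg DIM('a) \<delta>"])
      (use p gg_has_derivative[OF dim assms(1)] in \<open>auto intro!: continuous_intros continuous_q
          intro: continuous_at_imp_continuous_on DERIV_isCont\<close>)
  show "continuous_on UNIV (\<lambda>z. k2 \<delta> \<epsilon> z y v w)"
    unfolding k2_def by (intro continuous_intros continuous_B cP cg)
qed

text \<open>Crude bounds at fixed \<epsilon>, with a constant that degenerates as \<epsilon> tends
  to 0; they serve to differentiate under the integral.\<close>

lemma k_bounds:
  assumes "0 < \<delta>" "0 < \<epsilon>"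
  shows "\<exists>C\<ge>0. \<forall>z y v w. \<bar>k1 \<delta> \<epsilon> z y v\<bar> \<le> C * norm v \<and> \<bar>k2 \<delta> \<epsilon> z y v w\<bar> \<le> C * norm v * norm w"
proof -
  define G where "G = \<delta> / 4 * N1 DIM('a) \<delta> \<epsilon> / sqrt \<epsilon>"
  define P where "P = P2 DIM('a) \<delta> \<epsilon>"
  define X where "X = a0 * \<delta> / \<mu>"
  define C where "C = cmax * (4 * P * (X * X) + 2 * G / \<mu>) + 2 * cmax * G * X"
  have N: "0 \<le> N1 DIM('a) \<delta> \<epsilon>" "0 \<le> P" using assms N1_nonneg[OF dim assms(1)] P2_nonneg[OF dim assms(1)] by (auto simp: P_def)
  have G0: "0 \<le> G" using N assms by (simp add: G_def)
  have X0: "0 \<le> X" using a0_pos assms pos by (simp add: X_def)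
  have gp: "gg DIM('a) \<delta> p \<le> G" "P2 DIM('a) \<delta> p \<le> P" "0 \<le> gg DIM('a) \<delta> p" "0 \<le> P2 DIM('a) \<delta> p" if p: "\<epsilon> \<le> p" for p
  proof -
    have p0: "0 < p" using p assms by simp
    show g0: "0 \<le> gg DIM('a) \<delta> p" "0 \<le> P2 DIM('a) \<delta> p" using p0 gg_nonneg[OF dim assms(1)] P2_nonneg[OF dim assms(1)] by auto
    have "gg DIM('a) \<delta> p * sqrt \<epsilon> \<le> gg DIM('a) \<delta> p * sqrt p" using p g0 by (intro mult_left_mono) auto
    also have "\<dots> \<le> \<delta> / 4 * N1 DIM('a) \<delta> p" using p0 by (intro gg_le[OF dim assms(1)]) auto
    also have "\<dots> \<le> \<delta> / 4 * N1 DIM('a) \<delta> \<epsilon>" using p assms by (intro mult_left_mono N1_antimono[OF dim assms(1)]) auto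
    finally show "gg DIM('a) \<delta> p \<le> G" using assms by (simp add: G_def field_simps)
    show "P2 DIM('a) \<delta> p \<le> P" unfolding P_def using p assms by (intro P2_antimono[OF dim assms(1)]) auto
  qed
  have C0: "0 \<le> C" using N G0 X0 cmax_pos pos by (simp add: C_def)
  have "\<bar>k1 \<delta> \<epsilon> z y v\<bar> \<le> C * norm v \<and> \<bar>k2 \<delta> \<epsilon> z y v w\<bar> \<le> C * norm v * norm w" for z y v w
  proof (cases "a0 * \<delta> \<le> dist z y")
    case True
    then show ?thesis using kernel_support(4,5)[OF assms(1) less_imp_le[OF assms(2)] True] C0 by simp
  next
    case False
    define b where "b = Bi y (z - y)"
    define p where "p = q y (z - y) + \<epsilon>"
    have p: "\<epsilon> \<le> p" using q_nonneg[of y "z - y"] by (simp add: p_def)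
    note g = gp[OF p]
    have c: "0 < cc y" "cc y \<le> cmax" using cc_pos cc_bounds by auto
    have nb: "norm b \<le> X"
      unfolding b_def X_def using False pos by (intro order_trans[OF normB] divide_right_mono) (auto simp: dist_norm)
    have bv: "\<bar>b \<bullet> v\<bar> \<le> X * norm v" for v
      by (intro order_trans[OF Cauchy_Schwarz_ineq2] mult_right_mono nb) auto
    have Bwv: "\<bar>Bi y w \<bullet> v\<bar> \<le> 1 / \<mu> * (norm v * norm w)"
      using order_trans[OF Cauchy_Schwarz_ineq2 mult_right_mono[OF normB[of y w] norm_ge_zero[of v]]] by (simp add: mult_ac)
    have "\<bar>k1 \<delta> \<epsilon> z y v\<bar> = 2 * cc y * gg DIM('a) \<delta> p * \<bar>b \<bullet> v\<bar>"
      using c g by (simp add: k1_def p_def b_def abs_mult)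
    also have "\<dots> \<le> 2 * cmax * G * (X * norm v)"
      using c g bv X0 G0 by (intro mult_mono) auto
    also have "\<dots> \<le> C * norm v" using N G0 X0 cmax_pos pos by (simp add: C_def algebra_simps)
    finally have 1: "\<bar>k1 \<delta> \<epsilon> z y v\<bar> \<le> C * norm v" .
    have bb: "\<bar>(b \<bullet> v) * (b \<bullet> w)\<bar> \<le> (X * norm v) * (X * norm w)"
      unfolding abs_mult using X0 by (intro mult_mono bv) auto
    have "\<bar>4 * P2 DIM('a) \<delta> p * ((b \<bullet> v) * (b \<bullet> w)) - 2 * gg DIM('a) \<delta> p * (Bi y w \<bullet> v)\<bar>
      \<le> 4 * P2 DIM('a) \<delta> p * ((X * norm v) * (X * norm w)) + 2 * gg DIM('a) \<delta> p * (1 / \<mu> * (norm v * norm w))"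
      by (intro abs_diff_mult_le bb Bwv) (use g in auto)
    also have "\<dots> \<le> 4 * P * ((X * norm v) * (X * norm w)) + 2 * G * (1 / \<mu> * (norm v * norm w))"
      using g X0 pos by (intro add_mono mult_right_mono mult_left_mono) auto
    finally have "\<bar>4 * P2 DIM('a) \<delta> p * ((b \<bullet> v) * (b \<bullet> w)) - 2 * gg DIM('a) \<delta> p * (Bi y w \<bullet> v)\<bar>
      \<le> 4 * P * ((X * norm v) * (X * norm w)) + 2 * G * (1 / \<mu> * (norm v * norm w))" .
    then have "\<bar>4 * P2 DIM('a) \<delta> p * ((b \<bullet> v) * (b \<bullet> w)) - 2 * gg DIM('a) \<delta> p * (Bi y w \<bullet> v)\<bar>
      \<le> (4 * P * (X * X) + 2 * G / \<mu>) * (norm v * norm w)" by (simp add: algebra_simps)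
    then have "\<bar>k2 \<delta> \<epsilon> z y v w\<bar> \<le> cmax * ((4 * P * (X * X) + 2 * G / \<mu>) * (norm v * norm w))"
      unfolding k2_def b_def[symmetric] p_def[symmetric] abs_mult
      using c cmax_pos by (intro mult_mono) auto
    also have "\<dots> \<le> C * norm v * norm w" using N G0 X0 cmax_pos by (simp add: C_def algebra_simps)
    finally show ?thesis using 1 by simp
  qed
  then show ?thesis using C0 by blast
qed

text \<open>In contrast to \<open>k_bounds\<close> this is uniform in \<epsilon>, because
  \<open>nn\<close> has an integrable majorant independent of \<epsilon>. The factor \<delta>
  becomes 1 / \<delta> in the Lipschitz bound for \<open>SS\<close> after division by
  \<delta>^2.\<close>

lemma k1_bound:
  assumes "0 < \<delta>" "0 \<le> \<epsilon>"
  shows "\<bar>k1 \<delta> \<epsilon> z y v\<bar> \<le> (a0 / (2 * \<mu>) * \<delta> * nn \<delta> \<epsilon> z y) * norm v"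
proof -
  define p where "p = q y (z - y) + \<epsilon>"
  have p: "0 \<le> p" "q y (z - y) \<le> p" using q_nonneg[of y "z - y"] assms by (auto simp: p_def)
  have g: "0 \<le> gg DIM('a) \<delta> p" using gg_nonneg[OF dim assms(1) p(1)] .
  have "norm (z - y) \<le> a0 * sqrt p"
    using norm_le_q[of "z - y" y] a0_pos p by (meson mult_left_mono order_trans real_sqrt_le_mono less_imp_le)
  then have nb: "norm (Bi y (z - y)) \<le> a0 * sqrt p / \<mu>"
    using pos by (intro order_trans[OF normB] divide_right_mono) auto
  have "\<bar>k1 \<delta> \<epsilon> z y v\<bar> = 2 * cc y * gg DIM('a) \<delta> p * \<bar>Bi y (z - y) \<bullet> v\<bar>"
    using cc_pos[of y] g by (simp add: k1_def p_def abs_mult)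
  also have "\<dots> \<le> 2 * cc y * gg DIM('a) \<delta> p * ((a0 * sqrt p / \<mu>) * norm v)"
    using cc_pos[of y] g by (intro mult_left_mono order_trans[OF Cauchy_Schwarz_ineq2] mult_right_mono nb) auto
  also have "\<dots> = 2 * cc y * (a0 / \<mu>) * norm v * (gg DIM('a) \<delta> p * sqrt p)" by (simp add: algebra_simps)
  also have "\<dots> \<le> 2 * cc y * (a0 / \<mu>) * norm v * (\<delta> / 4 * N1 DIM('a) \<delta> p)"
    using cc_pos[of y] a0_pos pos by (intro mult_left_mono gg_le[OF dim assms(1) p(1)]) auto
  also have "\<dots> = (a0 / (2 * \<mu>) * \<delta> * nn \<delta> \<epsilon> z y) * norm v" by (simp add: nn_def p_def)
  finally show ?thesis .
qed

end

section \<open>Integral operators\<close>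

definition opr :: "('a::euclidean_space \<Rightarrow> 'a \<Rightarrow> real) \<Rightarrow> ('a \<Rightarrow> real) \<Rightarrow> 'a \<Rightarrow> real" where
  "opr \<kappa> g z = (\<integral>y. \<kappa> z y * g y \<partial>lborel)"

text \<open>A class preserved by all kernels: the bound, required at every point, makes each row
  integral meaningful, and integrability feeds Fubini.\<close>

definition BI :: "('a::euclidean_space \<Rightarrow> real) \<Rightarrow> bool" where
  "BI g \<longleftrightarrow> integrable lborel g \<and> (\<exists>B. \<forall>x. \<bar>g x\<bar> \<le> B)"

lemma BI_measurable: "BI g \<Longrightarrow> g \<in> borel_measurable borel"
  by (auto simp: BI_def dest: borel_measurable_integrable)

text \<open>A convolution majorant bounds row and column integrals at once. The diagonal, a null set
  in each row and column, is exempt because the majorant \<open>MM\<close> vanishes at 0 while the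
  regularised kernels need not.\<close>

locale kernel =
  fixes \<kappa> :: "'a::euclidean_space \<Rightarrow> 'a \<Rightarrow> real" and W :: "'a \<Rightarrow> real" and C :: real
  assumes meas [measurable]: "(\<lambda>p. \<kappa> (fst p) (snd p)) \<in> borel_measurable (borel \<Otimes>\<^sub>M borel)"
    and W: "integrable lborel W" "\<And>x. 0 \<le> W x" and C: "0 \<le> C"
    and bound: "\<And>z y. z \<noteq> y \<Longrightarrow> \<bar>\<kappa> z y\<bar> \<le> C * W (z - y)"
begin

lemma meas1 [measurable]: "(\<lambda>y. \<kappa> z y) \<in> borel_measurable borel" "(\<lambda>z. \<kappa> z y) \<in> borel_measurable borel"
  using measurable_compose[OF _ meas, of "\<lambda>y. (z, y)" borel] measurable_compose[OF _ meas, of "\<lambda>z. (z, y)" borel] by auto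

lemma row: 
  assumes g: "g \<in> borel_measurable borel" "\<And>x. \<bar>g x\<bar> \<le> B"
  shows "integrable lborel (\<lambda>y. \<kappa> z y * g y)" "\<bar>opr \<kappa> g z\<bar> \<le> C * (\<integral>x. W x \<partial>lborel) * B"
    "(\<integral>y. \<bar>\<kappa> z y * g y\<bar> \<partial>lborel) \<le> C * (\<integral>x. W x \<partial>lborel) * B"
proof -
  have B: "0 \<le> B" using g(2)[of 0] by linarith
  have i: "integrable lborel (\<lambda>y. C * B * W (z - y))" using integrable_lborel_reflect[OF W(1)] by simp
  have b: "AE y in lborel. \<bar>\<kappa> z y * g y\<bar> \<le> C * B * W (z - y)"
    using AE_lborel_singleton[of z]
  proof eventually_elim
    case (elim y)
    have "\<bar>\<kappa> z y\<bar> * \<bar>g y\<bar> \<le> (C * W (z - y)) * B" using bound[of z y] elim g(2) W(2) C by (intro mult_mono) auto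
    then show ?case by (simp add: abs_mult mult_ac)
  qed
  show 1: "integrable lborel (\<lambda>y. \<kappa> z y * g y)"
    by (rule Bochner_Integration.integrable_bound[OF i]) (use g(1) b in \<open>auto elim!: eventually_mono\<close>)
  have "(\<integral>y. \<bar>\<kappa> z y * g y\<bar> \<partial>lborel) \<le> (\<integral>y. C * B * W (z - y) \<partial>lborel)"
    using 1 i b by (intro integral_mono_AE) auto
  also have "\<dots> = C * (\<integral>x. W x \<partial>lborel) * B"
    using integral_lborel_reflect[of W z] W(1) by (auto dest: borel_measurable_integrable)
  finally show 2: "(\<integral>y. \<bar>\<kappa> z y * g y\<bar> \<partial>lborel) \<le> C * (\<integral>x. W x \<partial>lborel) * B" .
  then show "\<bar>opr \<kappa> g z\<bar> \<le> C * (\<integral>x. W x \<partial>lborel) * B"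
    unfolding opr_def by (rule order_trans[OF integral_abs_bound])
qed

lemma transpose: "kernel (\<lambda>z y. \<kappa> y z) (\<lambda>x. W (- x)) C"
proof
  show "(\<lambda>p. \<kappa> (snd p) (fst p)) \<in> borel_measurable (borel \<Otimes>\<^sub>M borel)"
    using measurable_compose[OF _ meas, of "\<lambda>p. (snd p, fst p)"] by simp
  show "integrable lborel (\<lambda>x. W (- x))" using integrable_lborel_reflect[OF W(1), of 0] by simp
  show "\<bar>\<kappa> y z\<bar> \<le> C * W (- (z - y))" if "z \<noteq> y" for z y using bound[of y z] that by simp
qed (use W C in auto)

lemma W_minus: "(\<integral>x. W (- x) \<partial>lborel) = (\<integral>x. W x \<partial>lborel)"
  using integral_lborel_reflect[of W 0] W(1) by (auto dest: borel_measurable_integrable)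

lemma col: 
  assumes g: "g \<in> borel_measurable borel" "\<And>x. \<bar>g x\<bar> \<le> B"
  shows "integrable lborel (\<lambda>z. \<kappa> z y * g z)" "\<bar>\<integral>z. \<kappa> z y * g z \<partial>lborel\<bar> \<le> C * (\<integral>x. W x \<partial>lborel) * B"
    "(\<integral>z. \<bar>\<kappa> z y * g z\<bar> \<partial>lborel) \<le> C * (\<integral>x. W x \<partial>lborel) * B"
  using kernel.row[OF transpose g, of y] by (auto simp: opr_def W_minus)

lemma opr_measurable: 
  assumes [measurable]: "g \<in> borel_measurable borel"
  shows "opr \<kappa> g \<in> borel_measurable borel"
  unfolding opr_def[abs_def] 
  using lborel.borel_measurable_lebesgue_integral[of "\<lambda>z y. \<kappa> z y * g y" borel]
    measurable_compose[OF _ meas] by (simp add: split_beta)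

lemma product_integrable:
  assumes g: "integrable lborel g" and \<phi>: "\<phi> \<in> borel_measurable borel" "\<And>x. \<bar>\<phi> x\<bar> \<le> P"
  shows "integrable (lborel \<Otimes>\<^sub>M lborel) (\<lambda>(y, z). \<kappa> z y * g y * \<phi> z)"
proof (rule lborel_pair.Fubini_integrable)
  have g': "g \<in> borel_measurable borel" using g by (auto dest: borel_measurable_integrable)
  have m: "(\<lambda>p. \<kappa> (snd p) (fst p) * g (fst p) * \<phi> (snd p)) \<in> borel_measurable (borel \<Otimes>\<^sub>M borel)"
    using kernel.meas[OF transpose] measurable_compose[OF measurable_fst g'] measurable_compose[OF measurable_snd \<phi>(1)]
    by (intro borel_measurable_times) auto
  then show mm: "(\<lambda>(y, z). \<kappa> z y * g y * \<phi> z) \<in> borel_measurable (lborel \<Otimes>\<^sub>M lborel)"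
    by (simp add: split_beta)
  have r: "(\<integral>z. norm (\<kappa> z y * g y * \<phi> z) \<partial>lborel) = \<bar>g y\<bar> * (\<integral>z. \<bar>\<kappa> z y * \<phi> z\<bar> \<partial>lborel)" for y
  proof -
    have "(\<lambda>z. norm (\<kappa> z y * g y * \<phi> z)) = (\<lambda>z. \<bar>g y\<bar> * \<bar>\<kappa> z y * \<phi> z\<bar>)" by (auto simp: abs_mult)
    then show ?thesis by simp
  qed
  show "integrable lborel (\<lambda>y. \<integral>z. norm (case (y, z) of (y, z) \<Rightarrow> \<kappa> z y * g y * \<phi> z) \<partial>lborel)"
  proof (rule Bochner_Integration.integrable_bound[of _ "\<lambda>y. (C * (\<integral>x. W x \<partial>lborel) * P) * g y"])
    show "(\<lambda>y. \<integral>z. norm (case (y, z) of (y, z) \<Rightarrow> \<kappa> z y * g y * \<phi> z) \<partial>lborel) \<in> borel_measurable lborel"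
      using mm by (intro lborel.borel_measurable_lebesgue_integral) (simp add: split_beta)
    show "AE y in lborel. norm (\<integral>z. norm (case (y, z) of (y, z) \<Rightarrow> \<kappa> z y * g y * \<phi> z) \<partial>lborel)
         \<le> norm ((C * (\<integral>x. W x \<partial>lborel) * P) * g y)"
    proof (rule AE_I2)
      fix y
      define X where "X = (\<integral>z. \<bar>\<kappa> z y * \<phi> z\<bar> \<partial>lborel)"
      define K where "K = C * (\<integral>x. W x \<partial>lborel) * P"
      have X: "0 \<le> X" "X \<le> K" unfolding X_def K_def by (intro integral_nonneg_AE AE_I2 abs_ge_zero, rule col(3)[OF \<phi>])
      have "norm (\<integral>z. norm (case (y, z) of (y, z) \<Rightarrow> \<kappa> z y * g y * \<phi> z) \<partial>lborel) = \<bar>g y\<bar> * X"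
        using X(1) by (simp only: prod.case r X_def[symmetric]) (simp add: abs_mult)
      also have "\<dots> \<le> \<bar>g y\<bar> * \<bar>K\<bar>" using X by (intro mult_left_mono) auto
      finally show "norm (\<integral>z. norm (case (y, z) of (y, z) \<Rightarrow> \<kappa> z y * g y * \<phi> z) \<partial>lborel)
         \<le> norm ((C * (\<integral>x. W x \<partial>lborel) * P) * g y)"
        unfolding K_def[symmetric] by (simp add: abs_mult mult.commute)
    qed
  qed (use g in simp)
  show "AE y in lborel. integrable lborel (\<lambda>z. case (y, z) of (y, z) \<Rightarrow> \<kappa> z y * g y * \<phi> z)"
  proof (rule AE_I2)
    fix y
    have "integrable lborel (\<lambda>z. g y * (\<kappa> z y * \<phi> z))" using col(1)[OF \<phi>] by simp
    then show "integrable lborel (\<lambda>z. case (y, z) of (y, z) \<Rightarrow> \<kappa> z y * g y * \<phi> z)" by (simp add: mult_ac)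
  qed
qed

lemma fubini:
  assumes g: "integrable lborel g" and \<phi>: "\<phi> \<in> borel_measurable borel" "\<And>x. \<bar>\<phi> x\<bar> \<le> P"
  shows "(\<integral>z. \<phi> z * opr \<kappa> g z \<partial>lborel) = (\<integral>y. g y * (\<integral>z. \<kappa> z y * \<phi> z \<partial>lborel) \<partial>lborel)"
    "integrable lborel (\<lambda>z. \<phi> z * opr \<kappa> g z)"
    "integrable lborel (\<lambda>y. g y * (\<integral>z. \<kappa> z y * \<phi> z \<partial>lborel))"
proof -
  note I = product_integrable[OF assms]
  have 1: "(\<integral>y. \<kappa> z y * g y * \<phi> z \<partial>lborel) = \<phi> z * opr \<kappa> g z" for z
    by (simp add: opr_def mult.commute)
  have 2: "(\<integral>z. \<kappa> z y * g y * \<phi> z \<partial>lborel) = g y * (\<integral>z. \<kappa> z y * \<phi> z \<partial>lborel)" for y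
    by (subst Bochner_Integration.integral_mult_right_zero[symmetric]) (simp add: mult_ac)
  show "(\<integral>z. \<phi> z * opr \<kappa> g z \<partial>lborel) = (\<integral>y. g y * (\<integral>z. \<kappa> z y * \<phi> z \<partial>lborel) \<partial>lborel)"
    using lborel_pair.Fubini_integral[OF I] by (simp only: 1 2)
  show "integrable lborel (\<lambda>z. \<phi> z * opr \<kappa> g z)" using lborel_pair.integrable_snd[OF I] by (simp only: 1)
  show "integrable lborel (\<lambda>y. g y * (\<integral>z. \<kappa> z y * \<phi> z \<partial>lborel))"
    using lborel_pair.integrable_fst[OF I] by (simp only: 2)
qed

lemma opr_BI: assumes "BI g" shows "BI (opr \<kappa> g)"
proof -
  obtain B where B: "\<And>x. \<bar>g x\<bar> \<le> B" using assms by (auto simp: BI_def)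
  have "integrable lborel (opr \<kappa> g)" using fubini(2)[of g "\<lambda>_. 1" 1] assms by (simp add: BI_def)
  then show ?thesis using row(2)[OF BI_measurable[OF assms] B] by (auto simp: BI_def)
qed

lemma opr_mono_nonneg:
  assumes "\<And>z y. 0 \<le> \<kappa> z y" "\<And>x. 0 \<le> g x" shows "0 \<le> opr \<kappa> g z"
  unfolding opr_def using assms by (intro integral_nonneg_AE) auto

lemma opr_add: "BI f \<Longrightarrow> BI g \<Longrightarrow> opr \<kappa> (\<lambda>x. f x + g x) z = opr \<kappa> f z + opr \<kappa> g z"
proof -
  assume f: "BI f" and g: "BI g"
  then obtain B B' where B: "\<And>x. \<bar>f x\<bar> \<le> B" "\<And>x. \<bar>g x\<bar> \<le> B'" by (auto simp: BI_def)
  show ?thesis unfolding opr_def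
    using row(1)[OF BI_measurable[OF f] B(1)] row(1)[OF BI_measurable[OF g] B(2)] by (simp add: distrib_left)
qed

end

lemma opr_support:
  assumes "\<And>z y. \<rho> \<le> dist z y \<Longrightarrow> \<kappa> z y = 0" "\<And>y. dist z y < \<rho> \<Longrightarrow> g y = 0"
  shows "opr \<kappa> g z = 0"
proof -
  have "(\<lambda>y. \<kappa> z y * g y) = (\<lambda>_. 0)" using assms by (metis mult_eq_0_iff not_le)
  then show ?thesis by (simp add: opr_def)
qed

lemma BI_add: "BI f \<Longrightarrow> BI g \<Longrightarrow> BI (\<lambda>x. f x + g x)"
  unfolding BI_def by (auto, meson abs_triangle_ineq add_mono order_trans)

lemma BI_cmult: "BI f \<Longrightarrow> BI (\<lambda>x. c * f x)"
  unfolding BI_def by (auto simp: abs_mult, meson abs_ge_zero mult_left_mono)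

lemma BI_sum: "(\<And>i. i \<in> I \<Longrightarrow> BI (f i)) \<Longrightarrow> BI (\<lambda>x. \<Sum>i\<in>I. f i x)"
proof (induction I rule: infinite_finite_induct)
  case (insert x F)
  then show ?case using BI_add[of "f x" "\<lambda>y. \<Sum>i\<in>F. f i y"] by simp
qed (auto simp: BI_def)

definition En :: "nat \<Rightarrow> real" where "En k = inverse (real (Suc k))"

lemma En: "0 < En k" "En \<longlonglongrightarrow> 0"
  using LIMSEQ_inverse_real_of_nat by (auto simp: En_def[abs_def])

lemma continuous_profile:
  assumes m: "2 \<le> m" and \<delta>: "0 < \<delta>" and f: "continuous_on S f" "\<And>t. t \<in> S \<Longrightarrow> 0 < f t"
  shows "continuous_on S (\<lambda>t. N1 m \<delta> (f t))" "continuous_on S (\<lambda>t. Ph m \<delta> (f t))"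
    "continuous_on S (\<lambda>t. gg m \<delta> (f t))" "continuous_on S (\<lambda>t. P2 m \<delta> (f t))"
proof -
  have 1: "continuous_on {0<..} (Ph m \<delta>)"
    using Ph_has_derivative[OF m \<delta>] by (meson continuous_at_imp_continuous_on DERIV_isCont greaterThan_iff)
  have 2: "continuous_on {0<..} (gg m \<delta>)"
    using gg_has_derivative[OF m \<delta>] by (meson continuous_at_imp_continuous_on DERIV_isCont greaterThan_iff)
  have 3: "continuous_on {0<..} (N1 m \<delta>)"
    unfolding N1_def[abs_def] w1_def using \<delta> by (auto intro!: continuous_intros)
  have i: "f ` S \<subseteq> {0<..}" using f by auto
  show "continuous_on S (\<lambda>t. N1 m \<delta> (f t))" "continuous_on S (\<lambda>t. Ph m \<delta> (f t))"
    "continuous_on S (\<lambda>t. gg m \<delta> (f t))" "continuous_on S (\<lambda>t. P2 m \<delta> (f t))"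
    using continuous_on_compose2[OF 3 f(1) i] continuous_on_compose2[OF 1 f(1) i]
      continuous_on_compose2[OF 2 f(1) i] continuous_on_compose2[OF continuous_P2[OF m \<delta>] f(1) i] by auto
qed

section \<open>Row and column masses of the kernels\<close>

context elliptic begin

text \<open>A minorant of \<open>kk\<close> / \<delta>^2, uniform over the poles, so that it removes
  the same mass \<open>b0\<close> from every row and every column.\<close>

definition "PL \<delta> (x::'a) = cmin * (3 / 128) / \<delta> ^ DIM('a) * indicator (ball 0 (\<delta> * sqrt \<mu> / 4)) x"

lemma PL_facts:
  assumes "0 < \<delta>"
  shows "integrable lborel (PL \<delta>)" "(\<integral>x. PL \<delta> x \<partial>lborel) = b0" "PL \<delta> (- x) = PL \<delta> x"
    "z \<noteq> y \<Longrightarrow> PL \<delta> (z - y) \<le> kk \<delta> 0 z y / \<delta>\<^sup>2"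
proof -
  show "integrable lborel (PL \<delta>)"
    unfolding PL_def[abs_def] using emeasure_bounded_finite[of "ball (0::'a) (\<delta> * sqrt \<mu> / 4)"] by (auto intro!: integrable_mult_right)
  have "measure lborel (ball (0::'a) (\<delta> * sqrt \<mu> / 4)) = unit_ball_vol DIM('a) * (\<delta> * sqrt \<mu> / 4) ^ DIM('a)"
    using assms pos by (simp add: content_ball)
  then show "(\<integral>x. PL \<delta> x \<partial>lborel) = b0"
    unfolding PL_def[abs_def] b0_def using assms by (simp add: power_mult_distrib power_divide)
  show "PL \<delta> (- x) = PL \<delta> x" by (simp add: PL_def indicator_def)
  show "PL \<delta> (z - y) \<le> kk \<delta> 0 z y / \<delta>\<^sup>2" if zy: "z \<noteq> y"
  proof (cases "z - y \<in> ball 0 (\<delta> * sqrt \<mu> / 4)")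
    case True
    have q0: "0 < q y (z - y)" using zy by (intro q_pos) auto
    have "(norm (z - y))\<^sup>2 \<le> (\<delta> * sqrt \<mu> / 4)\<^sup>2" using True by (intro power_mono) auto
    then have "((z - y) \<bullet> (z - y)) / \<mu> \<le> \<delta>\<^sup>2 / 16" using pos by (simp add: power2_norm_eq_inner power_mult_distrib power_divide field_simps)
    then have "q y (z - y) \<le> \<delta>\<^sup>2 / 16" using q_upper[of y "z - y"] by linarith
    then have "3 / 128 * \<delta>\<^sup>2 / \<delta> ^ DIM('a) \<le> Ph DIM('a) \<delta> (q y (z - y))" by (rule Ph_lower[OF dim assms q0])
    then have "cmin * (3 / 128 * \<delta>\<^sup>2 / \<delta> ^ DIM('a)) \<le> cc y * Ph DIM('a) \<delta> (q y (z - y))"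
      using cc_bounds(1)[of y] cmin_pos assms cc_pos[of y] by (intro mult_mono) auto
    then show ?thesis using True assms by (simp add: PL_def kk_def field_simps)
  next
    case False
    then show ?thesis using kk_nonneg[OF assms, of 0 z y] by (simp add: PL_def)
  qed
qed

lemma kernel_I:
  assumes "0 < \<delta>" "0 \<le> C" "\<And>f g :: 'a \<times> 'a \<Rightarrow> 'a. f \<in> borel_measurable (borel \<Otimes>\<^sub>M borel) \<Longrightarrow> g \<in> borel_measurable (borel \<Otimes>\<^sub>M borel) \<Longrightarrow>
      (\<lambda>t. \<kappa> (f t) (g t)) \<in> borel_measurable (borel \<Otimes>\<^sub>M borel)"
    "\<And>z y. z \<noteq> y \<Longrightarrow> \<bar>\<kappa> z y\<bar> \<le> C * MM \<delta> (z - y)"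
  shows "kernel \<kappa> (MM \<delta>) C"
  by standard (use assms(1,2) assms(3)[of fst snd] assms(4) MM_facts[OF assms(1)] in auto)

lemma kernel_nn: assumes "0 < \<delta>" "0 \<le> \<epsilon>" shows "kernel (nn \<delta> \<epsilon>) (MM \<delta>) 1"
  by (rule kernel_I[OF assms(1)]) (use nn_nonneg[OF assms] nn_le_MM[OF assms] kernel_measurable(2)[OF _ _ assms(1)] in auto)

lemma kernel_kk: assumes "0 < \<delta>" "0 \<le> \<epsilon>" shows "kernel (kk \<delta> \<epsilon>) (MM \<delta>) (\<delta>\<^sup>2 / 2)"
proof (rule kernel_I[OF assms(1)])
  show "\<bar>kk \<delta> \<epsilon> z y\<bar> \<le> \<delta>\<^sup>2 / 2 * MM \<delta> (z - y)" if "z \<noteq> y" for z y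
    using kk_nonneg[OF assms(1), of \<epsilon> z y] order_trans[OF kk_le[OF assms] mult_left_mono[OF nn_le_MM[OF assms that]]] by simp
qed (use kernel_measurable(1)[OF _ _ assms(1)] in auto)

lemma kernel_QQ: assumes "good \<delta>" "0 \<le> \<epsilon>" shows "kernel (QQ \<delta> \<epsilon>) (MM \<delta>) 2"
proof -
  have \<delta>: "0 < \<delta>" using assms by (simp add: good_def)
  show ?thesis
  proof (rule kernel_I[OF \<delta>])
    show "\<bar>QQ \<delta> \<epsilon> z y\<bar> \<le> 2 * MM \<delta> (z - y)" if "z \<noteq> y" for z y
      using QQ_bounds(1,3)[OF assms, of z y] nn_le_MM[OF \<delta> assms(2) that] by simp
  qed (use kernel_measurable(6)[OF _ _ \<delta>] in auto)
qed

lemma hh_le_nn: assumes "0 < \<delta>" "0 < \<epsilon>" shows "hh \<delta> \<epsilon> z y \<le> \<delta> * (DIM('a) + 2) / (2 * sqrt \<epsilon>) * nn \<delta> \<epsilon> z y"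
proof -
  define p where "p = q y (z - y) + \<epsilon>"
  have p: "\<epsilon> \<le> p" "0 \<le> p" using q_nonneg[of y "z - y"] assms by (auto simp: p_def)
  have "4 * \<epsilon> * P2 DIM('a) \<delta> p * sqrt \<epsilon> \<le> 4 * (P2 DIM('a) \<delta> p * (p * sqrt p))"
  proof -
    have "P2 DIM('a) \<delta> p * (\<epsilon> * sqrt \<epsilon>) \<le> P2 DIM('a) \<delta> p * (p * sqrt p)"
      using p assms P2_nonneg[OF dim assms(1) p(2)] by (intro mult_left_mono mult_mono) auto
    then show ?thesis by (simp add: mult_ac)
  qed
  also have "\<dots> \<le> \<delta> * (DIM('a) + 2) / 2 * N1 DIM('a) \<delta> p" using P2_le[OF dim assms(1) p(2)] by simp
  finally have "4 * \<epsilon> * P2 DIM('a) \<delta> p \<le> \<delta> * (DIM('a) + 2) / (2 * sqrt \<epsilon>) * N1 DIM('a) \<delta> p" using assms by (simp add: field_simps)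
  from mult_left_mono[OF this, of "cc y"] cc_pos[of y] show ?thesis by (simp add: hh_def nn_def p_def mult_ac)
qed

lemma kernel_hh: assumes "0 < \<delta>" "0 < \<epsilon>" shows "kernel (hh \<delta> \<epsilon>) (MM \<delta>) (\<delta> * (DIM('a) + 2) / (2 * sqrt \<epsilon>))"
proof (rule kernel_I[OF assms(1)])
  have C: "0 \<le> \<delta> * (DIM('a) + 2) / (2 * sqrt \<epsilon>)" using assms by simp
  show "\<bar>hh \<delta> \<epsilon> z y\<bar> \<le> \<delta> * (DIM('a) + 2) / (2 * sqrt \<epsilon>) * MM \<delta> (z - y)" if "z \<noteq> y" for z y
    using hh_nonneg[OF assms(1), of \<epsilon> z y] assms
      order_trans[OF hh_le_nn[OF assms] mult_left_mono[OF nn_le_MM[OF assms(1) _ that] C]] by simp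
qed (use kernel_measurable(3)[OF _ _ assms(1)] assms in auto)

text \<open>In a column the coefficients are frozen at y while z is integrated, so the mass is
  exactly the normalised one; \<epsilon> > 0 only lowers the antitone profile.\<close>

lemma nn_col: 
  assumes "0 < \<delta>" 
  shows "(\<integral>z. nn \<delta> 0 z y \<partial>lborel) = 1" "0 \<le> \<epsilon> \<Longrightarrow> integrable lborel (\<lambda>z. nn \<delta> \<epsilon> z y)"
    "0 \<le> \<epsilon> \<Longrightarrow> integrable lborel (\<lambda>y. nn \<delta> \<epsilon> z y)" "0 \<le> \<epsilon> \<Longrightarrow> (\<integral>z. nn \<delta> \<epsilon> z y \<partial>lborel) \<le> 1"
proof -
  have [measurable]: "q y \<in> borel_measurable borel" by measurable
  note [measurable] = profile_measurable[OF dim assms]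
  have "(\<integral>z. nn \<delta> 0 z y \<partial>lborel) = cc y * (\<integral>z. N1 DIM('a) \<delta> (q y (- y + z)) \<partial>lborel)"
    by (simp add: nn_def)
  also have "\<dots> = cc y * (\<integral>x. N1 DIM('a) \<delta> (1 * q y x) \<partial>lborel)"
    by (subst integral_lborel_translate[of "\<lambda>x. N1 DIM('a) \<delta> (q y x)"]) auto
  also have "\<dots> = 1" unfolding N1q_integrable(2)[OF zero_less_one assms] using cc_pos[of y] by (simp add: cc_def)
  finally show 1: "(\<integral>z. nn \<delta> 0 z y \<partial>lborel) = 1" .
  have I: "integrable lborel (\<lambda>z. nn \<delta> \<epsilon> z y)" "integrable lborel (\<lambda>y. nn \<delta> \<epsilon> z y)" if "0 \<le> \<epsilon>" for \<epsilon> y z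
    using kernel.col(1)[OF kernel_nn[OF assms that], of "\<lambda>_. 1" 1] kernel.row(1)[OF kernel_nn[OF assms that], of "\<lambda>_. 1" 1] by auto
  then show "0 \<le> \<epsilon> \<Longrightarrow> integrable lborel (\<lambda>z. nn \<delta> \<epsilon> z y)" "0 \<le> \<epsilon> \<Longrightarrow> integrable lborel (\<lambda>y. nn \<delta> \<epsilon> z y)" by auto
  assume \<epsilon>: "0 \<le> \<epsilon>"
  have "(\<integral>z. nn \<delta> \<epsilon> z y \<partial>lborel) \<le> (\<integral>z. nn \<delta> 0 z y \<partial>lborel)"
  proof (rule integral_mono_AE)
    show "AE z in lborel. nn \<delta> \<epsilon> z y \<le> nn \<delta> 0 z y"
      using AE_lborel_singleton[of y]
    proof eventually_elim
      case (elim z)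
      then show ?case unfolding nn_def using q_pos[of "z - y" y] cc_pos[of y] \<epsilon>
        by (intro mult_left_mono N1_antimono[OF dim assms]) auto
    qed
  qed (use I \<epsilon> in auto)
  then show "(\<integral>z. nn \<delta> \<epsilon> z y \<partial>lborel) \<le> 1" using 1 by simp
qed

lemma nn_row:
  assumes "good \<delta>"
  defines "e \<equiv> Lc * (a0 * \<delta>)"
  shows "(\<integral>y. nn \<delta> 0 z y \<partial>lborel) \<le> (sqrt (1 + e) / sqrt (1 - e)) ^ DIM('a)"
proof -
  have \<delta>: "0 < \<delta>" and e: "e \<le> 1 / 2" using assms by (auto simp: good_def)
  have e0: "0 \<le> e" using Lc_pos a0_pos \<delta> by (simp add: e_def)
  have [measurable]: "q z \<in> borel_measurable borel" by measurable
  note [measurable] = profile_measurable[OF dim \<delta>]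
  have I: "integrable lborel (\<lambda>x. N1 DIM('a) \<delta> ((1 - e) * q z x))" using N1q_integrable(1)[of "1 - e" \<delta> z] \<delta> e by simp
  have "(\<integral>y. nn \<delta> 0 z y \<partial>lborel) \<le> (\<integral>y. sqrt (1 + e) ^ DIM('a) * cc z * N1 DIM('a) \<delta> ((1 - e) * q z (z - y)) \<partial>lborel)"
  proof (rule integral_mono)
    fix y
    show "nn \<delta> 0 z y \<le> sqrt (1 + e) ^ DIM('a) * cc z * N1 DIM('a) \<delta> ((1 - e) * q z (z - y))"
    proof (cases "a0 * \<delta> \<le> dist z y")
      case True
      then show ?thesis using kernel_support(2)[OF \<delta> _ True, of 0] cc_pos[of z] e e0 N1_nonneg[OF dim \<delta>] q_nonneg
        by (auto intro!: mult_nonneg_nonneg)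
    next
      case False
      then have le: "Lc * dist y z \<le> e" unfolding e_def using Lc_pos by (intro mult_left_mono) (auto simp: dist_commute)
      have "Lc * dist y z * q z (z - y) \<le> e * q z (z - y)" using le q_nonneg by (intro mult_right_mono)
      then have "(1 - e) * q z (z - y) \<le> q y (z - y)" using q_diff[of y "z - y" z] by (simp add: algebra_simps)
      moreover have "(1 - e) * q z (z - y) = 0 \<Longrightarrow> q y (z - y) = 0"
        using q_pos[of "z - y" z] e by (cases "z = y") (auto simp: q_def linear_0[OF linB])
      ultimately have "N1 DIM('a) \<delta> (q y (z - y)) \<le> N1 DIM('a) \<delta> ((1 - e) * q z (z - y))"
        using e q_nonneg by (intro N1_mono0[OF \<delta>]) auto
      then show ?thesis unfolding nn_def using cc_compare(1)[OF le] e e0 cc_pos N1_nonneg[OF dim \<delta>] q_nonneg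
        by (intro mult_mono) (auto intro!: mult_nonneg_nonneg less_imp_le)
    qed
  qed (use nn_col(3)[OF \<delta>] integrable_lborel_reflect[OF I] in auto)
  also have "\<dots> = sqrt (1 + e) ^ DIM('a) * cc z * (\<integral>x. N1 DIM('a) \<delta> ((1 - e) * q z x) \<partial>lborel)"
    by (simp add: integral_lborel_reflect[of "\<lambda>x. N1 DIM('a) \<delta> ((1 - e) * q z x)" z])
  also have "\<dots> = (sqrt (1 + e) / sqrt (1 - e)) ^ DIM('a)"
    using N1q_integrable(2)[of "1 - e" \<delta> z] \<delta> e cc_pos[of z] by (simp add: cc_def power_divide)
  finally show ?thesis .
qed

text \<open>Rows give the contraction in the sup norm, columns the one in L^1; the Neumann remainder
  needs the first on f and the second on test functions.\<close>

lemma QQ_mass: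
  assumes "good \<delta>"
  shows "(\<integral>y. QQ \<delta> 0 z y \<partial>lborel) \<le> \<theta>" "(\<integral>z. QQ \<delta> 0 z y \<partial>lborel) \<le> \<theta>"
proof -
  define e where "e = Lc * (a0 * \<delta>)"
  define r where "r = (sqrt (1 + e) / sqrt (1 - e)) ^ DIM('a)"
  have \<delta>: "0 < \<delta>" and e: "e \<le> 1 / 2" and ct: "(1 + CE * \<delta>) * r - b0 \<le> \<theta>"
    using assms by (auto simp: good_def e_def r_def)
  have e0: "0 \<le> e" using Lc_pos a0_pos \<delta> by (simp add: e_def)
  have "1 \<le> sqrt (1 + e) / sqrt (1 - e)" using e e0 by simp
  then have r1: "1 \<le> r" unfolding r_def by (rule one_le_power)
  have CE: "0 \<le> CE * \<delta>" using CE_nonneg \<delta> by simp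
  have pw: "QQ \<delta> 0 z y \<le> (1 + CE * \<delta>) * nn \<delta> 0 z y - PL \<delta> (z - y)" if "z \<noteq> y" for z y
    using QQ_bounds(2)[OF assms, of 0 z y] PL_facts(4)[OF \<delta> that] by simp
  note kQ = kernel.row(1)[OF kernel_QQ[OF assms order_refl], of "\<lambda>_. 1" 1] kernel.col(1)[OF kernel_QQ[OF assms order_refl], of "\<lambda>_. 1" 1]
  have m: "PL \<delta> \<in> borel_measurable borel" using PL_facts(1)[OF \<delta>] by (auto dest: borel_measurable_integrable)
  have "(\<integral>y. QQ \<delta> 0 z y \<partial>lborel) \<le> (\<integral>y. (1 + CE * \<delta>) * nn \<delta> 0 z y - PL \<delta> (z - y) \<partial>lborel)"
    by (rule integral_mono_AE) (use kQ AE_lborel_singleton[of z] pw nn_col(3)[OF \<delta>] integrable_lborel_reflect[OF PL_facts(1)[OF \<delta>]] in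
       \<open>auto elim!: eventually_mono\<close>)
  also have "\<dots> = (1 + CE * \<delta>) * (\<integral>y. nn \<delta> 0 z y \<partial>lborel) - b0"
    using nn_col(3)[OF \<delta> order_refl, of z] integrable_lborel_reflect[OF PL_facts(1)[OF \<delta>]] integral_lborel_reflect[OF m, of z] PL_facts(2)[OF \<delta>]
    by simp
  also have "\<dots> \<le> (1 + CE * \<delta>) * r - b0"
    using nn_row[OF assms, of z] CE by (intro diff_right_mono mult_left_mono) (auto simp: r_def e_def)
  finally show "(\<integral>y. QQ \<delta> 0 z y \<partial>lborel) \<le> \<theta>" using ct by linarith
  have t: "(\<lambda>z. PL \<delta> (z - y)) = (\<lambda>z. PL \<delta> (- y + z))" by simp
  have "(\<integral>z. QQ \<delta> 0 z y \<partial>lborel) \<le> (\<integral>z. (1 + CE * \<delta>) * nn \<delta> 0 z y - PL \<delta> (z - y) \<partial>lborel)"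
    by (rule integral_mono_AE) (use kQ AE_lborel_singleton[of y] pw nn_col(2)[OF \<delta>] integrable_lborel_translate[OF PL_facts(1)[OF \<delta>], of "- y"] in
       \<open>auto elim!: eventually_mono\<close>)
  also have "\<dots> = (1 + CE * \<delta>) * 1 - b0"
    using nn_col(1)[OF \<delta>, of y] nn_col(2)[OF \<delta> order_refl, of y] integrable_lborel_translate[OF PL_facts(1)[OF \<delta>], of "- y"] integral_lborel_translate[OF m, of "- y"] PL_facts(2)[OF \<delta>]
    by simp
  also have "\<dots> \<le> (1 + CE * \<delta>) * r - b0" using r1 CE by (intro diff_right_mono mult_left_mono) auto
  finally show "(\<integral>z. QQ \<delta> 0 z y \<partial>lborel) \<le> \<theta>" using ct by linarith
qed

end

section \<open>Limits as the regularisation is removed\<close>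

lemma opr_tendsto:
  assumes kn: "\<And>n. kernel (\<kappa>n n) W C" and k: "kernel \<kappa> W C"
    and lim: "\<And>z y. z \<noteq> y \<Longrightarrow> (\<lambda>n. \<kappa>n n z y) \<longlonglongrightarrow> \<kappa> z y"
    and g: "g \<in> borel_measurable borel" "\<And>x. \<bar>g x\<bar> \<le> B"
  shows "(\<lambda>n. opr (\<kappa>n n) g z) \<longlonglongrightarrow> opr \<kappa> g z"
  unfolding opr_def
proof (rule integral_dominated_convergence[where w="\<lambda>y. C * B * W (z - y)"])
  interpret k: kernel \<kappa> W C by (rule k)
  have B: "0 \<le> B" using g(2)[of 0] by linarith
  show "integrable lborel (\<lambda>y. C * B * W (z - y))" using integrable_lborel_reflect[OF k.W(1)] by simp
  show "(\<lambda>y. \<kappa> z y * g y) \<in> borel_measurable lborel" using k.row(1)[OF g] by (rule borel_measurable_integrable)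
  show "(\<lambda>y. \<kappa>n n z y * g y) \<in> borel_measurable lborel" for n
    using kernel.row(1)[OF kn g] by (rule borel_measurable_integrable)
  show "AE y in lborel. (\<lambda>n. \<kappa>n n z y * g y) \<longlonglongrightarrow> \<kappa> z y * g y"
    using AE_lborel_singleton[of z] by eventually_elim (intro tendsto_intros lim, auto)
  show "AE y in lborel. norm (\<kappa>n n z y * g y) \<le> C * B * W (z - y)" for n
    using AE_lborel_singleton[of z]
  proof eventually_elim
    case (elim y)
    have "\<bar>\<kappa>n n z y\<bar> * \<bar>g y\<bar> \<le> (C * W (z - y)) * B"
      using kernel.bound[OF kn, of z y] elim g(2) k.W(2) k.C by (intro mult_mono) auto
    then show ?case by (simp add: abs_mult mult_ac)
  qed
qed

context elliptic begin

lemma kernel_limits: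
  assumes "0 < \<delta>" "z \<noteq> y"
  shows "(\<lambda>n. kk \<delta> (En n) z y) \<longlonglongrightarrow> kk \<delta> 0 z y" "(\<lambda>n. QQ \<delta> (En n) z y) \<longlonglongrightarrow> QQ \<delta> 0 z y"
    "(\<lambda>n. nn \<delta> (En n) z y) \<longlonglongrightarrow> nn \<delta> 0 z y"
proof -
  have q0: "0 < q y (z - y)" using assms by (intro q_pos) auto
  have c: "continuous_on {0..} (\<lambda>\<epsilon>. q y (z - y) + \<epsilon>)" by (intro continuous_intros)
  have p: "0 < q y (z - y) + t" if "t \<in> {0..}" for t using q0 that by simp
  note P = continuous_profile[OF dim assms(1) c p]
  have kk: "continuous_on {0..} (\<lambda>\<epsilon>. kk \<delta> \<epsilon> z y)" unfolding kk_def by (intro continuous_intros P)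
  have nn: "continuous_on {0..} (\<lambda>\<epsilon>. nn \<delta> \<epsilon> z y)" unfolding nn_def by (intro continuous_intros P)
  have QQ: "continuous_on {0..} (\<lambda>\<epsilon>. QQ \<delta> \<epsilon> z y)"
    unfolding QQ_def EE_def k2_def using assms by (intro continuous_intros kk nn P) auto
  have e: "\<forall>\<^sub>F n in sequentially. En n \<in> {0..}" using En(1) by (auto intro!: always_eventually less_imp_le)
  show "(\<lambda>n. kk \<delta> (En n) z y) \<longlonglongrightarrow> kk \<delta> 0 z y" "(\<lambda>n. QQ \<delta> (En n) z y) \<longlonglongrightarrow> QQ \<delta> 0 z y"
    "(\<lambda>n. nn \<delta> (En n) z y) \<longlonglongrightarrow> nn \<delta> 0 z y"
    using continuous_on_tendsto_compose[OF kk En(2) _ e] continuous_on_tendsto_compose[OF QQ En(2) _ e]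
      continuous_on_tendsto_compose[OF nn En(2) _ e] by auto
qed

text \<open>In the variables z and x = z - y the singularity stays at x = 0 while z moves, so that
  continuity of \<open>opr (QQ \<delta> 0) g\<close> follows by dominated convergence with a
  multiple of \<open>MM\<close> as majorant.\<close>

lemma QQ_shift_continuous:
  assumes "0 < \<delta>" "x \<noteq> 0"
  shows "continuous_on UNIV (\<lambda>z. QQ \<delta> 0 z (z - x))"
proof -
  have s: "z - (z - x) = x" for z :: 'a by simp
  have c: "continuous_on UNIV (\<lambda>z. q (z - x) x + 0)" by (intro continuous_intros continuous_q)
  have p: "0 < q (z - x) x + 0" for z using q_pos[OF assms(2)] by simp
  note P = continuous_profile[OF dim assms(1) c p]
  have cA: "continuous_on UNIV (\<lambda>z. A (z - x) i)" for i
    by (rule continuous_on_compose2[OF continuous_A[of UNIV]]) (auto intro!: continuous_intros)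
  have cB: "continuous_on UNIV (\<lambda>z. Bi (z - x) v)" for v by (intro continuous_B continuous_intros)
  have cc: "continuous_on UNIV (\<lambda>z. cc (z - x))"
    by (rule continuous_on_compose2[OF continuous_cc[of UNIV]]) (auto intro!: continuous_intros)
  show ?thesis unfolding QQ_def EE_def k2_def nn_def kk_def s
    using assms by (intro continuous_intros P cA cB cc continuous_A) auto
qed

lemma opr_QQ_continuous:
  assumes good: "good \<delta>" and g: "continuous_on UNIV g" "\<And>x. \<bar>g x\<bar> \<le> B"
  shows "continuous_on UNIV (opr (QQ \<delta> 0) g)"
proof -
  have \<delta>: "0 < \<delta>" using good by (simp add: good_def)
  interpret k: kernel "QQ \<delta> 0" "MM \<delta>" 2 by (rule kernel_QQ[OF good order_refl])
  have gm: "g \<in> borel_measurable borel" by (rule borel_measurable_continuous_onI[OF g(1)])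
  have B: "0 \<le> B" using g(2)[of 0] by linarith
  have eq: "opr (QQ \<delta> 0) g z = (\<integral>x. QQ \<delta> 0 z (z - x) * g (z - x) \<partial>lborel)" for z
    unfolding opr_def using k.meas1(1)[of z] gm
    by (subst integral_lborel_reflect[of "\<lambda>y. QQ \<delta> 0 z y * g y" z]) auto
  have "isCont (opr (QQ \<delta> 0) g) z" for z
    unfolding continuous_at_sequentially o_def eq
  proof (intro allI impI)
    fix zs assume zs: "zs \<longlonglongrightarrow> z"
    have m: "(\<lambda>x. QQ \<delta> 0 w (w - x) * g (w - x)) \<in> borel_measurable lborel" for w
      using measurable_compose[OF _ k.meas1(1)[of w], of "\<lambda>x. w - x" borel] measurable_compose[OF _ gm, of "\<lambda>x. w - x" borel] by simp
    show "(\<lambda>n. \<integral>x. QQ \<delta> 0 (zs n) (zs n - x) * g (zs n - x) \<partial>lborel) \<longlonglongrightarrow> (\<integral>x. QQ \<delta> 0 z (z - x) * g (z - x) \<partial>lborel)"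
    proof (rule integral_dominated_convergence[where w="\<lambda>x. 2 * B * MM \<delta> x"])
      show "integrable lborel (\<lambda>x. 2 * B * MM \<delta> x)" using MM_facts(1)[OF \<delta>] by simp
      show "AE x in lborel. (\<lambda>n. QQ \<delta> 0 (zs n) (zs n - x) * g (zs n - x)) \<longlonglongrightarrow> QQ \<delta> 0 z (z - x) * g (z - x)"
        using AE_lborel_singleton[of 0]
      proof eventually_elim
        case (elim x)
        have "(\<lambda>n. QQ \<delta> 0 (zs n) (zs n - x)) \<longlonglongrightarrow> QQ \<delta> 0 z (z - x)"
          using continuous_on_tendsto_compose[OF QQ_shift_continuous[OF \<delta> elim] zs] by simp
        moreover have "(\<lambda>n. g (zs n - x)) \<longlonglongrightarrow> g (z - x)"
          using continuous_on_tendsto_compose[OF g(1) tendsto_diff[OF zs tendsto_const]] by simp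
        ultimately show ?case by (intro tendsto_mult)
      qed
      show "AE x in lborel. norm (QQ \<delta> 0 (zs n) (zs n - x) * g (zs n - x)) \<le> 2 * B * MM \<delta> x" for n
        using AE_lborel_singleton[of 0]
      proof eventually_elim
        case (elim x)
        have "\<bar>QQ \<delta> 0 (zs n) (zs n - x)\<bar> * \<bar>g (zs n - x)\<bar> \<le> (2 * MM \<delta> x) * B"
          using k.bound[of "zs n" "zs n - x"] elim g(2) MM_facts(3)[OF \<delta>] by (intro mult_mono) auto
        then show ?case by (simp add: abs_mult mult_ac)
      qed
    qed (use m in auto)
  qed
  then show ?thesis by (simp add: continuous_at_imp_continuous_on)
qed

text \<open>In a column, \<open>nn\<close> - \<open>hh\<close> is a combination, with coefficients
  fixed at y, of derivatives of the compactly supported \<open>k1\<close>, hence has integral zero.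
  This transfers the known mass of \<open>nn\<close> to \<open>hh\<close>.\<close>

lemma hh_col_eq:
  assumes "0 < \<delta>" "0 < \<epsilon>"
  shows "(\<integral>z. hh \<delta> \<epsilon> z y \<partial>lborel) = (\<integral>z. nn \<delta> \<epsilon> z y \<partial>lborel)" "integrable lborel (\<lambda>z. hh \<delta> \<epsilon> z y)"
proof -
  note d = has_derivative_kk[OF assms]
  have z: "k1 \<delta> \<epsilon> x y v = 0" if "x \<notin> cball y (a0 * \<delta>)" for x v
    using that kernel_support(4)[OF assms(1) less_imp_le[OF assms(2)], of x y v] by (simp add: dist_commute)
  note I = integral_Dd_eq_0[OF d(2,3) compact_cball[of y "a0 * \<delta>"] z]
  show h: "integrable lborel (\<lambda>z. hh \<delta> \<epsilon> z y)"
    using kernel.col(1)[OF kernel_hh[OF assms], of "\<lambda>_. 1" 1] by simp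
  have n: "integrable lborel (\<lambda>z. nn \<delta> \<epsilon> z y)" using nn_col(2)[OF assms(1)] assms by simp
  have "(\<lambda>z. nn \<delta> \<epsilon> z y - hh \<delta> \<epsilon> z y) = (\<lambda>z. \<Sum>i\<in>Basis. \<Sum>j\<in>Basis. (A y i \<bullet> j) * k2 \<delta> \<epsilon> z y i j)"
    using trace_k2_frozen[OF assms(1)] q_nonneg assms(2) by (intro ext) (simp add: add_nonneg_pos)
  then have "(\<integral>z. nn \<delta> \<epsilon> z y - hh \<delta> \<epsilon> z y \<partial>lborel) = (\<integral>z. (\<Sum>i\<in>Basis. \<Sum>j\<in>Basis. (A y i \<bullet> j) * k2 \<delta> \<epsilon> z y i j) \<partial>lborel)"
    by simp
  also have "\<dots> = (\<Sum>i\<in>Basis. \<Sum>j\<in>Basis. (A y i \<bullet> j) * (\<integral>z. k2 \<delta> \<epsilon> z y i j \<partial>lborel))"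
    using I(1) by (simp add: Bochner_Integration.integral_sum)
  also have "\<dots> = 0" using I(2) by simp
  finally show "(\<integral>z. hh \<delta> \<epsilon> z y \<partial>lborel) = (\<integral>z. nn \<delta> \<epsilon> z y \<partial>lborel)" using h n by simp
qed

text \<open>At distance s from the diagonal \<open>P2\<close> stays bounded, so the prefactor
  \<epsilon> decides.\<close>

lemma hh_far:
  assumes "0 < \<delta>" "0 < \<epsilon>" "0 < s" "s \<le> dist z y"
  shows "hh \<delta> \<epsilon> z y \<le> \<epsilon> * (4 * cmax * P2 DIM('a) \<delta> (b1 * s\<^sup>2))"
proof -
  have "s\<^sup>2 \<le> (norm (z - y))\<^sup>2" using assms by (intro power_mono) (auto simp: dist_norm)
  then have "b1 * s\<^sup>2 \<le> b1 * ((z - y) \<bullet> (z - y))" using b1_pos by (simp add: power2_norm_eq_inner)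
  then have "b1 * s\<^sup>2 \<le> q y (z - y) + \<epsilon>" using q_lower[of "z - y" y] assms by linarith
  then have "P2 DIM('a) \<delta> (q y (z - y) + \<epsilon>) \<le> P2 DIM('a) \<delta> (b1 * s\<^sup>2)"
    using b1_pos assms by (intro P2_antimono[OF dim]) auto
  then have "cc y * (4 * \<epsilon> * P2 DIM('a) \<delta> (q y (z - y) + \<epsilon>)) \<le> cmax * (4 * \<epsilon> * P2 DIM('a) \<delta> (b1 * s\<^sup>2))"
    using cc_bounds(2)[of y] cc_pos[of y] cmax_pos assms q_nonneg[of y "z - y"] P2_nonneg[OF dim assms(1)]
    by (intro mult_mono mult_left_mono) auto
  then show ?thesis by (simp add: hh_def mult_ac)
qed

text \<open>The column mass tends to 1 and concentrates at the diagonal: on columns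
  \<open>hh\<close> is an approximate identity.\<close>

lemma hh_col_lim:
  assumes \<delta>: "0 < \<delta>" and \<xi>: "continuous_on UNIV \<xi>" "\<And>x. \<bar>\<xi> x\<bar> \<le> P"
  shows "(\<lambda>n. \<integral>z. hh \<delta> (En n) z y * \<xi> z \<partial>lborel) \<longlonglongrightarrow> \<xi> y"
proof -
  have \<xi>m: "\<xi> \<in> borel_measurable borel" by (rule borel_measurable_continuous_onI[OF \<xi>(1)])
  have P: "0 \<le> P" using \<xi>(2)[of 0] by linarith
  define H where "H n = (\<integral>z. hh \<delta> (En n) z y \<partial>lborel)" for n
  have Hn: "H n = (\<integral>z. nn \<delta> (En n) z y \<partial>lborel)" for n unfolding H_def by (rule hh_col_eq[OF \<delta> En(1)])
  have H1: "H n \<le> 1" for n unfolding Hn using nn_col(4)[OF \<delta> less_imp_le[OF En(1)]] .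
  have "(\<lambda>n. opr (\<lambda>z y. nn \<delta> (En n) y z) (\<lambda>_. 1) y) \<longlonglongrightarrow> opr (\<lambda>z y. nn \<delta> 0 y z) (\<lambda>_. 1) y"
    by (rule opr_tendsto[OF kernel.transpose[OF kernel_nn[OF \<delta> less_imp_le[OF En(1)]]] kernel.transpose[OF kernel_nn[OF \<delta> order_refl]], where B=1])
      (use kernel_limits(3)[OF \<delta>] in auto)
  then have H: "H \<longlonglongrightarrow> 1" using nn_col(1)[OF \<delta>, of y] by (simp add: opr_def Hn[abs_def])
  have hi: "integrable lborel (\<lambda>z. hh \<delta> (En n) z y)" for n by (rule hh_col_eq[OF \<delta> En(1)])
  have hxi: "integrable lborel (\<lambda>z. hh \<delta> (En n) z y * \<xi> z)" for n
    by (rule kernel.col(1)[OF kernel_hh[OF \<delta> En(1)] \<xi>m \<xi>(2)])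
  have "(\<lambda>n. (\<integral>z. hh \<delta> (En n) z y * \<xi> z \<partial>lborel) - \<xi> y * H n) \<longlonglongrightarrow> 0"
  proof (rule LIMSEQ_I)
    fix r :: real assume r: "0 < r"
    have "isCont \<xi> y" using \<xi>(1) by (simp add: continuous_on_eq_continuous_at)
    then obtain s where s: "s > 0" "\<And>x. dist x y < s \<Longrightarrow> \<bar>\<xi> x - \<xi> y\<bar> < r / 2"
      using r unfolding continuous_at_eps_delta dist_norm real_norm_def by (metis half_gt_zero)
    define Cs where "Cs = 2 * P * (4 * cmax * P2 DIM('a) \<delta> (b1 * s\<^sup>2))"
    have Cs: "0 \<le> Cs" using P cmax_pos P2_nonneg[OF dim \<delta>] b1_pos by (simp add: Cs_def)
    define V where "V = measure lborel (cball y (a0 * \<delta>))"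
    have Vi: "integrable lborel (indicator (cball y (a0 * \<delta>)) :: 'a \<Rightarrow> real)"
      using emeasure_bounded_finite[of "cball y (a0 * \<delta>)"] by (auto intro!: integrable_real_indicator)
    have "(\<lambda>n. En n * (Cs * V)) \<longlonglongrightarrow> 0 * (Cs * V)" by (intro tendsto_intros En)
    then have "\<forall>\<^sub>F n in sequentially. En n * (Cs * V) < r / 2" by (rule order_tendstoD) (use r in simp)
    then obtain N where N: "\<And>n. n \<ge> N \<Longrightarrow> En n * (Cs * V) < r / 2" by (auto simp: eventually_sequentially)
    have "norm ((\<integral>z. hh \<delta> (En n) z y * \<xi> z \<partial>lborel) - \<xi> y * H n - 0) < r" if n: "n \<ge> N" for n
    proof -
      have "(\<integral>z. hh \<delta> (En n) z y * \<xi> z \<partial>lborel) - \<xi> y * H n = (\<integral>z. hh \<delta> (En n) z y * \<xi> z - \<xi> y * hh \<delta> (En n) z y \<partial>lborel)"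
        unfolding H_def using hxi hi by simp
      then have "\<bar>(\<integral>z. hh \<delta> (En n) z y * \<xi> z \<partial>lborel) - \<xi> y * H n\<bar> \<le> (\<integral>z. \<bar>hh \<delta> (En n) z y * \<xi> z - \<xi> y * hh \<delta> (En n) z y\<bar> \<partial>lborel)"
        by (simp add: integral_abs_bound)
      also have "\<dots> \<le> (\<integral>z. r / 2 * hh \<delta> (En n) z y + En n * Cs * indicator (cball y (a0 * \<delta>)) z \<partial>lborel)"
      proof (rule integral_mono)
        fix z
        have h0: "0 \<le> hh \<delta> (En n) z y" by (rule hh_nonneg[OF \<delta> less_imp_le[OF En(1)]])
        have e: "\<bar>hh \<delta> (En n) z y * \<xi> z - \<xi> y * hh \<delta> (En n) z y\<bar> = hh \<delta> (En n) z y * \<bar>\<xi> z - \<xi> y\<bar>"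
        proof -
          have "hh \<delta> (En n) z y * \<xi> z - \<xi> y * hh \<delta> (En n) z y = hh \<delta> (En n) z y * (\<xi> z - \<xi> y)" by (simp add: algebra_simps)
          then show ?thesis using h0 by (simp add: abs_mult)
        qed
        consider "dist z y < s" | "s \<le> dist z y" "z \<in> cball y (a0 * \<delta>)" | "z \<notin> cball y (a0 * \<delta>)" by linarith
        then show "\<bar>hh \<delta> (En n) z y * \<xi> z - \<xi> y * hh \<delta> (En n) z y\<bar> \<le> r / 2 * hh \<delta> (En n) z y + En n * Cs * indicator (cball y (a0 * \<delta>)) z"
        proof cases
          case 1
          have "hh \<delta> (En n) z y * \<bar>\<xi> z - \<xi> y\<bar> \<le> hh \<delta> (En n) z y * (r / 2)"
            using s(2)[OF 1] h0 by (intro mult_left_mono) auto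
          moreover have "0 \<le> En n * Cs * indicator (cball y (a0 * \<delta>)) z" using Cs En(1)[of n] by simp
          ultimately show ?thesis unfolding e by (simp add: mult.commute)
        next
          case 2
          have "\<bar>\<xi> z - \<xi> y\<bar> \<le> 2 * P" using \<xi>(2)[of z] \<xi>(2)[of y] by linarith
          then have "hh \<delta> (En n) z y * \<bar>\<xi> z - \<xi> y\<bar> \<le> (En n * (4 * cmax * P2 DIM('a) \<delta> (b1 * s\<^sup>2))) * (2 * P)"
            using h0 hh_far[OF \<delta> En(1)[of n] s(1) 2(1)] by (intro mult_mono) (auto intro: order_trans)
          then show ?thesis unfolding e using 2(2) h0 r by (simp add: Cs_def mult_ac add_increasing)
        next
          case 3
          then have "hh \<delta> (En n) z y = 0"
            using kernel_support(3)[OF \<delta> less_imp_le[OF En(1)], of z y] by (simp add: dist_commute)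
          then show ?thesis using 3 by simp
        qed
      qed (use hxi hi Vi in auto)
      also have "\<dots> = r / 2 * H n + En n * Cs * V" unfolding H_def V_def using hi Vi by simp
      also have "\<dots> < r / 2 * 1 + r / 2" using N[OF n] H1[of n] r by (intro add_le_less_mono mult_left_mono) (auto simp: mult.assoc)
      finally show ?thesis by simp
    qed
    then show "\<exists>N. \<forall>n\<ge>N. norm ((\<integral>z. hh \<delta> (En n) z y * \<xi> z \<partial>lborel) - \<xi> y * H n - 0) < r" by blast
  qed
  from tendsto_add[OF this tendsto_mult[OF tendsto_const[of "\<xi> y"] H]] show ?thesis by simp
qed

text \<open>Fubini moves the limit to the columns, where the mass of \<open>hh\<close> is under
  exact control.\<close>

lemma hh_weak:
  assumes \<delta>: "0 < \<delta>" and \<xi>: "continuous_on UNIV \<xi>" "\<And>x. \<bar>\<xi> x\<bar> \<le> P" and g: "BI g"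
  shows "(\<lambda>n. \<integral>z. \<xi> z * opr (hh \<delta> (En n)) g z \<partial>lborel) \<longlonglongrightarrow> (\<integral>z. \<xi> z * g z \<partial>lborel)"
proof -
  have \<xi>m: "\<xi> \<in> borel_measurable borel" by (rule borel_measurable_continuous_onI[OF \<xi>(1)])
  have gi: "integrable lborel g" using g by (simp add: BI_def)
  note F = kernel.fubini[OF kernel_hh[OF \<delta> En(1)] gi \<xi>m \<xi>(2)]
  have P: "0 \<le> P" using \<xi>(2)[of 0] by linarith
  have b: "\<bar>\<integral>z. hh \<delta> (En n) z y * \<xi> z \<partial>lborel\<bar> \<le> P" for n y
  proof -
    note h = hh_col_eq[OF \<delta> En(1), of n y]
    have "\<bar>\<integral>z. hh \<delta> (En n) z y * \<xi> z \<partial>lborel\<bar> \<le> (\<integral>z. hh \<delta> (En n) z y * P \<partial>lborel)"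
    proof (rule order_trans[OF integral_abs_bound], rule integral_mono)
      show "integrable lborel (\<lambda>z. \<bar>hh \<delta> (En n) z y * \<xi> z\<bar>)"
        by (intro integrable_abs kernel.col(1)[OF kernel_hh[OF \<delta> En(1)] \<xi>m \<xi>(2)])
      show "integrable lborel (\<lambda>z. hh \<delta> (En n) z y * P)" using h by simp
      show "\<bar>hh \<delta> (En n) z y * \<xi> z\<bar> \<le> hh \<delta> (En n) z y * P" for z
        using hh_nonneg[OF \<delta> less_imp_le[OF En(1)], of n z y] \<xi>(2) by (simp add: abs_mult mult_left_mono)
    qed
    also have "\<dots> = (\<integral>z. nn \<delta> (En n) z y \<partial>lborel) * P" using h by simp
    also have "\<dots> \<le> 1 * P" using nn_col(4)[OF \<delta> less_imp_le[OF En(1)]] P by (intro mult_right_mono)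
    finally show ?thesis by simp
  qed
  have "(\<lambda>n. \<integral>y. g y * (\<integral>z. hh \<delta> (En n) z y * \<xi> z \<partial>lborel) \<partial>lborel) \<longlonglongrightarrow> (\<integral>y. g y * \<xi> y \<partial>lborel)"
  proof (rule integral_dominated_convergence[where w="\<lambda>y. \<bar>g y\<bar> * P"])
    show "AE y in lborel. (\<lambda>n. g y * (\<integral>z. hh \<delta> (En n) z y * \<xi> z \<partial>lborel)) \<longlonglongrightarrow> g y * \<xi> y"
      by (intro AE_I2 tendsto_intros hh_col_lim[OF \<delta> \<xi>])
    show "AE y in lborel. norm (g y * (\<integral>z. hh \<delta> (En n) z y * \<xi> z \<partial>lborel)) \<le> \<bar>g y\<bar> * P" for n
      using b by (intro AE_I2) (auto simp: abs_mult intro!: mult_left_mono)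
  qed (use F(3) gi \<xi>m in \<open>auto dest: borel_measurable_integrable\<close>)
  then show ?thesis by (simp add: F(1) mult.commute)
qed

definition "RR e = sqrt (1 + e) ^ DIM('a) / ((1 - e) * sqrt (1 - e) ^ DIM('a))"

text \<open>Rows of \<open>hh\<close> come without an exact mass. Near z the kernel is dominated by
  a dilate of the kernel frozen at z, at the price \<open>RR\<close>, which tends to 1 with s
  tending to 0; far from z \<open>hh_far\<close> applies. The result is an upper bound, whence the
  one-sided limit in \<open>opr_hh_row_lim\<close>.\<close>

lemma opr_hh_upper:
  assumes \<delta>: "0 < \<delta>" and \<epsilon>: "0 < \<epsilon>" and s: "0 < s" "Lc * s < 1"
    and g: "BI g" "\<And>x. 0 \<le> g x" "\<And>y. dist y z < s \<Longrightarrow> g y \<le> G"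
  shows "opr (hh \<delta> \<epsilon>) g z \<le> RR (Lc * s) * G + \<epsilon> * (4 * cmax * P2 DIM('a) \<delta> (b1 * s\<^sup>2)) * (\<integral>y. g y \<partial>lborel)"
proof -
  define e where "e = Lc * s"
  have e: "0 < e" "e < 1" using s Lc_pos by (auto simp: e_def)
  define \<epsilon>' where "\<epsilon>' = (1 - e) * \<epsilon>"
  have \<epsilon>': "0 < \<epsilon>'" using e \<epsilon> by (simp add: \<epsilon>'_def)
  \<comment> \<open>The column kernel with pole z, read as a function of the difference;
    \<open>hh_col_eq\<close> bounds its mass by 1.\<close>
  define F where "F x = cc z * (4 * \<epsilon>' * P2 DIM('a) \<delta> (q z x + \<epsilon>'))" for x
  have Fh: "hh \<delta> \<epsilon>' w z = F (- z + w)" for w by (simp add: F_def hh_def)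
  have [measurable]: "q z \<in> borel_measurable borel" by measurable
  note [measurable] = profile_measurable[OF dim \<delta>]
  have Fm[measurable]: "F \<in> borel_measurable borel" unfolding F_def[abs_def] by measurable
  have Fi: "integrable lborel F"
    using integrable_lborel_translate[of "\<lambda>w. hh \<delta> \<epsilon>' w z" z] hh_col_eq(2)[OF \<delta> \<epsilon>', of z] by (simp add: Fh)
  have F1: "(\<integral>x. F x \<partial>lborel) \<le> 1"
    using integral_lborel_translate[OF Fm, of "- z"] hh_col_eq(1)[OF \<delta> \<epsilon>', of z] nn_col(4)[OF \<delta>, of \<epsilon>' z] \<epsilon>' by (simp add: Fh)
  have F0: "0 \<le> F x" for x using cc_pos[of z] \<epsilon>' P2_nonneg[OF dim \<delta>] q_nonneg by (simp add: F_def)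
  define c where "c = sqrt (1 - e)"
  have c: "0 < c" "c\<^sup>2 = 1 - e" using e by (auto simp: c_def)
  \<comment> \<open>Dilation by c multiplies the form by 1 - e, and the factor 1 / (1 - e) restores
    \<epsilon> from \<epsilon>'.\<close>
  define near where "near y = sqrt (1 + e) ^ DIM('a) / (1 - e) * F (c *\<^sub>R (z - y))" for y
  have near0: "0 \<le> near y" for y using e F0 by (simp add: near_def)
  have Fci: "integrable lborel (\<lambda>x. F (c *\<^sub>R x))" using lborel_scale(1)[OF c(1) Fm] Fi by simp
  have near_i: "integrable lborel near" unfolding near_def[abs_def]
    using integrable_lborel_reflect[OF Fci, of z] by simp
  have near_int: "(\<integral>y. near y \<partial>lborel) \<le> RR e"
  proof -
    have "(\<integral>y. near y \<partial>lborel) = sqrt (1 + e) ^ DIM('a) / (1 - e) * (\<integral>x. F (c *\<^sub>R x) \<partial>lborel)"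
      unfolding near_def using integral_lborel_reflect[of "\<lambda>x. F (c *\<^sub>R x)" z] by simp
    also have "\<dots> = sqrt (1 + e) ^ DIM('a) / (1 - e) * ((\<integral>x. F x \<partial>lborel) / c ^ DIM('a))" using lborel_scale(2)[OF c(1) Fm] by simp
    also have "\<dots> \<le> sqrt (1 + e) ^ DIM('a) / (1 - e) * (1 / c ^ DIM('a))"
      using F1 e c by (intro mult_left_mono divide_right_mono) auto
    finally show ?thesis by (simp add: RR_def c_def)
  qed
  have hn: "hh \<delta> \<epsilon> z y \<le> near y" if d: "dist y z < s" for y
  proof -
    have le: "Lc * dist y z \<le> e" unfolding e_def using d Lc_pos by (intro mult_left_mono) auto
    have "Lc * dist y z * q z (z - y) \<le> e * q z (z - y)" using le q_nonneg by (intro mult_right_mono)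
    then have "(1 - e) * q z (z - y) \<le> q y (z - y)" using q_diff[of y "z - y" z] by (simp add: algebra_simps)
    moreover have "\<epsilon>' \<le> \<epsilon>" using e \<epsilon> by (simp add: \<epsilon>'_def)
    moreover have "0 < (1 - e) * q z (z - y) + \<epsilon>'" using e \<epsilon>' q_nonneg[of z "z - y"] by (intro add_nonneg_pos) auto
    ultimately have P: "P2 DIM('a) \<delta> (q y (z - y) + \<epsilon>) \<le> P2 DIM('a) \<delta> ((1 - e) * q z (z - y) + \<epsilon>')"
      by (intro P2_antimono[OF dim \<delta>]) auto
    have "hh \<delta> \<epsilon> z y \<le> (sqrt (1 + e) ^ DIM('a) * cc z) * (4 * \<epsilon> * P2 DIM('a) \<delta> ((1 - e) * q z (z - y) + \<epsilon>'))"
      unfolding hh_def using cc_compare(1)[OF le e(2)] cc_pos[of z] e \<epsilon> P P2_nonneg[OF dim \<delta>] q_nonneg[of y "z - y"]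
      by (intro mult_mono mult_left_mono) auto
    also have "\<dots> = near y" using e c by (simp add: near_def F_def q_scale \<epsilon>'_def)
    finally show ?thesis .
  qed
  define Cs where "Cs = 4 * cmax * P2 DIM('a) \<delta> (b1 * s\<^sup>2)"
  have Cs: "0 \<le> Cs" using cmax_pos P2_nonneg[OF dim \<delta>] b1_pos by (simp add: Cs_def)
  have G0: "0 \<le> G" using g(2)[of z] g(3)[of z] s by simp
  obtain B where B: "\<And>x. \<bar>g x\<bar> \<le> B" using g(1) by (auto simp: BI_def)
  have gi: "integrable lborel g" using g(1) by (simp add: BI_def)
  have "opr (hh \<delta> \<epsilon>) g z \<le> (\<integral>y. near y * G + \<epsilon> * Cs * g y \<partial>lborel)"
    unfolding opr_def
  proof (rule integral_mono)
    fix y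
    have h0: "0 \<le> hh \<delta> \<epsilon> z y" using hh_nonneg[OF \<delta>] \<epsilon> by simp
    show "hh \<delta> \<epsilon> z y * g y \<le> near y * G + \<epsilon> * Cs * g y"
    proof (cases "dist y z < s")
      case True
      have "hh \<delta> \<epsilon> z y * g y \<le> near y * G" using hn[OF True] g(3)[OF True] near0 g(2) h0 by (intro mult_mono) auto
      then show ?thesis using \<epsilon> Cs g(2)[of y] by (simp add: add_increasing2)
    next
      case False
      have "hh \<delta> \<epsilon> z y * g y \<le> (\<epsilon> * Cs) * g y"
        unfolding Cs_def using hh_far[OF \<delta> \<epsilon> s(1), of z y] False g(2) by (intro mult_right_mono) (auto simp: dist_commute)
      then show ?thesis using near0[of y] G0 by (simp add: add_increasing)
    qed
  qed (use kernel.row(1)[OF kernel_hh[OF \<delta> \<epsilon>] BI_measurable[OF g(1)] B] near_i gi in auto)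
  also have "\<dots> = (\<integral>y. near y \<partial>lborel) * G + \<epsilon> * Cs * (\<integral>y. g y \<partial>lborel)" using near_i gi by simp
  also have "\<dots> \<le> RR e * G + \<epsilon> * Cs * (\<integral>y. g y \<partial>lborel)" using near_int G0 by (intro add_right_mono mult_right_mono)
  finally show ?thesis by (simp add: e_def Cs_def)
qed

text \<open>The constant in \<open>kernel_hh\<close> blows up along \<open>En\<close>;
  \<open>opr_hh_upper\<close> at one fixed s gives a bound that does not.\<close>

lemma opr_hh_bounded:
  assumes \<delta>: "0 < \<delta>" and g: "BI g" "\<And>x. 0 \<le> g x"
  shows "\<exists>T. \<forall>n z. \<bar>opr (hh \<delta> (En n)) g z\<bar> \<le> T"
proof -
  obtain B where B: "\<And>x. \<bar>g x\<bar> \<le> B" using g(1) by (auto simp: BI_def)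
  define s where "s = 1 / (2 * Lc)"
  have s: "0 < s" "Lc * s < 1" using Lc_pos by (auto simp: s_def)
  define Cs where "Cs = 4 * cmax * P2 DIM('a) \<delta> (b1 * s\<^sup>2)"
  have Cs: "0 \<le> Cs" using cmax_pos P2_nonneg[OF dim \<delta>] b1_pos by (simp add: Cs_def)
  have I: "0 \<le> (\<integral>y. g y \<partial>lborel)" using g(2) by (intro integral_nonneg_AE) auto
  have "\<bar>opr (hh \<delta> (En n)) g z\<bar> \<le> RR (Lc * s) * B + 1 * Cs * (\<integral>y. g y \<partial>lborel)" for n z
  proof -
    have "En n \<le> 1" by (simp add: En_def field_simps)
    then have "En n * Cs * (\<integral>y. g y \<partial>lborel) \<le> 1 * Cs * (\<integral>y. g y \<partial>lborel)" using Cs I by (intro mult_right_mono)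
    moreover have "opr (hh \<delta> (En n)) g z \<le> RR (Lc * s) * B + En n * Cs * (\<integral>y. g y \<partial>lborel)"
      unfolding Cs_def by (rule opr_hh_upper[OF \<delta> En(1) s g]) (use B abs_le_D1 in blast)
    moreover have "0 \<le> opr (hh \<delta> (En n)) g z"
      by (rule kernel.opr_mono_nonneg[OF kernel_hh[OF \<delta> En(1)] hh_nonneg[OF \<delta> less_imp_le[OF En(1)]] g(2)])
    ultimately show ?thesis by linarith
  qed
  then show ?thesis by blast
qed

text \<open>The maximum with g expresses that the upper limit is at most g in the form of a genuine
  limit, fit for dominated convergence.\<close>

lemma opr_hh_row_lim:
  assumes \<delta>: "0 < \<delta>" and g: "BI g" "\<And>x. 0 \<le> g x" "continuous_on UNIV g"
  shows "(\<lambda>n. max (opr (hh \<delta> (En n)) g z) (g z)) \<longlonglongrightarrow> g z"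
proof (rule LIMSEQ_I)
  fix r :: real assume r: "0 < r"
  define \<eta> where "\<eta> = r / 3"
  have \<eta>: "0 < \<eta>" using r by (simp add: \<eta>_def)
  have "isCont g z" using g(3) by (simp add: continuous_on_eq_continuous_at)
  then obtain s0 where s0: "s0 > 0" "\<And>y. dist y z < s0 \<Longrightarrow> \<bar>g y - g z\<bar> < \<eta>"
    using \<eta> unfolding continuous_at_eps_delta dist_norm real_norm_def by metis
  have "((\<lambda>s. RR (Lc * s) * (g z + \<eta>)) \<longlongrightarrow> RR (Lc * 0) * (g z + \<eta>)) (at_right 0)"
    unfolding RR_def by (intro tendsto_intros) auto
  then have "\<forall>\<^sub>F s in at_right 0. RR (Lc * s) * (g z + \<eta>) < g z + 2 * \<eta>"
    by (rule order_tendstoD(2)) (use \<eta> in \<open>simp add: RR_def\<close>)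
  moreover have "\<forall>\<^sub>F s in at_right 0. Lc * s < 1"
    by (rule order_tendstoD(2)[of _ "Lc * 0"], intro tendsto_intros, simp)
  moreover have "\<forall>\<^sub>F s in at_right 0. s < s0" using s0(1) by (auto simp: eventually_at_right_field)
  moreover have "\<forall>\<^sub>F s in at_right 0. (0::real) < s" by (rule eventually_at_right_less)
  ultimately have "\<forall>\<^sub>F s in at_right 0. RR (Lc * s) * (g z + \<eta>) < g z + 2 * \<eta> \<and> Lc * s < 1 \<and> s < s0 \<and> 0 < s"
    by eventually_elim auto
  then obtain s where s: "RR (Lc * s) * (g z + \<eta>) < g z + 2 * \<eta>" "Lc * s < 1" "s < s0" "0 < s"
    using eventually_happens[of _ "at_right (0::real)"] by auto
  define C where "C = (4 * cmax * P2 DIM('a) \<delta> (b1 * s\<^sup>2)) * (\<integral>y. g y \<partial>lborel)"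
  have "(\<lambda>n. En n * C) \<longlonglongrightarrow> 0 * C" by (intro tendsto_intros En)
  then have "\<forall>\<^sub>F n in sequentially. En n * C < \<eta>" by (rule order_tendstoD) (use \<eta> in simp)
  then obtain N where N: "\<And>n. n \<ge> N \<Longrightarrow> En n * C < \<eta>" by (auto simp: eventually_sequentially)
  have "norm (max (opr (hh \<delta> (En n)) g z) (g z) - g z) < r" if n: "n \<ge> N" for n
  proof -
    have b: "g y \<le> g z + \<eta>" if "dist y z < s" for y using s0(2)[of y] that s(3) by auto
    have "opr (hh \<delta> (En n)) g z \<le> RR (Lc * s) * (g z + \<eta>) + En n * C"
      using opr_hh_upper[OF \<delta> En(1)[of n] s(4,2) g(1,2) b] by (simp add: C_def mult.assoc)
    also have "\<dots> < g z + 3 * \<eta>" using s(1) N[OF n] by linarith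
    finally show ?thesis using r by (simp add: \<eta>_def max_def)
  qed
  then show "\<exists>N. \<forall>n\<ge>N. norm (max (opr (hh \<delta> (En n)) g z) (g z) - g z) < r" by blast
qed

lemma opr_kk_C2:
  assumes \<delta>: "0 < \<delta>" and \<epsilon>: "0 < \<epsilon>" and g: "BI g"
  shows "Ck 2 (opr (kk \<delta> \<epsilon>) g) UNIV"
    "(opr (kk \<delta> \<epsilon>) g has_derivative (\<lambda>v. \<integral>y. k1 \<delta> \<epsilon> z y v * g y \<partial>lborel)) (at z)"
    "Dd (Dd (opr (kk \<delta> \<epsilon>) g) v) w z = (\<integral>y. k2 \<delta> \<epsilon> z y v w * g y \<partial>lborel)"
    "integrable lborel (\<lambda>y. k2 \<delta> \<epsilon> z y v w * g y)"
    "integrable lborel (\<lambda>y. k1 \<delta> \<epsilon> z y v * g y)"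
proof -
  obtain C where C: "0 \<le> C" "\<And>z y v. \<bar>k1 \<delta> \<epsilon> z y v\<bar> \<le> C * norm v" "\<And>z y v w. \<bar>k2 \<delta> \<epsilon> z y v w\<bar> \<le> C * norm v * norm w"
    using k_bounds[OF \<delta> \<epsilon>] by blast
  obtain B where B: "\<And>x. \<bar>g x\<bar> \<le> B" using g by (auto simp: BI_def)
  have gi: "integrable lborel g" using g by (simp add: BI_def)
  note gm[measurable] = BI_measurable[OF g]
  note d = has_derivative_kk[OF \<delta> \<epsilon>]
  have k1m[measurable]: "(\<lambda>y. k1 \<delta> \<epsilon> z y v * g y) \<in> borel_measurable lborel" for z v
    using kernel_measurable(4)[of "\<lambda>_. z" lborel "\<lambda>y. y" \<delta>] \<delta> by simp
  have k2m[measurable]: "(\<lambda>y. k2 \<delta> \<epsilon> z y v w * g y) \<in> borel_measurable lborel" for z v w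
    using kernel_measurable(5)[of "\<lambda>_. z" lborel "\<lambda>y. y" \<delta>] \<delta> by simp
  have b1': "\<bar>k1 \<delta> \<epsilon> z y v * g y\<bar> \<le> C * \<bar>g y\<bar> * norm v" for z y v
    using mult_right_mono[OF C(2)[of z y v] abs_ge_zero[of "g y"]] by (simp add: abs_mult mult_ac)
  have b2': "\<bar>k2 \<delta> \<epsilon> z y v w * g y\<bar> \<le> C * norm v * \<bar>g y\<bar> * norm w" for z y v w
    using mult_right_mono[OF C(3)[of z y v w] abs_ge_zero[of "g y"]] by (simp add: abs_mult mult_ac)
  have i1: "integrable lborel (\<lambda>y. k1 \<delta> \<epsilon> z y v * g y)" for z v
    by (rule Bochner_Integration.integrable_bound[of _ "\<lambda>y. C * \<bar>g y\<bar> * norm v"])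
      (use gi C(1) b1' in \<open>auto intro!: AE_I2 simp: abs_mult\<close>)
  have i2: "integrable lborel (\<lambda>y. k2 \<delta> \<epsilon> z y v w * g y)" for z v w
    by (rule Bochner_Integration.integrable_bound[of _ "\<lambda>y. C * norm v * \<bar>g y\<bar> * norm w"])
      (use gi C(1) b2' in \<open>auto intro!: AE_I2 simp: abs_mult\<close>)
  have D1: "((\<lambda>z. opr (kk \<delta> \<epsilon>) g z) has_derivative (\<lambda>v. \<integral>y. k1 \<delta> \<epsilon> z y v * g y \<partial>lborel)) (at z)" for z
    unfolding opr_def
  proof (rule has_derivative_integral[where S=UNIV and G="\<lambda>y. C * \<bar>g y\<bar>"])
    show "integrable lborel (\<lambda>y. kk \<delta> \<epsilon> z y * g y)" for z
      using kernel.row(1)[OF kernel_kk[OF \<delta> less_imp_le[OF \<epsilon>]] gm B] .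
    show "((\<lambda>z. kk \<delta> \<epsilon> z y * g y) has_derivative (\<lambda>v. k1 \<delta> \<epsilon> z y v * g y)) (at z)" for z y
      by (rule has_derivative_mult_left[OF d(1)])
  qed (use gi b1' in auto)
  have D2: "((\<lambda>z. \<integral>y. k1 \<delta> \<epsilon> z y v * g y \<partial>lborel) has_derivative (\<lambda>w. \<integral>y. k2 \<delta> \<epsilon> z y v w * g y \<partial>lborel)) (at z)" for z v
  proof (rule has_derivative_integral[where S=UNIV and G="\<lambda>y. C * norm v * \<bar>g y\<bar>"])
    show "((\<lambda>z. k1 \<delta> \<epsilon> z y v * g y) has_derivative (\<lambda>w. k2 \<delta> \<epsilon> z y v w * g y)) (at z)" for z y
      by (rule has_derivative_mult_left[OF d(2)])
  qed (use gi i1 b2' in auto)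
  have D3: "continuous_on UNIV (\<lambda>z. \<integral>y. k2 \<delta> \<epsilon> z y v w * g y \<partial>lborel)" for v w
  proof -
    have "isCont (\<lambda>z. \<integral>y. k2 \<delta> \<epsilon> z y v w * g y \<partial>lborel) z" for z
      unfolding continuous_at_sequentially o_def
    proof (intro allI impI)
      fix zs assume zs: "zs \<longlonglongrightarrow> z"
      show "(\<lambda>n. \<integral>y. k2 \<delta> \<epsilon> (zs n) y v w * g y \<partial>lborel) \<longlonglongrightarrow> (\<integral>y. k2 \<delta> \<epsilon> z y v w * g y \<partial>lborel)"
        by (rule integral_dominated_convergence[where w="\<lambda>y. C * norm v * \<bar>g y\<bar> * norm w"])
          (use gi b2' continuous_on_tendsto_compose[OF d(3) zs] in \<open>auto intro!: AE_I2 tendsto_intros\<close>)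
    qed
    then show ?thesis by (simp add: continuous_at_imp_continuous_on)
  qed
  note R = Ck2I[OF open_UNIV D1 D2 D3]
  show "Ck 2 (opr (kk \<delta> \<epsilon>) g) UNIV" using R(1) by simp
  show "Dd (Dd (opr (kk \<delta> \<epsilon>) g) v) w z = (\<integral>y. k2 \<delta> \<epsilon> z y v w * g y \<partial>lborel)"
    using R(3)[of z v w] by simp
  show "(opr (kk \<delta> \<epsilon>) g has_derivative (\<lambda>v. \<integral>y. k1 \<delta> \<epsilon> z y v * g y \<partial>lborel)) (at z)" using D1 by simp
  show "integrable lborel (\<lambda>y. k2 \<delta> \<epsilon> z y v w * g y)" "integrable lborel (\<lambda>y. k1 \<delta> \<epsilon> z y v * g y)" by (rule i2 i1)+
qed

lemma Lg_opr_kk: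
  assumes good: "good \<delta>" and \<epsilon>: "0 < \<epsilon>" and g: "BI g"
  shows "opr (kk \<delta> \<epsilon>) g z / \<delta>\<^sup>2 - Lg A (opr (kk \<delta> \<epsilon>) g) z = opr (hh \<delta> \<epsilon>) g z - opr (QQ \<delta> \<epsilon>) g z"
proof -
  have \<delta>: "0 < \<delta>" using good by (simp add: good_def)
  obtain B where B: "\<And>x. \<bar>g x\<bar> \<le> B" using g by (auto simp: BI_def)
  note gm = BI_measurable[OF g]
  note I = kernel.row(1)[OF kernel_kk[OF \<delta> less_imp_le[OF \<epsilon>]] gm B] kernel.row(1)[OF kernel_hh[OF \<delta> \<epsilon>] gm B]
     kernel.row(1)[OF kernel_QQ[OF good less_imp_le[OF \<epsilon>]] gm B]
  note k = opr_kk_C2[OF \<delta> \<epsilon> g]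
  have "Lg A (opr (kk \<delta> \<epsilon>) g) z = (\<integral>y. (\<Sum>i\<in>Basis. \<Sum>j\<in>Basis. (A z i \<bullet> j) * (k2 \<delta> \<epsilon> z y i j * g y)) \<partial>lborel)"
    unfolding Lg_def k(3) using k(4) by (simp add: Bochner_Integration.integral_sum)
  also have "\<dots> = (\<integral>y. kk \<delta> \<epsilon> z y * g y / \<delta>\<^sup>2 - (hh \<delta> \<epsilon> z y * g y - QQ \<delta> \<epsilon> z y * g y) \<partial>lborel)"
  proof (intro Bochner_Integration.integral_cong refl)
    fix y
    have "(\<Sum>i\<in>Basis. \<Sum>j\<in>Basis. (A z i \<bullet> j) * (k2 \<delta> \<epsilon> z y i j * g y)) = (\<Sum>i\<in>Basis. \<Sum>j\<in>Basis. (A z i \<bullet> j) * k2 \<delta> \<epsilon> z y i j) * g y"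
      by (simp add: sum_distrib_right mult.assoc)
    also have "\<dots> = (kk \<delta> \<epsilon> z y / \<delta>\<^sup>2 - (hh \<delta> \<epsilon> z y - QQ \<delta> \<epsilon> z y)) * g y"
      using kernel_identity[OF \<delta>, of y z \<epsilon>] q_nonneg[of y "z - y"] \<epsilon> by simp
    finally show "(\<Sum>i\<in>Basis. \<Sum>j\<in>Basis. (A z i \<bullet> j) * (k2 \<delta> \<epsilon> z y i j * g y)) = kk \<delta> \<epsilon> z y * g y / \<delta>\<^sup>2 - (hh \<delta> \<epsilon> z y * g y - QQ \<delta> \<epsilon> z y * g y)"
      by (simp add: algebra_simps)
  qed
  also have "\<dots> = opr (kk \<delta> \<epsilon>) g z / \<delta>\<^sup>2 - (opr (hh \<delta> \<epsilon>) g z - opr (QQ \<delta> \<epsilon>) g z)"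
    unfolding opr_def using I by simp
  finally show ?thesis by simp
qed

text \<open>Derivatives are available for \<epsilon> > 0; their bound is uniform in \<epsilon>, so
  the Lipschitz estimate survives the limit.\<close>

lemma opr_kk_lipschitz:
  assumes \<delta>: "0 < \<delta>" and g: "BI g" "\<And>x. \<bar>g x\<bar> \<le> B"
  shows "\<bar>opr (kk \<delta> 0) g z - opr (kk \<delta> 0) g w\<bar> \<le> (a0 / (2 * \<mu>) * \<delta> * CM * B) * dist z w"
proof -
  have B: "0 \<le> B" using g(2)[of 0] by linarith
  let ?C = "a0 / (2 * \<mu>) * \<delta> * CM * B"
  have L: "\<bar>opr (kk \<delta> (En n)) g z - opr (kk \<delta> (En n)) g w\<bar> \<le> ?C * dist z w" for n
  proof -
    note e = En(1)[of n]
    note k = opr_kk_C2[OF \<delta> e g(1)]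
    have "norm (opr (kk \<delta> (En n)) g z - opr (kk \<delta> (En n)) g w) \<le> ?C * norm (z - w)"
    proof (rule differentiable_bound[of UNIV])
      show "(opr (kk \<delta> (En n)) g has_derivative (\<lambda>v. \<integral>y. k1 \<delta> (En n) x y v * g y \<partial>lborel)) (at x within UNIV)" for x
        using k(2) by simp
      show "onorm (\<lambda>v. \<integral>y. k1 \<delta> (En n) x y v * g y \<partial>lborel) \<le> ?C" for x
      proof (rule onorm_le)
        fix v :: 'a
        have i: "integrable lborel (\<lambda>y. (a0 / (2 * \<mu>) * \<delta> * norm v * B) * MM \<delta> (x - y))"
          using integrable_lborel_reflect[OF MM_facts(1)[OF \<delta>]] by simp
        have "\<bar>\<integral>y. k1 \<delta> (En n) x y v * g y \<partial>lborel\<bar> \<le> (\<integral>y. (a0 / (2 * \<mu>) * \<delta> * norm v * B) * MM \<delta> (x - y) \<partial>lborel)"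
        proof (rule order_trans[OF integral_abs_bound], rule integral_mono_AE)
          show "AE y in lborel. \<bar>k1 \<delta> (En n) x y v * g y\<bar> \<le> (a0 / (2 * \<mu>) * \<delta> * norm v * B) * MM \<delta> (x - y)"
            using AE_lborel_singleton[of x]
          proof eventually_elim
            case (elim y)
            have "\<bar>k1 \<delta> (En n) x y v\<bar> \<le> (a0 / (2 * \<mu>) * \<delta> * nn \<delta> (En n) x y) * norm v"
              using k1_bound[OF \<delta> less_imp_le[OF e]] .
            also have "\<dots> \<le> (a0 / (2 * \<mu>) * \<delta> * MM \<delta> (x - y)) * norm v"
              using a0_pos pos \<delta> elim less_imp_le[OF e] by (intro mult_right_mono mult_left_mono nn_le_MM) auto
            finally have "\<bar>k1 \<delta> (En n) x y v\<bar> * \<bar>g y\<bar> \<le> ((a0 / (2 * \<mu>) * \<delta> * MM \<delta> (x - y)) * norm v) * B"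
              using a0_pos pos \<delta> MM_facts(3)[OF \<delta>] by (intro mult_mono g(2)) auto
            then show ?case by (simp add: abs_mult mult_ac)
          qed
        qed (use k(5) i in auto)
        also have "\<dots> = ?C * norm v"
          using integral_lborel_reflect[of "MM \<delta>" x] MM_facts(1,2)[OF \<delta>] by (simp add: borel_measurable_integrable)
        finally show "norm (\<integral>y. k1 \<delta> (En n) x y v * g y \<partial>lborel) \<le> ?C * norm v" by simp
      qed
    qed auto
    then show ?thesis by (simp add: dist_norm)
  qed
  have t: "(\<lambda>n. opr (kk \<delta> (En n)) g x) \<longlonglongrightarrow> opr (kk \<delta> 0) g x" for x
    by (rule opr_tendsto[OF kernel_kk[OF \<delta> less_imp_le[OF En(1)]] kernel_kk[OF \<delta> order_refl] _ BI_measurable[OF g(1)] g(2)])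
      (rule kernel_limits(1)[OF \<delta>])
  have "(\<lambda>n. \<bar>opr (kk \<delta> (En n)) g z - opr (kk \<delta> (En n)) g w\<bar>) \<longlonglongrightarrow> \<bar>opr (kk \<delta> 0) g z - opr (kk \<delta> 0) g w\<bar>"
    by (intro tendsto_intros t)
  then show ?thesis by (rule LIMSEQ_le_const2) (use L in auto)
qed

end

section \<open>The smoothing operator\<close>

context elliptic begin

text \<open>\<open>SS\<close> is the parametrix composed with the truncated Neumann series \<open>GN\<close>; the truncation keeps its range finite.\<close>

definition "QN \<delta> k f = (opr (QQ \<delta> 0) ^^ k) f"
definition "GN \<delta> N f = (\<lambda>x. \<Sum>k<N. QN \<delta> k f x)"
definition "SS \<delta> N f = (\<lambda>z. opr (kk \<delta> 0) (GN \<delta> N f) z / \<delta>\<^sup>2)"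

lemma QN_Suc: "QN \<delta> (Suc k) f = opr (QQ \<delta> 0) (QN \<delta> k f)" by (simp add: QN_def)
lemma QN_0 [simp]: "QN \<delta> 0 f = f" by (simp add: QN_def)

lemma good_pos: "good \<delta> \<Longrightarrow> 0 < \<delta>" by (simp add: good_def)

lemma QN_BI: "good \<delta> \<Longrightarrow> BI f \<Longrightarrow> BI (QN \<delta> k f)"
  by (induction k) (auto simp: QN_Suc intro: kernel.opr_BI[OF kernel_QQ])

lemma GN_BI: "good \<delta> \<Longrightarrow> BI f \<Longrightarrow> BI (GN \<delta> N f)"
  unfolding GN_def by (intro BI_sum QN_BI)

text \<open>The partial sums telescope; the remainder \<open>QN \<delta> N f\<close> is the price of
  a finite range.\<close>

lemma opr_GN:
  assumes "good \<delta>" "BI f"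
  shows "GN \<delta> N f z - opr (QQ \<delta> 0) (GN \<delta> N f) z = f z - QN \<delta> N f z"
proof -
  have "opr (QQ \<delta> 0) (GN \<delta> N f) z = (\<Sum>k<N. QN \<delta> (Suc k) f z)"
  proof (induction N)
    case 0 then show ?case by (simp add: GN_def opr_def)
  next
    case (Suc N)
    have e: "GN \<delta> (Suc N) f = (\<lambda>x. GN \<delta> N f x + QN \<delta> N f x)" by (simp add: GN_def)
    show ?case unfolding e kernel.opr_add[OF kernel_QQ[OF assms(1) order_refl] GN_BI[OF assms] QN_BI[OF assms]]
      using Suc by (simp add: QN_Suc)
  qed
  then have "GN \<delta> N f z - opr (QQ \<delta> 0) (GN \<delta> N f) z = (\<Sum>k<N. QN \<delta> k f z - QN \<delta> (Suc k) f z)"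
    by (simp add: GN_def sum_subtractf)
  also have "\<dots> = f z - QN \<delta> N f z" using sum_lessThan_telescope'[of "\<lambda>k. QN \<delta> k f z" N] by simp
  finally show ?thesis .
qed

lemma \<theta>_bounds: assumes "good \<delta>" shows "0 \<le> \<theta>" "\<theta> < 1"
proof -
  have "0 \<le> (\<integral>y. QQ \<delta> 0 0 y \<partial>lborel)" using QQ_bounds(1)[OF assms order_refl] by (intro integral_nonneg_AE) auto
  then show "0 \<le> \<theta>" using QQ_mass(1)[OF assms, of 0] by linarith
  show "\<theta> < 1" using b0_pos by (simp add: \<theta>_def)
qed

lemma opr_QQ_contract:
  assumes good: "good \<delta>" and f: "f \<in> borel_measurable borel" "\<And>x. \<bar>f x\<bar> \<le> B"
  shows "\<bar>opr (QQ \<delta> 0) f z\<bar> \<le> \<theta> * B"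
proof -
  have B: "0 \<le> B" using f(2)[of 0] by linarith
  note Q0 = QQ_bounds(1)[OF good order_refl]
  note kr = kernel.row(1)[OF kernel_QQ[OF good order_refl]]
  have "\<bar>opr (QQ \<delta> 0) f z\<bar> \<le> (\<integral>y. QQ \<delta> 0 z y * B \<partial>lborel)"
    unfolding opr_def
  proof (rule order_trans[OF integral_abs_bound], rule integral_mono)
    show "integrable lborel (\<lambda>y. \<bar>QQ \<delta> 0 z y * f y\<bar>)" by (intro integrable_abs kr[OF f])
    show "integrable lborel (\<lambda>y. QQ \<delta> 0 z y * B)" using kr[of "\<lambda>_. B" B z] B by simp
    show "\<bar>QQ \<delta> 0 z y * f y\<bar> \<le> QQ \<delta> 0 z y * B" for y
      using Q0[of z y] f(2) by (simp add: abs_mult mult_left_mono)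
  qed
  also have "\<dots> = (\<integral>y. QQ \<delta> 0 z y \<partial>lborel) * B" by simp
  also have "\<dots> \<le> \<theta> * B" using QQ_mass(1)[OF good] B by (intro mult_right_mono)
  finally show ?thesis .
qed

lemma QN_contract:
  assumes good: "good \<delta>" and f: "BI f" "\<And>x. \<bar>f x\<bar> \<le> B"
  shows "\<bar>QN \<delta> k f z\<bar> \<le> \<theta> ^ k * B"
proof (induction k arbitrary: z)
  case (Suc k)
  have "\<bar>opr (QQ \<delta> 0) (QN \<delta> k f) z\<bar> \<le> \<theta> * (\<theta> ^ k * B)"
    by (rule opr_QQ_contract[OF good BI_measurable[OF QN_BI[OF good f(1)]] Suc.IH])
  then show ?case by (simp add: QN_Suc mult.assoc)
qed (use f in simp)

lemma QN_nonneg: assumes "good \<delta>" "\<And>x. 0 \<le> f x" shows "0 \<le> QN \<delta> k f z"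
  by (induction k arbitrary: z)
    (use assms(2) kernel.opr_mono_nonneg[OF kernel_QQ[OF assms(1) order_refl] QQ_bounds(1)[OF assms(1) order_refl]] in \<open>auto simp: QN_Suc\<close>)

lemma QN_nonpos: assumes "good \<delta>" "\<And>x. f x \<le> 0" shows "QN \<delta> k f z \<le> 0"
proof (induction k arbitrary: z)
  case (Suc k)
  have "0 \<le> (\<integral>y. QQ \<delta> 0 z y * - QN \<delta> k f y \<partial>lborel)"
    using QQ_bounds(1)[OF assms(1) order_refl] Suc.IH by (intro integral_nonneg_AE AE_I2 mult_nonneg_nonneg) auto
  then show ?case by (simp add: QN_Suc opr_def)
qed (use assms in simp)

lemma QN_mass:
  assumes good: "good \<delta>" and f: "BI f" "\<And>x. 0 \<le> f x"
  shows "(\<integral>x. QN \<delta> k f x \<partial>lborel) \<le> \<theta> ^ k * (\<integral>x. f x \<partial>lborel)"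
proof (induction k)
  case (Suc k)
  let ?g = "QN \<delta> k f"
  have g: "BI ?g" "integrable lborel ?g" using QN_BI[OF good f(1), of k] by (auto simp: BI_def)
  note F = kernel.fubini[OF kernel_QQ[OF good order_refl] g(2), of "\<lambda>_. 1" 1]
  have "(\<integral>x. QN \<delta> (Suc k) f x \<partial>lborel) = (\<integral>y. ?g y * (\<integral>z. QQ \<delta> 0 z y \<partial>lborel) \<partial>lborel)"
    using F(1) by (simp add: QN_Suc)
  also have "\<dots> \<le> (\<integral>y. ?g y * \<theta> \<partial>lborel)"
    using F(3) g(2) QN_nonneg[OF good f(2)] QQ_mass(2)[OF good] by (intro integral_mono mult_left_mono) auto
  also have "\<dots> = \<theta> * (\<integral>y. ?g y \<partial>lborel)" by simp
  also have "\<dots> \<le> \<theta> * (\<theta> ^ k * (\<integral>x. f x \<partial>lborel))" using Suc \<theta>_bounds[OF good] by (intro mult_left_mono) auto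
  finally show ?case by (simp add: mult.assoc)
qed simp

lemma GN_bound:
  assumes good: "good \<delta>" and f: "BI f" "\<And>x. \<bar>f x\<bar> \<le> B"
  shows "\<bar>GN \<delta> N f z\<bar> \<le> B / (1 - \<theta>)"
proof -
  note t = \<theta>_bounds[OF good]
  have B: "0 \<le> B" using f(2)[of 0] by linarith
  have "\<bar>GN \<delta> N f z\<bar> \<le> (\<Sum>k<N. \<theta> ^ k * B)"
    unfolding GN_def by (intro order_trans[OF sum_abs] sum_mono QN_contract[OF good f])
  also have "\<dots> = (\<Sum>k<N. \<theta> ^ k) * B" by (simp add: sum_distrib_right)
  also have "(\<Sum>k<N. \<theta> ^ k) = (1 - \<theta> ^ N) / (1 - \<theta>)" using t sum_gp_strict[of \<theta> N] by simp
  also have "\<dots> * B \<le> 1 / (1 - \<theta>) * B" using t B by (intro mult_right_mono divide_right_mono) auto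
  finally show ?thesis by simp
qed

lemma GN_nonneg: "good \<delta> \<Longrightarrow> (\<And>x. 0 \<le> f x) \<Longrightarrow> 0 \<le> GN \<delta> N f z"
  unfolding GN_def by (intro sum_nonneg QN_nonneg)

lemma SS_BI: assumes "good \<delta>" "BI f" shows "BI (SS \<delta> N f)"
proof -
  have "BI (opr (kk \<delta> 0) (GN \<delta> N f))"
    by (rule kernel.opr_BI[OF kernel_kk[OF good_pos[OF assms(1)] order_refl] GN_BI[OF assms]])
  from BI_cmult[OF this, of "1 / \<delta>\<^sup>2"] show ?thesis by (simp add: SS_def)
qed

lemma SS_nonneg: assumes "good \<delta>" "\<And>x. 0 \<le> f x" shows "0 \<le> SS \<delta> N f z"
  unfolding SS_def
  using kernel.opr_mono_nonneg[OF kernel_kk[OF good_pos[OF assms(1)] order_refl] kk_nonneg[OF good_pos[OF assms(1)]] GN_nonneg[OF assms]]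
  by simp

lemma SS_nonpos: assumes "good \<delta>" "\<And>x. f x \<le> 0" shows "SS \<delta> N f z \<le> 0"
proof -
  have "GN \<delta> N f x \<le> 0" for x unfolding GN_def by (intro sum_nonpos QN_nonpos assms)
  then have "0 \<le> (\<integral>y. kk \<delta> 0 z y * - GN \<delta> N f y \<partial>lborel)"
    using kk_nonneg[OF good_pos[OF assms(1)]] by (intro integral_nonneg_AE AE_I2 mult_nonneg_nonneg) auto
  then show ?thesis using good_pos[OF assms(1)] by (simp add: SS_def opr_def divide_nonpos_pos)
qed

lemma SS_bound:
  assumes good: "good \<delta>" and f: "BI f" "\<And>x. \<bar>f x\<bar> \<le> B"
  shows "\<bar>SS \<delta> N f z\<bar> \<le> CM / 2 * (B / (1 - \<theta>))"
proof -
  note \<delta> = good_pos[OF good]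
  have "\<bar>opr (kk \<delta> 0) (GN \<delta> N f) z\<bar> \<le> \<delta>\<^sup>2 / 2 * (\<integral>x. MM \<delta> x \<partial>lborel) * (B / (1 - \<theta>))"
    by (rule kernel.row(2)[OF kernel_kk[OF \<delta> order_refl] BI_measurable[OF GN_BI[OF good f(1)]] GN_bound[OF good f]])
  then show ?thesis using \<delta> MM_facts(2)[OF \<delta>] by (simp add: SS_def abs_div field_simps)
qed

lemma SS_lipschitz:
  assumes good: "good \<delta>" and f: "BI f" "\<And>x. \<bar>f x\<bar> \<le> B"
  shows "\<bar>SS \<delta> N f z - SS \<delta> N f w\<bar> \<le> (a0 / (2 * \<mu>) * CM * (B / (1 - \<theta>)) / \<delta>) * dist z w"
proof -
  note \<delta> = good_pos[OF good]
  have "\<bar>opr (kk \<delta> 0) (GN \<delta> N f) z - opr (kk \<delta> 0) (GN \<delta> N f) w\<bar> \<le> (a0 / (2 * \<mu>) * \<delta> * CM * (B / (1 - \<theta>))) * dist z w"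
    by (rule opr_kk_lipschitz[OF \<delta> GN_BI[OF good f(1)] GN_bound[OF good f]])
  then have "\<bar>opr (kk \<delta> 0) (GN \<delta> N f) z - opr (kk \<delta> 0) (GN \<delta> N f) w\<bar> / \<delta>\<^sup>2 \<le> ((a0 / (2 * \<mu>) * \<delta> * CM * (B / (1 - \<theta>))) * dist z w) / \<delta>\<^sup>2"
    by (rule divide_right_mono) simp
  then show ?thesis using \<delta> by (simp add: SS_def power2_eq_square flip: diff_divide_distrib)
qed

lemma SS_continuous: assumes "good \<delta>" "BI f" shows "continuous_on S (SS \<delta> N f)"
proof -
  obtain B where B: "\<And>x. \<bar>f x\<bar> \<le> B" using assms(2) by (auto simp: BI_def)
  note L = SS_lipschitz[OF assms B, of N]
  let ?L = "a0 / (2 * \<mu>) * CM * (B / (1 - \<theta>)) / \<delta>"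
  have "dist (SS \<delta> N f z) (SS \<delta> N f w) \<le> \<bar>?L\<bar> * dist z w" for z w
    using order_trans[OF L[of z w] mult_right_mono[OF abs_ge_self zero_le_dist]] by (simp add: dist_real_def)
  then have "\<bar>?L\<bar>-lipschitz_on UNIV (SS \<delta> N f)" by (intro lipschitz_onI) auto
  then show ?thesis using lipschitz_on_continuous_on continuous_on_subset by blast
qed

lemma QN_support:
  assumes "good \<delta>" "\<And>y. dist z y \<le> k * (a0 * \<delta>) \<Longrightarrow> f y = 0"
  shows "QN \<delta> k f z = 0"
  using assms(2)
proof (induction k arbitrary: z)
  case (Suc k)
  show ?case unfolding QN_Suc
  proof (rule opr_support[where \<rho>="a0 * \<delta>"])
    show "QQ \<delta> 0 z y = 0" if "a0 * \<delta> \<le> dist z y" for z y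
      by (rule kernel_support(6)[OF good_pos[OF assms(1)] order_refl that])
    fix y assume y: "dist z y < a0 * \<delta>"
    show "QN \<delta> k f y = 0"
    proof (rule Suc.IH)
      fix y' assume "dist y y' \<le> k * (a0 * \<delta>)"
      then have "dist z y' \<le> Suc k * (a0 * \<delta>)" using y dist_triangle[of z y' y] by (simp add: algebra_simps)
      then show "f y' = 0" by (rule Suc.prems)
    qed
  qed
qed simp

lemma GN_support:
  assumes "good \<delta>" "\<And>y. dist z y \<le> N * (a0 * \<delta>) \<Longrightarrow> f y = 0"
  shows "GN \<delta> N f z = 0"
  unfolding GN_def
proof (intro sum.neutral ballI QN_support[OF assms(1)])
  fix k y assume k: "k \<in> {..<N}" and y: "dist z y \<le> k * (a0 * \<delta>)"
  have "real k * (a0 * \<delta>) \<le> real N * (a0 * \<delta>)" using k a0_pos good_pos[OF assms(1)] by (intro mult_right_mono) auto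
  then show "f y = 0" using y assms(2) by simp
qed

text \<open>Each factor \<open>QQ\<close> widens the range by a0 \<delta>, and so does the outer
  kernel; \<open>Suc N\<close> such steps cover them all.\<close>

lemma kernel_GN_support:
  assumes good: "good \<delta>" and \<kappa>: "\<And>z y. a0 * \<delta> \<le> dist z y \<Longrightarrow> \<kappa> z y = 0"
    and f: "\<And>y. dist z y \<le> real (Suc N) * (a0 * \<delta>) \<Longrightarrow> f y = 0"
  shows "opr \<kappa> (GN \<delta> N f) z = 0"
proof (rule opr_support[OF \<kappa>])
  fix y assume y: "dist z y < a0 * \<delta>"
  show "GN \<delta> N f y = 0"
  proof (rule GN_support[OF good])
    fix y' assume "dist y y' \<le> N * (a0 * \<delta>)"
    then have "dist z y' \<le> real (Suc N) * (a0 * \<delta>)" using y dist_triangle[of z y' y] by (simp add: algebra_simps)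
    then show "f y' = 0" by (rule f)
  qed
qed

lemma SS_support:
  assumes "good \<delta>" "\<And>y. dist z y \<le> real (Suc N) * (a0 * \<delta>) \<Longrightarrow> f y = 0"
  shows "SS \<delta> N f z = 0"
  unfolding SS_def using kernel_GN_support[OF assms(1), of "kk \<delta> 0"] kernel_support(1)[OF good_pos[OF assms(1)] order_refl] assms(2) by simp

lemma QN_continuous:
  assumes good: "good \<delta>" and f: "BI f" "continuous_on UNIV f"
  shows "continuous_on UNIV (QN \<delta> k f)"
proof (induction k)
  case (Suc k)
  obtain B where "\<And>x. \<bar>QN \<delta> k f x\<bar> \<le> B" using QN_BI[OF good f(1), of k] by (auto simp: BI_def)
  then show ?case unfolding QN_Suc by (rule opr_QQ_continuous[OF good Suc.IH])
qed (use f in simp)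

lemma GN_continuous: "good \<delta> \<Longrightarrow> BI f \<Longrightarrow> continuous_on UNIV f \<Longrightarrow> continuous_on UNIV (GN \<delta> N f)"
  unfolding GN_def by (intro continuous_on_sum QN_continuous)

text \<open>\<open>SS\<close> with its outer kernel regularised by \<open>En n\<close>, the inner
  series being left as it is: of class C^2, and compactly supported when f is, hence a legitimate
  test function.\<close>

definition "\<psi>n \<delta> N f n = (\<lambda>z. opr (kk \<delta> (En n)) (GN \<delta> N f) z * (1 / \<delta>\<^sup>2))"

lemma \<psi>n_facts:
  assumes good: "good \<delta>" and f: "BI f"
  shows "Ck 2 (\<psi>n \<delta> N f n) UNIV"
    "\<psi>n \<delta> N f n z - Lg A (\<psi>n \<delta> N f n) z * \<delta>\<^sup>2 = opr (hh \<delta> (En n)) (GN \<delta> N f) z - opr (QQ \<delta> (En n)) (GN \<delta> N f) z"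
    "(\<lambda>n. \<psi>n \<delta> N f n z) \<longlonglongrightarrow> SS \<delta> N f z"
    "\<exists>C. \<forall>n z. \<bar>\<psi>n \<delta> N f n z\<bar> \<le> C"
    "\<exists>C. \<forall>n z. \<bar>opr (QQ \<delta> (En n)) (GN \<delta> N f) z\<bar> \<le> C"
    "(\<lambda>n. opr (QQ \<delta> (En n)) (GN \<delta> N f) z) \<longlonglongrightarrow> opr (QQ \<delta> 0) (GN \<delta> N f) z"
    "(\<And>x. 0 \<le> f x) \<Longrightarrow> 0 \<le> \<psi>n \<delta> N f n z"
    "\<psi>n \<delta> N f n \<in> borel_measurable borel"
proof -
  note \<delta> = good_pos[OF good]
  note e = En(1)
  note G = GN_BI[OF good f, of N]
  obtain B where B: "\<And>x. \<bar>GN \<delta> N f x\<bar> \<le> B" using G by (auto simp: BI_def)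
  note Gm = BI_measurable[OF G]
  show "Ck 2 (\<psi>n \<delta> N f n) UNIV" unfolding \<psi>n_def by (intro Ck_mult opr_kk_C2[OF \<delta> e G]) auto
  have "Lg A (\<psi>n \<delta> N f n) z = Lg A (opr (kk \<delta> (En n)) (GN \<delta> N f)) z / \<delta>\<^sup>2"
  proof -
    note k = opr_kk_C2[OF \<delta> e[of n] G]
    let ?h = "opr (kk \<delta> (En n)) (GN \<delta> N f)"
    have d1: "(?h has_derivative (\<lambda>v. Dd ?h v x)) (at x)" "(Dd ?h v has_derivative (\<lambda>w. Dd (Dd ?h v) w x)) (at x)" for x v
      using C2_open_D(1,2)[OF k(1) open_UNIV] by auto
    have e: "Dd (\<psi>n \<delta> N f n) v = (\<lambda>x. Dd ?h v x * (1 / \<delta>\<^sup>2))" for v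
      unfolding \<psi>n_def by (rule ext) (rule Dd_unique[OF has_derivative_mult_left[OF d1(1)]])
    have "Dd (Dd (\<psi>n \<delta> N f n) v) w z = Dd (Dd ?h v) w z * (1 / \<delta>\<^sup>2)" for v w
      unfolding e by (rule Dd_unique[OF has_derivative_mult_left[OF d1(2)]])
    then show ?thesis by (simp add: Lg_def sum_divide_distrib)
  qed
  then show "\<psi>n \<delta> N f n z - Lg A (\<psi>n \<delta> N f n) z * \<delta>\<^sup>2 = opr (hh \<delta> (En n)) (GN \<delta> N f) z - opr (QQ \<delta> (En n)) (GN \<delta> N f) z"
    using Lg_opr_kk[OF good e[of n] G, of z] \<delta> by (simp add: \<psi>n_def)
  have "(\<lambda>n. opr (kk \<delta> (En n)) (GN \<delta> N f) z) \<longlonglongrightarrow> opr (kk \<delta> 0) (GN \<delta> N f) z"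
    by (rule opr_tendsto[OF kernel_kk[OF \<delta> less_imp_le[OF e]] kernel_kk[OF \<delta> order_refl] kernel_limits(1)[OF \<delta>] Gm B])
  from tendsto_mult[OF this tendsto_const[of "1 / \<delta>\<^sup>2"]] show "(\<lambda>n. \<psi>n \<delta> N f n z) \<longlonglongrightarrow> SS \<delta> N f z"
    by (simp add: \<psi>n_def SS_def)
  show "(\<lambda>n. opr (QQ \<delta> (En n)) (GN \<delta> N f) z) \<longlonglongrightarrow> opr (QQ \<delta> 0) (GN \<delta> N f) z"
    by (rule opr_tendsto[OF kernel_QQ[OF good less_imp_le[OF e]] kernel_QQ[OF good order_refl] kernel_limits(2)[OF \<delta>] Gm B])
  show "\<exists>C. \<forall>n z. \<bar>opr (QQ \<delta> (En n)) (GN \<delta> N f) z\<bar> \<le> C"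
    using kernel.row(2)[OF kernel_QQ[OF good less_imp_le[OF e]] Gm B] by blast
  have "\<bar>opr (kk \<delta> (En n)) (GN \<delta> N f) z * (1 / \<delta>\<^sup>2)\<bar> \<le> (\<delta>\<^sup>2 / 2 * (\<integral>x. MM \<delta> x \<partial>lborel) * B) * (1 / \<delta>\<^sup>2)" for n z
    using kernel.row(2)[OF kernel_kk[OF \<delta> less_imp_le[OF e]] Gm B, of n z] unfolding abs_mult
    by (intro mult_mono) auto
  then show "\<exists>C. \<forall>n z. \<bar>\<psi>n \<delta> N f n z\<bar> \<le> C" unfolding \<psi>n_def by blast
  show "0 \<le> \<psi>n \<delta> N f n z" if "\<And>x. 0 \<le> f x"
    unfolding \<psi>n_def using kernel.opr_mono_nonneg[OF kernel_kk[OF \<delta> less_imp_le[OF e]] kk_nonneg[OF \<delta>] GN_nonneg[OF good that]] by simp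
  show "\<psi>n \<delta> N f n \<in> borel_measurable borel"
    using kernel.opr_measurable[OF kernel_kk[OF \<delta> less_imp_le[OF e]] Gm] by (simp add: \<psi>n_def[abs_def])
qed

lemma \<psi>n_support:
  assumes good: "good \<delta>" and f: "\<And>y. dist z y \<le> real (Suc N) * (a0 * \<delta>) \<Longrightarrow> f y = 0"
  shows "\<psi>n \<delta> N f n z = 0" "opr (QQ \<delta> (En n)) (GN \<delta> N f) z = 0" "opr (hh \<delta> (En n)) (GN \<delta> N f) z = 0"
    "opr (QQ \<delta> 0) (GN \<delta> N f) z = 0" "GN \<delta> N f z = 0"
proof -
  note s = kernel_support[OF good_pos[OF good] less_imp_le[OF En(1)]]
  show "\<psi>n \<delta> N f n z = 0" "opr (QQ \<delta> (En n)) (GN \<delta> N f) z = 0" "opr (hh \<delta> (En n)) (GN \<delta> N f) z = 0"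
    "opr (QQ \<delta> 0) (GN \<delta> N f) z = 0"
    unfolding \<psi>n_def using kernel_GN_support[OF good _ f] s(1,3,6) kernel_support(6)[OF good_pos[OF good] order_refl] by simp_all
  show "GN \<delta> N f z = 0"
  proof (rule GN_support[OF good f])
    fix y assume "dist z y \<le> real N * (a0 * \<delta>)"
    moreover have "real N * (a0 * \<delta>) \<le> real (Suc N) * (a0 * \<delta>)"
      using a0_pos good_pos[OF good] by (intro mult_right_mono) auto
    ultimately show "dist z y \<le> real (Suc N) * (a0 * \<delta>)" by linarith
  qed
qed

text \<open>The sign \<open>u \<le> 0\<close> is what allows the one-sided limits \<open>opr_hh_row_lim\<close> to be used.\<close>

lemma subsolution_le_SS:
  assumes good: "good \<delta>" and K: "compact K" "K \<subseteq> \<Omega>'" and uK: "set_integrable lebesgue K u"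
    and sub: "\<And>w. C2c \<Omega>' w \<Longrightarrow> (\<And>z. 0 \<le> w z) \<Longrightarrow> 0 \<le> (\<integral>z. u z * Lg A w z \<partial>lebesgue)"
    and neg: "\<And>z. z \<in> K \<Longrightarrow> u z \<le> 0"
    and \<phi>: "continuous_on UNIV \<phi>" "\<And>z. 0 \<le> \<phi> z" "BI \<phi>"
    and supp: "\<And>z y. z \<notin> K \<Longrightarrow> dist z y \<le> real (Suc N) * (a0 * \<delta>) \<Longrightarrow> \<phi> y = 0"
  shows "(\<integral>z. u z * \<phi> z \<partial>lebesgue) \<le> (\<integral>z. u z * SS \<delta> N \<phi> z \<partial>lebesgue)"
proof -
  note \<delta> = good_pos[OF good]
  note F = \<psi>n_facts[OF good \<phi>(3), of N]
  have Z: "\<psi>n \<delta> N \<phi> n z = 0" "opr (QQ \<delta> (En n)) (GN \<delta> N \<phi>) z = 0" "opr (hh \<delta> (En n)) (GN \<delta> N \<phi>) z = 0"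
    "opr (QQ \<delta> 0) (GN \<delta> N \<phi>) z = 0" "GN \<delta> N \<phi> z = 0" if "z \<notin> K" for z n
    by (rule \<psi>n_support[OF good], rule supp[OF that], assumption)+
  define g where "g = GN \<delta> N \<phi>"
  have gBI: "BI g" unfolding g_def by (rule GN_BI[OF good \<phi>(3)])
  have g0: "0 \<le> g x" for x unfolding g_def by (rule GN_nonneg[OF good \<phi>(2)])
  have gc: "continuous_on UNIV g" unfolding g_def by (rule GN_continuous[OF good \<phi>(3,1)])
  \<comment> \<open>Replacing the \<open>hh\<close> term by its maximum with g can only increase the
    pairing with u \<le> 0, and it makes the integrand converge pointwise.\<close>
  define T where "T n z = max (opr (hh \<delta> (En n)) g z) (g z)" for n z
  define R where "R n z = \<psi>n \<delta> N \<phi> n z + opr (QQ \<delta> (En n)) g z - T n z" for n z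
  define R' where "R' z = SS \<delta> N \<phi> z + opr (QQ \<delta> 0) g z - g z" for z
  have R'eq: "R' z = SS \<delta> N \<phi> z - \<phi> z + QN \<delta> N \<phi> z" for z
    using opr_GN[OF good \<phi>(3), of N z] by (simp add: R'_def g_def)
  have lim: "(\<lambda>n. R n z) \<longlonglongrightarrow> R' z" for z
    unfolding R_def R'_def T_def
    by (intro tendsto_intros opr_hh_row_lim[OF \<delta> gBI g0 gc] F(3)) (use F(6) in \<open>simp add: g_def\<close>)
  have Rz: "R n z = 0" "R' z = 0" "SS \<delta> N \<phi> z = 0" "\<phi> z = 0" if "z \<notin> K" for n z
  proof -
    show s: "SS \<delta> N \<phi> z = 0" by (rule SS_support[OF good supp[OF that]])
    show "R n z = 0" "R' z = 0" using Z[OF that] s by (simp_all add: R_def R'_def T_def g_def)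
    show "\<phi> z = 0" using supp[OF that, of z] a0_pos \<delta> by simp
  qed
  obtain C1 where C1: "\<And>n z. \<bar>\<psi>n \<delta> N \<phi> n z\<bar> \<le> C1" using F(4) by blast
  obtain C2 where C2: "\<And>n z. \<bar>opr (QQ \<delta> (En n)) g z\<bar> \<le> C2" using F(5) by (auto simp: g_def)
  obtain C3 where C3: "\<And>n z. \<bar>opr (hh \<delta> (En n)) g z\<bar> \<le> C3" using opr_hh_bounded[OF \<delta> gBI g0] by blast
  obtain C4 where C4: "\<And>z. \<bar>g z\<bar> \<le> C4" using gBI by (auto simp: BI_def)
  have Rb: "\<bar>R n z\<bar> \<le> C1 + C2 + C3 + C4" for n z
    using C1[of n z] C2[of n z] C3[of n z] C4[of z] unfolding R_def T_def by (auto simp: max_def abs_le_iff)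
  note gm = BI_measurable[OF gBI]
  have Rm: "R n \<in> borel_measurable borel" for n
    unfolding R_def[abs_def] T_def
    using F(8) kernel.opr_measurable[OF kernel_QQ[OF good less_imp_le[OF En(1)]] gm] kernel.opr_measurable[OF kernel_hh[OF \<delta> En(1)] gm] gm
    by simp
  have SBI: "BI (SS \<delta> N \<phi>)" by (rule SS_BI[OF good \<phi>(3)])
  have R'm: "R' \<in> borel_measurable borel"
    unfolding R'_def[abs_def] using BI_measurable[OF SBI] kernel.opr_measurable[OF kernel_QQ[OF good order_refl] gm] gm by simp
  have uK': "integrable lebesgue (\<lambda>z. indicator K z *\<^sub>R u z)" using uK by (simp add: set_integrable_def)
  have ui: "integrable lebesgue (\<lambda>z. u z * h z)" and um: "(\<lambda>z. u z * h z) \<in> borel_measurable lebesgue"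
    if h: "h \<in> borel_measurable borel" "\<And>z. \<bar>h z\<bar> \<le> C" "\<And>z. z \<notin> K \<Longrightarrow> h z = 0" for h C
  proof -
    have eq: "(\<lambda>z. u z * h z) = (\<lambda>z. (indicator K z *\<^sub>R u z) * h z)" using h(3) by (auto simp: indicator_def fun_eq_iff)
    have hm: "h \<in> borel_measurable lebesgue" using h(1) by (simp add: measurable_completion)
    show "(\<lambda>z. u z * h z) \<in> borel_measurable lebesgue"
      unfolding eq using uK' hm by (intro borel_measurable_times) (auto dest: borel_measurable_integrable)
    then show "integrable lebesgue (\<lambda>z. u z * h z)" unfolding eq
      by (intro Bochner_Integration.integrable_bound[OF integrable_mult_left[OF integrable_norm[OF uK'], of C]])
        (use h(2) in \<open>auto simp: abs_mult intro!: mult_left_mono order_trans[OF h(2) abs_ge_self]\<close>)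
  qed
  have pos: "0 \<le> (\<integral>z. u z * R n z \<partial>lebesgue)" for n
  proof -
    let ?\<psi> = "\<psi>n \<delta> N \<phi> n"
    have "C2c \<Omega>' ?\<psi>" unfolding C2c_def by (intro conjI exI[of _ K] allI impI F(1) K Z(1))
    then have 1: "0 \<le> (\<integral>z. u z * Lg A ?\<psi> z \<partial>lebesgue)" by (rule sub) (rule F(7)[OF \<phi>(2)])
    have eq: "Lg A ?\<psi> z * \<delta>\<^sup>2 = ?\<psi> z + opr (QQ \<delta> (En n)) g z - opr (hh \<delta> (En n)) g z" for z
      using F(2)[of n z] by (simp add: g_def)
    have "(\<integral>z. u z * Lg A ?\<psi> z \<partial>lebesgue) * \<delta>\<^sup>2 = (\<integral>z. u z * (?\<psi> z + opr (QQ \<delta> (En n)) g z - opr (hh \<delta> (En n)) g z) \<partial>lebesgue)"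
      by (simp flip: eq integral_mult_left_zero add: mult.assoc)
    also have "\<dots> \<le> (\<integral>z. u z * R n z \<partial>lebesgue)"
    proof (rule integral_mono)
      show "integrable lebesgue (\<lambda>z. u z * R n z)" by (rule ui[OF Rm Rb Rz(1)])
      show "integrable lebesgue (\<lambda>z. u z * (?\<psi> z + opr (QQ \<delta> (En n)) g z - opr (hh \<delta> (En n)) g z))"
      proof (rule ui)
        show "(\<lambda>z. ?\<psi> z + opr (QQ \<delta> (En n)) g z - opr (hh \<delta> (En n)) g z) \<in> borel_measurable borel"
          using F(8) kernel.opr_measurable[OF kernel_QQ[OF good less_imp_le[OF En(1)]] gm] kernel.opr_measurable[OF kernel_hh[OF \<delta> En(1)] gm]
          by simp
        show "\<bar>?\<psi> z + opr (QQ \<delta> (En n)) g z - opr (hh \<delta> (En n)) g z\<bar> \<le> C1 + C2 + C3" for z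
          using C1[of n z] C2[of n z] C3[of n z] by linarith
        show "?\<psi> z + opr (QQ \<delta> (En n)) g z - opr (hh \<delta> (En n)) g z = 0" if "z \<notin> K" for z
          using Z[OF that] by (simp add: g_def)
      qed
      show "u z * (?\<psi> z + opr (QQ \<delta> (En n)) g z - opr (hh \<delta> (En n)) g z) \<le> u z * R n z" for z
      proof (cases "z \<in> K")
        case True
        then show ?thesis using neg[OF True] by (intro mult_left_mono_neg) (auto simp: R_def T_def)
      next
        case False
        then show ?thesis using Z[OF False] Rz(1)[OF False] by (simp add: g_def)
      qed
    qed
    finally show ?thesis using 1 by (meson mult_nonneg_nonneg order_trans zero_le_power2)
  qed
  have "(\<lambda>n. \<integral>z. u z * R n z \<partial>lebesgue) \<longlonglongrightarrow> (\<integral>z. u z * R' z \<partial>lebesgue)"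
  proof (rule integral_dominated_convergence[where w="\<lambda>z. \<bar>indicator K z *\<^sub>R u z\<bar> * (C1 + C2 + C3 + C4)"])
    show "integrable lebesgue (\<lambda>z. \<bar>indicator K z *\<^sub>R u z\<bar> * (C1 + C2 + C3 + C4))"
      by (intro integrable_mult_left integrable_abs uK')
    show "AE z in lebesgue. (\<lambda>n. u z * R n z) \<longlonglongrightarrow> u z * R' z" by (intro AE_I2 tendsto_intros lim)
    show "AE z in lebesgue. norm (u z * R n z) \<le> \<bar>indicator K z *\<^sub>R u z\<bar> * (C1 + C2 + C3 + C4)" for n
    proof (rule AE_I2)
      fix z show "norm (u z * R n z) \<le> \<bar>indicator K z *\<^sub>R u z\<bar> * (C1 + C2 + C3 + C4)"
        using Rb[of n z] Rz(1)[of z n] by (cases "z \<in> K") (auto simp: abs_mult intro!: mult_left_mono)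
    qed
    have "\<bar>R' z\<bar> \<le> C1 + C2 + C3 + C4" for z
      by (rule LIMSEQ_le_const2[OF tendsto_rabs[OF lim]]) (use Rb in auto)
    then show "(\<lambda>z. u z * R' z) \<in> borel_measurable lebesgue" by (rule um[OF R'm _ Rz(2)])
  qed (rule um[OF Rm Rb Rz(1)])
  then have "0 \<le> (\<integral>z. u z * R' z \<partial>lebesgue)" by (rule LIMSEQ_le_const) (use pos in auto)
  \<comment> \<open>The remainder \<open>QN\<close> of a nonnegative test function is nonnegative
    and may be dropped, again because u \<le> 0.\<close>
  also have "\<dots> \<le> (\<integral>z. u z * SS \<delta> N \<phi> z - u z * \<phi> z \<partial>lebesgue)"
  proof (rule integral_mono)
    obtain CS where CS: "\<And>z. \<bar>SS \<delta> N \<phi> z\<bar> \<le> CS" using SBI by (auto simp: BI_def)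
    obtain CP where CP: "\<And>z. \<bar>\<phi> z\<bar> \<le> CP" using \<phi>(3) by (auto simp: BI_def)
    have Rb': "\<bar>R' z\<bar> \<le> C1 + C2 + C3 + C4" for z
      by (rule LIMSEQ_le_const2[OF tendsto_rabs[OF lim]]) (use Rb in auto)
    show "integrable lebesgue (\<lambda>z. u z * R' z)" by (rule ui[OF R'm Rb' Rz(2)])
    show "integrable lebesgue (\<lambda>z. u z * SS \<delta> N \<phi> z - u z * \<phi> z)"
      by (intro Bochner_Integration.integrable_diff ui[OF BI_measurable[OF SBI] CS Rz(3)] ui[OF BI_measurable[OF \<phi>(3)] CP Rz(4)])
    show "u z * R' z \<le> u z * SS \<delta> N \<phi> z - u z * \<phi> z" for z
    proof (cases "z \<in> K")
      case True
      have "u z * QN \<delta> N \<phi> z \<le> 0" using neg[OF True] QN_nonneg[OF good \<phi>(2)] by (simp add: mult_nonpos_nonneg)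
      then show ?thesis by (simp add: R'eq algebra_simps)
    next
      case False then show ?thesis by (simp add: Rz)
    qed
  qed
  also have "\<dots> = (\<integral>z. u z * SS \<delta> N \<phi> z \<partial>lebesgue) - (\<integral>z. u z * \<phi> z \<partial>lebesgue)"
  proof (rule Bochner_Integration.integral_diff)
    obtain CS where CS: "\<And>z. \<bar>SS \<delta> N \<phi> z\<bar> \<le> CS" using SBI by (auto simp: BI_def)
    obtain CP where CP: "\<And>z. \<bar>\<phi> z\<bar> \<le> CP" using \<phi>(3) by (auto simp: BI_def)
    show "integrable lebesgue (\<lambda>z. u z * SS \<delta> N \<phi> z)" by (rule ui[OF BI_measurable[OF SBI] CS Rz(3)])
    show "integrable lebesgue (\<lambda>z. u z * \<phi> z)" by (rule ui[OF BI_measurable[OF \<phi>(3)] CP Rz(4)])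
  qed
  finally show ?thesis by simp
qed

end

section \<open>Resolvent equation, symmetry and mass of the smoothing operator\<close>

locale elliptic_region = elliptic A \<mu> \<Lambda> Lip + divfree A \<Omega>
  for A :: "'a::euclidean_space \<Rightarrow> 'a \<Rightarrow> 'a" and \<mu> \<Lambda> Lip \<Omega>
begin

text \<open>For \<epsilon> > 0 the smoothed function is C^2 and \<open>green\<close> carries L over
  to \<phi>; then \<epsilon> tends to 0, where \<open>hh\<close> becomes the identity by
  \<open>hh_weak\<close>.\<close>

lemma opr_kk_weak:
  assumes good: "good \<delta>" and g: "BI g" and \<phi>: "C2c \<Omega> \<phi>"
  shows "(\<integral>z. opr (kk \<delta> 0) g z * (\<phi> z / \<delta>\<^sup>2 - Lg A \<phi> z) \<partial>lborel) = (\<integral>z. \<phi> z * g z \<partial>lborel) - (\<integral>z. \<phi> z * opr (QQ \<delta> 0) g z \<partial>lborel)"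
proof -
  note \<delta> = good_pos[OF good]
  note e = En(1)
  obtain K where K: "compact K" "K \<subseteq> \<Omega>" "\<And>x. x \<notin> K \<Longrightarrow> \<phi> x = 0" using \<phi> by (auto simp: C2c_def)
  note wi = Ck_compact_support[OF C2cD(1)[OF \<phi>] K(1,3)]
  obtain P where P: "\<And>x. \<bar>\<phi> x\<bar> \<le> P" using wi(3) by auto
  have Lz: "Lg A \<phi> x = 0" if "x \<notin> K" for x by (rule Lg_zero_outside[OF compact_imp_closed[OF K(1)] K(3) that])
  have cL: "continuous_on K (Lg A \<phi>)"
    using cont_Lg[OF Ck_subset[OF open_UNIV open_dom subset_UNIV C2cD(1)[OF \<phi>]] open_dom order_refl] K(2) continuous_on_subset by blast
  note Li = integrable_continuous_compact_support[OF K(1) cL Lz]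
  obtain B where B: "\<And>x. \<bar>g x\<bar> \<le> B" using g by (auto simp: BI_def)
  have gi: "integrable lborel g" using g by (simp add: BI_def)
  note gm = BI_measurable[OF g]
  define v where "v n = opr (kk \<delta> (En n)) g" for n
  define D where "D z = \<phi> z / \<delta>\<^sup>2 - Lg A \<phi> z" for z
  have Di: "integrable lborel D" unfolding D_def[abs_def] using wi(1) Li(1) by simp
  define V where "V = \<delta>\<^sup>2 / 2 * (\<integral>x. MM \<delta> x \<partial>lborel) * B"
  have vb: "\<bar>v n z\<bar> \<le> V" for n z unfolding v_def V_def by (rule kernel.row(2)[OF kernel_kk[OF \<delta> less_imp_le[OF e]] gm B])
  have vl: "(\<lambda>n. v n z) \<longlonglongrightarrow> opr (kk \<delta> 0) g z" for z unfolding v_def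
    by (rule opr_tendsto[OF kernel_kk[OF \<delta> less_imp_le[OF e]] kernel_kk[OF \<delta> order_refl] kernel_limits(1)[OF \<delta>] gm B])
  have ql: "(\<lambda>n. opr (QQ \<delta> (En n)) g z) \<longlonglongrightarrow> opr (QQ \<delta> 0) g z" for z
    by (rule opr_tendsto[OF kernel_QQ[OF good less_imp_le[OF e]] kernel_QQ[OF good order_refl] kernel_limits(2)[OF \<delta>] gm B])
  have qb: "\<bar>opr (QQ \<delta> (En n)) g z\<bar> \<le> 2 * (\<integral>x. MM \<delta> x \<partial>lborel) * B" for n z
    by (rule kernel.row(2)[OF kernel_QQ[OF good less_imp_le[OF e]] gm B])
  have vm: "v n \<in> borel_measurable borel" for n unfolding v_def by (rule kernel.opr_measurable[OF kernel_kk[OF \<delta> less_imp_le[OF e]] gm])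
  have vm0: "opr (kk \<delta> 0) g \<in> borel_measurable borel" by (rule kernel.opr_measurable[OF kernel_kk[OF \<delta> order_refl] gm])
  have 1: "(\<lambda>n. \<integral>z. v n z * D z \<partial>lborel) \<longlonglongrightarrow> (\<integral>z. opr (kk \<delta> 0) g z * D z \<partial>lborel)"
  proof (rule integral_dominated_convergence[where w="\<lambda>z. V * \<bar>D z\<bar>"])
    show "AE z in lborel. norm (v n z * D z) \<le> V * \<bar>D z\<bar>" for n
      using vb by (intro AE_I2) (auto simp: abs_mult intro!: mult_right_mono)
  qed (use Di vl vm vm0 in \<open>auto intro!: AE_I2 tendsto_intros dest: borel_measurable_integrable\<close>)
  have F: "integrable lborel (\<lambda>z. \<phi> z * opr (hh \<delta> (En n)) g z)" "integrable lborel (\<lambda>z. \<phi> z * opr (QQ \<delta> (En n)) g z)" for n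
    using kernel.fubini(2)[OF kernel_hh[OF \<delta> e] gi wi(2) P] kernel.fubini(2)[OF kernel_QQ[OF good less_imp_le[OF e]] gi wi(2) P] by auto
  have eq: "(\<integral>z. v n z * D z \<partial>lborel) = (\<integral>z. \<phi> z * opr (hh \<delta> (En n)) g z \<partial>lborel) - (\<integral>z. \<phi> z * opr (QQ \<delta> (En n)) g z \<partial>lborel)" for n
  proof -
    have C: "Ck 2 (v n) \<Omega>" unfolding v_def by (rule Ck_subset[OF open_UNIV open_dom subset_UNIV opr_kk_C2(1)[OF \<delta> e g]])
    note G = green[OF C \<phi>]
    have vi: "integrable lborel (\<lambda>z. v n z * \<phi> z)"
      by (rule Bochner_Integration.integrable_bound[of _ "\<lambda>z. V * \<phi> z"])
        (use wi vm vb in \<open>auto simp: abs_mult intro!: AE_I2 mult_right_mono order_trans[OF vb abs_ge_self]\<close>)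
    have Lv: "\<phi> z * Lg A (v n) z = v n z * \<phi> z / \<delta>\<^sup>2 - (\<phi> z * opr (hh \<delta> (En n)) g z - \<phi> z * opr (QQ \<delta> (En n)) g z)" for z
    proof -
      have l: "Lg A (v n) z = v n z / \<delta>\<^sup>2 - (opr (hh \<delta> (En n)) g z - opr (QQ \<delta> (En n)) g z)"
        using Lg_opr_kk[OF good e[of n] g, of z] unfolding v_def by linarith
      show ?thesis unfolding l by (simp add: algebra_simps)
    qed
    have "(\<integral>z. v n z * D z \<partial>lborel) = (\<integral>z. v n z * \<phi> z / \<delta>\<^sup>2 - v n z * Lg A \<phi> z \<partial>lborel)"
      by (simp add: D_def right_diff_distrib)
    also have "\<dots> = (\<integral>z. v n z * \<phi> z / \<delta>\<^sup>2 \<partial>lborel) - (\<integral>z. \<phi> z * Lg A (v n) z \<partial>lborel)" using vi G by simp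
    also have "(\<integral>z. \<phi> z * Lg A (v n) z \<partial>lborel) = (\<integral>z. v n z * \<phi> z / \<delta>\<^sup>2 \<partial>lborel) - ((\<integral>z. \<phi> z * opr (hh \<delta> (En n)) g z \<partial>lborel) - (\<integral>z. \<phi> z * opr (QQ \<delta> (En n)) g z \<partial>lborel))"
      unfolding Lv using vi F by simp
    finally show ?thesis by simp
  qed
  have 2: "(\<lambda>n. \<integral>z. \<phi> z * opr (hh \<delta> (En n)) g z \<partial>lborel) \<longlonglongrightarrow> (\<integral>z. \<phi> z * g z \<partial>lborel)"
    by (rule hh_weak[OF \<delta> C2cD(6)[OF \<phi>] P g])
  have 3: "(\<lambda>n. \<integral>z. \<phi> z * opr (QQ \<delta> (En n)) g z \<partial>lborel) \<longlonglongrightarrow> (\<integral>z. \<phi> z * opr (QQ \<delta> 0) g z \<partial>lborel)"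
  proof (rule integral_dominated_convergence[where w="\<lambda>z. \<bar>\<phi> z\<bar> * (2 * (\<integral>x. MM \<delta> x \<partial>lborel) * B)"])
    show "AE z in lborel. norm (\<phi> z * opr (QQ \<delta> (En n)) g z) \<le> \<bar>\<phi> z\<bar> * (2 * (\<integral>x. MM \<delta> x \<partial>lborel) * B)" for n
      using qb by (intro AE_I2) (auto simp: abs_mult intro!: mult_left_mono)
  qed (use wi F ql kernel.opr_measurable[OF kernel_QQ[OF good order_refl] gm] in \<open>auto intro!: AE_I2 tendsto_intros dest: borel_measurable_integrable\<close>)
  show ?thesis using LIMSEQ_unique[OF 1[unfolded eq] tendsto_diff[OF 2 3]] by (simp add: D_def)
qed

lemma BI_times:
  assumes h: "BI h" and \<phi>: "\<phi> \<in> borel_measurable borel" "\<And>x. \<bar>\<phi> x\<bar> \<le> P"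
  shows "integrable lborel (\<lambda>z. \<phi> z * h z)"
proof (rule Bochner_Integration.integrable_bound[of _ "\<lambda>z. P * h z"])
  show "AE z in lborel. norm (\<phi> z * h z) \<le> norm (P * h z)"
    using \<phi>(2) by (intro AE_I2) (auto simp: abs_mult intro!: mult_right_mono order_trans[OF \<phi>(2) abs_ge_self])
qed (use h \<phi>(1) BI_measurable[OF h] in \<open>auto simp: BI_def\<close>)

text \<open>The resolvent equation (1 - \<delta>^2 L) \<open>SS\<close> f = f - \<open>QN\<close> f
  in weak form; the telescoped remainder is its only defect.\<close>

lemma SS_weak:
  assumes good: "good \<delta>" and f: "BI f" and \<phi>: "C2c \<Omega> \<phi>"
  shows "(\<integral>z. SS \<delta> N f z * (\<phi> z - \<delta>\<^sup>2 * Lg A \<phi> z) \<partial>lborel) = (\<integral>z. \<phi> z * (f z - QN \<delta> N f z) \<partial>lborel)"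
proof -
  note \<delta> = good_pos[OF good]
  let ?g = "GN \<delta> N f"
  have g: "BI ?g" by (rule GN_BI[OF good f])
  obtain K where K: "compact K" "K \<subseteq> \<Omega>" "\<And>x. x \<notin> K \<Longrightarrow> \<phi> x = 0" using \<phi> by (auto simp: C2c_def)
  note wi = Ck_compact_support[OF C2cD(1)[OF \<phi>] K(1,3)]
  obtain P where P: "\<And>x. \<bar>\<phi> x\<bar> \<le> P" using wi(3) by auto
  have "BI (opr (QQ \<delta> 0) ?g)" by (rule kernel.opr_BI[OF kernel_QQ[OF good order_refl] g])
  then have i: "integrable lborel (\<lambda>z. \<phi> z * ?g z)" "integrable lborel (\<lambda>z. \<phi> z * opr (QQ \<delta> 0) ?g z)"
    using BI_times[OF _ wi(2) P] g by auto
  have "(\<integral>z. SS \<delta> N f z * (\<phi> z - \<delta>\<^sup>2 * Lg A \<phi> z) \<partial>lborel) = (\<integral>z. opr (kk \<delta> 0) ?g z * (\<phi> z / \<delta>\<^sup>2 - Lg A \<phi> z) \<partial>lborel)"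
    using \<delta> by (intro Bochner_Integration.integral_cong refl) (simp add: SS_def field_simps)
  also have "\<dots> = (\<integral>z. \<phi> z * ?g z - \<phi> z * opr (QQ \<delta> 0) ?g z \<partial>lborel)"
    unfolding opr_kk_weak[OF good g \<phi>] using i by simp
  also have "\<dots> = (\<integral>z. \<phi> z * (f z - QN \<delta> N f z) \<partial>lborel)"
    by (intro Bochner_Integration.integral_cong refl) (simp add: opr_GN[OF good f, symmetric] right_diff_distrib)
  finally show ?thesis .
qed

text \<open>The support hypothesis keeps all the functions
  \<open>\<psi>n \<delta> N \<phi> n\<close> in one compact subset of \<Omega>; this makes them
  admissible test functions and supplies the dominating functions.\<close>

lemma SS_pairing:
  assumes good: "good \<delta>" and f: "BI f" and \<phi>: "BI \<phi>" and K: "compact K" "K \<subseteq> \<Omega>"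
    and supp: "\<forall>z y. z \<notin> K \<longrightarrow> dist z y \<le> real (Suc N) * (a0 * \<delta>) \<longrightarrow> \<phi> y = 0"
    and \<xi>: "continuous_on UNIV \<xi>" "\<And>z. \<bar>\<xi> z\<bar> \<le> X"
  shows "(\<lambda>n. \<integral>z. \<xi> z * (\<psi>n \<delta> N \<phi> n z - \<delta>\<^sup>2 * Lg A (\<psi>n \<delta> N \<phi> n) z) \<partial>lborel) \<longlonglongrightarrow> (\<integral>z. \<xi> z * (\<phi> z - QN \<delta> N \<phi> z) \<partial>lborel)"
    "h \<in> borel_measurable borel \<Longrightarrow> (\<And>z. \<bar>h z\<bar> \<le> H) \<Longrightarrow> (\<lambda>n. \<integral>z. \<psi>n \<delta> N \<phi> n z * h z \<partial>lborel) \<longlonglongrightarrow> (\<integral>z. SS \<delta> N \<phi> z * h z \<partial>lborel)"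
    "C2c \<Omega> (\<psi>n \<delta> N \<phi> n)"
proof -
  note \<delta> = good_pos[OF good]
  note e = En(1)
  note F = \<psi>n_facts[OF good \<phi>, of N]
  have Z: "\<psi>n \<delta> N \<phi> n z = 0" "opr (QQ \<delta> (En n)) (GN \<delta> N \<phi>) z = 0" "opr (hh \<delta> (En n)) (GN \<delta> N \<phi>) z = 0"
    "opr (QQ \<delta> 0) (GN \<delta> N \<phi>) z = 0" "GN \<delta> N \<phi> z = 0" if "z \<notin> K" for z n
    by (rule \<psi>n_support[OF good], rule supp[rule_format, OF that], assumption)+
  let ?g = "GN \<delta> N \<phi>"
  have g: "BI ?g" by (rule GN_BI[OF good \<phi>])
  obtain B where B: "\<And>x. \<bar>?g x\<bar> \<le> B" using g by (auto simp: BI_def)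
  have gi: "integrable lborel ?g" using g by (simp add: BI_def)
  have \<xi>m: "\<xi> \<in> borel_measurable borel" by (rule borel_measurable_continuous_onI[OF \<xi>(1)])
  have X: "0 \<le> X" using \<xi>(2)[of 0] by linarith
  have Ki: "integrable lborel (\<lambda>z. indicator K z * c :: real)" for c
    using emeasure_compact_finite[OF K(1)] compact_imp_closed[OF K(1)] by (auto intro!: integrable_mult_left integrable_real_indicator)
  show "C2c \<Omega> (\<psi>n \<delta> N \<phi> n)" for n unfolding C2c_def by (intro conjI exI[of _ K] allI impI F(1) K Z(1))
  have 1: "(\<lambda>n. \<integral>z. \<xi> z * opr (hh \<delta> (En n)) ?g z \<partial>lborel) \<longlonglongrightarrow> (\<integral>z. \<xi> z * ?g z \<partial>lborel)" by (rule hh_weak[OF \<delta> \<xi> g])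
  obtain C where C: "\<And>n z. \<bar>opr (QQ \<delta> (En n)) ?g z\<bar> \<le> C" using F(5) by blast
  have Fi: "integrable lborel (\<lambda>z. \<xi> z * opr (hh \<delta> (En n)) ?g z)" "integrable lborel (\<lambda>z. \<xi> z * opr (QQ \<delta> (En n)) ?g z)" for n
    using kernel.fubini(2)[OF kernel_hh[OF \<delta> e] gi \<xi>m \<xi>(2)] kernel.fubini(2)[OF kernel_QQ[OF good less_imp_le[OF e]] gi \<xi>m \<xi>(2)] by auto
  have Fi0: "integrable lborel (\<lambda>z. \<xi> z * opr (QQ \<delta> 0) ?g z)"
    by (rule kernel.fubini(2)[OF kernel_QQ[OF good order_refl] gi \<xi>m \<xi>(2)])
  have gxi: "integrable lborel (\<lambda>z. \<xi> z * ?g z)"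
    by (rule Bochner_Integration.integrable_bound[of _ "\<lambda>z. X * ?g z"])
      (use gi \<xi>m \<xi>(2) X in \<open>auto simp: abs_mult intro!: AE_I2 mult_right_mono\<close>)
  have 2: "(\<lambda>n. \<integral>z. \<xi> z * opr (QQ \<delta> (En n)) ?g z \<partial>lborel) \<longlonglongrightarrow> (\<integral>z. \<xi> z * opr (QQ \<delta> 0) ?g z \<partial>lborel)"
  proof (rule integral_dominated_convergence[where w="\<lambda>z. indicator K z * (X * C)"])
    show "AE z in lborel. norm (\<xi> z * opr (QQ \<delta> (En n)) ?g z) \<le> indicator K z * (X * C)" for n
    proof (rule AE_I2)
      fix z show "norm (\<xi> z * opr (QQ \<delta> (En n)) ?g z) \<le> indicator K z * (X * C)"
        using \<xi>(2)[of z] C[of n z] Z(2)[of z n] X by (cases "z \<in> K") (auto simp: abs_mult intro!: mult_mono)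
    qed
  qed (use Ki Fi Fi0 F(6) in \<open>auto intro!: AE_I2 tendsto_intros dest: borel_measurable_integrable\<close>)
  have "(\<integral>z. \<xi> z * (\<psi>n \<delta> N \<phi> n z - \<delta>\<^sup>2 * Lg A (\<psi>n \<delta> N \<phi> n) z) \<partial>lborel) = (\<integral>z. \<xi> z * opr (hh \<delta> (En n)) ?g z \<partial>lborel) - (\<integral>z. \<xi> z * opr (QQ \<delta> (En n)) ?g z \<partial>lborel)" for n
    using Fi[of n] F(2)[of n] by (simp add: mult.commute[of "\<delta>\<^sup>2"] right_diff_distrib[of "\<xi> _" "opr _ _ _"])
  moreover have "(\<integral>z. \<xi> z * (\<phi> z - QN \<delta> N \<phi> z) \<partial>lborel) = (\<integral>z. \<xi> z * ?g z \<partial>lborel) - (\<integral>z. \<xi> z * opr (QQ \<delta> 0) ?g z \<partial>lborel)"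
    unfolding opr_GN[OF good \<phi>, symmetric] using gxi Fi0 by (simp add: right_diff_distrib)
  ultimately show "(\<lambda>n. \<integral>z. \<xi> z * (\<psi>n \<delta> N \<phi> n z - \<delta>\<^sup>2 * Lg A (\<psi>n \<delta> N \<phi> n) z) \<partial>lborel) \<longlonglongrightarrow> (\<integral>z. \<xi> z * (\<phi> z - QN \<delta> N \<phi> z) \<partial>lborel)"
    using tendsto_diff[OF 1 2] by simp
  show "(\<lambda>n. \<integral>z. \<psi>n \<delta> N \<phi> n z * h z \<partial>lborel) \<longlonglongrightarrow> (\<integral>z. SS \<delta> N \<phi> z * h z \<partial>lborel)"
    if h: "h \<in> borel_measurable borel" "\<And>z. \<bar>h z\<bar> \<le> H"
  proof -
    obtain C where C: "\<And>n z. \<bar>\<psi>n \<delta> N \<phi> n z\<bar> \<le> C" using F(4) by blast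
    show ?thesis
    proof (rule integral_dominated_convergence[where w="\<lambda>z. indicator K z * (C * H)"])
      show "AE z in lborel. norm (\<psi>n \<delta> N \<phi> n z * h z) \<le> indicator K z * (C * H)" for n
      proof (rule AE_I2)
        fix z
        have "0 \<le> C" using C[of 0 0] by linarith
        then show "norm (\<psi>n \<delta> N \<phi> n z * h z) \<le> indicator K z * (C * H)"
          using h(2)[of z] C[of n z] Z(1)[of z n] by (cases "z \<in> K") (auto simp: abs_mult intro!: mult_mono)
      qed
    qed (use Ki F(3,8) h(1) BI_measurable[OF SS_BI[OF good \<phi>]] in \<open>auto intro!: AE_I2 tendsto_intros\<close>)
  qed
qed

text \<open>Formally \<open>SS\<close> inverts the self-adjoint operator 1 - \<delta>^2 L up to
  \<open>QN\<close>. The proof tests the resolvent equation for f against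
  \<open>\<psi>n \<delta> N \<phi> n\<close> and lets n grow.\<close>

lemma SS_symmetric:
  assumes good: "good \<delta>" and f: "BI f" and \<phi>: "BI \<phi>" and K: "compact K" "K \<subseteq> \<Omega>"
    and supp: "\<And>z y. z \<notin> K \<Longrightarrow> dist z y \<le> real (Suc N) * (a0 * \<delta>) \<Longrightarrow> \<phi> y = 0"
  shows "(\<integral>z. SS \<delta> N f z * (\<phi> z - QN \<delta> N \<phi> z) \<partial>lborel) = (\<integral>z. SS \<delta> N \<phi> z * (f z - QN \<delta> N f z) \<partial>lborel)"
proof -
  obtain X where X: "\<And>z. \<bar>SS \<delta> N f z\<bar> \<le> X" using SS_BI[OF good f] by (auto simp: BI_def)
  have B: "BI (\<lambda>z. f z - QN \<delta> N f z)" using BI_add[OF f BI_cmult[OF QN_BI[OF good f], of "-1" N]] by simp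
  then obtain H where H: "\<And>z. \<bar>f z - QN \<delta> N f z\<bar> \<le> H" by (auto simp: BI_def)
  have supp': "\<forall>z y. z \<notin> K \<longrightarrow> dist z y \<le> real (Suc N) * (a0 * \<delta>) \<longrightarrow> \<phi> y = 0" using supp by blast
  note P = SS_pairing[OF good f \<phi> K supp' SS_continuous[OF good f] X]
  have "(\<lambda>n. \<integral>z. SS \<delta> N f z * (\<psi>n \<delta> N \<phi> n z - \<delta>\<^sup>2 * Lg A (\<psi>n \<delta> N \<phi> n) z) \<partial>lborel) \<longlonglongrightarrow> (\<integral>z. SS \<delta> N f z * (\<phi> z - QN \<delta> N \<phi> z) \<partial>lborel)"
    by (rule P(1))
  then have "(\<lambda>n. \<integral>z. \<psi>n \<delta> N \<phi> n z * (f z - QN \<delta> N f z) \<partial>lborel) \<longlonglongrightarrow> (\<integral>z. SS \<delta> N f z * (\<phi> z - QN \<delta> N \<phi> z) \<partial>lborel)"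
    unfolding SS_weak[OF good f P(3)] .
  from LIMSEQ_unique[OF this P(2)[OF BI_measurable[OF B] H]] show ?thesis .
qed

text \<open>The same limit with the constant 1 in place of \<open>SS\<close> f: L of a compactly
  supported function has integral zero, so mass is preserved up to the remainder.\<close>

lemma SS_mass:
  assumes good: "good \<delta>" and \<phi>: "BI \<phi>" and K: "compact K" "K \<subseteq> \<Omega>"
    and supp: "\<And>z y. z \<notin> K \<Longrightarrow> dist z y \<le> real (Suc N) * (a0 * \<delta>) \<Longrightarrow> \<phi> y = 0"
  shows "(\<integral>z. SS \<delta> N \<phi> z \<partial>lborel) = (\<integral>z. \<phi> z \<partial>lborel) - (\<integral>z. QN \<delta> N \<phi> z \<partial>lborel)"
proof -
  have z: "BI (\<lambda>_. 0 :: real)" unfolding BI_def by (auto intro!: exI[of _ 0])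
  have supp': "\<forall>z y. z \<notin> K \<longrightarrow> dist z y \<le> real (Suc N) * (a0 * \<delta>) \<longrightarrow> \<phi> y = 0" using supp by blast
  note P = SS_pairing[OF good z \<phi> K supp' continuous_on_const[of UNIV 1], of 1]
  have "(\<integral>z. 1 * (\<psi>n \<delta> N \<phi> n z - \<delta>\<^sup>2 * Lg A (\<psi>n \<delta> N \<phi> n) z) \<partial>lborel) = (\<integral>z. \<psi>n \<delta> N \<phi> n z * 1 \<partial>lborel)" for n
  proof -
    have c: "C2c \<Omega> (\<psi>n \<delta> N \<phi> n)" by (rule P(3)) simp
    obtain K' where K': "compact K'" "K' \<subseteq> \<Omega>" "\<And>x. x \<notin> K' \<Longrightarrow> \<psi>n \<delta> N \<phi> n x = 0" using c by (auto simp: C2c_def)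
    note i = Ck_compact_support(1)[OF C2cD(1)[OF c] K'(1,3)]
    note G = green[OF Ck_const[OF open_dom, of 2 1] c]
    have "Lg A (\<lambda>x. 1) z = 0" for z by (simp add: Lg_def Dd_def)
    then have "(\<integral>z. Lg A (\<psi>n \<delta> N \<phi> n) z \<partial>lborel) = 0" "integrable lborel (Lg A (\<psi>n \<delta> N \<phi> n))" using G by simp_all
    then show ?thesis using i by simp
  qed
  then have L1: "(\<lambda>n. \<integral>z. \<psi>n \<delta> N \<phi> n z * 1 \<partial>lborel) \<longlonglongrightarrow> (\<integral>z. 1 * (\<phi> z - QN \<delta> N \<phi> z) \<partial>lborel)" using P(1) by simp
  have L2: "(\<lambda>n. \<integral>z. \<psi>n \<delta> N \<phi> n z * 1 \<partial>lborel) \<longlonglongrightarrow> (\<integral>z. SS \<delta> N \<phi> z * 1 \<partial>lborel)" by (rule P(2)[where H=1]) simp_all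
  have "(\<integral>z. 1 * (\<phi> z - QN \<delta> N \<phi> z) \<partial>lborel) = (\<integral>z. SS \<delta> N \<phi> z * 1 \<partial>lborel)" by (rule LIMSEQ_unique[OF L1 L2])
  then have "(\<integral>z. \<phi> z - QN \<delta> N \<phi> z \<partial>lborel) = (\<integral>z. SS \<delta> N \<phi> z \<partial>lborel)" by simp
  moreover have "integrable lborel \<phi>" "integrable lborel (QN \<delta> N \<phi>)" using \<phi> QN_BI[OF good \<phi>, of N] by (auto simp: BI_def)
  ultimately show ?thesis by simp
qed

end

section \<open>From weak to pointwise inequalities\<close>

lemma weak_nonneg_AE:
  fixes g :: "'a::euclidean_space \<Rightarrow> real"
  assumes D: "open D" "bounded D" and g: "integrable lborel g"
    and weak: "\<And>\<phi> K. continuous_on UNIV \<phi> \<Longrightarrow> (\<And>x. 0 \<le> \<phi> x) \<Longrightarrow> compact K \<Longrightarrow> K \<subseteq> D \<Longrightarrow> (\<And>x. x \<notin> K \<Longrightarrow> \<phi> x = 0) \<Longrightarrow> 0 \<le> (\<integral>x. g x * \<phi> x \<partial>lborel)"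
  shows "AE x in lborel. x \<in> D \<longrightarrow> 0 \<le> g x"
proof -
  have gm[measurable]: "g \<in> borel_measurable borel" using g by (auto dest: borel_measurable_integrable)
  have [measurable]: "D \<in> sets borel" using D by simp
  \<comment> \<open>If this exceptional set had positive measure, a compact part C of positive
    measure could be tested by functions decreasing to its indicator, contradicting g < 0 on
    C.\<close>
  define B where "B = {x \<in> space borel. x \<in> D \<and> g x < 0}"
  have Bm: "B \<in> sets borel" unfolding B_def by measurable
  have "bounded B" using D by (auto simp: B_def intro: bounded_subset)
  then have Bl: "B \<in> lmeasurable" using Bm by (intro bounded_set_imp_lmeasurable) (auto simp: sets_completionI_sets)
  have "measure lebesgue B = 0"
  proof (rule ccontr)
    assume "measure lebesgue B \<noteq> 0"
    then have mB: "0 < measure lebesgue B" by (simp add: zero_less_measure_iff)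
    obtain C where C0: "closed C" "C \<subseteq> B" "emeasure lebesgue (B - C) < ennreal (measure lebesgue B)"
      using sets_lebesgue_inner_closed[OF fmeasurableD[OF Bl] mB] by metis
    have C: "compact C" "C \<subseteq> B"
      using C0 \<open>bounded B\<close> by (auto simp: compact_eq_bounded_closed intro: bounded_subset)
    have Cl: "C \<in> lmeasurable" using C(1) by (rule lmeasurable_compact)
    have "measure lebesgue (B - C) < measure lebesgue B"
      using C0(3) emeasure_eq_measure2[of "B - C" lebesgue] mB fmeasurable.Diff[OF Bl Cl]
      by (simp add: emeasure_eq_measure2 ennreal_less_iff)
    then have "0 < measure lebesgue C"
      using measurable_measure_Diff[OF Bl fmeasurableD[OF Cl] C(2)] by linarith
    then have mC: "0 < measure lborel C" using borel_closed[OF C0(1)] by (simp add: measure_completion)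
    have Cne: "C \<noteq> {}" using mC by auto
    have CD: "C \<subseteq> D" using C(2) by (auto simp: B_def)
    have [measurable]: "C \<in> sets borel" using C0(1) by (rule borel_closed)
    obtain r where r: "0 < r" "(\<Union>x\<in>C. cball x r) \<subseteq> D"
      using compact_subset_open_imp_cball_epsilon_subset[OF C(1) D(1) CD] by blast
    define \<phi> where "\<phi> j x = max 0 (1 - real j * infdist x C)" for j x
    have \<phi>c: "continuous_on UNIV (\<phi> j)" for j unfolding \<phi>_def by (intro continuous_intros)
    have \<phi>01: "0 \<le> \<phi> j x" "\<phi> j x \<le> 1" for j x using infdist_nonneg[of x C] by (auto simp: \<phi>_def)
    have lim: "(\<lambda>j. \<phi> j x) \<longlonglongrightarrow> indicator C x" for x
    proof (cases "x \<in> C")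
      case True then show ?thesis by (simp add: \<phi>_def)
    next
      case False
      then have p: "0 < infdist x C"
        using infdist_nonneg[of x C] in_closed_iff_infdist_zero[OF compact_imp_closed[OF C(1)] Cne, of x] by linarith
      obtain N where N: "1 / infdist x C < real N" using reals_Archimedean2 by blast
      have "\<phi> j x = 0" if "j \<ge> N" for j
      proof -
        have "1 / infdist x C \<le> real j" using N that by linarith
        then show ?thesis using p by (simp add: \<phi>_def field_simps)
      qed
      then have "\<forall>\<^sub>F j in sequentially. \<phi> j x = 0" by (auto simp: eventually_sequentially)
      then show ?thesis using False by (simp add: tendsto_eventually)
    qed
    have "(\<lambda>j. \<integral>x. g x * \<phi> j x \<partial>lborel) \<longlonglongrightarrow> (\<integral>x. g x * indicator C x \<partial>lborel)"
    proof (rule integral_dominated_convergence[where w="\<lambda>x. \<bar>g x\<bar>"])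
      have [measurable]: "\<phi> j \<in> borel_measurable borel" for j by (rule borel_measurable_continuous_onI[OF \<phi>c])
      show "(\<lambda>x. g x * \<phi> j x) \<in> borel_measurable lborel" for j by measurable
      show "AE x in lborel. norm (g x * \<phi> j x) \<le> \<bar>g x\<bar>" for j
        using \<phi>01 by (intro AE_I2) (auto simp: abs_mult intro: mult_left_le)
      show "AE x in lborel. (\<lambda>j. g x * \<phi> j x) \<longlonglongrightarrow> g x * indicator C x" by (intro AE_I2 tendsto_intros lim)
    qed (use g in auto)
    moreover obtain N where N: "1 / r < real N" using reals_Archimedean2 by blast
    have "0 \<le> (\<integral>x. g x * \<phi> j x \<partial>lborel)" if j: "j \<ge> N" for j
    proof (rule weak[OF \<phi>c \<phi>01(1)])
      let ?K = "{x. infdist x C \<le> r}"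
      show "compact ?K" by (rule compact_infdist_le[OF Cne C(1) r(1)])
      show "?K \<subseteq> D"
      proof
        fix x assume x: "x \<in> ?K"
        obtain y where "y \<in> C" "infdist x C = dist x y" using infdist_attains_inf[OF compact_imp_closed[OF C(1)] Cne] by blast
        then have "x \<in> cball y r" "y \<in> C" using x by (auto simp: dist_commute)
        then show "x \<in> D" using r(2) by blast
      qed
      fix x assume x: "x \<notin> ?K"
      have "1 / r \<le> real j" using N j by linarith
      then have "1 \<le> real j * r" using r by (simp add: field_simps)
      also have "\<dots> \<le> real j * infdist x C" using x by (intro mult_left_mono) auto
      finally show "\<phi> j x = 0" by (simp add: \<phi>_def)
    qed
    ultimately have g0: "0 \<le> (\<integral>x. g x * indicator C x \<partial>lborel)" by (intro LIMSEQ_le_const) auto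
    have gi: "integrable lborel (\<lambda>x. g x * indicator C x)" by (intro integrable_real_mult_indicator g) simp
    have gC: "0 \<le> - (g x * indicator C x)" for x using C(2) by (cases "x \<in> C") (auto simp: B_def)
    have "(\<integral>x. - (g x * indicator C x) \<partial>lborel) \<noteq> 0"
    proof
      assume "(\<integral>x. - (g x * indicator C x) \<partial>lborel) = 0"
      then have "AE x in lborel. - (g x * indicator C x) = 0"
        using integral_nonneg_eq_0_iff_AE[of lborel "\<lambda>x. - (g x * indicator C x)"] gi gC by auto
      then have "AE x in lborel. x \<notin> C" by eventually_elim (use C(2) in \<open>auto simp: B_def\<close>)
      then have "C \<in> null_sets lborel" by (subst AE_iff_null_sets) auto
      then show False using mC by (simp add: null_sets_def measure_def)
    qed
    moreover have "0 \<le> (\<integral>x. - (g x * indicator C x) \<partial>lborel)"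
      using gC by (intro integral_nonneg_AE AE_I2)
    ultimately show False using g0 by simp
  qed
  then have "B \<in> null_sets lebesgue" using Bl by (auto simp: null_sets_def emeasure_eq_measure2 intro: fmeasurableD)
  then have "B \<in> null_sets lborel" using Bm by (simp add: null_sets_def)
  then have "AE x in lborel. x \<notin> B" by (rule AE_not_in)
  then show ?thesis by eventually_elim (auto simp: B_def)
qed

text \<open>If v exceeded c at z0, it would do so on a small ball by continuity, and a tent function
  supported there would violate the weak inequality.\<close>

lemma weak_upper_pointwise:
  fixes v :: "'a::euclidean_space \<Rightarrow> real"
  assumes v: "continuous_on UNIV v" and R: "0 < R"
    and weak: "\<And>\<phi>. continuous_on UNIV \<phi> \<Longrightarrow> (\<And>x. 0 \<le> \<phi> x) \<Longrightarrow> (\<And>x. x \<notin> cball z0 R \<Longrightarrow> \<phi> x = 0) \<Longrightarrow>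
      (\<integral>x. v x * \<phi> x \<partial>lborel) \<le> c * (\<integral>x. \<phi> x \<partial>lborel)"
  shows "v z0 \<le> c"
proof (rule ccontr)
  assume "\<not> v z0 \<le> c"
  then have "0 < v z0 - c" by simp
  moreover have "isCont v z0" using v by (simp add: continuous_on_eq_continuous_at)
  ultimately obtain s0 where s0: "s0 > 0" "\<And>x. dist x z0 < s0 \<Longrightarrow> \<bar>v x - v z0\<bar> < v z0 - c"
    unfolding continuous_at_eps_delta dist_norm real_norm_def by metis
  define s where "s = min s0 R"
  have s: "0 < s" "s \<le> s0" "s \<le> R" using s0 R by (auto simp: s_def)
  define \<phi> where "\<phi> x = max 0 (s - dist x z0)" for x
  have \<phi>c: "continuous_on UNIV \<phi>" unfolding \<phi>_def by (intro continuous_intros)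
  have \<phi>0: "0 \<le> \<phi> x" for x by (simp add: \<phi>_def)
  have \<phi>z: "\<phi> x = 0" if "x \<notin> cball z0 R" for x using that s by (simp add: \<phi>_def dist_commute)
  have i1: "integrable lborel \<phi>"
    by (rule integrable_continuous_compact_support(1)[OF compact_cball continuous_on_subset[OF \<phi>c subset_UNIV] \<phi>z])
  have i2: "integrable lborel (\<lambda>x. v x * \<phi> x)"
    by (rule integrable_continuous_compact_support(1)[OF compact_cball[of z0 R]])
      (use \<phi>z in \<open>auto intro!: continuous_on_mult continuous_on_subset[OF \<phi>c] continuous_on_subset[OF v]\<close>)
  have vb: "c < v x" if "dist x z0 < s" for x using s0(2)[of x] that s(2) by auto
  have nn: "0 \<le> (v x - c) * \<phi> x" for x
    using vb[of x] by (cases "dist x z0 < s") (auto simp: \<phi>_def intro!: mult_nonneg_nonneg)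
  have i3: "integrable lborel (\<lambda>x. (v x - c) * \<phi> x)" using i1 i2 by (simp add: left_diff_distrib)
  have "(\<integral>x. (v x - c) * \<phi> x \<partial>lborel) \<le> 0"
    using weak[OF \<phi>c \<phi>0 \<phi>z] i1 i2 by (simp add: left_diff_distrib)
  moreover have "0 \<le> (\<integral>x. (v x - c) * \<phi> x \<partial>lborel)" using nn by (intro integral_nonneg_AE) auto
  ultimately have "(\<integral>x. (v x - c) * \<phi> x \<partial>lborel) = 0" by linarith
  then have "AE x in lborel. (v x - c) * \<phi> x = 0" using integral_nonneg_eq_0_iff_AE[OF i3] nn by auto
  then have "AE x in lborel. x \<notin> ball z0 s"
    by eventually_elim (use vb in \<open>fastforce simp: \<phi>_def dist_commute max_def split: if_splits\<close>)
  then have "ball z0 s \<in> null_sets lborel" by (subst AE_iff_null_sets) auto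
  then show False using content_ball_pos[OF s(1), of z0] by (simp add: null_sets_def measure_def)
qed

lemma lebesgue_integral_eq_lborel:
  fixes f :: "'a::euclidean_space \<Rightarrow> real"
  assumes "f \<in> borel_measurable borel" shows "(\<integral>x. f x \<partial>lebesgue) = (\<integral>x. f x \<partial>lborel)"
  using assms by (intro integral_completion) simp

context elliptic begin

lemma QN_add: "good \<delta> \<Longrightarrow> BI f \<Longrightarrow> BI g \<Longrightarrow> QN \<delta> k (\<lambda>x. f x + g x) = (\<lambda>z. QN \<delta> k f z + QN \<delta> k g z)"
proof (induction k)
  case (Suc k)
  show ?case unfolding QN_Suc Suc.IH[OF Suc.prems]
    by (rule ext) (rule kernel.opr_add[OF kernel_QQ[OF Suc.prems(1) order_refl] QN_BI[OF Suc.prems(1,2)] QN_BI[OF Suc.prems(1,3)]])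
qed simp

lemma SS_add: "good \<delta> \<Longrightarrow> BI f \<Longrightarrow> BI g \<Longrightarrow> SS \<delta> N (\<lambda>x. f x + g x) z = SS \<delta> N f z + SS \<delta> N g z"
proof -
  assume g: "good \<delta>" and f: "BI f" "BI g"
  have "GN \<delta> N (\<lambda>x. f x + g x) = (\<lambda>x. GN \<delta> N f x + GN \<delta> N g x)"
    unfolding GN_def QN_add[OF g f] by (simp add: sum.distrib)
  then show ?thesis unfolding SS_def
    using kernel.opr_add[OF kernel_kk[OF good_pos[OF g] order_refl] GN_BI[OF g f(1)] GN_BI[OF g f(2)], of N N z]
    by (simp add: add_divide_distrib)
qed

definition "CS B = CM / 2 * (B / (1 - \<theta>))"

end

lemma BI_continuous_compact_support:
  fixes f :: "'a::euclidean_space \<Rightarrow> real"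
  assumes "continuous_on UNIV f" "compact K" "\<And>x. x \<notin> K \<Longrightarrow> f x = 0"
  shows "BI f"
  using integrable_continuous_compact_support(1,3)[OF assms(2) continuous_on_subset[OF assms(1) subset_UNIV] assms(3)]
  by (simp add: BI_def)

section \<open>Comparison of a glued function with its smoothing\<close>

context elliptic_region begin

text \<open>\<open>SS_symmetric\<close> leaves two remainder pairings, and f \<le> 0 gives both
  integrals a sign. Each inequality discards the favourable one and estimates the other by
  \<open>\<theta> ^ N\<close>, through the L^1 bound on \<open>QN \<phi>\<close> or the sup bound on
  \<open>QN f\<close>. The upper bound also uses \<open>SS_mass\<close>.\<close>

lemma SS_bounds_weak:
  assumes good: "good \<delta>" and f: "BI f" "\<And>x. \<bar>f x\<bar> \<le> B" "\<And>x. f x \<le> 0" and \<phi>: "BI \<phi>" "\<And>x. 0 \<le> \<phi> x"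
    and K: "compact K" "K \<subseteq> \<Omega>"
    and supp': "\<forall>z y. z \<notin> K \<longrightarrow> dist z y \<le> real (Suc N) * (a0 * \<delta>) \<longrightarrow> \<phi> y = 0"
  shows "(\<integral>z. SS \<delta> N \<phi> z * f z \<partial>lborel) - CS B * \<theta> ^ N * (\<integral>z. \<phi> z \<partial>lborel) \<le> (\<integral>z. SS \<delta> N f z * \<phi> z \<partial>lborel)"
    "(\<And>z. z \<in> K \<Longrightarrow> f z \<le> s) \<Longrightarrow> \<bar>s\<bar> \<le> B \<Longrightarrow> s \<le> 0 \<Longrightarrow> (\<integral>z. SS \<delta> N f z * \<phi> z \<partial>lborel) \<le> (s + 2 * B * \<theta> ^ N) * (\<integral>z. \<phi> z \<partial>lborel)"
proof -
  note supp = supp'[rule_format]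
  note t = \<theta>_bounds[OF good]
  have B: "0 \<le> B" using f(2)[of 0] by linarith
  note Sf = SS_BI[OF good f(1), of N] and S\<phi> = SS_BI[OF good \<phi>(1), of N] and Q\<phi> = QN_BI[OF good \<phi>(1), of N] and Qf = QN_BI[OF good f(1), of N]
  have prod: "integrable lborel (\<lambda>z. g z * h z)" if gh: "BI g" "BI h" for g h :: "'a \<Rightarrow> real"
  proof -
    obtain C where C: "\<And>x. \<bar>g x\<bar> \<le> C" using gh(1) by (auto simp: BI_def)
    show ?thesis
      by (rule Bochner_Integration.integrable_bound[of _ "\<lambda>z. C * h z"])
        (use gh BI_measurable[OF gh(1)] BI_measurable[OF gh(2)] C in
          \<open>auto simp: BI_def abs_mult intro!: AE_I2 mult_right_mono order_trans[OF C abs_ge_self]\<close>)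
  qed
  have ints: "integrable lborel \<phi>" "integrable lborel (QN \<delta> N \<phi>)" "integrable lborel (SS \<delta> N \<phi>)"
    using \<phi>(1) Q\<phi> S\<phi> by (auto simp: BI_def)
  have S\<phi>0: "0 \<le> SS \<delta> N \<phi> z" and Q\<phi>0: "0 \<le> QN \<delta> N \<phi> z" for z
    using SS_nonneg[OF good \<phi>(2)] QN_nonneg[OF good \<phi>(2)] by auto
  have Sf0: "SS \<delta> N f z \<le> 0" "\<bar>SS \<delta> N f z\<bar> \<le> CS B" and Qf0: "QN \<delta> N f z \<le> 0" "\<bar>QN \<delta> N f z\<bar> \<le> \<theta> ^ N * B" for z
    using SS_nonpos[OF good f(3)] SS_bound[OF good f(1,2)] QN_nonpos[OF good f(3)] QN_contract[OF good f(1,2)] by (auto simp: CS_def)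
  have \<phi>I: "0 \<le> (\<integral>z. \<phi> z \<partial>lborel)" using \<phi>(2) by (intro integral_nonneg_AE) auto
  have QI: "(\<integral>z. QN \<delta> N \<phi> z \<partial>lborel) \<le> \<theta> ^ N * (\<integral>z. \<phi> z \<partial>lborel)" "0 \<le> (\<integral>z. QN \<delta> N \<phi> z \<partial>lborel)"
    using QN_mass[OF good \<phi>] Q\<phi>0 by (auto intro!: integral_nonneg_AE)
  have "(\<integral>z. SS \<delta> N f z * (\<phi> z - QN \<delta> N \<phi> z) \<partial>lborel) = (\<integral>z. SS \<delta> N \<phi> z * (f z - QN \<delta> N f z) \<partial>lborel)"
    by (rule SS_symmetric[OF good f(1) \<phi>(1) K], rule supp)
  then have eq: "(\<integral>z. SS \<delta> N f z * \<phi> z \<partial>lborel) = (\<integral>z. SS \<delta> N \<phi> z * f z \<partial>lborel)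
      + (\<integral>z. SS \<delta> N f z * QN \<delta> N \<phi> z \<partial>lborel) - (\<integral>z. SS \<delta> N \<phi> z * QN \<delta> N f z \<partial>lborel)"
    using prod[OF Sf \<phi>(1)] prod[OF Sf Q\<phi>] prod[OF S\<phi> f(1)] prod[OF S\<phi> Qf] by (simp add: right_diff_distrib)
  have e1: "- (CS B * \<theta> ^ N * (\<integral>z. \<phi> z \<partial>lborel)) \<le> (\<integral>z. SS \<delta> N f z * QN \<delta> N \<phi> z \<partial>lborel)"
  proof -
    have CS0: "0 \<le> CS B" using Sf0(2)[of 0] by linarith
    have "- (CS B * (\<integral>z. QN \<delta> N \<phi> z \<partial>lborel)) = (\<integral>z. - CS B * QN \<delta> N \<phi> z \<partial>lborel)" using ints by simp
    also have "\<dots> \<le> (\<integral>z. SS \<delta> N f z * QN \<delta> N \<phi> z \<partial>lborel)"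
    proof (rule integral_mono)
      show "- CS B * QN \<delta> N \<phi> z \<le> SS \<delta> N f z * QN \<delta> N \<phi> z" for z
        using Sf0(2)[of z] by (intro mult_right_mono Q\<phi>0) linarith
    qed (use ints prod[OF Sf Q\<phi>] in auto)
    finally show ?thesis using mult_left_mono[OF QI(1) CS0] by (simp add: mult.assoc)
  qed
  have e2: "(\<integral>z. SS \<delta> N f z * QN \<delta> N \<phi> z \<partial>lborel) \<le> 0"
  proof -
    have "0 \<le> (\<integral>z. - (SS \<delta> N f z * QN \<delta> N \<phi> z) \<partial>lborel)"
      by (intro integral_nonneg_AE AE_I2) (simp add: mult_nonpos_nonneg Sf0(1) Q\<phi>0)
    then show ?thesis by simp
  qed
  have e3: "(\<integral>z. SS \<delta> N \<phi> z * QN \<delta> N f z \<partial>lborel) \<le> 0"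
  proof -
    have "0 \<le> (\<integral>z. - (SS \<delta> N \<phi> z * QN \<delta> N f z) \<partial>lborel)"
      by (intro integral_nonneg_AE AE_I2) (simp add: mult_nonneg_nonpos Qf0(1) S\<phi>0)
    then show ?thesis by simp
  qed
  show "(\<integral>z. SS \<delta> N \<phi> z * f z \<partial>lborel) - CS B * \<theta> ^ N * (\<integral>z. \<phi> z \<partial>lborel) \<le> (\<integral>z. SS \<delta> N f z * \<phi> z \<partial>lborel)"
    using eq e1 e3 by linarith
  assume s: "\<And>z. z \<in> K \<Longrightarrow> f z \<le> s" "\<bar>s\<bar> \<le> B" "s \<le> 0"
  have mass: "(\<integral>z. SS \<delta> N \<phi> z \<partial>lborel) = (\<integral>z. \<phi> z \<partial>lborel) - (\<integral>z. QN \<delta> N \<phi> z \<partial>lborel)"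
    by (rule SS_mass[OF good \<phi>(1) K], rule supp)
  have "(\<integral>z. SS \<delta> N \<phi> z * f z \<partial>lborel) \<le> (\<integral>z. SS \<delta> N \<phi> z * s \<partial>lborel)"
  proof (rule integral_mono)
    show "SS \<delta> N \<phi> z * f z \<le> SS \<delta> N \<phi> z * s" for z
    proof (cases "z \<in> K")
      case True then show ?thesis using s(1) S\<phi>0 by (intro mult_left_mono) auto
    next
      case False
      have "SS \<delta> N \<phi> z = 0" by (rule SS_support[OF good], rule supp[OF False])
      then show ?thesis by simp
    qed
  qed (use prod[OF S\<phi> f(1)] ints in auto)
  also have "\<dots> = s * (\<integral>z. \<phi> z \<partial>lborel) + (- s) * (\<integral>z. QN \<delta> N \<phi> z \<partial>lborel)" 
  proof -
    have "(\<integral>z. SS \<delta> N \<phi> z * s \<partial>lborel) = s * (\<integral>z. SS \<delta> N \<phi> z \<partial>lborel)" by simp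
    then show ?thesis unfolding mass by (simp add: algebra_simps)
  qed
  also have "\<dots> \<le> s * (\<integral>z. \<phi> z \<partial>lborel) + B * (\<theta> ^ N * (\<integral>z. \<phi> z \<partial>lborel))"
    using s(2,3) QI B by (intro add_left_mono mult_mono) auto
  finally have u1: "(\<integral>z. SS \<delta> N \<phi> z * f z \<partial>lborel) \<le> s * (\<integral>z. \<phi> z \<partial>lborel) + B * (\<theta> ^ N * (\<integral>z. \<phi> z \<partial>lborel))" .
  have "- (\<integral>z. SS \<delta> N \<phi> z * QN \<delta> N f z \<partial>lborel) = (\<integral>z. - (SS \<delta> N \<phi> z * QN \<delta> N f z) \<partial>lborel)" by simp
  also have "\<dots> \<le> (\<integral>z. SS \<delta> N \<phi> z * (\<theta> ^ N * B) \<partial>lborel)"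
  proof (rule integral_mono)
    show "- (SS \<delta> N \<phi> z * QN \<delta> N f z) \<le> SS \<delta> N \<phi> z * (\<theta> ^ N * B)" for z
      using mult_left_mono[OF _ S\<phi>0[of z], of "- QN \<delta> N f z" "\<theta> ^ N * B"] Qf0(2)[of z] by simp
  qed (use prod[OF S\<phi> Qf] ints in auto)
  also have "\<dots> = (\<theta> ^ N * B) * (\<integral>z. SS \<delta> N \<phi> z \<partial>lborel)" by simp
  also have "\<dots> \<le> (\<theta> ^ N * B) * (\<integral>z. \<phi> z \<partial>lborel)" using mass QI(2) t B by (intro mult_left_mono) auto
  finally have "- (\<integral>z. SS \<delta> N \<phi> z * QN \<delta> N f z \<partial>lborel) \<le> (\<theta> ^ N * B) * (\<integral>z. \<phi> z \<partial>lborel)" .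
  then show "(\<integral>z. SS \<delta> N f z * \<phi> z \<partial>lborel) \<le> (s + 2 * B * \<theta> ^ N) * (\<integral>z. \<phi> z \<partial>lborel)"
    using eq e2 u1 by (simp add: algebra_simps)
qed

end

text \<open>Data of the comparison argument at scale \<open>\<delta>\<close>: \<open>f\<close> is the maximum of the subsolutions \<open>u1\<close> (on \<open>D\<close>) and
  \<open>u2\<close> (on a neighbourhood of \<open>D\<close>), and \<open>u1\<close> is the larger one only on \<open>F\<close>, away from the boundary of \<open>D\<close>.\<close>

locale glued = elliptic_region A \<mu> \<Lambda> Lip \<Omega> for A :: "'a::euclidean_space \<Rightarrow> 'a \<Rightarrow> 'a" and \<mu> \<Lambda> Lip \<Omega> +
  fixes \<delta> R B :: real and N :: nat and D Kc F :: "'a set" and f u1 u2 :: "'a \<Rightarrow> real"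
  assumes good: "good \<delta>" and R: "R = real (Suc N) * (a0 * \<delta>)"
    and D: "open D" "bounded D" and Kc: "compact Kc" "Kc \<subseteq> \<Omega>" "\<And>z. z \<in> D \<Longrightarrow> cball z (2 * R) \<subseteq> Kc"
    and F: "compact F" "\<And>z. z \<in> F \<Longrightarrow> cball z (2 * R) \<subseteq> D"
    and f: "f \<in> borel_measurable borel" "\<And>x. \<bar>f x\<bar> \<le> B" "\<And>x. f x \<le> 0" "\<And>x. x \<notin> Kc \<Longrightarrow> f x = 0"
    and u1: "\<And>K. compact K \<Longrightarrow> K \<subseteq> D \<Longrightarrow> set_integrable lebesgue K u1" "\<And>z. z \<in> D \<Longrightarrow> u1 z \<le> f z" "\<And>z. z \<in> F \<Longrightarrow> f z = u1 z"
      "\<And>w. C2c D w \<Longrightarrow> (\<And>z. 0 \<le> w z) \<Longrightarrow> 0 \<le> (\<integral>z. u1 z * Lg A w z \<partial>lebesgue)"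
    and u2: "set_integrable lebesgue Kc u2" "\<And>z. z \<in> Kc \<Longrightarrow> u2 z \<le> f z" "\<And>z. z \<in> D - F \<Longrightarrow> f z = u2 z"
      "\<And>w. C2c \<Omega> w \<Longrightarrow> (\<And>z. 0 \<le> w z) \<Longrightarrow> 0 \<le> (\<integral>z. u2 z * Lg A w z \<partial>lebesgue)"
begin

abbreviation "v \<equiv> SS \<delta> N f"

lemma R_pos: "0 < R" using a0_pos good_pos[OF good] by (simp add: R)

lemma f_BI: "BI f"
proof -
  have "integrable lborel (\<lambda>x. indicator Kc x * B)"
    using emeasure_compact_finite[OF Kc(1)] compact_imp_closed[OF Kc(1)] by (auto intro!: integrable_mult_left integrable_real_indicator)
  then have "integrable lborel f"
    by (rule Bochner_Integration.integrable_bound) (use f in \<open>auto intro!: AE_I2 simp: indicator_def intro: order_trans[OF _ abs_ge_self]\<close>)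
  then show ?thesis using f(2) by (auto simp: BI_def)
qed

text \<open>\<phi> is split into a part near F, tested with \<open>u1\<close>, and a part off F,
  tested with \<open>u2\<close>. Each function satisfies the subsolution inequality against its part
  and lies below f, while \<open>SS\<close> of each part is nonnegative; the two inequalities add
  up.\<close>

lemma f_le_SS_weak:
  assumes \<phi>: "continuous_on UNIV \<phi>" "\<And>x. 0 \<le> \<phi> x" and K\<phi>: "compact K\<phi>" "K\<phi> \<subseteq> D" "\<And>x. x \<notin> K\<phi> \<Longrightarrow> \<phi> x = 0"
  shows "(\<integral>z. f z * \<phi> z \<partial>lborel) \<le> (\<integral>z. SS \<delta> N \<phi> z * f z \<partial>lborel)"
proof -
  have BI\<phi>: "BI \<phi>" by (rule BI_continuous_compact_support[OF \<phi>(1) K\<phi>(1,3)])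
  obtain P where P: "\<And>x. \<bar>\<phi> x\<bar> \<le> P" using BI\<phi> by (auto simp: BI_def)
  \<comment> \<open>Cut-offs tending to the indicator of the complement of F, so that in the limit
    \<open>u1\<close> and \<open>u2\<close> are integrated exactly where they equal f.\<close>
  define \<eta> where "\<eta> j z = (if F = {} then 1 else min 1 (real j * infdist z F))" for j z
  have \<eta>c: "continuous_on UNIV (\<eta> j)" for j unfolding \<eta>_def by (cases "F = {}") (auto intro!: continuous_intros)
  have \<eta>01: "0 \<le> \<eta> j z" "\<eta> j z \<le> 1" for j z using infdist_nonneg[of z F] by (auto simp: \<eta>_def)
  have \<eta>lim: "(\<lambda>j. \<eta> j z) \<longlonglongrightarrow> 1 - indicator F z" for z
  proof (cases "z \<in> F")
    case True
    then have "F \<noteq> {}" "infdist z F = 0" by auto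
    then show ?thesis using True by (simp add: \<eta>_def)
  next
    case False
    show ?thesis
    proof (cases "F = {}")
      case True then show ?thesis by (simp add: \<eta>_def)
    next
      case ne: False
      have p: "0 < infdist z F"
        using infdist_nonneg[of z F] in_closed_iff_infdist_zero[OF compact_imp_closed[OF F(1)] ne, of z] False by linarith
      obtain n where n: "1 / infdist z F < real n" using reals_Archimedean2 by blast
      have "\<eta> j z = 1" if "j \<ge> n" for j
      proof -
        have "1 / infdist z F \<le> real j" using n that by linarith
        then show ?thesis using p ne by (simp add: \<eta>_def field_simps min_def)
      qed
      then have "\<forall>\<^sub>F j in sequentially. \<eta> j z = 1" by (auto simp: eventually_sequentially)
      then show ?thesis using False by (simp add: tendsto_eventually)
    qed
  qed
  \<comment> \<open>For large j the first part of \<phi> lives within R of F, and \<open>SS\<close>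
    widens this by R; the 2R-neighbourhood stays inside D by the hypothesis on F.\<close>
  define K1 where "K1 = {x + y | x y. x \<in> F \<and> y \<in> cball 0 (2 * R)}"
  have K1: "compact K1" unfolding K1_def by (intro compact_sums F compact_cball)
  have K1D: "K1 \<subseteq> D" using F(2) by (fastforce simp: K1_def dist_norm)
  obtain n0 where n0: "1 / R < real n0" using reals_Archimedean2 by blast
  define \<phi>1 where "\<phi>1 j z = \<phi> z * (1 - \<eta> j z)" for j z
  define \<phi>2 where "\<phi>2 j z = \<phi> z * \<eta> j z" for j z
  have c12: "continuous_on UNIV (\<phi>1 j)" "continuous_on UNIV (\<phi>2 j)" for j
    unfolding \<phi>1_def \<phi>2_def by (intro continuous_intros \<phi> \<eta>c)+
  have p12: "0 \<le> \<phi>1 j z" "0 \<le> \<phi>2 j z" "\<phi>1 j z \<le> P" "\<phi>2 j z \<le> P" for j z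
  proof -
    show "0 \<le> \<phi>1 j z" "0 \<le> \<phi>2 j z" using \<phi>(2) \<eta>01 by (auto simp: \<phi>1_def \<phi>2_def)
    have "\<phi>1 j z \<le> \<phi> z" "\<phi>2 j z \<le> \<phi> z" unfolding \<phi>1_def \<phi>2_def using \<phi>(2) \<eta>01 by (auto intro!: mult_left_le)
    then show "\<phi>1 j z \<le> P" "\<phi>2 j z \<le> P" using P[of z] by auto
  qed
  have z12: "\<phi>1 j x = 0" "\<phi>2 j x = 0" if "x \<notin> K\<phi>" for j x using K\<phi>(3)[OF that] by (auto simp: \<phi>1_def \<phi>2_def)
  have BI12: "BI (\<phi>1 j)" "BI (\<phi>2 j)" for j
    using BI_continuous_compact_support[OF c12(1) K\<phi>(1) z12(1)] BI_continuous_compact_support[OF c12(2) K\<phi>(1) z12(2)] by auto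
  have supp1: "\<phi>1 j y = 0" if j: "j \<ge> n0" and z: "z \<notin> K1" and d: "dist z y \<le> R" for j z y
  proof (rule ccontr)
    assume n: "\<phi>1 j y \<noteq> 0"
    then have ne: "F \<noteq> {}" by (auto simp: \<phi>1_def \<eta>_def)
    have "real j * infdist y F < 1" using n ne by (auto simp: \<phi>1_def \<eta>_def min_def split: if_splits)
    moreover have "1 / R \<le> real j" using n0 j by linarith
    then have "1 \<le> real j * R" using R_pos by (simp add: field_simps)
    ultimately have "real j * infdist y F < real j * R" by linarith
    then have iR: "infdist y F < R" by (simp add: mult_less_cancel_left)
    obtain x where x: "x \<in> F" "infdist y F = dist y x" using infdist_attains_inf[OF compact_imp_closed[OF F(1)] ne] by blast
    have "dist z x \<le> 2 * R" using d iR x(2) dist_triangle[of z x y] by linarith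
    then have "z = x + (z - x)" "z - x \<in> cball 0 (2 * R)" by (auto simp: dist_norm norm_minus_commute)
    then show False using z x(1) unfolding K1_def by blast
  qed
  have supp2: "\<phi>2 j y = 0" "\<phi> y = 0" if z: "z \<notin> Kc" and d: "dist z y \<le> R" for j z y
  proof -
    have "y \<notin> D" using Kc(3)[of y] z d R_pos by (auto simp: dist_commute subset_iff)
    then have "\<phi> y = 0" using K\<phi> by auto
    then show "\<phi> y = 0" "\<phi>2 j y = 0" by (auto simp: \<phi>2_def)
  qed
  have fneg: "\<And>z. z \<in> D \<Longrightarrow> u1 z \<le> 0" "\<And>z. z \<in> Kc \<Longrightarrow> u2 z \<le> 0" using u1(2) u2(2) f(3) order_trans by blast+
  have S1: "(\<integral>z. u1 z * \<phi>1 j z \<partial>lebesgue) \<le> (\<integral>z. u1 z * SS \<delta> N (\<phi>1 j) z \<partial>lebesgue)" if "j \<ge> n0" for j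
    by (rule subsolution_le_SS[OF good K1 K1D u1(1)[OF K1 K1D] u1(4) fneg(1) c12(1) p12(1) BI12(1)])
      (use K1D supp1[OF that] R in auto)
  have S2: "(\<integral>z. u2 z * \<phi>2 j z \<partial>lebesgue) \<le> (\<integral>z. u2 z * SS \<delta> N (\<phi>2 j) z \<partial>lebesgue)" for j
    by (rule subsolution_le_SS[OF good Kc(1,2) u2(1,4) fneg(2) c12(2) p12(2) BI12(2)])
      (use supp2 R in auto)
  have Sz1: "SS \<delta> N (\<phi>1 j) z = 0" if "j \<ge> n0" "z \<notin> K1" for j z
    by (rule SS_support[OF good]) (use supp1[OF that] R in auto)
  have Sz2: "SS \<delta> N (\<phi>2 j) z = 0" if "z \<notin> Kc" for j z
    by (rule SS_support[OF good]) (use supp2(1)[OF that] R in auto)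
  have K1c: "K1 \<subseteq> Kc"
  proof
    fix z assume "z \<in> K1"
    then have "z \<in> D" using K1D by auto
    then show "z \<in> Kc" using Kc(3)[of z] R_pos by auto
  qed
  have ui: "integrable lebesgue (\<lambda>z. u z * h z)"
    if uK: "set_integrable lebesgue K u" and h: "BI h" "\<And>z. z \<notin> K \<Longrightarrow> h z = 0" for K u and h :: "'a \<Rightarrow> real"
  proof -
    obtain C where C: "\<And>z. \<bar>h z\<bar> \<le> C" using h by (auto simp: BI_def)
    have uK': "integrable lebesgue (\<lambda>z. indicator K z *\<^sub>R u z)" using uK by (simp add: set_integrable_def)
    have eq: "(\<lambda>z. u z * h z) = (\<lambda>z. (indicator K z *\<^sub>R u z) * h z)" using h(2) by (auto simp: indicator_def fun_eq_iff)
    have hm: "h \<in> borel_measurable lebesgue" using BI_measurable[OF h(1)] by (simp add: measurable_completion)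
    show "integrable lebesgue (\<lambda>z. u z * h z)" unfolding eq
      by (intro Bochner_Integration.integrable_bound[OF integrable_mult_left[OF integrable_norm[OF uK'], of C]])
        (use hm uK' in \<open>auto simp: abs_mult intro!: AE_I2 mult_left_mono order_trans[OF C abs_ge_self] dest: borel_measurable_integrable\<close>)
  qed
  have fK: "set_integrable lebesgue K f" if "compact K" for K
    unfolding set_integrable_def
  proof (rule integrable_mult_indicator)
    show "K \<in> sets lebesgue" using compact_imp_closed[OF that] by auto
    show "integrable lebesgue f" using f_BI by (simp add: BI_def integrable_completion f(1))
  qed
  note SB = SS_BI[OF good BI12(1), of N] SS_BI[OF good BI12(2), of N]
  have main: "(\<integral>z. u1 z * \<phi>1 j z \<partial>lebesgue) + (\<integral>z. u2 z * \<phi>2 j z \<partial>lebesgue) \<le> (\<integral>z. SS \<delta> N \<phi> z * f z \<partial>lborel)" if j: "j \<ge> n0" for j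
  proof -
    have a1: "(\<integral>z. u1 z * SS \<delta> N (\<phi>1 j) z \<partial>lebesgue) \<le> (\<integral>z. f z * SS \<delta> N (\<phi>1 j) z \<partial>lebesgue)"
    proof (rule integral_mono)
      show "u1 z * SS \<delta> N (\<phi>1 j) z \<le> f z * SS \<delta> N (\<phi>1 j) z" for z
        using Sz1[OF j, of z] u1(2)[of z] K1D SS_nonneg[OF good p12(1)[of j]] by (cases "z \<in> K1") (auto intro!: mult_right_mono)
    qed (use ui[OF u1(1)[OF K1 K1D] SB(1) Sz1[OF j]] ui[OF fK[OF K1] SB(1) Sz1[OF j]] in auto)
    have a2: "(\<integral>z. u2 z * SS \<delta> N (\<phi>2 j) z \<partial>lebesgue) \<le> (\<integral>z. f z * SS \<delta> N (\<phi>2 j) z \<partial>lebesgue)"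
    proof (rule integral_mono)
      show "u2 z * SS \<delta> N (\<phi>2 j) z \<le> f z * SS \<delta> N (\<phi>2 j) z" for z
        using Sz2[of z j] u2(2)[of z] SS_nonneg[OF good p12(2)[of j]] by (cases "z \<in> Kc") (auto intro!: mult_right_mono)
    qed (use ui[OF u2(1) SB(2) Sz2] ui[OF fK[OF Kc(1)] SB(2) Sz2] in auto)
    have e: "\<phi> = (\<lambda>x. \<phi>1 j x + \<phi>2 j x)" by (auto simp: \<phi>1_def \<phi>2_def algebra_simps)
    have "(\<integral>z. f z * SS \<delta> N (\<phi>1 j) z \<partial>lebesgue) + (\<integral>z. f z * SS \<delta> N (\<phi>2 j) z \<partial>lebesgue) = (\<integral>z. f z * SS \<delta> N (\<phi>1 j) z + f z * SS \<delta> N (\<phi>2 j) z \<partial>lebesgue)"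
      using ui[OF fK[OF K1] SB(1) Sz1[OF j]] ui[OF fK[OF Kc(1)] SB(2) Sz2] by simp
    also have "\<dots> = (\<integral>z. SS \<delta> N \<phi> z * f z \<partial>lebesgue)"
      by (subst e) (simp add: SS_add[OF good BI12] algebra_simps)
    also have "\<dots> = (\<integral>z. SS \<delta> N \<phi> z * f z \<partial>lborel)"
      by (rule lebesgue_integral_eq_lborel) (use f(1) BI_measurable[OF SS_BI[OF good BI\<phi>]] in simp)
    finally show ?thesis using S1[OF j] S2[of j] a1 a2 by linarith
  qed
  have K\<phi>c: "K\<phi> \<subseteq> Kc"
  proof
    fix z assume "z \<in> K\<phi>"
    then have "z \<in> D" using K\<phi> by auto
    then show "z \<in> Kc" using Kc(3)[of z] R_pos by auto
  qed
  have Fm: "F \<in> sets borel" using compact_imp_closed[OF F(1)] by auto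
  have uL: "set_integrable lebesgue K\<phi> u1" by (rule u1(1)[OF K\<phi>(1,2)])
  have uL2: "set_integrable lebesgue K\<phi> u2"
    by (rule set_integrable_subset[OF u2(1) _ K\<phi>c]) (use compact_imp_closed[OF K\<phi>(1)] in auto)
  have limg: "(\<lambda>j. \<integral>z. u z * h j z \<partial>lebesgue) \<longlonglongrightarrow> (\<integral>z. u z * h' z \<partial>lebesgue)"
    if uK: "set_integrable lebesgue K\<phi> u" and h: "\<And>j. BI (h j)" "BI h'" "\<And>j z. z \<notin> K\<phi> \<Longrightarrow> h j z = 0" "\<And>z. z \<notin> K\<phi> \<Longrightarrow> h' z = 0"
      "\<And>j z. \<bar>h j z\<bar> \<le> P" "\<And>z. (\<lambda>j. h j z) \<longlonglongrightarrow> h' z" for u and h :: "nat \<Rightarrow> 'a \<Rightarrow> real" and h'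
  proof (rule integral_dominated_convergence[where w="\<lambda>z. \<bar>indicator K\<phi> z *\<^sub>R u z\<bar> * P"])
    show "integrable lebesgue (\<lambda>z. \<bar>indicator K\<phi> z *\<^sub>R u z\<bar> * P)"
      using uK unfolding set_integrable_def by (intro integrable_mult_left integrable_abs)
    show "AE z in lebesgue. (\<lambda>j. u z * h j z) \<longlonglongrightarrow> u z * h' z" by (intro AE_I2 tendsto_intros h)
    show "AE z in lebesgue. norm (u z * h j z) \<le> \<bar>indicator K\<phi> z *\<^sub>R u z\<bar> * P" for j
    proof (rule AE_I2)
      fix z show "norm (u z * h j z) \<le> \<bar>indicator K\<phi> z *\<^sub>R u z\<bar> * P"
        using h(3)[of z j] h(5)[of j z] by (cases "z \<in> K\<phi>") (auto simp: abs_mult intro!: mult_left_mono)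
    qed
  qed (use ui[OF uK h(1) h(3)] ui[OF uK h(2) h(4)] in \<open>auto dest: borel_measurable_integrable\<close>)
  have BIF: "BI (\<lambda>z. \<phi> z * indicator F z)"
  proof -
    have "integrable lborel (\<lambda>z. \<phi> z * indicator F z)" using BI\<phi> Fm by (intro integrable_real_mult_indicator) (auto simp: BI_def)
    moreover have "\<bar>\<phi> z * indicator F z\<bar> \<le> P" for z using P[of z] by (auto simp: indicator_def)
    ultimately show ?thesis by (auto simp: BI_def)
  qed
  have BIF': "BI (\<lambda>z. \<phi> z * (1 - indicator F z))" using BI_add[OF BI\<phi> BI_cmult[OF BIF, of "-1"]] by (simp add: algebra_simps)
  have l1: "(\<lambda>j. \<integral>z. u1 z * \<phi>1 j z \<partial>lebesgue) \<longlonglongrightarrow> (\<integral>z. u1 z * (\<phi> z * indicator F z) \<partial>lebesgue)"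
  proof (rule limg[OF uL BI12(1) BIF z12(1)])
    show "(\<lambda>j. \<phi>1 j z) \<longlonglongrightarrow> \<phi> z * indicator F z" for z
      using tendsto_mult[OF tendsto_const[of "\<phi> z"] tendsto_diff[OF tendsto_const[of 1] \<eta>lim[of z]]] by (simp add: \<phi>1_def)
    show "\<bar>\<phi>1 j z\<bar> \<le> P" for j z using p12[of j z] by simp
  qed (use K\<phi>(3) in auto)
  have l2: "(\<lambda>j. \<integral>z. u2 z * \<phi>2 j z \<partial>lebesgue) \<longlonglongrightarrow> (\<integral>z. u2 z * (\<phi> z * (1 - indicator F z)) \<partial>lebesgue)"
  proof (rule limg[OF uL2 BI12(2) BIF' z12(2)])
    show "(\<lambda>j. \<phi>2 j z) \<longlonglongrightarrow> \<phi> z * (1 - indicator F z)" for z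
      unfolding \<phi>2_def by (intro tendsto_intros \<eta>lim)
    show "\<bar>\<phi>2 j z\<bar> \<le> P" for j z using p12[of j z] by simp
  qed (use K\<phi>(3) in auto)
  have "(\<integral>z. u1 z * (\<phi> z * indicator F z) \<partial>lebesgue) + (\<integral>z. u2 z * (\<phi> z * (1 - indicator F z)) \<partial>lebesgue) \<le> (\<integral>z. SS \<delta> N \<phi> z * f z \<partial>lborel)"
    using main by (intro LIMSEQ_le_const2[OF tendsto_add[OF l1 l2]]) auto
  moreover have "(\<integral>z. u1 z * (\<phi> z * indicator F z) \<partial>lebesgue) + (\<integral>z. u2 z * (\<phi> z * (1 - indicator F z)) \<partial>lebesgue) = (\<integral>z. f z * \<phi> z \<partial>lebesgue)"
  proof -
    have "(\<integral>z. u1 z * (\<phi> z * indicator F z) \<partial>lebesgue) + (\<integral>z. u2 z * (\<phi> z * (1 - indicator F z)) \<partial>lebesgue)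
      = (\<integral>z. u1 z * (\<phi> z * indicator F z) + u2 z * (\<phi> z * (1 - indicator F z)) \<partial>lebesgue)"
      using ui[OF uL BIF] ui[OF uL2 BIF'] K\<phi>(3) by simp
    also have "\<dots> = (\<integral>z. f z * \<phi> z \<partial>lebesgue)"
    proof (intro Bochner_Integration.integral_cong refl)
      fix z show "u1 z * (\<phi> z * indicator F z) + u2 z * (\<phi> z * (1 - indicator F z)) = f z * \<phi> z"
        using u1(3)[of z] u2(3)[of z] K\<phi>(2,3) by (cases "z \<in> K\<phi>"; cases "z \<in> F") auto
    qed
    finally show ?thesis .
  qed
  moreover have "(\<integral>z. f z * \<phi> z \<partial>lebesgue) = (\<integral>z. f z * \<phi> z \<partial>lborel)"
    by (rule lebesgue_integral_eq_lborel) (use f(1) BI_measurable[OF BI\<phi>] in simp)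
  ultimately show ?thesis by simp
qed

lemma supp_Kc:
  assumes "K\<phi> \<subseteq> D" "\<And>x. x \<notin> K\<phi> \<Longrightarrow> \<phi> x = 0"
  shows "\<forall>z y. z \<notin> Kc \<longrightarrow> dist z y \<le> real (Suc N) * (a0 * \<delta>) \<longrightarrow> \<phi> y = 0"
proof (intro allI impI)
  fix z y assume zy: "z \<notin> Kc" "dist z y \<le> real (Suc N) * (a0 * \<delta>)"
  have "y \<notin> D" using Kc(3)[of y] zy R_pos R by (auto simp: dist_commute subset_iff)
  then show "\<phi> y = 0" using assms by auto
qed

lemma v_ge_f_weak:
  assumes \<phi>: "continuous_on UNIV \<phi>" "\<And>x. 0 \<le> \<phi> x" and K\<phi>: "compact K\<phi>" "K\<phi> \<subseteq> D" "\<And>x. x \<notin> K\<phi> \<Longrightarrow> \<phi> x = 0"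
  shows "(\<integral>z. f z * \<phi> z \<partial>lborel) - CS B * \<theta> ^ N * (\<integral>z. \<phi> z \<partial>lborel) \<le> (\<integral>z. v z * \<phi> z \<partial>lborel)"
proof -
  have BI\<phi>: "BI \<phi>" by (rule BI_continuous_compact_support[OF \<phi>(1) K\<phi>(1,3)])
  have "\<forall>z y. z \<notin> Kc \<longrightarrow> dist z y \<le> real (Suc N) * (a0 * \<delta>) \<longrightarrow> \<phi> y = 0"
    by (rule supp_Kc[OF K\<phi>(2)]) (rule K\<phi>(3))
  then show ?thesis
    using f_le_SS_weak[OF assms] SS_bounds_weak(1)[OF good f_BI f(2,3) BI\<phi> \<phi>(2) Kc(1,2)] by force
qed

lemma v_ge_f: "AE x in lborel. x \<in> D \<longrightarrow> f x - CS B * \<theta> ^ N \<le> v x"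
proof -
  \<comment> \<open>The indicator of \<open>Kc\<close> makes the constant integrable; on D it equals
    1.\<close>
  define h where "h x = (v x - f x) + indicator Kc x * (CS B * \<theta> ^ N)" for x
  have i: "integrable lborel v" "integrable lborel f" "integrable lborel (\<lambda>x. indicator Kc x * (CS B * \<theta> ^ N))"
    using SS_BI[OF good f_BI] f_BI emeasure_compact_finite[OF Kc(1)] compact_imp_closed[OF Kc(1)]
    by (auto simp: BI_def intro!: integrable_mult_left integrable_real_indicator)
  have "AE x in lborel. x \<in> D \<longrightarrow> 0 \<le> h x"
  proof (rule weak_nonneg_AE[OF D])
    show "integrable lborel h" unfolding h_def[abs_def] using i by simp
    fix \<phi> K assume \<phi>: "continuous_on UNIV \<phi>" "\<And>x. 0 \<le> \<phi> x" and K: "compact K" "K \<subseteq> D" "\<And>x. x \<notin> K \<Longrightarrow> \<phi> x = (0::real)"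
    have BI\<phi>: "BI \<phi>" by (rule BI_continuous_compact_support[OF \<phi>(1) K(1,3)])
    obtain P where P: "\<And>x. \<bar>\<phi> x\<bar> \<le> P" using BI\<phi> by (auto simp: BI_def)
    have prod: "integrable lborel (\<lambda>x. g x * \<phi> x)" if g: "integrable lborel g" for g :: "'a \<Rightarrow> real"
      by (rule Bochner_Integration.integrable_bound[of _ "\<lambda>x. P * g x"])
        (use g BI_measurable[OF BI\<phi>] in \<open>auto simp: abs_mult mult.commute[of P] intro!: AE_I2 mult_left_mono order_trans[OF P abs_ge_self] dest: borel_measurable_integrable\<close>)
    have "h x * \<phi> x = v x * \<phi> x - f x * \<phi> x + (CS B * \<theta> ^ N) * \<phi> x" for x
    proof (cases "x \<in> K")
      case True
      then have "x \<in> Kc" using K(2) Kc(3)[of x] R_pos by (auto simp: subset_iff)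
      then show ?thesis by (simp add: h_def algebra_simps)
    qed (use K(3) in simp)
    then have "(\<integral>x. h x * \<phi> x \<partial>lborel) = (\<integral>x. v x * \<phi> x \<partial>lborel) - (\<integral>x. f x * \<phi> x \<partial>lborel) + (CS B * \<theta> ^ N) * (\<integral>x. \<phi> x \<partial>lborel)"
      using prod[OF i(1)] prod[OF i(2)] BI\<phi> by (simp add: BI_def)
    then show "0 \<le> (\<integral>x. h x * \<phi> x \<partial>lborel)" using v_ge_f_weak[OF \<phi> K] by simp
  qed
  then show ?thesis
  proof eventually_elim
    case (elim x)
    show ?case
    proof
      assume x: "x \<in> D"
      then have "x \<in> Kc" using Kc(3)[of x] R_pos by auto
      then show "f x - CS B * \<theta> ^ N \<le> v x" using elim x by (simp add: h_def)
    qed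
  qed
qed

text \<open>The resolvent equation reads \<delta>^2 L v = v - f + \<open>QN\<close> f. The
  difference v - f is almost nonnegative by \<open>v_ge_f_weak\<close>, and the remainder is of
  order \<open>\<theta> ^ N\<close>.\<close>

lemma v_almost_subsolution:
  assumes \<phi>: "C2c D \<phi>" "\<And>x. 0 \<le> \<phi> x"
  shows "- ((CS B + B) * \<theta> ^ N / \<delta>\<^sup>2) * (\<integral>z. \<phi> z \<partial>lborel) \<le> (\<integral>z. v z * Lg A \<phi> z \<partial>lborel)"
proof -
  note \<delta> = good_pos[OF good]
  have D\<Omega>: "D \<subseteq> \<Omega>"
  proof
    fix z assume "z \<in> D"
    then show "z \<in> \<Omega>" using Kc(2,3) R_pos by (auto simp: subset_iff)
  qed
  have c: "C2c \<Omega> \<phi>" using \<phi>(1) D\<Omega> by (auto simp: C2c_def)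
  obtain K where K: "compact K" "K \<subseteq> D" "\<And>x. x \<notin> K \<Longrightarrow> \<phi> x = 0" using \<phi>(1) by (auto simp: C2c_def)
  have \<phi>c: "continuous_on UNIV \<phi>" by (rule C2cD(6)[OF \<phi>(1)])
  have BI\<phi>: "BI \<phi>" by (rule BI_continuous_compact_support[OF \<phi>c K(1,3)])
  have \<phi>i: "integrable lborel \<phi>" using BI\<phi> by (simp add: BI_def)
  have \<phi>I: "0 \<le> (\<integral>z. \<phi> z \<partial>lborel)" using \<phi>(2) by (intro integral_nonneg_AE) auto
  have Lz: "Lg A \<phi> x = 0" if "x \<notin> K" for x by (rule Lg_zero_outside[OF compact_imp_closed[OF K(1)] K(3) that])
  have cL: "continuous_on K (Lg A \<phi>)"
    using cont_Lg[OF Ck_subset[OF open_UNIV open_dom subset_UNIV C2cD(1)[OF c]] open_dom order_refl] K(2) D\<Omega> continuous_on_subset by blast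
  have vc: "continuous_on S v" for S by (rule SS_continuous[OF good f_BI])
  have i1: "integrable lborel (\<lambda>z. v z * \<phi> z)"
    by (rule integrable_continuous_compact_support(1)[OF K(1)]) (use K(3) vc continuous_on_subset[OF \<phi>c] in \<open>auto intro!: continuous_intros\<close>)
  have i2: "integrable lborel (\<lambda>z. v z * Lg A \<phi> z)"
    by (rule integrable_continuous_compact_support(1)[OF K(1)]) (use Lz vc cL in \<open>auto intro!: continuous_intros\<close>)
  obtain P where P: "\<And>x. \<bar>\<phi> x\<bar> \<le> P" using BI\<phi> by (auto simp: BI_def)
  have i3: "integrable lborel (\<lambda>z. \<phi> z * g z)" if "BI g" for g
    by (rule Bochner_Integration.integrable_bound[of _ "\<lambda>x. P * g x"])
      (use that BI_measurable[OF that] BI_measurable[OF BI\<phi>] in \<open>auto simp: BI_def abs_mult intro!: AE_I2 mult_right_mono order_trans[OF P abs_ge_self]\<close>)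
  note Q = QN_contract[OF good f_BI f(2), of N]
  have Qint: "- (\<theta> ^ N * B) * (\<integral>z. \<phi> z \<partial>lborel) \<le> (\<integral>z. \<phi> z * QN \<delta> N f z \<partial>lborel)"
  proof -
    have "- (\<theta> ^ N * B) * (\<integral>z. \<phi> z \<partial>lborel) = (\<integral>z. \<phi> z * - (\<theta> ^ N * B) \<partial>lborel)" by simp
    also have "\<dots> \<le> (\<integral>z. \<phi> z * QN \<delta> N f z \<partial>lborel)"
    proof (rule integral_mono)
      show "\<phi> z * - (\<theta> ^ N * B) \<le> \<phi> z * QN \<delta> N f z" for z using Q[of z] by (intro mult_left_mono \<phi>(2)) linarith
    qed (use i3[OF QN_BI[OF good f_BI]] \<phi>i in auto)
    finally show ?thesis .
  qed
  have "(\<integral>z. v z * (\<phi> z - \<delta>\<^sup>2 * Lg A \<phi> z) \<partial>lborel) = (\<integral>z. v z * \<phi> z \<partial>lborel) - \<delta>\<^sup>2 * (\<integral>z. v z * Lg A \<phi> z \<partial>lborel)"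
  proof -
    have "(\<integral>z. v z * (\<phi> z - \<delta>\<^sup>2 * Lg A \<phi> z) \<partial>lborel) = (\<integral>z. v z * \<phi> z - \<delta>\<^sup>2 * (v z * Lg A \<phi> z) \<partial>lborel)"
      by (intro Bochner_Integration.integral_cong refl) (simp add: algebra_simps)
    then show ?thesis using i1 i2 by simp
  qed
  moreover have "(\<integral>z. \<phi> z * (f z - QN \<delta> N f z) \<partial>lborel) = (\<integral>z. f z * \<phi> z \<partial>lborel) - (\<integral>z. \<phi> z * QN \<delta> N f z \<partial>lborel)"
    using i3[OF f_BI] i3[OF QN_BI[OF good f_BI]] by (simp add: right_diff_distrib mult.commute[of "f _"])
  ultimately have "\<delta>\<^sup>2 * (\<integral>z. v z * Lg A \<phi> z \<partial>lborel) = (\<integral>z. v z * \<phi> z \<partial>lborel) - (\<integral>z. f z * \<phi> z \<partial>lborel) + (\<integral>z. \<phi> z * QN \<delta> N f z \<partial>lborel)"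
    using SS_weak[OF good f_BI c, of N] by simp
  also have "\<dots> \<ge> - ((CS B + B) * \<theta> ^ N) * (\<integral>z. \<phi> z \<partial>lborel)"
    using v_ge_f_weak[OF \<phi>c \<phi>(2) K] Qint by (simp add: algebra_simps)
  finally show ?thesis using \<delta> by (simp add: field_simps)
qed

text \<open>Up to the truncation error v averages f near z0. The radius 2R is R for the range of the
  kernel plus R for the support of the test functions in
  \<open>weak_upper_pointwise\<close>.\<close>

lemma v_upper:
  assumes z0: "z0 \<in> D" "cball z0 (2 * R) \<subseteq> D" and s: "\<And>z. z \<in> cball z0 (2 * R) \<Longrightarrow> f z \<le> s" "s \<le> 0"
  shows "v z0 \<le> s + 2 * B * \<theta> ^ N"
proof (rule weak_upper_pointwise[OF SS_continuous[OF good f_BI] R_pos])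
  fix \<phi> :: "'a \<Rightarrow> real" assume \<phi>: "continuous_on UNIV \<phi>" "\<And>x. 0 \<le> \<phi> x" "\<And>x. x \<notin> cball z0 R \<Longrightarrow> \<phi> x = 0"
  show "(\<integral>x. v x * \<phi> x \<partial>lborel) \<le> (s + 2 * B * \<theta> ^ N) * (\<integral>x. \<phi> x \<partial>lborel)"
  proof (rule SS_bounds_weak(2)[OF good f_BI f(2,3) BI_continuous_compact_support[OF \<phi>(1) compact_cball \<phi>(3)] \<phi>(2) compact_cball[of z0 "2 * R"]])
    show "cball z0 (2 * R) \<subseteq> \<Omega>" using Kc(3)[OF z0(1)] Kc(2) by blast
    show "\<forall>z y. z \<notin> cball z0 (2 * R) \<longrightarrow> dist z y \<le> real (Suc N) * (a0 * \<delta>) \<longrightarrow> \<phi> y = 0"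
    proof (intro allI impI \<phi>(3))
      fix z y assume "z \<notin> cball z0 (2 * R)" "dist z y \<le> real (Suc N) * (a0 * \<delta>)"
      then show "y \<notin> cball z0 R" using R dist_triangle[of z0 z y] by (auto simp: dist_commute)
    qed
    have "f z0 \<le> s" using s(1)[of z0] R_pos by simp
    then show "\<bar>s\<bar> \<le> B" using f(2)[of z0] s(2) by linarith
  qed (use s in auto)
qed

end

section \<open>Coefficient matrices of forms as elliptic operators\<close>

lemma infdist_le_add: "dist z y \<le> t \<Longrightarrow> infdist z K \<le> s \<Longrightarrow> infdist y K \<le> s + t"
  using infdist_triangle_abs[of y K z] by (simp add: dist_commute)

text \<open>Segments of length at most r that start in the 3r-neighbourhood stay in the compact
  4r-neighbourhood, where the derivatives are bounded.\<close>

lemma C1_lipschitz_near: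
  fixes f :: "'a::euclidean_space \<Rightarrow> 'b::real_normed_vector"
  assumes f: "Ck 1 f W" "open W" and K: "compact K" "K \<noteq> {}" and r: "0 < r" and W: "{z. infdist z K \<le> 4 * r} \<subseteq> W"
  shows "\<exists>L\<ge>0. \<forall>z y. infdist z K \<le> 3 * r \<longrightarrow> dist z y \<le> r \<longrightarrow> norm (f z - f y) \<le> L * dist z y"
proof -
  let ?K = "{z. infdist z K \<le> 4 * r}"
  have f1: "f differentiable_on W" "continuous_on W (Dd f v)" for v using f(1) by (auto simp: One_nat_def Ck_Suc_iff)
  have Kc: "compact ?K" by (rule compact_infdist_le[OF K(2,1)]) (use r in simp)
  have "\<exists>B. \<forall>x\<in>?K. norm (Dd f b x) \<le> B" for b
  proof -
    have "compact (Dd f b ` ?K)" by (intro compact_continuous_image continuous_on_subset[OF f1(2) W] Kc)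
    then show ?thesis by (auto simp: bounded_iff dest!: compact_imp_bounded)
  qed
  then obtain B where B: "\<And>b x. x \<in> ?K \<Longrightarrow> norm (Dd f b x) \<le> B b" by metis
  define L where "L = (\<Sum>b\<in>Basis. \<bar>B b\<bar>)"
  have on: "onorm (\<lambda>v. Dd f v x) \<le> L" if x: "x \<in> ?K" for x
  proof (rule onorm_le)
    fix v :: 'a
    have "bounded_linear (\<lambda>v. Dd f v x)"
      by (rule has_derivative_bounded_linear[OF has_derivative_Dd[OF f1(1) f(2)]]) (use x W in auto)
    then have lin: "linear (\<lambda>v. Dd f v x)" by (rule bounded_linear.linear)
    have "Dd f v x = Dd f (\<Sum>b\<in>Basis. (v \<bullet> b) *\<^sub>R b) x" by (simp add: euclidean_representation)
    also have "\<dots> = (\<Sum>b\<in>Basis. (v \<bullet> b) *\<^sub>R Dd f b x)" using linear_sum[OF lin, of "\<lambda>b. (v \<bullet> b) *\<^sub>R b" Basis] by (simp only: linear_scale[OF lin])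
    also have "norm \<dots> \<le> (\<Sum>b\<in>Basis. \<bar>B b\<bar> * norm v)"
    proof (intro sum_norm_le)
      fix b :: 'a assume b: "b \<in> Basis"
      have "norm ((v \<bullet> b) *\<^sub>R Dd f b x) = \<bar>v \<bullet> b\<bar> * norm (Dd f b x)" by simp
      also have "\<dots> \<le> norm v * \<bar>B b\<bar>" using Basis_le_norm[OF b, of v] B[OF x, of b] by (intro mult_mono) auto
      finally show "norm ((v \<bullet> b) *\<^sub>R Dd f b x) \<le> \<bar>B b\<bar> * norm v" by (simp add: mult.commute)
    qed
    finally show "norm (Dd f v x) \<le> L * norm v" by (simp add: L_def sum_distrib_right)
  qed
  have "norm (f z - f y) \<le> L * dist z y" if z: "infdist z K \<le> 3 * r" "dist z y \<le> r" for z y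
  proof -
    have sub: "cball z r \<subseteq> ?K" using infdist_le_add[OF _ z(1), of _ r] by (force simp: subset_iff)
    have "norm (f z - f y) \<le> L * norm (z - y)"
    proof (rule differentiable_bound[OF convex_cball[of z r]])
      show "(f has_derivative (\<lambda>v. Dd f v x)) (at x within cball z r)" if "x \<in> cball z r" for x
        by (rule has_derivative_at_withinI[OF has_derivative_Dd[OF f1(1) f(2)]]) (use that sub W in auto)
      show "onorm (\<lambda>v. Dd f v x) \<le> L" if "x \<in> cball z r" for x using on sub that by blast
    qed (use z r in auto)
    then show ?thesis by (simp add: dist_norm)
  qed
  moreover have "0 \<le> L" by (simp add: L_def sum_nonneg)
  ultimately show ?thesis by blast
qed

text \<open>The real operator on R^(2n) belonging to a complex matrix, symmetric when the matrix is
  Hermitian; 1/4 is the factor that appears when d^2 / dz d conj z is written with real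
  derivatives.\<close>

definition hop :: "complex^'n^'n \<Rightarrow> 'n::finite cvec \<Rightarrow> 'n cvec" where
  "hop M v = (1 / 4) *\<^sub>R (M *v v)"

lemma hop_nth: "hop M v $ j = (\<Sum>k\<in>UNIV. M $ j $ k * v $ k) / 4"
  by (simp add: hop_def matrix_vector_mult_def scaleR_conv_of_real[where 'a=complex])

lemma hop_inner: "hop M v \<bullet> w = (1 / 4) * Re (\<Sum>j\<in>UNIV. \<Sum>k\<in>UNIV. cnj (w $ j) * M $ j $ k * v $ k)"
proof -
  have c: "x \<bullet> y = Re (cnj y * x)" for x y :: complex by (simp add: inner_complex_def mult.commute)
  have "hop M v \<bullet> w = (\<Sum>j\<in>UNIV. Re (cnj (w $ j) * (\<Sum>k\<in>UNIV. M $ j $ k * v $ k)) / 4)"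
    unfolding inner_vec_def c hop_nth by (intro sum.cong refl) (simp flip: Re_divide_numeral)
  then show ?thesis by (simp add: sum_distrib_left sum_divide_distrib mult.assoc Re_sum)
qed

lemma linear_hop: "linear (hop M)"
proof (rule linearI)
  show "hop M (x + y) = hop M x + hop M y" for x y
    by (simp add: vec_eq_iff hop_nth distrib_left sum.distrib add_divide_distrib)
  show "hop M (c *\<^sub>R x) = c *\<^sub>R hop M x" for c x
    by (simp add: vec_eq_iff hop_nth sum_distrib_left scaleR_conv_of_real[where 'a=complex] mult.left_commute)
qed

lemma linear_hop_matrix: "linear (\<lambda>M. hop M v)"
proof (rule linearI)
  show "hop (x + y) v = hop x v + hop y v" for x y
    by (simp add: vec_eq_iff hop_nth distrib_right sum.distrib add_divide_distrib)
  show "hop (c *\<^sub>R x) v = c *\<^sub>R hop x v" for c x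
    by (simp add: vec_eq_iff hop_nth sum_distrib_left scaleR_conv_of_real[where 'a=complex] mult.assoc)
qed

lemma hop_symmetric:
  assumes "\<And>j k. M $ j $ k = cnj (M $ k $ j)"
  shows "hop M v \<bullet> w = v \<bullet> hop M w"
proof -
  have "(\<Sum>j\<in>UNIV. \<Sum>k\<in>UNIV. cnj (w $ j) * M $ j $ k * v $ k) = cnj (\<Sum>j\<in>UNIV. \<Sum>k\<in>UNIV. cnj (v $ j) * M $ j $ k * w $ k)"
    (is "?l = cnj ?r")
  proof -
    have "?l = (\<Sum>k\<in>UNIV. \<Sum>j\<in>UNIV. cnj (w $ j) * M $ j $ k * v $ k)" by (rule sum.swap)
    also have "\<dots> = cnj ?r"
      unfolding cnj_sum complex_cnj_mult complex_cnj_cnj assms[of _ _, symmetric] by (simp add: mult_ac)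
    finally show ?thesis .
  qed
  then have "Re ?l = Re ?r" by (simp only: cnj.sel(1))
  then show ?thesis using hop_inner[of M v w] hop_inner[of M w v] by (simp add: inner_commute)
qed

lemma norm_hop_le: "norm (hop M v) \<le> (real CARD('n))\<^sup>2 * norm M * norm v" for M :: "complex^'n::finite^'n"
proof -
  have "norm (hop M v $ j) \<le> (\<Sum>k\<in>(UNIV::'n set). norm M * norm v)" for j
  proof -
    have "norm (hop M v $ j) \<le> (\<Sum>k\<in>UNIV. norm (M $ j $ k * v $ k)) / 4"
      unfolding hop_nth norm_divide by (simp add: sum_norm_le norm_sum divide_right_mono)
    also have "\<dots> \<le> (\<Sum>k\<in>UNIV. norm (M $ j $ k * v $ k))"
      by (simp add: sum_nonneg)
    also have "\<dots> \<le> (\<Sum>k\<in>(UNIV::'n set). norm M * norm v)"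
    proof (rule sum_mono)
      fix k :: 'n
      have "norm (M $ j $ k) \<le> norm M" by (rule order_trans[OF Finite_Cartesian_Product.norm_nth_le Finite_Cartesian_Product.norm_nth_le])
      then show "norm (M $ j $ k * v $ k) \<le> norm M * norm v"
        unfolding norm_mult by (intro mult_mono Finite_Cartesian_Product.norm_nth_le) auto
    qed
    finally show ?thesis .
  qed
  then have "norm (hop M v) \<le> (\<Sum>j\<in>(UNIV::'n set). \<Sum>k\<in>(UNIV::'n set). norm M * norm v)"
    unfolding norm_vec_def[of "hop M v"] by (intro order_trans[OF L2_set_le_sum sum_mono]) auto
  then show ?thesis by (simp add: power2_eq_square)
qed

lemma sum_Basis_cvec: "(\<Sum>i\<in>(Basis::'n::finite cvec set). f i) = (\<Sum>j\<in>UNIV. f (ex j) + f (ey j))"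
proof -
  have B: "(Basis::'n cvec set) = range ex \<union> range ey" by (auto simp: Basis_vec_def ex_def ey_def Basis_complex_def)
  have "(\<Sum>i\<in>(Basis::'n cvec set). f i) = sum f (range ex) + sum f (range ey)"
    unfolding B by (rule sum.union_disjoint) (auto simp: ex_def ey_def axis_eq_axis complex_eq_iff)
  moreover have "inj (ex :: 'n \<Rightarrow> 'n cvec)" "inj (ey :: 'n \<Rightarrow> 'n cvec)" by (auto simp: inj_def ex_def ey_def axis_eq_axis)
  ultimately show ?thesis by (simp add: sum.reindex sum.distrib)
qed

lemma hop_axis: "hop M (axis j c) \<bullet> axis k d = ((M $ k $ j * c) / 4) \<bullet> d"
proof -
  have "(\<Sum>l\<in>UNIV. M $ k $ l * axis j c $ l) = (\<Sum>l\<in>UNIV. if l = j then M $ k $ l * c else 0)"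
    by (intro sum.cong refl) (simp add: axis_def)
  then show ?thesis unfolding inner_axis hop_nth by (simp add: sum.delta)
qed

lemma hop_ex_ey:
  "hop M (ex j) \<bullet> ex k = Re (M $ k $ j) / 4" "hop M (ex j) \<bullet> ey k = Im (M $ k $ j) / 4"
  "hop M (ey j) \<bullet> ex k = - Im (M $ k $ j) / 4" "hop M (ey j) \<bullet> ey k = Re (M $ k $ j) / 4"
  unfolding ex_def ey_def hop_axis by (simp_all add: inner_complex_def)

text \<open>\<open>hop\<close> brings the entry (k, j) where \<open>Lop\<close> has (j, k);
  Hermitian symmetry reconciles the signs of the imaginary parts.\<close>

lemma Lg_hop:
  fixes a :: "'n::finite coefmat"
  assumes "\<And>j k. a z $ j $ k = cnj (a z $ k $ j)"
  shows "Lg (\<lambda>z. hop (a z)) w z = Lop a w z"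
proof -
  have d: "d2 w z u v = Dd (Dd w u) v z" for u v by (simp add: d2_def Dd_def)
  have "Lg (\<lambda>z. hop (a z)) w z = (\<Sum>j\<in>UNIV. \<Sum>k\<in>UNIV. Re (a z $ j $ k * ddbar w j k z))"
    unfolding Lg_def sum_Basis_cvec hop_ex_ey sum.distrib[symmetric]
  proof (intro sum.cong refl)
    fix j k :: 'n
    have "Re (a z $ k $ j) = Re (a z $ j $ k)" "Im (a z $ k $ j) = - Im (a z $ j $ k)" using assms[of k j] by simp_all
    then show "Re (a z $ k $ j) / 4 * Dd (Dd w (ex j)) (ex k) z + Im (a z $ k $ j) / 4 * Dd (Dd w (ex j)) (ey k) z +
        (- Im (a z $ k $ j) / 4 * Dd (Dd w (ey j)) (ex k) z + Re (a z $ k $ j) / 4 * Dd (Dd w (ey j)) (ey k) z) =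
        Re (a z $ j $ k * ddbar w j k z)"
      by (simp add: ddbar_def d algebra_simps add_divide_distrib diff_divide_distrib)
  qed
  then show ?thesis by (simp add: Lop_def Re_sum)
qed

lemma Lop_zero_outside:
  assumes "closed K" "\<And>x. x \<notin> K \<Longrightarrow> f x = 0" "x \<notin> K"
  shows "Lop a f x = 0"
proof -
  have "d2 f x u v = 0" for u v
    using Dd_zero_outside[OF assms(1) Dd_zero_outside[OF assms(1,2)] assms(3)] by (simp add: d2_def Dd_def)
  then show ?thesis by (simp add: Lop_def ddbar_def)
qed

text \<open>The parametrix lives on the whole space, the form only on U. Interpolating between the
  form and the identity by a Lipschitz cut-off keeps ellipticity and the Lipschitz bound; vanishing
  divergence is claimed where the cut-off is 1.\<close>

lemma form_extension:
  fixes a :: "'n::finite coefmat"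
  assumes a: "alpha_form a U" and K: "compact K" "K \<noteq> {}" and W: "open W" "K \<subseteq> W" "W \<subseteq> U"
  obtains r A \<mu> \<Lambda> Lip where "0 < r" "{z. infdist z K \<le> 4 * r} \<subseteq> W"
    "elliptic_region A \<mu> \<Lambda> Lip {z. infdist z K < 2 * r}"
    "\<And>w z. infdist z K < 2 * r \<Longrightarrow> Lg A w z = Lop a w z"
proof -
  have aU: "open U" "Ck 1 a U" and herm: "\<And>z j k. z \<in> U \<Longrightarrow> a z $ j $ k = cnj (a z $ k $ j)"
    and posd: "\<And>z v. z \<in> U \<Longrightarrow> v \<noteq> 0 \<Longrightarrow> 0 < Re (\<Sum>j\<in>UNIV. \<Sum>k\<in>UNIV. cnj (v $ j) * a z $ j $ k * v $ k)"
    and closed_form: "\<And>z k. z \<in> U \<Longrightarrow> (\<Sum>j\<in>UNIV. dz (\<lambda>y. a y $ j $ k) j z) = 0"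
    using a unfolding alpha_form_def by blast+
  obtain r0 where r0: "r0 > 0" "(\<Union>x\<in>K. cball x r0) \<subseteq> W"
    using compact_subset_open_imp_cball_epsilon_subset[OF K(1) W(1,2)] by blast
  define r where "r = r0 / 4"
  have r: "0 < r" using r0 by (simp add: r_def)
  define C where "C = {z. infdist z K \<le> 4 * r}"
  have CW: "C \<subseteq> W"
  proof
    fix x assume x: "x \<in> C"
    obtain y where "y \<in> K" "infdist x K = dist x y" using infdist_attains_inf[OF compact_imp_closed[OF K(1)] K(2)] by blast
    then have "x \<in> cball y r0" "y \<in> K" using x by (auto simp: C_def r_def dist_commute)
    then show "x \<in> W" using r0(2) by blast
  qed
  have CU: "C \<subseteq> U" using CW W by blast
  have Cc: "compact C" unfolding C_def by (rule compact_infdist_le[OF K(2,1)]) (use r in simp)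
  have a1: "a differentiable_on U" "continuous_on U (Dd a v)" for v using aU(2) by (auto simp: One_nat_def Ck_Suc_iff)
  have ac: "continuous_on U a" by (rule differentiable_imp_continuous_on[OF a1(1)])
  obtain S where S: "\<And>z. z \<in> C \<Longrightarrow> norm (a z) \<le> S" "0 < S"
  proof -
    have "compact (a ` C)" by (intro compact_continuous_image continuous_on_subset[OF ac CU] Cc)
    then obtain S where "0 < S" "\<forall>x\<in>a ` C. norm x \<le> S" using compact_imp_bounded bounded_pos by blast
    then show thesis using that by blast
  qed
  obtain L0 where L0: "0 \<le> L0" "\<And>z y. infdist z K \<le> 3 * r \<Longrightarrow> dist z y \<le> r \<Longrightarrow> norm (a z - a y) \<le> L0 * dist z y"
    using C1_lipschitz_near[OF aU(2,1) K r] CU unfolding C_def by blast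
  define \<eta> where "\<eta> z = max 0 (min 1 (3 - infdist z K / r))" for z
  have \<eta>01: "0 \<le> \<eta> z" "\<eta> z \<le> 1" for z by (auto simp: \<eta>_def)
  have \<eta>1: "\<eta> z = 1" if "infdist z K < 2 * r" for z
  proof -
    have "infdist z K / r < 2" using that r by (simp add: pos_divide_less_eq)
    then show ?thesis by (simp add: \<eta>_def)
  qed
  have \<eta>0: "\<eta> z = 0" if "\<not> infdist z K \<le> 3 * r" for z
  proof -
    have "3 \<le> infdist z K / r" using that r by (simp add: pos_le_divide_eq)
    then show ?thesis by (simp add: \<eta>_def)
  qed
  have \<eta>L: "\<bar>\<eta> z - \<eta> y\<bar> \<le> dist z y / r" for z y
  proof -
    have "\<bar>\<eta> z - \<eta> y\<bar> \<le> \<bar>infdist z K / r - infdist y K / r\<bar>" unfolding \<eta>_def by linarith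
    also have "\<dots> = \<bar>infdist z K - infdist y K\<bar> / r" using r by (simp flip: diff_divide_distrib)
    also have "\<dots> \<le> dist z y / r" using infdist_triangle_abs r by (intro divide_right_mono) auto
    finally show ?thesis .
  qed
  have Sb: "norm (\<eta> z *\<^sub>R a z) \<le> S" for z
  proof (cases "infdist z K \<le> 3 * r")
    case True
    then have "z \<in> C" using r by (simp add: C_def)
    then have "\<eta> z * norm (a z) \<le> 1 * S" using S \<eta>01[of z] by (intro mult_mono) auto
    then show ?thesis using \<eta>01[of z] by simp
  qed (use S(2) \<eta>0 in simp)
  \<comment> \<open>The term 2 S / r serves twice: it majorises the contribution S / r of the
    cut-off at short distance, and it covers the trivial bound 2 S at distances beyond r.\<close>
  define LM where "LM = 2 * S / r + L0"
  have LM0: "0 \<le> LM" using S r L0 by (simp add: LM_def)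
  have near: "norm (\<eta> z *\<^sub>R a z - \<eta> y *\<^sub>R a y) \<le> LM * dist z y" if z: "infdist z K \<le> 3 * r" "dist z y \<le> r" for z y
  proof -
    have "z \<in> C" using z r by (simp add: C_def)
    have "\<eta> z *\<^sub>R a z - \<eta> y *\<^sub>R a y = (\<eta> z - \<eta> y) *\<^sub>R a z + \<eta> y *\<^sub>R (a z - a y)" by (simp add: algebra_simps)
    also have "norm \<dots> \<le> \<bar>\<eta> z - \<eta> y\<bar> * norm (a z) + \<eta> y * norm (a z - a y)"
      by (rule norm_triangle_le) (use \<eta>01[of y] in simp)
    also have "\<dots> \<le> dist z y / r * S + 1 * (L0 * dist z y)"
      using \<eta>L S(1)[OF \<open>z \<in> C\<close>] L0(2)[OF z] \<eta>01[of y] r by (intro add_mono mult_mono) auto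
    also have "\<dots> \<le> LM * dist z y"
    proof -
      define t where "t = dist z y / r * S"
      have "0 \<le> t" unfolding t_def using S(2) r by simp
      moreover have "LM * dist z y = 2 * t + L0 * dist z y" using r by (simp add: t_def LM_def field_simps)
      ultimately show ?thesis unfolding t_def[symmetric] by simp
    qed
    finally show ?thesis .
  qed
  have Mlip: "norm (\<eta> z *\<^sub>R a z - \<eta> y *\<^sub>R a y) \<le> LM * dist z y" for z y
  proof (cases "dist z y \<le> r")
    case True
    show ?thesis
    proof (cases "infdist z K \<le> 3 * r \<or> infdist y K \<le> 3 * r")
      case True
      then show ?thesis using near[of z y] near[of y z] \<open>dist z y \<le> r\<close> by (metis dist_commute norm_minus_commute)
    next
      case False then show ?thesis using \<eta>0 LM0 by simp
    qed
  next
    case False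
    have "norm (\<eta> z *\<^sub>R a z - \<eta> y *\<^sub>R a y) \<le> 2 * S" using norm_triangle_ineq4[of "\<eta> z *\<^sub>R a z" "\<eta> y *\<^sub>R a y"] Sb[of z] Sb[of y] by linarith
    also have "\<dots> = 2 * S / r * r" using r by simp
    also have "\<dots> \<le> 2 * S / r * dist z y" using False S r by (intro mult_left_mono) auto
    also have "\<dots> \<le> LM * dist z y" using L0 by (simp add: LM_def distrib_right)
    finally show ?thesis .
  qed
  define A where "A z v = hop (\<eta> z *\<^sub>R a z) v + (1 - \<eta> z) *\<^sub>R v" for z v
  have A_eq: "A z v = \<eta> z *\<^sub>R hop (a z) v + (1 - \<eta> z) *\<^sub>R v" for z v
    using linear_scale[OF linear_hop_matrix[of v]] by (simp add: A_def)
  define c where "c = (real CARD('n))\<^sup>2"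
  have c0: "0 \<le> c" by (simp add: c_def)
  have supp: "z \<in> C" if "\<eta> z \<noteq> 0" for z using that \<eta>0[of z] r by (force simp: C_def)
  \<comment> \<open>Uniform positivity by compactness of C times the unit sphere, extended to all
    vectors by homogeneity.\<close>
  obtain m where m: "0 < m" "\<And>z v. z \<in> C \<Longrightarrow> m * (v \<bullet> v) \<le> hop (a z) v \<bullet> v"
  proof -
    let ?S = "C \<times> sphere (0::'n cvec) 1"
    let ?g = "\<lambda>(z, v). hop (a z) v \<bullet> v"
    have "continuous_on ?S (\<lambda>p. (1 / 4) * Re (\<Sum>j\<in>UNIV. \<Sum>k\<in>UNIV. cnj (snd p $ j) * a (fst p) $ j $ k * snd p $ k))"
      by (intro continuous_intros continuous_on_compose2[OF ac continuous_on_fst[OF continuous_on_id]]) (use CU in auto)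
    then have gc: "continuous_on ?S ?g" by (simp add: hop_inner case_prod_unfold)
    have ne: "?S \<noteq> {}"
    proof -
      obtain z where "z \<in> K" using K(2) by blast
      then have "z \<in> C" using r by (simp add: C_def)
      moreover have "(ex undefined :: 'n cvec) \<in> Basis" by (auto simp: ex_def Basis_vec_def Basis_complex_def)
      then have "ex undefined \<in> sphere (0::'n cvec) 1" by simp
      ultimately show ?thesis by blast
    qed
    obtain p where p: "p \<in> ?S" "\<And>q. q \<in> ?S \<Longrightarrow> ?g p \<le> ?g q"
      using continuous_attains_inf[OF compact_Times[OF Cc compact_sphere] ne gc] by blast
    have "0 < ?g p"
    proof -
      have "fst p \<in> U" "snd p \<noteq> 0" using p(1) CU by auto
      then show ?thesis using posd[of "fst p" "snd p"] by (simp add: hop_inner case_prod_unfold)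
    qed
    moreover have "?g p * (v \<bullet> v) \<le> hop (a z) v \<bullet> v" if "z \<in> C" for z v
    proof (cases "v = 0")
      case True then show ?thesis by simp
    next
      case False
      let ?u = "(1 / norm v) *\<^sub>R v"
      have u: "norm ?u = 1" using False by simp
      have E1: "hop (a z) v \<bullet> v = (hop (a z) ?u \<bullet> ?u) * (v \<bullet> v)"
        using False by (simp add: linear_scale[OF linear_hop] power2_norm_eq_inner[symmetric] power2_eq_square)
      have E2: "?g p \<le> hop (a z) ?u \<bullet> ?u" using p(2)[of "(z, ?u)"] u that by (simp del: norm_scaleR inner_scaleR_left inner_scaleR_right)
      show ?thesis unfolding E1 by (rule mult_right_mono[OF E2]) simp
    qed
    ultimately show thesis using that by blast
  qed
  define \<Omega> where "\<Omega> = {z. infdist z K < 2 * r}"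
  have \<Omega>U: "\<Omega> \<subseteq> U" using CU r by (auto simp: \<Omega>_def C_def)
  have \<Omega>o: "open \<Omega>" unfolding \<Omega>_def by (intro open_Collect_less continuous_intros)
  have A\<Omega>: "A z = hop (a z)" if "z \<in> \<Omega>" for z using \<eta>1[of z] that by (auto simp: A_eq \<Omega>_def)
  have der: "((\<lambda>z. A z i \<bullet> j) has_derivative (\<lambda>v. hop (Dd a v z) i \<bullet> j)) (at z)" if z: "z \<in> \<Omega>" for z i j
  proof -
    have bl: "bounded_linear (\<lambda>M. hop M i)" using linear_hop_matrix by (simp add: linear_conv_bounded_linear)
    have "((\<lambda>z. hop (a z) i \<bullet> j) has_derivative (\<lambda>v. hop (Dd a v z) i \<bullet> j)) (at z)"
      by (intro has_derivative_inner_left bounded_linear.has_derivative[OF bl] has_derivative_Dd[OF a1(1) aU(1)]) (use z \<Omega>U in auto)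
    then show ?thesis by (rule has_derivative_transform_within_open[OF _ \<Omega>o z]) (simp add: A\<Omega>)
  qed
  have DdA: "Dd (\<lambda>z. A z i \<bullet> j) v z = hop (Dd a v z) i \<bullet> j" if "z \<in> \<Omega>" for z i j v by (rule Dd_unique[OF der[OF that]])
  have div0: "(\<Sum>j\<in>Basis. hop (Dd a j z) i \<bullet> j) = 0" if z: "z \<in> \<Omega>" and i: "i \<in> Basis" for z i
  proof -
    have zU: "z \<in> U" using z \<Omega>U by auto
    have d1: "d1 (\<lambda>y. a y $ j $ k) z v = Dd a v z $ j $ k" for j k v
    proof -
      have "((\<lambda>y. a y $ j $ k) has_derivative (\<lambda>v. Dd a v z $ j $ k)) (at z)"
        by (intro bounded_linear.has_derivative[OF bounded_linear_vec_nth] has_derivative_Dd[OF a1(1) aU(1) zU])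
      from Dd_unique[OF this, of v] show ?thesis by (simp add: d1_def Dd_def)
    qed
    \<comment> \<open>The real and imaginary parts of this equation are the divergence conditions
      for the coordinates \<open>ex p\<close> and \<open>ey p\<close>.\<close>
    have z0: "(\<Sum>j\<in>UNIV. Dd a (ex j) z $ j $ k - \<i> * Dd a (ey j) z $ j $ k) = 0" for k
      using closed_form[OF zU, of k] by (simp add: dz_def d1 flip: sum_divide_distrib)
    have re: "(\<Sum>j\<in>UNIV. Re (Dd a (ex j) z $ j $ k) + Im (Dd a (ey j) z $ j $ k)) = 0" for k
      using arg_cong[OF z0[of k], of Re] by (simp add: Re_sum)
    have im: "(\<Sum>j\<in>UNIV. Im (Dd a (ex j) z $ j $ k) - Re (Dd a (ey j) z $ j $ k)) = 0" for k
      using arg_cong[OF z0[of k], of Im] by (simp add: Im_sum)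
    obtain p where "i = ex p \<or> i = ey p" using i by (auto simp: Basis_vec_def ex_def ey_def Basis_complex_def)
    then show ?thesis
    proof
      assume "i = ex p"
      then show ?thesis using re[of p] by (simp add: sum_Basis_cvec hop_ex_ey flip: add_divide_distrib sum_divide_distrib)
    next
      assume "i = ey p"
      then have "(\<Sum>j\<in>Basis. hop (Dd a j z) i \<bullet> j) = - (\<Sum>j\<in>UNIV. Im (Dd a (ex j) z $ j $ p) - Re (Dd a (ey j) z $ j $ p)) / 4"
        by (simp add: sum_Basis_cvec hop_ex_ey sum_subtractf sum.distrib sum_negf sum_divide_distrib[symmetric] diff_divide_distrib add_divide_distrib)
      then show ?thesis using im[of p] by simp
    qed
  qed
  define \<mu> where "\<mu> = min m 1"
  have "elliptic_region A \<mu> (c * S + 1) (c * LM + 1 / r) \<Omega>"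
  proof (intro elliptic_region.intro)
    show "elliptic A \<mu> (c * S + 1) (c * LM + 1 / r)"
    proof (rule elliptic.intro)
      show "2 \<le> DIM('n cvec)" by simp
      show "linear (A z)" for z
        unfolding A_def[abs_def] by (intro linear_compose_add linear_hop linear_scaleR)
      show "A z v \<bullet> w = v \<bullet> A z w" for z v w
      proof (cases "\<eta> z = 0")
        case False
        have "hop (a z) v \<bullet> w = v \<bullet> hop (a z) w" by (rule hop_symmetric) (rule herm, use supp[OF False] CU in blast)
        then show ?thesis by (simp add: A_eq inner_add_left inner_add_right)
      qed (simp add: A_eq)
      show "\<mu> * (v \<bullet> v) \<le> A z v \<bullet> v" for z v
      proof -
        have 1: "\<eta> z * (\<mu> * (v \<bullet> v)) \<le> \<eta> z * (hop (a z) v \<bullet> v)"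
        proof (cases "\<eta> z = 0")
          case False
          have "\<mu> * (v \<bullet> v) \<le> m * (v \<bullet> v)" by (intro mult_right_mono) (auto simp: \<mu>_def)
          then show ?thesis using m(2)[OF supp[OF False], of v] \<eta>01[of z] by (intro mult_left_mono) auto
        qed simp
        have "\<mu> * (v \<bullet> v) \<le> 1 * (v \<bullet> v)" by (intro mult_right_mono) (auto simp: \<mu>_def)
        then have "(1 - \<eta> z) * (\<mu> * (v \<bullet> v)) \<le> (1 - \<eta> z) * (v \<bullet> v)" using \<eta>01[of z] by (intro mult_left_mono) auto
        with 1 show ?thesis by (simp add: A_eq inner_add_left algebra_simps)
      qed
      show "norm (A z v) \<le> (c * S + 1) * norm v" for z v
      proof -
        have "norm (hop (\<eta> z *\<^sub>R a z) v) \<le> c * norm (\<eta> z *\<^sub>R a z) * norm v" unfolding c_def by (rule norm_hop_le)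
        also have "\<dots> \<le> c * S * norm v" using Sb c0 by (intro mult_right_mono mult_left_mono) auto
        finally have 1: "norm (hop (\<eta> z *\<^sub>R a z) v) \<le> c * S * norm v" .
        have "norm ((1 - \<eta> z) *\<^sub>R v) \<le> 1 * norm v" unfolding norm_scaleR using \<eta>01[of z] by (intro mult_right_mono) auto
        with 1 show ?thesis unfolding A_def by (intro norm_triangle_le) (simp add: distrib_right)
      qed
      show "norm (A z v - A y v) \<le> (c * LM + 1 / r) * dist z y * norm v" for z y v
      proof -
        have e: "A z v - A y v = hop (\<eta> z *\<^sub>R a z - \<eta> y *\<^sub>R a y) v + (\<eta> y - \<eta> z) *\<^sub>R v"
          using linear_diff[OF linear_hop_matrix[of v]] by (simp add: A_def algebra_simps)
        have "norm (hop (\<eta> z *\<^sub>R a z - \<eta> y *\<^sub>R a y) v) \<le> c * norm (\<eta> z *\<^sub>R a z - \<eta> y *\<^sub>R a y) * norm v"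
          unfolding c_def by (rule norm_hop_le)
        also have "\<dots> \<le> c * (LM * dist z y) * norm v" using Mlip c0 by (intro mult_right_mono mult_left_mono) auto
        finally have 1: "norm (hop (\<eta> z *\<^sub>R a z - \<eta> y *\<^sub>R a y) v) \<le> c * (LM * dist z y) * norm v" .
        have "norm ((\<eta> y - \<eta> z) *\<^sub>R v) \<le> dist z y / r * norm v"
          unfolding norm_scaleR using \<eta>L[of y z] by (intro mult_right_mono) (auto simp: dist_commute)
        with 1 show ?thesis unfolding e by (intro norm_triangle_le) (simp add: algebra_simps)
      qed
      show "0 < \<mu>" "0 < c * S + 1" "0 < c * LM + 1 / r"
        using m(1) c0 S(2) LM0 r by (auto simp: \<mu>_def intro!: add_nonneg_pos)
    qed
    then interpret elliptic A \<mu> "c * S + 1" "c * LM + 1 / r" .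
    show "divfree A \<Omega>"
    proof
      show "open \<Omega>" by (rule \<Omega>o)
      show "A z i \<bullet> j = A z j \<bullet> i" for z i j using symA[of z i j] by (simp add: inner_commute)
      show "(\<lambda>z. A z i \<bullet> j) differentiable_on \<Omega>" for i j
        unfolding differentiable_on_def differentiable_def using has_derivative_at_withinI[OF der] by blast
      show "continuous_on \<Omega> (Dd (\<lambda>z. A z i \<bullet> j) j)" for i j
      proof -
        have "bounded_linear (\<lambda>M. hop M i)" using linear_hop_matrix by (simp add: linear_conv_bounded_linear)
        then have "continuous_on (Dd a j ` \<Omega>) (\<lambda>M. hop M i)" by (rule linear_continuous_on)
        then have "continuous_on \<Omega> (\<lambda>z. hop (Dd a j z) i \<bullet> j)"
          by (intro continuous_on_inner continuous_on_const continuous_on_compose2[OF _ continuous_on_subset[OF a1(2) \<Omega>U] order_refl])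
        then show ?thesis by (rule continuous_on_eq) (simp add: DdA)
      qed
      show "(\<Sum>j\<in>Basis. Dd (\<lambda>z. A z i \<bullet> j) j z) = 0" if "z \<in> \<Omega>" "i \<in> Basis" for z i
        using div0[OF that] DdA[OF that(1)] by simp
    qed
  qed
  moreover have "Lg A w z = Lop a w z" if "infdist z K < 2 * r" for w z
  proof -
    have z: "z \<in> \<Omega>" using that by (simp add: \<Omega>_def)
    have "Lg A w z = Lg (\<lambda>z. hop (a z)) w z" unfolding Lg_def A\<Omega>[OF z] ..
    also have "\<dots> = Lop a w z" by (rule Lg_hop) (rule herm, use z \<Omega>U in blast)
    finally show ?thesis .
  qed
  ultimately show thesis using that[OF r] CW unfolding C_def \<Omega>_def by blast
qed

section \<open>Competitors for the extremal function\<close>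

text \<open>A set of full measure near z0 accumulates at z0, since a punctured neighbourhood is not
  null. A limit determines the \<open>Limsup\<close> along such a set only for a nontrivial
  filter.\<close>

lemma at_within_full_measure_neq_bot:
  fixes z0 :: "'a::euclidean_space"
  assumes D: "open D" "z0 \<in> D" and A: "0 < r" "ball z0 r - A \<in> null_sets lebesgue"
  shows "at z0 within (A \<inter> D) \<noteq> bot"
proof
  assume "at z0 within (A \<inter> D) = bot"
  then have "\<not> z0 islimpt (A \<inter> D)" using trivial_limit_within by blast
  then obtain T where T: "open T" "z0 \<in> T" "\<And>y. y \<in> A \<inter> D \<Longrightarrow> y \<in> T \<Longrightarrow> y = z0" unfolding islimpt_def by blast
  have "open (T \<inter> D \<inter> ball z0 r)" "z0 \<in> T \<inter> D \<inter> ball z0 r" using T D A by auto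
  moreover have "negligible (T \<inter> D \<inter> ball z0 r)"
  proof (rule negligible_subset)
    show "negligible ((ball z0 r - A) \<union> {z0})" using A(2) by (simp add: negligible_iff_null_sets negligible_Un)
    show "T \<inter> D \<inter> ball z0 r \<subseteq> (ball z0 r - A) \<union> {z0}" using T(3) by blast
  qed
  ultimately show False using open_not_negligible by blast
qed

lemma strongly_usc_continuous:
  assumes D: "open D" and h: "continuous_on D h"
  shows "strongly_usc D (\<lambda>z. ereal (h z))"
  unfolding strongly_usc_def
proof (intro conjI ballI allI impI)
  fix z0 assume z0: "z0 \<in> D"
  have t: "((\<lambda>z. ereal (h z)) \<longlongrightarrow> ereal (h z0)) (at z0 within D)" using h z0 by (simp add: continuous_on_def)
  show "Limsup (at z0 within D) (\<lambda>z. ereal (h z)) \<le> ereal (h z0)"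
    using lim_imp_Limsup[OF _ t] at_within_open[OF z0 D] by simp
  fix A assume "\<exists>r>0. ball z0 r - A \<in> null_sets lebesgue"
  then obtain r where r: "0 < r" "ball z0 r - A \<in> null_sets lebesgue" by blast
  show "Limsup (at z0 within (A \<inter> D)) (\<lambda>z. ereal (h z)) = ereal (h z0)"
    by (rule lim_imp_Limsup[OF at_within_full_measure_neq_bot[OF D z0 r] tendsto_within_subset[OF t Int_lower2]])
qed

lemma set_integrable_continuous_compact:
  fixes h :: "'a::euclidean_space \<Rightarrow> real"
  assumes "compact K" "continuous_on K h"
  shows "set_integrable lebesgue K h"
proof -
  have "integrable lborel (\<lambda>x. indicator K x *\<^sub>R h x)" by (rule borel_integrable_compact[OF assms])
  then show ?thesis
    unfolding set_integrable_def by (subst integrable_completion) (auto dest: borel_measurable_integrable)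
qed

lemma alpha_sh_continuous:
  assumes D: "open D" and h: "continuous_on D h"
    and test: "\<And>w. test_fun D w \<Longrightarrow> 0 \<le> (\<integral>z. h z * Lop a w z \<partial>lebesgue)"
  shows "alpha_sh a D (\<lambda>z. ereal (h z))"
  unfolding alpha_sh_def loc_integrable_def
  using strongly_usc_continuous[OF D h] test set_integrable_continuous_compact continuous_on_subset[OF h] by auto

text \<open>A single value other than minus infinity excludes the degenerate alternative in the
  definition.\<close>

lemma alpha_shD:
  assumes "alpha_sh a D u" "z1 \<in> D" "u z1 \<noteq> -\<infinity>"
  shows "z \<in> D \<Longrightarrow> u z \<noteq> \<infinity>" "AE z in lebesgue. z \<in> D \<longrightarrow> \<bar>u z\<bar> \<noteq> \<infinity>" "strongly_usc D u"
    "compact K \<Longrightarrow> K \<subseteq> D \<Longrightarrow> set_integrable lebesgue K (\<lambda>z. real_of_ereal (u z))"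
    "test_fun D w \<Longrightarrow> 0 \<le> (\<integral>z. real_of_ereal (u z) * Lop a w z \<partial>lebesgue)"
  using assms unfolding alpha_sh_def loc_integrable_def by blast+

text \<open>Makes the set where a competitor exceeds a barrier relatively closed, and the superlevel
  sets of competitors Borel.\<close>

lemma open_usc_less:
  assumes D: "open D" and u: "strongly_usc D u" and g: "continuous_on D g"
  shows "open {z \<in> D. u z < ereal (g z)}"
proof (subst open_subopen, intro ballI)
  fix z0 assume "z0 \<in> {z \<in> D. u z < ereal (g z)}"
  then have z0: "z0 \<in> D" "u z0 < ereal (g z0)" by auto
  obtain c where c: "u z0 < c" "c < ereal (g z0)" using dense[OF z0(2)] by blast
  have "Limsup (at z0) u \<le> u z0" using u z0(1) at_within_open[OF z0(1) D] by (auto simp: strongly_usc_def)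
  then have "\<forall>\<^sub>F z in at z0. u z < c" using c(1) by (intro Limsup_lessD) auto
  moreover have "((\<lambda>z. ereal (g z)) \<longlongrightarrow> ereal (g z0)) (at z0)"
    using g z0(1) at_within_open[OF z0(1) D] by (auto simp: continuous_on_def)
  then have "\<forall>\<^sub>F z in at z0. c < ereal (g z)" using order_tendstoD(1) c(2) by blast
  moreover have "\<forall>\<^sub>F z in at z0. z \<in> D" using D z0(1) by (rule eventually_at_in_open')
  ultimately have "\<forall>\<^sub>F z in at z0. z \<in> {z \<in> D. u z < ereal (g z)}" by eventually_elim auto
  then obtain T where T: "open T" "z0 \<in> T" "\<And>z. z \<in> T \<Longrightarrow> z \<noteq> z0 \<Longrightarrow> z \<in> {z \<in> D. u z < ereal (g z)}"
    unfolding eventually_at_topological by blast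
  then have "T \<subseteq> {z \<in> D. u z < ereal (g z)}" using z0 by blast
  then show "\<exists>T. open T \<and> z0 \<in> T \<and> T \<subseteq> {z \<in> D. u z < ereal (g z)}" using T by blast
qed

lemma test_fun_C2c: assumes "test_fun D w" shows "C2c D w" "0 \<le> w z"
proof -
  show "C2c D w" unfolding C2c_def
    using assms closure_subset[of "{z. w z \<noteq> 0}"] by (intro conjI exI[of _ "closure {z. w z \<noteq> 0}"]) (auto simp: test_fun_def smooth_on_def)
qed (use assms in \<open>simp add: test_fun_def\<close>)

context elliptic_region begin

lemma C2c_subset: "C2c D w \<Longrightarrow> D \<subseteq> D' \<Longrightarrow> C2c D' w" unfolding C2c_def by blast

lemma integrable_times_Lg:
  assumes h: "continuous_on \<Omega> h" and w: "C2c \<Omega> w"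
  shows "integrable lborel (\<lambda>z. h z * Lg A w z)" "(\<lambda>z. h z * Lg A w z) \<in> borel_measurable borel"
    "(\<integral>z. h z * Lg A w z \<partial>lebesgue) = (\<integral>z. h z * Lg A w z \<partial>lborel)"
proof -
  obtain K where K: "compact K" "K \<subseteq> \<Omega>" "\<And>x. x \<notin> K \<Longrightarrow> w x = 0" using w by (auto simp: C2c_def)
  have c: "continuous_on K (\<lambda>z. h z * Lg A w z)"
    by (intro continuous_on_mult continuous_on_subset[OF h K(2)]
        continuous_on_subset[OF cont_Lg[OF Ck_subset[OF open_UNIV open_dom subset_UNIV C2cD(1)[OF w]] open_dom order_refl] K(2)])
  have z: "h x * Lg A w x = 0" if "x \<notin> K" for x using Lg_zero_outside[OF compact_imp_closed[OF K(1)] K(3) that] by simp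
  note I = integrable_continuous_compact_support[OF K(1) c z]
  show "integrable lborel (\<lambda>z. h z * Lg A w z)" by (rule I(1))
  show m: "(\<lambda>z. h z * Lg A w z) \<in> borel_measurable borel" by (rule I(2))
  show "(\<integral>z. h z * Lg A w z \<partial>lebesgue) = (\<integral>z. h z * Lg A w z \<partial>lborel)" by (rule lebesgue_integral_eq_lborel[OF m])
qed

lemma integral_Lg_0: assumes "C2c \<Omega> w" shows "(\<integral>z. Lg A w z \<partial>lborel) = 0"
proof -
  have "Lg A (\<lambda>x. 1) z = 0" for z by (simp add: Lg_def Dd_def)
  then show ?thesis using green(1)[OF Ck_const[OF open_dom, of 2 1] assms] by simp
qed

lemma Lg_norm_sq: "Ck 2 (\<lambda>z::'a. (norm z)\<^sup>2) UNIV" "2 * \<mu> \<le> Lg A (\<lambda>z. (norm z)\<^sup>2) z"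
proof -
  have e: "(\<lambda>z::'a. (norm z)\<^sup>2) = (\<lambda>z. z \<bullet> z)" by (simp add: power2_norm_eq_inner)
  have d1: "((\<lambda>z::'a. z \<bullet> z) has_derivative (\<lambda>v. 2 * (x \<bullet> v))) (at x)" for x
    by (auto intro!: derivative_eq_intros simp: inner_commute)
  have d2: "((\<lambda>y::'a. 2 * (y \<bullet> v)) has_derivative (\<lambda>w. 2 * (w \<bullet> v))) (at x)" for x v
    by (auto intro!: derivative_eq_intros)
  note C = Ck2I[OF open_UNIV, of "\<lambda>z::'a. z \<bullet> z" "\<lambda>x v. 2 * (x \<bullet> v)" "\<lambda>x v w. 2 * (w \<bullet> v)", OF d1 d2 continuous_on_const]
  show "Ck 2 (\<lambda>z::'a. (norm z)\<^sup>2) UNIV" unfolding e by (rule C(1))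
  have "Lg A (\<lambda>z. (norm z)\<^sup>2) z = (\<Sum>i\<in>Basis. \<Sum>j\<in>Basis. (A z i \<bullet> j) * (2 * (j \<bullet> i)))"
    unfolding e Lg_def by (intro sum.cong refl) (simp add: C(3))
  also have "\<dots> = (\<Sum>i\<in>Basis. 2 * (A z i \<bullet> i))"
    by (intro sum.cong refl) (simp add: inner_Basis if_distrib sum.delta cong: if_cong)
  also have "\<dots> \<ge> (\<Sum>i\<in>(Basis::'a set). 2 * \<mu>)"
  proof (rule sum_mono)
    fix i :: 'a assume "i \<in> Basis"
    then show "2 * \<mu> \<le> 2 * (A z i \<bullet> i)" using ell[of i z] by simp
  qed
  also have "(\<Sum>i\<in>(Basis::'a set). 2 * \<mu>) \<ge> 2 * \<mu>" using pos dim by simp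
  finally show "2 * \<mu> \<le> Lg A (\<lambda>z. (norm z)\<^sup>2) z" .
qed

end

section \<open>From forms to operators\<close>

locale form_region = elliptic_region A \<mu> \<Lambda> Lip \<Omega> for A :: "'n::finite cvec \<Rightarrow> 'n cvec \<Rightarrow> 'n cvec" and \<mu> \<Lambda> Lip \<Omega> +
  fixes a :: "'n coefmat"
  assumes Lop: "\<And>w z. z \<in> \<Omega> \<Longrightarrow> Lg A w z = Lop a w z"
begin

lemma Lg_eq_Lop: assumes "C2c \<Omega> w" shows "Lg A w z = Lop a w z"
proof -
  obtain K where K: "compact K" "K \<subseteq> \<Omega>" "\<And>x. x \<notin> K \<Longrightarrow> w x = 0" using assms by (auto simp: C2c_def)
  show ?thesis
  proof (cases "z \<in> \<Omega>")
    case False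
    then have z: "z \<notin> K" using K(2) by blast
    have "Lg A w z = 0" by (rule Lg_zero_outside[OF compact_imp_closed[OF K(1)] K(3) z])
    moreover have "Lop a w z = 0" by (rule Lop_zero_outside[OF compact_imp_closed[OF K(1)] K(3) z])
    ultimately show ?thesis by simp
  qed (rule Lop)
qed

lemma alpha_sh_C2c:
  assumes D: "open D" "D \<subseteq> \<Omega>" and u: "alpha_sh a D u" "z1 \<in> D" "u z1 \<noteq> -\<infinity>" and w: "C2c D w" "\<And>z. 0 \<le> w z"
  shows "0 \<le> (\<integral>z. real_of_ereal (u z) * Lg A w z \<partial>lebesgue)"
proof (rule smooth_test_extend[OF D(1) _ _ _ w])
  show "continuous_on D (\<lambda>z. A z i \<bullet> j)" if "i \<in> Basis" "j \<in> Basis" for i j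
    by (rule continuous_on_subset[OF contA[OF that] D(2)])
  show "set_integrable lebesgue K (\<lambda>z. real_of_ereal (u z))" if "compact K" "K \<subseteq> D" for K by (rule alpha_shD(4)[OF u that])
  fix w :: "'n cvec \<Rightarrow> real" assume "smooth_on w UNIV" "\<forall>z. 0 \<le> w z" "compact (closure {z. w z \<noteq> 0})" "closure {z. w z \<noteq> 0} \<subseteq> D"
  then have t: "test_fun D w" by (simp add: test_fun_def)
  show "0 \<le> (\<integral>z. real_of_ereal (u z) * Lg A w z \<partial>lebesgue)"
    unfolding Lg_eq_Lop[OF C2c_subset[OF test_fun_C2c(1)[OF t] D(2)]] by (rule alpha_shD(5)[OF u t])
qed

text \<open>Strictness in quantitative form: \<epsilon> |z|^2 may be subtracted, and L |z|^2 is at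
  least 2 \<mu>. The gain will pay for the defect of smoothed competitors.\<close>

lemma weak_strictness:
  assumes D: "\<Omega> \<noteq> {}" and \<rho>: "continuous_on \<Omega> \<rho>" and \<epsilon>: "0 < \<epsilon>" "alpha_sh a \<Omega> (\<lambda>z. ereal (\<rho> z) - ereal (\<epsilon> * (norm z)\<^sup>2))"
    and w: "C2c \<Omega> w" "\<And>z. 0 \<le> w z"
  shows "\<epsilon> * (2 * \<mu>) * (\<integral>z. w z \<partial>lborel) \<le> (\<integral>z. \<rho> z * Lg A w z \<partial>lborel)"
proof -
  obtain z1 where z1: "z1 \<in> \<Omega>" using D by blast
  have nc: "continuous_on \<Omega> (\<lambda>z. (norm z)\<^sup>2)" by (intro continuous_intros)
  have "0 \<le> (\<integral>z. real_of_ereal (ereal (\<rho> z) - ereal (\<epsilon> * (norm z)\<^sup>2)) * Lg A w z \<partial>lebesgue)"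
    by (rule alpha_sh_C2c[OF open_dom order_refl \<epsilon>(2) z1 _ w]) simp
  also have "\<dots> = (\<integral>z. (\<rho> z - \<epsilon> * (norm z)\<^sup>2) * Lg A w z \<partial>lborel)"
    using integrable_times_Lg(3)[OF _ w(1), of "\<lambda>z. \<rho> z - \<epsilon> * (norm z)\<^sup>2"] \<rho> nc by (simp add: continuous_on_diff continuous_on_mult_left)
  also have "\<dots> = (\<integral>z. \<rho> z * Lg A w z - \<epsilon> * ((norm z)\<^sup>2 * Lg A w z) \<partial>lborel)"
    by (simp add: algebra_simps)
  also have "\<dots> = (\<integral>z. \<rho> z * Lg A w z \<partial>lborel) - \<epsilon> * (\<integral>z. (norm z)\<^sup>2 * Lg A w z \<partial>lborel)"
    using integrable_times_Lg(1)[OF \<rho> w(1)] integrable_times_Lg(1)[OF nc w(1)] by simp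
  finally have 1: "\<epsilon> * (\<integral>z. (norm z)\<^sup>2 * Lg A w z \<partial>lborel) \<le> (\<integral>z. \<rho> z * Lg A w z \<partial>lborel)" by simp
  have C: "Ck 2 (\<lambda>z::'n cvec. (norm z)\<^sup>2) \<Omega>" by (rule Ck_subset[OF open_UNIV open_dom subset_UNIV Lg_norm_sq(1)])
  obtain K where K: "compact K" "K \<subseteq> \<Omega>" "\<And>x. x \<notin> K \<Longrightarrow> w x = 0" using w(1) by (auto simp: C2c_def)
  have "2 * \<mu> * (\<integral>z. w z \<partial>lborel) = (\<integral>z. w z * (2 * \<mu>) \<partial>lborel)" by simp
  also have "\<dots> \<le> (\<integral>z. w z * Lg A (\<lambda>z. (norm z)\<^sup>2) z \<partial>lborel)"
  proof (rule integral_mono)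
    show "integrable lborel (\<lambda>z. w z * (2 * \<mu>))" using Ck_compact_support(1)[OF C2cD(1)[OF w(1)] K(1,3)] by simp
    show "integrable lborel (\<lambda>z. w z * Lg A (\<lambda>z. (norm z)\<^sup>2) z)"
      by (rule integrable_continuous_compact_support(1)[OF K(1)])
        (use K C2cD(6)[OF w(1)] continuous_on_subset[OF cont_Lg[OF C open_dom order_refl] K(2)] in \<open>auto intro!: continuous_on_mult\<close>)
    show "w z * (2 * \<mu>) \<le> w z * Lg A (\<lambda>z. (norm z)\<^sup>2) z" for z by (intro mult_left_mono Lg_norm_sq w)
  qed
  also have "\<dots> = (\<integral>z. (norm z)\<^sup>2 * Lg A w z \<partial>lborel)" using green(1)[OF C w(1)] by simp
  finally show ?thesis using mult_left_mono[OF _ less_imp_le[OF \<epsilon>(1)]] 1 by (simp add: mult.assoc) (meson order_trans)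
qed

end

text \<open>\<open>real_of_ereal\<close> sends minus infinity to 0, the wrong side for an upper
  bound. Lowering the function by b on the null set \<open>N0\<close> repairs this, and neither that
  nor the constant c changes the pairing with a function of integral zero.\<close>

lemma null_modification:
  fixes u0 :: "'a::euclidean_space \<Rightarrow> real" and u :: "'a \<Rightarrow> ereal"
  assumes N0: "N0 \<in> null_sets lebesgue" and K: "compact K" and u0: "set_integrable lebesgue K u0"
    and h: "continuous_on K h" "\<And>x. x \<notin> K \<Longrightarrow> h x = 0" and h0: "(\<integral>x. h x \<partial>lborel) = 0"
    and u1: "\<And>z. u1 z = u0 z - c - indicator N0 z * b"
  shows "set_integrable lebesgue K u1" "(\<integral>z. u1 z * h z \<partial>lebesgue) = (\<integral>z. u0 z * h z \<partial>lebesgue)"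
proof -
  have Ks: "K \<in> sets lebesgue" using compact_imp_closed[OF K] by auto
  have N0s: "N0 \<in> sets lebesgue" "K \<inter> N0 \<in> sets lebesgue" using N0 Ks by auto
  have iN: "integrable lebesgue (\<lambda>z. indicator N0 z * b :: real)"
    using N0 N0s by (intro integrable_mult_left integrable_real_indicator) (auto simp: null_sets_def)
  have iK: "integrable lebesgue (\<lambda>z. indicator K z * (indicator N0 z * b) :: real)"
    using integrable_mult_indicator[OF Ks iN] by simp
  have "integrable lebesgue (\<lambda>z. indicator K z *\<^sub>R u0 z - indicator K z *\<^sub>R c - indicator K z * (indicator N0 z * b))"
    by (intro Bochner_Integration.integrable_diff iK u0[unfolded set_integrable_def]
        set_integrable_continuous_compact[OF K continuous_on_const, unfolded set_integrable_def])
  then show "set_integrable lebesgue K u1" unfolding set_integrable_def u1 by (simp add: algebra_simps)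
  note I = integrable_continuous_compact_support[OF K h]
  obtain C where C: "\<And>x. \<bar>h x\<bar> \<le> C" using I(3) by blast
  have hm: "h \<in> borel_measurable lebesgue" using I(2) by (simp add: measurable_completion)
  have hi: "integrable lebesgue h" using I(1,2) by (simp add: integrable_completion)
  have h0': "(\<integral>x. h x \<partial>lebesgue) = 0" using h0 lebesgue_integral_eq_lborel[OF I(2)] by simp
  have "integrable lebesgue (\<lambda>z. (indicator K z *\<^sub>R u0 z) * h z)"
  proof (rule Bochner_Integration.integrable_bound[of _ "\<lambda>z. C * (indicator K z *\<^sub>R u0 z)"])
    show "integrable lebesgue (\<lambda>z. C * (indicator K z *\<^sub>R u0 z))" using u0 by (simp add: set_integrable_def)
    show "(\<lambda>z. (indicator K z *\<^sub>R u0 z) * h z) \<in> borel_measurable lebesgue"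
      using u0 hm by (intro borel_measurable_times) (auto simp: set_integrable_def dest: borel_measurable_integrable)
    show "AE z in lebesgue. norm ((indicator K z *\<^sub>R u0 z) * h z) \<le> norm (C * (indicator K z *\<^sub>R u0 z))"
      unfolding norm_mult by (intro AE_I2) (subst mult.commute, intro mult_right_mono, auto intro: order_trans[OF C abs_ge_self])
  qed
  moreover have "(\<lambda>z. (indicator K z *\<^sub>R u0 z) * h z) = (\<lambda>z. u0 z * h z)" using h(2) by (auto simp: indicator_def fun_eq_iff)
  ultimately have i0: "integrable lebesgue (\<lambda>z. u0 z * h z)" by simp
  have ae: "AE z in lebesgue. (indicator N0 z * b) * h z = 0" using AE_not_in[OF N0] by eventually_elim simp
  have m3: "(\<lambda>z. (indicator N0 z * b) * h z) \<in> borel_measurable lebesgue" using N0s hm by measurable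
  have i3: "integrable lebesgue (\<lambda>z. (indicator N0 z * b) * h z)"
    by (rule Bochner_Integration.integrable_bound[of _ "\<lambda>_. 0 :: real"]) (use ae m3 in auto)
  have z3: "(\<integral>z. (indicator N0 z * b) * h z \<partial>lebesgue) = 0" by (rule integral_eq_zero_AE[OF ae])
  have "(\<integral>z. u1 z * h z \<partial>lebesgue) = (\<integral>z. u0 z * h z - c * h z - (indicator N0 z * b) * h z \<partial>lebesgue)"
    unfolding u1 by (simp add: left_diff_distrib)
  also have "\<dots> = (\<integral>z. u0 z * h z \<partial>lebesgue) - c * (\<integral>z. h z \<partial>lebesgue) - (\<integral>z. (indicator N0 z * b) * h z \<partial>lebesgue)"
    using i0 hi i3 by simp
  finally show "(\<integral>z. u1 z * h z \<partial>lebesgue) = (\<integral>z. u0 z * h z \<partial>lebesgue)" using h0' z3 by simp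
qed

section \<open>Smoothing a competitor on a regular domain\<close>

locale regular_domain = form_region A \<mu> \<Lambda> Lip \<Omega> a
  for A :: "'n::finite cvec \<Rightarrow> 'n cvec \<Rightarrow> 'n cvec" and \<mu> \<Lambda> Lip \<Omega> a +
  fixes D K :: "'n cvec set" and \<psi> \<rho> :: "'n cvec \<Rightarrow> real" and r L\<rho> M\<rho> \<kappa> \<beta> :: real
  assumes D: "open D" "bounded D" "D \<noteq> {}"
    and r: "0 < r" and \<Omega>: "\<Omega> = {z. infdist z (closure D) < 2 * r}"
    and \<rho>c: "continuous_on \<Omega> \<rho>"
    and \<rho>L: "0 < L\<rho>" "\<And>z y. z \<in> closure D \<Longrightarrow> dist z y \<le> r \<Longrightarrow> \<bar>\<rho> z - \<rho> y\<bar> \<le> L\<rho> * dist z y"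
    and \<rho>M: "\<And>z. infdist z (closure D) \<le> r \<Longrightarrow> \<bar>\<rho> z\<bar> \<le> M\<rho>"
    and \<rho>neg: "\<And>z. z \<in> D \<Longrightarrow> \<rho> z < 0" and \<rho>fr: "\<And>z. z \<in> frontier D \<Longrightarrow> \<rho> z = 0"
    and \<kappa>: "0 < \<kappa>" "\<And>w. C2c \<Omega> w \<Longrightarrow> (\<And>z. 0 \<le> w z) \<Longrightarrow> \<kappa> * (\<integral>z. w z \<partial>lborel) \<le> (\<integral>z. \<rho> z * Lg A w z \<partial>lborel)"
    and K: "compact K" "K \<subseteq> D"
    and \<beta>: "0 < \<beta>" "\<And>z. z \<in> K \<Longrightarrow> \<beta> * \<rho> z \<le> \<psi> z"
begin

abbreviation "\<omega> \<equiv> omega_alpha a K D \<psi>"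
definition "om z = real_of_ereal (\<omega> z)"

lemma closure_D: "compact (closure D)" "closure D \<noteq> {}" "D \<subseteq> closure D"
  using D closure_subset by auto

lemma D_\<Omega>: "D \<subseteq> \<Omega>" "closure D \<subseteq> \<Omega>"
proof -
  show "closure D \<subseteq> \<Omega>" using r by (auto simp: \<Omega>)
  then show "D \<subseteq> \<Omega>" using closure_D by blast
qed

lemma \<rho>_closure: "z \<in> closure D \<Longrightarrow> \<rho> z \<le> 0"
  using \<rho>neg[of z] \<rho>fr[of z] D(1) by (cases "z \<in> D") (auto simp: frontier_def interior_open)

lemma integral_C2c_nonneg: "(\<And>z. 0 \<le> w z) \<Longrightarrow> 0 \<le> (\<integral>z. w z \<partial>lborel)" for w :: "'n cvec \<Rightarrow> real"
  by (intro integral_nonneg_AE) auto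

lemma \<rho>_sub:
  assumes w: "C2c \<Omega> w" "\<And>z. 0 \<le> w z" shows "0 \<le> (\<integral>z. \<rho> z * Lg A w z \<partial>lborel)"
  using \<kappa>(2)[OF w] mult_nonneg_nonneg[OF less_imp_le[OF \<kappa>(1)] integral_C2c_nonneg[where w=w, OF w(2)]] by linarith

lemma alpha_sh_of_Lg:
  assumes h: "continuous_on D h"
    and test: "\<And>w. C2c D w \<Longrightarrow> (\<And>z. 0 \<le> w z) \<Longrightarrow> 0 \<le> (\<integral>z. h z * Lg A w z \<partial>lebesgue)"
  shows "alpha_sh a D (\<lambda>z. ereal (h z))"
proof (rule alpha_sh_continuous[OF D(1) h])
  fix w assume w: "test_fun D w"
  show "0 \<le> (\<integral>z. h z * Lop a w z \<partial>lebesgue)"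
    using test[OF test_fun_C2c[OF w]] Lg_eq_Lop[OF C2c_subset[OF test_fun_C2c(1)[OF w] D_\<Omega>(1)]] by simp
qed

text \<open>This competitor pins the extremal function between \<beta> \<rho> and 0, and a shift of
  it replaces the other competitors near the boundary.\<close>

lemma barrier_in_class: "(\<lambda>z. ereal (\<beta> * \<rho> z)) \<in> U_class a K D \<psi>"
proof -
  have "alpha_sh a D (\<lambda>z. ereal (\<beta> * \<rho> z))"
  proof (rule alpha_sh_of_Lg)
    show "continuous_on D (\<lambda>z. \<beta> * \<rho> z)" by (intro continuous_intros continuous_on_subset[OF \<rho>c D_\<Omega>(1)])
    fix w assume w: "C2c D w" "\<And>z. 0 \<le> w z"
    note w' = C2c_subset[OF w(1) D_\<Omega>(1)]
    show "0 \<le> (\<integral>z. \<beta> * \<rho> z * Lg A w z \<partial>lebesgue)"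
      using \<rho>_sub[OF w' w(2)] integrable_times_Lg(3)[OF \<rho>c w'] \<beta>(1) by (simp add: mult.assoc)
  qed
  then show ?thesis using \<rho>neg \<beta> by (auto simp: U_class_def mult_pos_neg)
qed

lemma \<omega>_bounds:
  assumes "z \<in> D" shows "ereal (\<beta> * \<rho> z) \<le> \<omega> z" "\<omega> z \<le> 0" "\<omega> z = ereal (om z)" "\<beta> * \<rho> z \<le> om z" "om z \<le> 0"
proof -
  show 1: "ereal (\<beta> * \<rho> z) \<le> \<omega> z" unfolding omega_alpha_def using barrier_in_class by (rule SUP_upper)
  show 2: "\<omega> z \<le> 0" unfolding omega_alpha_def using assms by (intro SUP_least) (auto simp: U_class_def intro: less_imp_le)
  show 3: "\<omega> z = ereal (om z)" unfolding om_def using 1 2 by (cases "\<omega> z") auto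
  show "\<beta> * \<rho> z \<le> om z" "om z \<le> 0" using 1 2 unfolding 3 by (simp_all add: zero_ereal_def)
qed

lemma class_le_om: "u \<in> U_class a K D \<psi> \<Longrightarrow> z \<in> D \<Longrightarrow> u z \<le> ereal (om z)"
  using \<omega>_bounds(3)[of z] by (metis SUP_upper omega_alpha_def)

text \<open>A bound for |\<beta> \<rho> - c2| on the neighbourhood \<open>Kc\<close> in
  \<open>class_bound\<close>, hence for the glued function.\<close>

definition "B0 = \<beta> * (M\<rho> + L\<rho> * r)"
text \<open>In order: the excess near K, the shift \<open>c1\<close> that keeps the gluing away from
  the boundary, the truncation losses of \<open>v_upper\<close> and \<open>v_ge_f\<close>, and the
  cost of the multiple of \<rho> that restores subharmonicity of the smoothed function.\<close>

definition "err \<delta> N Er = Er + 5 * \<beta> * L\<rho> * (real (Suc N) * (a0 * \<delta>)) + (2 * B0 + CS B0) * \<theta> ^ N + M\<rho> * ((CS B0 + B0) * \<theta> ^ N / (\<delta>\<^sup>2 * \<kappa>))"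

lemma M\<rho>_nonneg: "0 \<le> M\<rho>" using \<rho>M[of "SOME z. z \<in> closure D"] closure_D(2) r some_in_eq[of "closure D"] by force

text \<open>The smoothed and corrected function is itself in the class, so it lies below
  \<open>om\<close> at w; up to errors it lies above u at z. Its Lipschitz bound joins the two
  points.\<close>

lemma class_bound:
  assumes good: "good \<delta>" and Rr: "2 * (real (Suc N) * (a0 * \<delta>)) \<le> r"
    and near: "\<And>z. z \<in> K \<Longrightarrow> cball z (2 * (real (Suc N) * (a0 * \<delta>))) \<subseteq> D"
    and upper: "\<And>z y. z \<in> K \<Longrightarrow> dist z y \<le> 2 * (real (Suc N) * (a0 * \<delta>)) \<Longrightarrow> om y \<le> \<psi> z + Er" and Er: "0 < Er"
    and u: "u \<in> U_class a K D \<psi>" and z: "z \<in> D" and w: "w \<in> D"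
  shows "u z \<le> ereal (om w + err \<delta> N Er + a0 / (2 * \<mu>) * CM * (B0 / (1 - \<theta>)) / \<delta> * dist z w)"
proof (cases "u z = -\<infinity>")
  case True then show ?thesis by simp
next
  case uz: False
  define R where "R = real (Suc N) * (a0 * \<delta>)"
  have \<delta>: "0 < \<delta>" by (rule good_pos[OF good])
  have R0: "0 < R" unfolding R_def using a0_pos \<delta> by simp
  have Rr: "2 * R \<le> r" using Rr by (simp add: R_def)
  note t = \<theta>_bounds[OF good]
  have ush: "alpha_sh a D u" and uneg: "\<And>z. z \<in> D \<Longrightarrow> u z < 0" using u by (auto simp: U_class_def)
  note us = alpha_shD[OF ush z uz]
  \<comment> \<open>On the 2R-neighbourhood of D the function \<rho> can reach 2 L\<rho> R; this
    shift keeps \<open>u2\<close> nonpositive there, as \<open>subsolution_le_SS\<close>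
    requires.\<close>
  define c2 where "c2 = \<beta> * L\<rho> * (2 * R)"
  \<comment> \<open>The surplus c1 - c2 = 3 \<beta> L\<rho> R confines F to \<rho> \<le> - 3 L\<rho>
    R. Such points are farther than 2R from the boundary, because \<rho> vanishes there and has
    Lipschitz constant L\<rho>.\<close>
  define c1 where "c1 = 5 * \<beta> * L\<rho> * R"
  have c: "0 < c2" "0 < c1" "c1 - c2 = 3 * \<beta> * L\<rho> * R" using \<beta>(1) \<rho>L(1) R0 by (auto simp: c1_def c2_def)
  define h where "h z = \<beta> * \<rho> z - c2 + c1" for z
  have hc: "continuous_on D h" unfolding h_def by (intro continuous_intros continuous_on_subset[OF \<rho>c D_\<Omega>(1)])
  define F where "F = {z \<in> D. ereal (h z) \<le> u z}"
  have F\<rho>: "\<rho> z \<le> - (3 * L\<rho> * R)" if "z \<in> F" for z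
  proof -
    have "ereal (h z) \<le> u z" "u z < 0" using that uneg by (auto simp: F_def)
    then have "ereal (h z) < 0" by (rule le_less_trans)
    then have "\<beta> * (\<rho> z + 3 * L\<rho> * R) < 0" using c(3) by (simp add: h_def zero_ereal_def algebra_simps)
    then show ?thesis using \<beta>(1) by (simp add: mult_less_0_iff)
  qed
  \<comment> \<open>Semicontinuity makes F closed relative to D only; the bound on \<rho> keeps it
    away from the frontier, so that it becomes compact.\<close>
  have F_eq: "F = (closure D \<inter> \<rho> -` {.. - (3 * L\<rho> * R)}) - {z \<in> D. u z < ereal (h z)}"
  proof
    show "F \<subseteq> (closure D \<inter> \<rho> -` {.. - (3 * L\<rho> * R)}) - {z \<in> D. u z < ereal (h z)}"
      using F\<rho> closure_D(3) by (auto simp: F_def)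
    show "(closure D \<inter> \<rho> -` {.. - (3 * L\<rho> * R)}) - {z \<in> D. u z < ereal (h z)} \<subseteq> F"
    proof
      fix x assume x: "x \<in> (closure D \<inter> \<rho> -` {.. - (3 * L\<rho> * R)}) - {z \<in> D. u z < ereal (h z)}"
      have "0 < 3 * L\<rho> * R" using \<rho>L(1) R0 by simp
      then have "\<rho> x \<noteq> 0" using x by auto
      then have "x \<notin> frontier D" using \<rho>fr by blast
      then have "x \<in> D" using x D(1) by (auto simp: frontier_def interior_open)
      then show "x \<in> F" using x by (auto simp: F_def)
    qed
  qed
  have Fc: "compact F" unfolding F_eq
  proof (rule compact_diff)
    have "closed (closure D \<inter> \<rho> -` {.. - (3 * L\<rho> * R)})"
      by (rule continuous_closed_preimage[OF continuous_on_subset[OF \<rho>c D_\<Omega>(2)]]) auto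
    then show "compact (closure D \<inter> \<rho> -` {.. - (3 * L\<rho> * R)})"
      using closure_D(1) by (metis compact_Int_closed inf.right_idem inf_commute inf_left_idem)
    show "open {z \<in> D. u z < ereal (h z)}" by (rule open_usc_less[OF D(1) us(3) hc])
  qed
  have FD: "F \<subseteq> D" by (auto simp: F_def)
  have Fb: "cball z (2 * R) \<subseteq> D" if zF: "z \<in> F" for z
  proof (rule ccontr)
    assume "\<not> cball z (2 * R) \<subseteq> D"
    then obtain y where y: "dist z y \<le> 2 * R" "y \<notin> D" unfolding subset_iff mem_cball by blast
    have "closed_segment z y \<inter> frontier D \<noteq> {}"
      by (rule connected_Int_frontier[OF connected_segment(1)]) (use zF FD y(2) in auto)
    then obtain \<xi> where \<xi>: "\<xi> \<in> closed_segment z y" "\<xi> \<in> frontier D" by blast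
    have d: "dist z \<xi> \<le> 2 * R" using dist_in_closed_segment(1)[OF \<xi>(1)] y(1) by (simp add: dist_commute)
    have zc: "z \<in> closure D" using zF FD closure_D(3) by blast
    have "dist z \<xi> \<le> r" using d Rr by linarith
    then have "\<bar>\<rho> z\<bar> \<le> L\<rho> * dist z \<xi>" using \<rho>L(2)[OF zc] \<rho>fr[OF \<xi>(2)] by force
    also have "\<dots> \<le> L\<rho> * (2 * R)" using d \<rho>L(1) by (intro mult_left_mono) auto
    finally have "- \<rho> z \<le> L\<rho> * (2 * R)" by linarith
    moreover have "3 * L\<rho> * R \<le> - \<rho> z" using F\<rho>[OF zF] by linarith
    ultimately have "L\<rho> * R \<le> 0" by (simp add: algebra_simps)
    then show False using mult_pos_pos[OF \<rho>L(1) R0] by linarith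
  qed
  define Kc where "Kc = {z. infdist z (closure D) \<le> 2 * R}"
  have Kc: "compact Kc" unfolding Kc_def by (rule compact_infdist_le[OF closure_D(2,1)]) (use R0 in simp)
  have Kc\<Omega>: "Kc \<subseteq> \<Omega>" using Rr r by (auto simp: Kc_def \<Omega>)
  have KcD: "cball z (2 * R) \<subseteq> Kc" if "z \<in> D" for z
    using infdist_le2[of z "closure D"] that closure_D(3) by (force simp: Kc_def dist_commute)
  have DKc: "D \<subseteq> Kc" using KcD R0 by (force simp: subset_iff)
  have \<rho>Kc: "\<rho> z \<le> 2 * L\<rho> * R" "\<bar>\<rho> z\<bar> \<le> M\<rho>" if "z \<in> Kc" for z
  proof -
    obtain y where y: "y \<in> closure D" "infdist z (closure D) = dist z y"
      using infdist_attains_inf[OF closed_closure closure_D(2)] by blast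
    have d: "dist y z \<le> 2 * R" using that y(2) by (simp add: Kc_def dist_commute)
    then have "\<bar>\<rho> y - \<rho> z\<bar> \<le> L\<rho> * dist y z" using \<rho>L(2)[OF y(1)] Rr by simp
    also have "\<dots> \<le> L\<rho> * (2 * R)" using d \<rho>L(1) by (intro mult_left_mono) auto
    finally show "\<rho> z \<le> 2 * L\<rho> * R" using \<rho>_closure[OF y(1)] by (simp add: mult_ac)
    show "\<bar>\<rho> z\<bar> \<le> M\<rho>" using \<rho>M that Rr by (simp add: Kc_def)
  qed
  define N0 where "N0 = {z \<in> D. \<bar>u z\<bar> = \<infinity>}"
  have N0: "N0 \<in> null_sets lebesgue"
  proof -
    obtain N' where N': "\<And>z. z \<in> space lebesgue - N' \<Longrightarrow> z \<in> D \<longrightarrow> \<bar>u z\<bar> \<noteq> \<infinity>" "N' \<in> null_sets lebesgue"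
      using AE_E3[OF us(2)] by blast
    then have "N0 \<subseteq> N'" by (fastforce simp: N0_def)
    then show ?thesis using N'(2) by (rule null_sets_completion_subset)
  qed
  have N0_iff: "z \<in> N0 \<longleftrightarrow> u z = -\<infinity>" if "z \<in> D" for z using that uneg[OF that] by (cases "u z") (auto simp: N0_def)
  have B0: "0 \<le> B0" unfolding B0_def using \<beta>(1) M\<rho>_nonneg \<rho>L(1) r by simp
  have B0': "- B0 \<le> \<beta> * \<rho> z - c2" if "z \<in> Kc" for z
  proof -
    have "\<beta> * (- M\<rho>) \<le> \<beta> * \<rho> z" using \<rho>Kc(2)[OF that] \<beta>(1) by (intro mult_left_mono) auto
    moreover have "\<beta> * L\<rho> * (2 * R) \<le> \<beta> * L\<rho> * r" using Rr \<beta>(1) \<rho>L(1) by (intro mult_left_mono) auto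
    ultimately show ?thesis by (simp add: B0_def c2_def algebra_simps)
  qed
  \<comment> \<open>On \<open>N0\<close> the real value of u is 0 by convention; subtracting B0
    there restores \<open>u1 z \<le> f z\<close>.\<close>
  define u1 where "u1 z = real_of_ereal (u z) - c1 - indicator N0 z * B0" for z
  define u2 where "u2 z = \<beta> * \<rho> z - c2" for z
  define f where "f z = (if z \<in> F then real_of_ereal (u z) - c1 else if z \<in> Kc then u2 z else 0)" for z
  have uF: "u z = ereal (real_of_ereal (u z))" "u2 z \<le> real_of_ereal (u z) - c1" "z \<notin> N0" if "z \<in> F" for z
    using that uneg[of z] by (cases "u z"; auto simp: F_def h_def u2_def N0_def)+
  have f_u2: "u2 z \<le> f z" if "z \<in> Kc" for z using that uF(2)[of z] by (auto simp: f_def)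
  have f0: "f z \<le> 0" for z
  proof (cases "z \<in> F")
    case True
    have "ereal (real_of_ereal (u z)) < ereal 0" using uneg[OF subsetD[OF FD True]] uF(1)[OF True] by (metis zero_ereal_def)
    then have "real_of_ereal (u z) < 0" by (simp only: less_ereal.simps(1))
    moreover have "f z = real_of_ereal (u z) - c1" using True by (simp add: f_def)
    ultimately show ?thesis using c by linarith
  next
    case False
    have "u2 z \<le> 0" if "z \<in> Kc"
    proof -
      have "\<beta> * \<rho> z \<le> \<beta> * (2 * L\<rho> * R)" using \<rho>Kc(1)[OF that] \<beta>(1) by (intro mult_left_mono) auto
      then show ?thesis by (simp add: u2_def c2_def mult_ac)
    qed
    then show ?thesis using False by (simp add: f_def)
  qed
  have fKc: "f z = 0" if "z \<notin> Kc" for z using that FD DKc by (auto simp: f_def)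
  have fB: "\<bar>f z\<bar> \<le> B0" for z
    using f0[of z] f_u2[of z] B0'[of z] fKc[of z] B0 by (cases "z \<in> Kc") (auto simp: u2_def)
  have fm: "f \<in> borel_measurable borel"
  proof -
    define g1 where "g1 z = (if z \<in> F then real_of_ereal (u z) - c1 else 0)" for z
    have [measurable]: "F \<in> sets borel" "Kc \<in> sets borel" using Fc Kc compact_imp_closed by (auto intro: borel_closed)
    \<comment> \<open>Upper semicontinuity makes the superlevel sets inside the compact set F
      closed, so f is Borel and not merely Lebesgue measurable.\<close>
    have "g1 \<in> borel_measurable borel"
    proof (subst borel_measurable_iff_ge, rule allI)
      fix s
      have "closed (F - {z \<in> D. u z < ereal (s + c1)})"
        by (intro closed_Diff compact_imp_closed[OF Fc] open_usc_less[OF D(1) us(3) continuous_on_const])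
      moreover have "{z \<in> space borel. s \<le> g1 z} = (F - {z \<in> D. u z < ereal (s + c1)}) \<union> (if s \<le> 0 then - F else {})"
      proof (intro set_eqI)
        fix z
        show "z \<in> {z \<in> space borel. s \<le> g1 z} \<longleftrightarrow> z \<in> (F - {z \<in> D. u z < ereal (s + c1)}) \<union> (if s \<le> 0 then - F else {})"
        proof (cases "z \<in> F")
          case True
          then have "u z < ereal (s + c1) \<longleftrightarrow> real_of_ereal (u z) < s + c1" using uF(1)[OF True] by (metis ereal_less_eq(3) not_le)
          then show ?thesis using True FD by (auto simp: g1_def)
        qed (auto simp: g1_def)
      qed
      ultimately show "{z \<in> space borel. s \<le> g1 z} \<in> sets borel" by (auto intro!: sets.Un borel_closed)
    qed
    moreover have "(\<lambda>z. indicator Kc z *\<^sub>R u2 z) \<in> borel_measurable borel"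
      unfolding u2_def
      by (intro borel_measurable_continuous_on_indicator continuous_intros continuous_on_subset[OF \<rho>c Kc\<Omega>]) simp
    ultimately have "(\<lambda>z. g1 z + indicator (- F) z * (indicator Kc z *\<^sub>R u2 z)) \<in> borel_measurable borel" by measurable
    moreover have "f = (\<lambda>z. g1 z + indicator (- F) z * (indicator Kc z *\<^sub>R u2 z))"
      by (auto simp: f_def g1_def fun_eq_iff indicator_def)
    ultimately show ?thesis by simp
  qed
  have Lw: "continuous_on K' (Lg A w)" "x \<notin> K' \<Longrightarrow> Lg A w x = 0"
    if "C2c \<Omega> w" "compact K'" "K' \<subseteq> \<Omega>" "\<forall>x. x \<notin> K' \<longrightarrow> w x = 0" for w K' x
    using continuous_on_subset[OF cont_Lg[OF Ck_subset[OF open_UNIV open_dom subset_UNIV C2cD(1)[OF that(1)]] open_dom order_refl] that(3)]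
      Lg_zero_outside[OF compact_imp_closed[OF that(2)], of w x] that(4) by auto
  interpret G: glued A \<mu> \<Lambda> Lip \<Omega> \<delta> R B0 N D Kc F f u1 u2
  proof
    show "good \<delta>" "open D" "bounded D" "compact Kc" "Kc \<subseteq> \<Omega>" "compact F" by (fact good D(1,2) Kc Kc\<Omega> Fc)+
    show "R = real (Suc N) * (a0 * \<delta>)" by (rule R_def)
    show "cball z (2 * R) \<subseteq> Kc" if "z \<in> D" for z by (rule KcD[OF that])
    show "cball z (2 * R) \<subseteq> D" if "z \<in> F" for z by (rule Fb[OF that])
    show "f \<in> borel_measurable borel" "\<bar>f x\<bar> \<le> B0" "f x \<le> 0" for x by (fact fm fB f0)+
    show "f x = 0" if "x \<notin> Kc" for x by (rule fKc[OF that])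
    show "set_integrable lebesgue K' u1" if "compact K'" "K' \<subseteq> D" for K'
      by (rule null_modification(1)[OF N0 that(1) us(4)[OF that] continuous_on_const[of _ 0] _ _ u1_def]) auto
    show "u1 z \<le> f z" if zD: "z \<in> D" for z
    proof (cases "z \<in> F")
      case True then show ?thesis using uF(3)[OF True] by (simp add: f_def u1_def)
    next
      case False
      then have lt: "u z < ereal (h z)" using zD by (auto simp: F_def)
      have "z \<in> Kc" using zD DKc by blast
      then have fz: "f z = u2 z" using False by (simp add: f_def)
      show ?thesis
      proof (cases "u z = -\<infinity>")
        case True
        then show ?thesis using N0_iff[OF zD] B0'[OF \<open>z \<in> Kc\<close>] c by (simp add: u1_def fz u2_def)
      next
        case nF: False
        then have "real_of_ereal (u z) < h z" using lt uneg[OF zD] by (cases "u z") auto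
        then show ?thesis using N0_iff[OF zD] nF by (simp add: u1_def fz u2_def h_def)
      qed
    qed
    show "f z = u1 z" if "z \<in> F" for z using that uF(3)[OF that] by (simp add: f_def u1_def)
    show "0 \<le> (\<integral>z. u1 z * Lg A w z \<partial>lebesgue)" if w: "C2c D w" "\<And>z. 0 \<le> w z" for w
    proof -
      obtain K' where K': "compact K'" "K' \<subseteq> D" "\<forall>x. x \<notin> K' \<longrightarrow> w x = 0" using w(1) by (auto simp: C2c_def)
      note w' = C2c_subset[OF w(1) D_\<Omega>(1)]
      have K'\<Omega>: "K' \<subseteq> \<Omega>" using K'(2) D_\<Omega>(1) by blast
      have "(\<integral>z. u1 z * Lg A w z \<partial>lebesgue) = (\<integral>z. real_of_ereal (u z) * Lg A w z \<partial>lebesgue)"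
        by (rule null_modification(2)[OF N0 K'(1) us(4)[OF K'(1,2)] Lw[OF w' K'(1) K'\<Omega> K'(3)] integral_Lg_0[OF w'] u1_def])
      then show ?thesis using alpha_sh_C2c[OF D(1) D_\<Omega>(1) ush z uz w] by simp
    qed
    have u2c: "continuous_on \<Omega> u2" unfolding u2_def by (intro continuous_intros \<rho>c)
    show "set_integrable lebesgue Kc u2" by (rule set_integrable_continuous_compact[OF Kc continuous_on_subset[OF u2c Kc\<Omega>]])
    show "u2 z \<le> f z" if "z \<in> Kc" for z by (rule f_u2[OF that])
    show "f z = u2 z" if "z \<in> D - F" for z using that DKc by (auto simp: f_def)
    show "0 \<le> (\<integral>z. u2 z * Lg A w z \<partial>lebesgue)" if w: "C2c \<Omega> w" "\<And>z. 0 \<le> w z" for w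
    proof -
      have "(\<integral>z. u2 z * Lg A w z \<partial>lebesgue) = (\<integral>z. \<beta> * (\<rho> z * Lg A w z) - c2 * Lg A w z \<partial>lborel)"
        unfolding integrable_times_Lg(3)[OF u2c w(1)] by (simp add: u2_def algebra_simps)
      also have "\<dots> = \<beta> * (\<integral>z. \<rho> z * Lg A w z \<partial>lborel) - c2 * (\<integral>z. Lg A w z \<partial>lborel)"
        using integrable_times_Lg(1)[OF \<rho>c w(1)] integrable_times_Lg(1)[OF continuous_on_const[of _ 1] w(1)] by simp
      finally show ?thesis using integral_Lg_0[OF w(1)] \<rho>_sub[OF w] \<beta>(1) by simp
    qed
  qed
  let ?v = "SS \<delta> N f"
  have vc: "continuous_on S ?v" for S by (rule SS_continuous[OF good G.f_BI])
  have CS0: "0 \<le> CS B0"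
    using SS_bound[OF good G.f_BI fB, of N z] unfolding CS_def by linarith
  \<comment> \<open>Chosen so that \<eta> \<kappa> is exactly the defect in
    \<open>v_almost_subsolution\<close>.\<close>
  define \<eta> where "\<eta> = (CS B0 + B0) * \<theta> ^ N / (\<delta>\<^sup>2 * \<kappa>)"
  have \<eta>0: "0 \<le> \<eta>" unfolding \<eta>_def using CS0 B0 t \<kappa>(1) \<delta> by simp
  \<comment> \<open>The amount by which \<open>v_upper\<close> lets the smoothed function exceed
    \<psi> on K.\<close>
  define c3 where "c3 = Er + 2 * B0 * \<theta> ^ N"
  have c3: "0 < c3" unfolding c3_def using Er B0 t by (simp add: add_pos_nonneg)
  define v where "v z = ?v z + \<eta> * \<rho> z - c3" for z
  have "(\<lambda>z. ereal (v z)) \<in> U_class a K D \<psi>"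
  proof -
    have "alpha_sh a D (\<lambda>z. ereal (v z))"
    proof (rule alpha_sh_of_Lg)
      show "continuous_on D v" unfolding v_def by (intro continuous_intros vc continuous_on_subset[OF \<rho>c D_\<Omega>(1)])
      fix w assume w: "C2c D w" "\<And>z. 0 \<le> w z"
      note w' = C2c_subset[OF w(1) D_\<Omega>(1)]
      have v\<Omega>: "continuous_on \<Omega> v" unfolding v_def by (intro continuous_intros vc \<rho>c)
      have "(\<integral>z. v z * Lg A w z \<partial>lebesgue) = (\<integral>z. ?v z * Lg A w z + \<eta> * (\<rho> z * Lg A w z) - c3 * Lg A w z \<partial>lborel)"
        unfolding integrable_times_Lg(3)[OF v\<Omega> w'] by (simp add: v_def algebra_simps)
      also have "\<dots> = (\<integral>z. ?v z * Lg A w z \<partial>lborel) + \<eta> * (\<integral>z. \<rho> z * Lg A w z \<partial>lborel) - c3 * (\<integral>z. Lg A w z \<partial>lborel)"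
        using integrable_times_Lg(1)[OF vc w'] integrable_times_Lg(1)[OF \<rho>c w'] integrable_times_Lg(1)[OF continuous_on_const[of _ 1] w'] by simp
      also have "\<dots> \<ge> - ((CS B0 + B0) * \<theta> ^ N / \<delta>\<^sup>2) * (\<integral>z. w z \<partial>lborel) + \<eta> * (\<kappa> * (\<integral>z. w z \<partial>lborel))"
        using G.v_almost_subsolution[OF w] mult_left_mono[OF \<kappa>(2)[OF w' w(2)] \<eta>0] integral_Lg_0[OF w'] by simp
      also have "- ((CS B0 + B0) * \<theta> ^ N / \<delta>\<^sup>2) * (\<integral>z. w z \<partial>lborel) + \<eta> * (\<kappa> * (\<integral>z. w z \<partial>lborel)) = 0"
        using \<kappa>(1) \<delta> by (simp add: \<eta>_def field_simps)
      finally show "0 \<le> (\<integral>z. v z * Lg A w z \<partial>lebesgue)" .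
    qed
    moreover have "v z < 0" if "z \<in> D" for z
      using SS_nonpos[where f=f and N=N and z=z, OF good f0] mult_nonneg_nonpos[OF \<eta>0 less_imp_le[OF \<rho>neg[OF that]]] c3 by (simp add: v_def)
    moreover have "v z \<le> \<psi> z" if zK: "z \<in> K" for z
    proof -
      have zD: "z \<in> D" using zK K(2) by blast
      have b: "cball z (2 * R) \<subseteq> D" using near[OF zK] by (simp add: R_def)
      \<comment> \<open>\<open>v_upper\<close> asks for a nonpositive bound, and f \<le> 0 permits
        the minimum with 0. On D the function f lies below \<open>om\<close>: on F because u does,
        elsewhere because \<beta> \<rho> does.\<close>
      have "?v z \<le> min (\<psi> z + Er) 0 + 2 * B0 * \<theta> ^ N"
      proof (rule G.v_upper[OF zD b])
        fix y assume y: "y \<in> cball z (2 * R)"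
        have yD: "y \<in> D" using b y by blast
        have "f y \<le> om y"
        proof (cases "y \<in> F")
          case True
          have "real_of_ereal (u y) \<le> om y" using class_le_om[OF u yD] uF(1)[OF True] by (metis ereal_less_eq(3))
          then show ?thesis using True c by (simp add: f_def)
        next
          case False then show ?thesis using \<omega>_bounds(4)[OF yD] c yD DKc by (auto simp: f_def u2_def)
        qed
        then show "f y \<le> min (\<psi> z + Er) 0" using upper[OF zK, of y] y f0[of y] by (simp add: R_def)
      qed simp
      then show ?thesis using mult_nonneg_nonpos[OF \<eta>0 less_imp_le[OF \<rho>neg[OF zD]]] by (simp add: v_def c3_def)
    qed
    ultimately show ?thesis by (auto simp: U_class_def zero_ereal_def)
  qed
  from class_le_om[OF this w] have vw: "v w \<le> om w" by simp
  \<comment> \<open>The comparison of f with its smoothing holds almost everywhere only. Strong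
    upper semicontinuity recovers u z as a limit superior along the set S of full measure.\<close>
  have uv: "u z \<le> ereal (?v z + c1 + CS B0 * \<theta> ^ N)"
  proof -
    define S where "S = {x. x \<in> D \<longrightarrow> f x - CS B0 * \<theta> ^ N \<le> ?v x}"
    have "AE x in lebesgue. x \<in> S" unfolding S_def mem_Collect_eq by (rule AE_completion[OF G.v_ge_f])
    from AE_E3[OF this] obtain N' where N': "\<And>x. x \<in> space lebesgue - N' \<Longrightarrow> x \<in> S" "N' \<in> null_sets lebesgue" by blast
    have "ball z 1 - S \<in> null_sets lebesgue" by (rule null_sets_completion_subset[OF _ N'(2)]) (use N'(1) in auto)
    then have ex: "\<exists>r>0. ball z r - S \<in> null_sets lebesgue" by (intro exI[of _ 1]) simp
    then have "u z = Limsup (at z within (S \<inter> D)) u" using us(3) z unfolding strongly_usc_def by metis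
    also have "\<dots> \<le> Limsup (at z within (S \<inter> D)) (\<lambda>x. ereal (?v x + c1 + CS B0 * \<theta> ^ N))"
    proof (rule Limsup_mono)
      have "u x \<le> ereal (?v x + c1 + CS B0 * \<theta> ^ N)" if x: "x \<in> S \<inter> D" for x
      proof (cases "u x = -\<infinity>")
        case False
        then have b: "u1 x = real_of_ereal (u x) - c1" using N0_iff[of x] x by (simp add: u1_def)
        have c': "u1 x \<le> f x" using G.u1(2) x by blast
        have e: "u x = ereal (real_of_ereal (u x))" using False uneg[of x] x by (cases "u x") auto
        have "f x - CS B0 * \<theta> ^ N \<le> ?v x" using x by (simp add: S_def)
        then have "real_of_ereal (u x) \<le> ?v x + c1 + CS B0 * \<theta> ^ N" using b c' by linarith
        then show ?thesis using e by (metis ereal_less_eq(3))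
      qed simp
      then show "\<forall>\<^sub>F x in at z within (S \<inter> D). u x \<le> ereal (?v x + c1 + CS B0 * \<theta> ^ N)"
        by (simp add: eventually_at_filter)
    qed
    also have "\<dots> = ereal (?v z + c1 + CS B0 * \<theta> ^ N)"
    proof (rule lim_imp_Limsup)
      show "at z within (S \<inter> D) \<noteq> bot" using ex at_within_full_measure_neq_bot[OF D(1) z] by blast
      have "continuous_on UNIV (\<lambda>x. ?v x + c1 + CS B0 * \<theta> ^ N)" by (intro continuous_intros vc)
      then have "((\<lambda>x. ?v x + c1 + CS B0 * \<theta> ^ N) \<longlongrightarrow> ?v z + c1 + CS B0 * \<theta> ^ N) (at z)" by (simp add: continuous_on_def)
      then have "((\<lambda>x. ?v x + c1 + CS B0 * \<theta> ^ N) \<longlongrightarrow> ?v z + c1 + CS B0 * \<theta> ^ N) (at z within (S \<inter> D))"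
        by (rule tendsto_within_subset) simp
      then show "((\<lambda>x. ereal (?v x + c1 + CS B0 * \<theta> ^ N)) \<longlongrightarrow> ereal (?v z + c1 + CS B0 * \<theta> ^ N)) (at z within (S \<inter> D))"
        by (simp only: lim_ereal)
    qed
    finally show ?thesis .
  qed
  let ?L = "a0 / (2 * \<mu>) * CM * (B0 / (1 - \<theta>)) / \<delta> * dist z w"
  have "?v z - ?v w \<le> ?L" using SS_lipschitz[OF good G.f_BI fB, of N z w] by linarith
  moreover have "- (\<eta> * \<rho> w) \<le> \<eta> * M\<rho>"
  proof -
    have "w \<in> Kc" using w DKc by blast
    then have "\<eta> * (- \<rho> w) \<le> \<eta> * M\<rho>" using \<rho>Kc(2)[of w] \<eta>0 by (intro mult_left_mono) auto
    then show ?thesis by simp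
  qed
  ultimately have "?v z + c1 + CS B0 * \<theta> ^ N \<le> om w + err \<delta> N Er + ?L"
    using vw by (simp add: v_def err_def c3_def c1_def \<eta>_def R_def algebra_simps)
  then show ?thesis using uv by (meson ereal_less_eq(3) order_trans)
qed

lemma om_bound:
  assumes good: "good \<delta>" and Rr: "2 * (real (Suc N) * (a0 * \<delta>)) \<le> r"
    and near: "\<And>z. z \<in> K \<Longrightarrow> cball z (2 * (real (Suc N) * (a0 * \<delta>))) \<subseteq> D"
    and upper: "\<And>z y. z \<in> K \<Longrightarrow> dist z y \<le> 2 * (real (Suc N) * (a0 * \<delta>)) \<Longrightarrow> om y \<le> \<psi> z + Er" and Er: "0 < Er"
    and z: "z \<in> D" and w: "w \<in> D"
  shows "om z \<le> om w + err \<delta> N Er + a0 / (2 * \<mu>) * CM * (B0 / (1 - \<theta>)) / \<delta> * dist z w"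
proof -
  have "\<omega> z \<le> ereal (om w + err \<delta> N Er + a0 / (2 * \<mu>) * CM * (B0 / (1 - \<theta>)) / \<delta> * dist z w)"
    unfolding omega_alpha_def by (intro SUP_least class_bound[OF good Rr near upper Er _ z w])
  then show ?thesis using \<omega>_bounds(3)[OF z] by simp
qed

end

section \<open>Choice of scales and the Hoelder estimate\<close>

lemma power6_geometric_bounded:
  fixes \<theta> :: real
  assumes "0 \<le> \<theta>" "\<theta> < 1"
  obtains C where "0 < C" "\<And>N. real N ^ 6 * \<theta> ^ N \<le> C"
proof -
  define y where "y = root 6 \<theta>"
  have y: "0 \<le> y" "y < 1" "y ^ 6 = \<theta>" using assms by (auto simp: y_def real_root_pow_pos2)
  have "(\<lambda>n. of_nat n * y ^ n) \<longlonglongrightarrow> 0" by (rule powser_times_n_limit_0) (use y in simp)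
  then have "Bseq (\<lambda>n. real n * y ^ n)" by (intro convergent_imp_Bseq convergentI)
  then obtain C where C: "0 < C" "\<And>n. norm (real n * y ^ n) \<le> C" unfolding Bseq_def by blast
  have "real N ^ 6 * \<theta> ^ N \<le> C ^ 6" for N
  proof -
    have "real N ^ 6 * \<theta> ^ N = (real N * y ^ N) ^ 6"
      unfolding y(3)[symmetric] power_mult_distrib by (simp add: mult.commute flip: power_mult)
    also have "\<dots> \<le> C ^ 6" by (rule power_mono) (use C(2)[of N] y in auto)
    finally show ?thesis .
  qed
  then show thesis using that[of "C ^ 6"] C(1) by simp
qed

context regular_domain begin

text \<open>Here s is the fourth root of the distance scale, \<delta> = s^2 and N is about 1 / s, so
  the range is of order s. The sixth power beats the division by the square of \<delta>, that is by
  s^4, in \<open>err\<close>, with s^2 to spare.\<close>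

lemma smoothing_scale:
  assumes s: "0 < s" "s \<le> 1" and C6: "0 < C6" "\<And>N. real N ^ 6 * \<theta> ^ N \<le> C6" and \<theta>0: "0 \<le> \<theta>"
  defines "N \<equiv> nat \<lceil>1 / s\<rceil>"
  shows "real (Suc N) * (a0 * s\<^sup>2) \<le> 3 * a0 * s" "\<theta> ^ N \<le> C6 * s ^ 6"
proof -
  have N: "1 / s \<le> real N" "real N \<le> 1 / s + 1" using s(1) by (auto simp: N_def of_nat_ceiling)
  have "real (Suc N) * s\<^sup>2 \<le> (1 / s + 2) * s\<^sup>2" using N by (intro mult_right_mono) auto
  also have "\<dots> = s + 2 * (s * s)" using s(1) by (simp add: field_simps power2_eq_square)
  also have "\<dots> \<le> 3 * s" using s mult_left_le[of s s] by simp
  finally have "a0 * (real (Suc N) * s\<^sup>2) \<le> a0 * (3 * s)" using a0_pos by (intro mult_left_mono) auto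
  then show "real (Suc N) * (a0 * s\<^sup>2) \<le> 3 * a0 * s" by (simp add: mult_ac)
  have "(1 / s) ^ 6 * \<theta> ^ N \<le> real N ^ 6 * \<theta> ^ N" using N(1) s(1) \<theta>0 by (intro mult_right_mono power_mono) auto
  also have "\<dots> \<le> C6" by (rule C6)
  finally show "\<theta> ^ N \<le> C6 * s ^ 6" using s(1) by (simp add: power_one_over field_simps)
qed

text \<open>The hypothesis compares \<omega> at y with \<psi> at the nearest point w only; Hoelder
  continuity of \<psi> passes from w to z, at most 2t away. Since t \<le> 1, both exponents may be
  lowered to the smaller one.\<close>

lemma nearest_point_bound:
  assumes \<psi>: "0 < C\<psi>" "0 < \<gamma>" "\<gamma> \<le> 1" "\<And>z w. z \<in> K \<Longrightarrow> w \<in> K \<Longrightarrow> \<bar>\<psi> z - \<psi> w\<bar> \<le> C\<psi> * dist z w powr \<gamma>"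
    and V: "0 < C" "0 < lam" "lam \<le> 1" "\<And>z w. z \<in> V \<inter> D \<Longrightarrow> w \<in> K \<Longrightarrow> dist z w = infdist z K \<Longrightarrow>
      \<bar>\<omega> z - ereal (\<psi> w)\<bar> \<le> ereal (C * infdist z K powr lam)"
    and y: "z \<in> K" "y \<in> V \<inter> D" "dist z y \<le> t" "t \<le> 1"
  shows "om y \<le> \<psi> z + (C + 2 * C\<psi>) * t powr min lam \<gamma>"
proof -
  define g where "g = min lam \<gamma>"
  have t0: "0 \<le> t" using y(3) zero_le_dist[of z y] by linarith
  have ne: "K \<noteq> {}" using y(1) by blast
  obtain w where w: "w \<in> K" "infdist y K = dist y w" using infdist_attains_inf[OF compact_imp_closed[OF K(1)] ne] by blast
  have i: "infdist y K \<le> t" using infdist_le[OF y(1), of y] y(3) by (simp add: dist_commute)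
  have "\<bar>\<omega> y - ereal (\<psi> w)\<bar> \<le> ereal (C * infdist y K powr lam)" using V(4)[OF y(2) w(1)] w(2) by simp
  then have "om y \<le> \<psi> w + C * infdist y K powr lam" using \<omega>_bounds(3)[of y] y(2) by simp
  moreover have "C * infdist y K powr lam \<le> C * t powr g"
  proof -
    have "infdist y K powr lam \<le> t powr lam" using V(2) i infdist_nonneg[of y K] by (intro powr_mono2) auto
    also have "\<dots> \<le> t powr g" using t0 y(4) by (intro powr_mono') (auto simp: g_def)
    finally show ?thesis using V(1) by (intro mult_left_mono) auto
  qed
  moreover have "\<psi> w \<le> \<psi> z + C\<psi> * (2 * t powr g)"
  proof -
    have "dist w z \<le> 2 * t" using dist_triangle[of w z y] i y(3) w(2) by (simp add: dist_commute)
    then have "dist w z powr \<gamma> \<le> (2 * t) powr \<gamma>" using \<psi>(2) by (intro powr_mono2) auto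
    also have "\<dots> = 2 powr \<gamma> * t powr \<gamma>" using t0 by (simp add: powr_mult)
    also have "\<dots> \<le> 2 * t powr g"
    proof (rule mult_mono)
      show "2 powr \<gamma> \<le> (2::real)" using powr_mono[of \<gamma> 1 2] \<psi>(3) by simp
      show "t powr \<gamma> \<le> t powr g" using t0 y(4) by (intro powr_mono') (auto simp: g_def)
    qed auto
    finally have "C\<psi> * dist w z powr \<gamma> \<le> C\<psi> * (2 * t powr g)" using \<psi>(1) by (intro mult_left_mono) auto
    then show ?thesis using \<psi>(4)[OF w(1) y(1)] by linarith
  qed
  ultimately show ?thesis by (simp add: g_def algebra_simps)
qed

text \<open>Distances of size s^4 give the exponent g / 4. From s0 on, the bound \<beta> M\<rho> on
  the oscillation suffices after enlarging the constant.\<close>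

lemma hoelder_of_modulus:
  assumes E: "0 < E" "0 < s0" "0 < g" "g \<le> 1"
    and mod: "\<And>s z w. 0 < s \<Longrightarrow> s < s0 \<Longrightarrow> z \<in> D \<Longrightarrow> w \<in> D \<Longrightarrow> dist z w \<le> s ^ 4 \<Longrightarrow> om z - om w \<le> E * s powr g"
  shows "hoelder_on D om"
proof -
  have bd: "\<bar>om z - om w\<bar> \<le> \<beta> * M\<rho>" if "z \<in> D" "w \<in> D" for z w
  proof -
    have "- (\<beta> * M\<rho>) \<le> om z" if z: "z \<in> D" for z
    proof -
      have "infdist z (closure D) \<le> r" using z closure_D(3) r by (auto simp: subset_iff)
      then have "\<beta> * (- M\<rho>) \<le> \<beta> * \<rho> z" using \<rho>M[of z] \<beta>(1) by (intro mult_left_mono) auto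
      then show ?thesis using \<omega>_bounds(4)[OF z] by simp
    qed
    then show ?thesis using that \<omega>_bounds(5) by (smt (verit))
  qed
  define C where "C = E + \<beta> * M\<rho> / s0 powr g"
  have C0: "0 < C" using E(1) \<beta>(1) M\<rho>_nonneg by (simp add: C_def add_pos_nonneg)
  have "\<bar>om z - om w\<bar> \<le> C * dist z w powr (g / 4)" if zw: "z \<in> D" "w \<in> D" for z w
  proof (cases "z = w")
    case False
    define s where "s = dist z w powr (1 / 4)"
    have s: "0 < s" "s ^ 4 = dist z w" "s powr g = dist z w powr (g / 4)"
      using False by (auto simp: s_def powr_powr powr_power)
    show ?thesis
    proof (cases "s < s0")
      case True
      have "\<bar>om z - om w\<bar> \<le> E * s powr g"
        using mod[OF s(1) True zw] mod[OF s(1) True zw(2,1)] s(2) by (simp add: dist_commute abs_le_iff)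
      also have "\<dots> \<le> C * s powr g" using \<beta>(1) M\<rho>_nonneg by (intro mult_right_mono) (auto simp: C_def)
      finally show ?thesis by (simp add: s(3))
    next
      case False
      have "\<beta> * M\<rho> = \<beta> * M\<rho> / s0 powr g * s0 powr g" using E(2) by simp
      also have "\<dots> \<le> \<beta> * M\<rho> / s0 powr g * s powr g"
        using False E \<beta>(1) M\<rho>_nonneg by (intro mult_left_mono powr_mono2) auto
      also have "\<dots> \<le> C * s powr g" using E(1) by (intro mult_right_mono) (auto simp: C_def)
      finally show ?thesis using bd[OF zw] by (simp add: s(3))
    qed
  qed (use C0 in simp)
  then show ?thesis unfolding hoelder_on_def using C0 E(3,4) by (intro exI[of _ C] exI[of _ "g / 4"]) auto
qed

lemma hoelder_of_boundary_estimate: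
  assumes \<psi>: "hoelder_on K \<psi>" and V: "open V" "K \<subseteq> V" "0 < C" "0 < lam" "lam \<le> 1"
    and est: "\<And>z w. z \<in> V \<inter> D \<Longrightarrow> w \<in> K \<Longrightarrow> dist z w = infdist z K \<Longrightarrow> \<bar>\<omega> z - ereal (\<psi> w)\<bar> \<le> ereal (C * infdist z K powr lam)"
  shows "hoelder_on D om"
proof -
  obtain C\<psi> \<gamma> where \<psi>: "0 < C\<psi>" "0 < \<gamma>" "\<gamma> \<le> 1" "\<And>z w. z \<in> K \<Longrightarrow> w \<in> K \<Longrightarrow> \<bar>\<psi> z - \<psi> w\<bar> \<le> C\<psi> * dist z w powr \<gamma>"
    using \<psi> by (auto simp: hoelder_on_def)
  define g where "g = min lam \<gamma>"
  have g: "0 < g" "g \<le> 1" using V \<psi> by (auto simp: g_def)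
  obtain d0 where d0: "0 < d0" "(\<Union>x\<in>K. cball x d0) \<subseteq> V \<inter> D"
    using compact_subset_open_imp_cball_epsilon_subset[OF K(1), of "V \<inter> D"] V K D(1) by blast
  obtain \<delta>0 where \<delta>0: "0 < \<delta>0" "\<And>\<delta>. 0 < \<delta> \<Longrightarrow> \<delta> < \<delta>0 \<Longrightarrow> good \<delta>" using exists_good by blast
  have \<theta>: "0 \<le> \<theta>" "\<theta> < 1" using \<theta>_bounds[OF \<delta>0(2)[of "\<delta>0 / 2"]] \<delta>0(1) by auto
  obtain C6 where C6: "0 < C6" "\<And>N. real N ^ 6 * \<theta> ^ N \<le> C6" using power6_geometric_bounded[OF \<theta>] by blast
  \<comment> \<open>In turn: s \<le> 1; \<delta> = s^2 \<le> s < \<delta>0 is admissible; and 6 a0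
    s, which bounds 2R, is at most 1, at most r, and at most the width d0 of a neighbourhood of K
    inside V and D.\<close>
  define s0 where "s0 = min (min 1 \<delta>0) (min (1 / (6 * a0)) (min (r / (6 * a0)) (d0 / (6 * a0))))"
  have s0: "0 < s0" unfolding s0_def using \<delta>0(1) a0_pos r d0(1) by simp
  define LL where "LL = a0 / (2 * \<mu>) * CM * (B0 / (1 - \<theta>))"
  define C' where "C' = C + 2 * C\<psi>"
  \<comment> \<open>The coefficients of s powr g contributed by the terms of \<open>err\<close> and
    by the Lipschitz term; absolute values spare a discussion of signs.\<close>
  define E where "E = C' * (6 * a0) powr g + 15 * \<beta> * L\<rho> * a0 + (2 * \<bar>B0\<bar> + \<bar>CS B0\<bar>) * C6 + M\<rho> * ((\<bar>CS B0\<bar> + \<bar>B0\<bar>) * C6 / \<kappa>) + \<bar>LL\<bar>"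
  have C'0: "0 < C'" using V(3) \<psi>(1) by (simp add: C'_def)
  have E0: "0 < E" unfolding E_def
    using C'0 a0_pos \<beta>(1) \<rho>L(1) C6(1) M\<rho>_nonneg \<kappa>(1) by (intro add_pos_nonneg mult_pos_pos mult_nonneg_nonneg divide_nonneg_nonneg) auto
  show ?thesis
  proof (rule hoelder_of_modulus[OF E0 s0 g])
    fix s z w assume s: "0 < s" "s < s0" and zw: "z \<in> D" "w \<in> D" "dist z w \<le> s ^ 4"
    have s1: "s \<le> 1" "s < \<delta>0" "6 * a0 * s \<le> 1" "6 * a0 * s \<le> r" "6 * a0 * s \<le> d0"
      using s a0_pos by (auto simp: s0_def field_simps)
    define N where "N = nat \<lceil>1 / s\<rceil>"
    note sc = smoothing_scale[OF s(1) s1(1) C6 \<theta>(1), folded N_def]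
    define R where "R = real (Suc N) * (a0 * s\<^sup>2)"
    define Er where "Er = C' * (6 * a0 * s) powr g"
    have R1: "R \<le> 3 * a0 * s" using sc(1) unfolding R_def .
    then have R2: "2 * R \<le> 6 * a0 * s" by linarith
    have ss: "s\<^sup>2 \<le> s" "s ^ 6 \<le> s" using s s1(1) power_decreasing[of 1 2 s] power_decreasing[of 1 6 s] by auto
    have "0 < s\<^sup>2" "s\<^sup>2 < \<delta>0" using s ss s1 by auto
    then have gd: "good (s\<^sup>2)" using \<delta>0(2) by blast
    have sg: "s \<le> s powr g" using powr_mono'[of g 1 s] g s s1 by simp
    have Er: "0 < Er" unfolding Er_def using C'0 a0_pos s by simp
    have cb: "y \<in> V \<inter> D" if "z \<in> K" "dist z y \<le> 2 * R" for z y
    proof -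
      have "dist z y \<le> d0" using that(2) R2 s1(5) by linarith
      then have "y \<in> cball z d0" by simp
      then show ?thesis using d0(2) that(1) by blast
    qed
    have "om z \<le> om w + err (s\<^sup>2) N Er + LL / s\<^sup>2 * dist z w"
      unfolding LL_def
    proof (rule om_bound[OF gd _ _ _ Er zw(1,2)], fold R_def)
      show "2 * R \<le> r" using R2 s1 by linarith
      show "cball z (2 * R) \<subseteq> D" if "z \<in> K" for z using cb[OF that] by auto
      show "om y \<le> \<psi> z + Er" if zy: "z \<in> K" "dist z y \<le> 2 * R" for z y
      proof -
        have d: "dist z y \<le> 6 * a0 * s" using zy(2) R2 by linarith
        have "om y \<le> \<psi> z + (C + 2 * C\<psi>) * (6 * a0 * s) powr min lam \<gamma>"
        proof (rule nearest_point_bound[where V=V])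
          show "0 < C\<psi>" "0 < \<gamma>" "\<gamma> \<le> 1" "0 < C" "0 < lam" "lam \<le> 1" "z \<in> K" "dist z y \<le> 6 * a0 * s" "6 * a0 * s \<le> 1"
            by (fact \<psi> V zy d s1)+
          show "y \<in> V \<inter> D" by (rule cb[OF zy])
          show "\<bar>\<psi> z - \<psi> w\<bar> \<le> C\<psi> * dist z w powr \<gamma>" if "z \<in> K" "w \<in> K" for z w by (rule \<psi>(4)[OF that])
          show "\<bar>\<omega> z - ereal (\<psi> w)\<bar> \<le> ereal (C * infdist z K powr lam)" if "z \<in> V \<inter> D" "w \<in> K" "dist z w = infdist z K" for z w
            by (rule est[OF that])
        qed
        then show ?thesis unfolding Er_def C'_def g_def .
      qed
    qed
    moreover have "LL / s\<^sup>2 * dist z w \<le> \<bar>LL\<bar> * s powr g"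
    proof -
      have "LL / s\<^sup>2 * dist z w \<le> \<bar>LL\<bar> / s\<^sup>2 * s ^ 4" using zw(3) by (intro mult_mono divide_right_mono) auto
      also have "\<dots> = \<bar>LL\<bar> * s\<^sup>2" using s(1) by (simp add: power2_eq_square power4_eq_xxxx)
      also have "\<dots> \<le> \<bar>LL\<bar> * s powr g" using ss sg by (intro mult_left_mono) auto
      finally show ?thesis .
    qed
    moreover have "err (s\<^sup>2) N Er \<le> (E - \<bar>LL\<bar>) * s powr g"
    proof -
      have e1: "Er = C' * (6 * a0) powr g * s powr g" unfolding Er_def using a0_pos s(1) by (simp add: powr_mult)
      have e2: "5 * \<beta> * L\<rho> * R \<le> 15 * \<beta> * L\<rho> * a0 * s powr g"
      proof -
        have "5 * \<beta> * L\<rho> * R \<le> 5 * \<beta> * L\<rho> * (3 * a0 * s)" using R1 \<beta>(1) \<rho>L(1) by (intro mult_left_mono) auto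
        also have "\<dots> = 15 * \<beta> * L\<rho> * a0 * s" by simp
        also have "\<dots> \<le> 15 * \<beta> * L\<rho> * a0 * s powr g" using sg \<beta>(1) \<rho>L(1) a0_pos by (intro mult_left_mono) auto
        finally show ?thesis .
      qed
      have \<theta>N: "\<theta> ^ N \<le> C6 * s powr g" "\<theta> ^ N / s ^ 4 \<le> C6 * s powr g"
      proof -
        show "\<theta> ^ N \<le> C6 * s powr g" using sc(2) mult_left_mono[OF order_trans[OF ss(2) sg], of C6] C6(1) by linarith
        have "\<theta> ^ N / s ^ 4 \<le> C6 * s ^ 6 / s ^ 4" using sc(2) s(1) by (intro divide_right_mono) auto
        also have "\<dots> = C6 * s\<^sup>2" using s(1) by (simp add: field_simps flip: power_add)
        also have "\<dots> \<le> C6 * s powr g" using ss(1) sg C6(1) by (intro mult_left_mono) auto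
        finally show "\<theta> ^ N / s ^ 4 \<le> C6 * s powr g" .
      qed
      have e3: "(2 * B0 + CS B0) * \<theta> ^ N \<le> (2 * \<bar>B0\<bar> + \<bar>CS B0\<bar>) * (C6 * s powr g)"
        using \<theta>N(1) \<theta>(1) by (intro mult_mono) auto
      have e4: "M\<rho> * ((CS B0 + B0) * \<theta> ^ N / ((s\<^sup>2)\<^sup>2 * \<kappa>)) \<le> M\<rho> * ((\<bar>CS B0\<bar> + \<bar>B0\<bar>) * (C6 * s powr g) / \<kappa>)"
      proof (rule mult_left_mono[OF _ M\<rho>_nonneg])
        have "(CS B0 + B0) * \<theta> ^ N / ((s\<^sup>2)\<^sup>2 * \<kappa>) = (CS B0 + B0) * (\<theta> ^ N / s ^ 4) / \<kappa>" by (simp flip: power_mult)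
        also have "\<dots> \<le> (\<bar>CS B0\<bar> + \<bar>B0\<bar>) * (C6 * s powr g) / \<kappa>"
          using \<theta>N(2) \<theta>(1) s(1) \<kappa>(1) by (intro divide_right_mono mult_mono) auto
        finally show "(CS B0 + B0) * \<theta> ^ N / ((s\<^sup>2)\<^sup>2 * \<kappa>) \<le> (\<bar>CS B0\<bar> + \<bar>B0\<bar>) * (C6 * s powr g) / \<kappa>" .
      qed
      have "(E - \<bar>LL\<bar>) * s powr g = C' * (6 * a0) powr g * s powr g + 15 * \<beta> * L\<rho> * a0 * s powr g
          + (2 * \<bar>B0\<bar> + \<bar>CS B0\<bar>) * (C6 * s powr g) + M\<rho> * ((\<bar>CS B0\<bar> + \<bar>B0\<bar>) * (C6 * s powr g) / \<kappa>)"
        by (simp add: E_def algebra_simps add_divide_distrib)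
      then show ?thesis unfolding err_def using e1 e2 e3 e4 by (fold R_def) linarith
    qed
    ultimately show "om z - om w \<le> E * s powr g" by (simp add: left_diff_distrib)
  qed
qed

end

section \<open>Construction of the setting and the equivalence\<close>

lemma regular_domain_exists:
  fixes a :: "'n::finite coefmat"
  assumes a: "alpha_form a U" and D: "strongly_alpha_regular a U D" and K: "compact K" "K \<subseteq> D" and \<psi>: "continuous_on K \<psi>"
  obtains A \<mu> \<Lambda> Lip \<Omega> \<rho> r L\<rho> M\<rho> \<kappa> \<beta> where "regular_domain A \<mu> \<Lambda> Lip \<Omega> a D K \<psi> \<rho> r L\<rho> M\<rho> \<kappa> \<beta>"
proof -
  obtain Dp \<rho> where D: "open D" "D \<noteq> {}" "bounded D" and Dp: "open Dp" "closure D \<subseteq> Dp" "Dp \<subseteq> U"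
    and \<rho>: "Ck 2 \<rho> Dp" "strictly_alpha_sh a Dp (\<lambda>z. ereal (\<rho> z))" "\<And>z. z \<in> D \<Longrightarrow> \<rho> z < 0"
      "\<And>\<xi>. \<xi> \<in> frontier D \<Longrightarrow> (\<rho> \<longlongrightarrow> 0) (at \<xi> within D)"
    using D unfolding strongly_alpha_regular_def by blast
  have cD: "compact (closure D)" "closure D \<noteq> {}" using D by auto
  obtain r A \<mu> \<Lambda> Lip where r: "0 < r" "{z. infdist z (closure D) \<le> 4 * r} \<subseteq> Dp"
    and er: "elliptic_region A \<mu> \<Lambda> Lip {z. infdist z (closure D) < 2 * r}"
    and Lop: "\<And>w z. infdist z (closure D) < 2 * r \<Longrightarrow> Lg A w z = Lop a w z"
    using form_extension[OF a cD Dp] by blast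
  define \<Omega> where "\<Omega> = {z. infdist z (closure D) < 2 * r}"
  interpret form_region A \<mu> \<Lambda> Lip \<Omega> a
    using er Lop by (auto simp: form_region_def form_region_axioms_def \<Omega>_def)
  have \<Omega>Dp: "\<Omega> \<subseteq> Dp" using r by (force simp: \<Omega>_def)
  have \<rho>1: "Ck 1 \<rho> Dp" using Ck_SucD[of 1 \<rho> Dp] \<rho>(1) by (simp add: numeral_2_eq_2)
  have \<rho>c: "continuous_on Dp \<rho>" by (rule Ck_continuous[OF \<rho>(1)])
  obtain L where L: "0 \<le> L" "\<And>z y. infdist z (closure D) \<le> 3 * r \<Longrightarrow> dist z y \<le> r \<Longrightarrow> norm (\<rho> z - \<rho> y) \<le> L * dist z y"
    using C1_lipschitz_near[OF \<rho>1 Dp(1) cD r] by blast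
  have "compact (\<rho> ` {z. infdist z (closure D) \<le> r})"
    by (intro compact_continuous_image compact_infdist_le[OF cD(2,1) r(1)] continuous_on_subset[OF \<rho>c]) (use r in force)
  then have "\<exists>M. \<forall>z. infdist z (closure D) \<le> r \<longrightarrow> \<bar>\<rho> z\<bar> \<le> M"
    by (auto simp: bounded_iff dest!: compact_imp_bounded)
  then obtain M where M: "\<And>z. infdist z (closure D) \<le> r \<Longrightarrow> \<bar>\<rho> z\<bar> \<le> M" by blast
  have \<Omega>o: "open \<Omega>" by (rule open_dom)
  have c\<Omega>: "closure \<Omega> \<subseteq> {z. infdist z (closure D) \<le> 2 * r}"
  proof (rule closure_minimal)
    show "\<Omega> \<subseteq> {z. infdist z (closure D) \<le> 2 * r}" by (auto simp: \<Omega>_def)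
    show "closed {z. infdist z (closure D) \<le> 2 * r}" by (intro compact_imp_closed compact_infdist_le[OF cD(2,1)]) (use r in simp)
  qed
  have "compact {z. infdist z (closure D) \<le> 2 * r}" by (intro compact_infdist_le[OF cD(2,1)]) (use r in simp)
  then have "compact (closure \<Omega>)" using c\<Omega> by (meson bounded_subset closed_closure compact_eq_bounded_closed)
  moreover have "closure \<Omega> \<subseteq> Dp"
  proof
    fix z assume "z \<in> closure \<Omega>"
    then have "infdist z (closure D) \<le> 2 * r" using c\<Omega> by blast
    then have "z \<in> {z. infdist z (closure D) \<le> 4 * r}" using r(1) by simp
    then show "z \<in> Dp" using r(2) by blast
  qed
  ultimately obtain \<epsilon> where \<epsilon>: "0 < \<epsilon>" "alpha_sh a \<Omega> (\<lambda>z. ereal (\<rho> z) - ereal (\<epsilon> * (norm z)\<^sup>2))"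
    using \<rho>(2) \<Omega>o unfolding strictly_alpha_sh_def by blast
  have D\<Omega>: "D \<subseteq> \<Omega>" using closure_subset[of D] r by (auto simp: \<Omega>_def subset_iff)
  \<comment> \<open>Only the limit along D is prescribed; continuity of \<rho> across the frontier
    identifies it with the value.\<close>
  have fr: "\<rho> \<xi> = 0" if \<xi>: "\<xi> \<in> frontier D" for \<xi>
  proof -
    have x: "\<xi> \<in> closure D" "\<xi> \<notin> D" using \<xi> D(1) by (auto simp: frontier_def interior_open)
    then have "at \<xi> within D \<noteq> bot" by (auto simp: closure_def trivial_limit_within)
    moreover have "(\<rho> \<longlongrightarrow> \<rho> \<xi>) (at \<xi> within D)"
      using \<rho>c x Dp(2) closure_subset[of D] by (meson continuous_on_def subset_iff tendsto_within_subset)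
    ultimately show ?thesis using \<rho>(4)[OF \<xi>] tendsto_unique by blast
  qed
  \<comment> \<open>\<rho> has no zero on the compact set K, so \<psi> / \<rho> is bounded there; a
    multiple of the negative function \<rho> at least as large as this bound lies below
    \<psi>.\<close>
  obtain b where b: "\<And>z. z \<in> K \<Longrightarrow> \<psi> z / \<rho> z \<le> b"
  proof -
    have nz: "\<rho> z \<noteq> 0" if "z \<in> K" for z using \<rho>(3)[of z] that K(2) by force
    have c1: "continuous_on K \<rho>" using \<rho>c K(2) Dp(2) closure_subset[of D] by (meson continuous_on_subset order_trans)
    have "compact ((\<lambda>z. \<psi> z / \<rho> z) ` K)"
      by (intro compact_continuous_image continuous_on_divide \<psi> c1 K) (use nz in blast)
    then have "\<exists>b. \<forall>x\<in>(\<lambda>z. \<psi> z / \<rho> z) ` K. norm x \<le> b" using compact_imp_bounded bounded_iff by metis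
    then obtain b where "\<forall>x\<in>(\<lambda>z. \<psi> z / \<rho> z) ` K. norm x \<le> b" by blast
    then have "\<bar>\<psi> z / \<rho> z\<bar> \<le> b" if "z \<in> K" for z using that by (metis image_eqI real_norm_def)
    then show thesis using that[of b] abs_le_D1 by blast
  qed
  define \<beta> where "\<beta> = max 1 b"
  have \<beta>: "\<beta> * \<rho> z \<le> \<psi> z" if z: "z \<in> K" for z
  proof -
    have neg: "\<rho> z < 0" using \<rho>(3) z K(2) by blast
    have "\<psi> z / \<rho> z \<le> \<beta>" using b[OF z] by (simp add: \<beta>_def)
    then show ?thesis using neg by (simp add: neg_divide_le_eq)
  qed
  \<comment> \<open>\<epsilon> times 2 \<mu> is the gain from \<open>weak_strictness\<close> on
    \<Omega>, whose closure is compact in \<open>Dp\<close>; L + 1 rather than L ensures a positive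
    constant.\<close>
  have "regular_domain A \<mu> \<Lambda> Lip \<Omega> a D K \<psi> \<rho> r (L + 1) M (\<epsilon> * (2 * \<mu>)) \<beta>"
  proof
    show "open D" "bounded D" "D \<noteq> {}" "0 < r" "compact K" "K \<subseteq> D" by (fact D r K)+
    show "\<Omega> = {z. infdist z (closure D) < 2 * r}" by (rule \<Omega>_def)
    show "continuous_on \<Omega> \<rho>" by (rule continuous_on_subset[OF \<rho>c \<Omega>Dp])
    show "0 < L + 1" using L(1) by simp
    show "\<bar>\<rho> z - \<rho> y\<bar> \<le> (L + 1) * dist z y" if "z \<in> closure D" "dist z y \<le> r" for z y
    proof -
      have "\<bar>\<rho> z - \<rho> y\<bar> \<le> L * dist z y" using L(2)[of z y] that r(1) by simp
      also have "\<dots> \<le> (L + 1) * dist z y" by (intro mult_right_mono) auto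
      finally show ?thesis .
    qed
    show "\<bar>\<rho> z\<bar> \<le> M" if "infdist z (closure D) \<le> r" for z by (rule M[OF that])
    show "\<rho> z < 0" if "z \<in> D" for z by (rule \<rho>(3)[OF that])
    show "\<rho> z = 0" if "z \<in> frontier D" for z by (rule fr[OF that])
    show "0 < \<epsilon> * (2 * \<mu>)" using \<epsilon>(1) pos by simp
    show "\<epsilon> * (2 * \<mu>) * (\<integral>z. w z \<partial>lborel) \<le> (\<integral>z. \<rho> z * Lg A w z \<partial>lborel)" if "C2c \<Omega> w" "\<And>z. 0 \<le> w z" for w
      by (rule weak_strictness[OF _ continuous_on_subset[OF \<rho>c \<Omega>Dp] \<epsilon> that]) (use D(2) D\<Omega> in blast)
    show "0 < \<beta>" by (simp add: \<beta>_def)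
    show "\<beta> * \<rho> z \<le> \<psi> z" if "z \<in> K" for z by (rule \<beta>[OF that])
  qed
  then show thesis by (rule that)
qed

lemma hoelder_on_imp_continuous_on:
  fixes f :: "'a::metric_space \<Rightarrow> real"
  assumes "hoelder_on S f" shows "continuous_on S f"
proof -
  obtain C \<gamma> where C: "0 < C" "0 < \<gamma>" "\<And>z w. z \<in> S \<Longrightarrow> w \<in> S \<Longrightarrow> \<bar>f z - f w\<bar> \<le> C * dist z w powr \<gamma>"
    using assms by (auto simp: hoelder_on_def)
  show ?thesis unfolding continuous_on_def
  proof
    fix x assume x: "x \<in> S"
    have "((\<lambda>y. dist y x) \<longlongrightarrow> dist x x) (at x within S)" by (intro tendsto_intros)
    then have "((\<lambda>y. C * dist y x powr \<gamma>) \<longlongrightarrow> C * 0 powr \<gamma>) (at x within S)"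
      using C(2) by (intro tendsto_mult_left tendsto_powr') (auto simp: eventually_at_filter)
    then have "((\<lambda>y. C * dist y x powr \<gamma>) \<longlongrightarrow> 0) (at x within S)" by simp
    then have "((\<lambda>y. f y - f x) \<longlongrightarrow> 0) (at x within S)"
      by (rule Lim_null_comparison[rotated]) (use C(3) x in \<open>auto simp: eventually_at_filter\<close>)
    then show "(f \<longlongrightarrow> f x) (at x within S)" by (rule LIM_zero_cancel)
  qed
qed

theorem theorem1p3:
  fixes a :: "'n::finite coefmat" and U D K :: "'n cvec set" and \<psi> :: "'n cvec \<Rightarrow> real"
  assumes "alpha_form a U"
    and "closure D \<subseteq> U"
    and "strongly_alpha_regular a U D"
    and "compact K" and "K \<subseteq> D"
    and "hoelder_on K \<psi>"
    and "\<forall>z\<in>K. \<psi> z < 0"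
    and "\<exists>\<psi>t. alpha_sh a D \<psi>t \<and> (\<forall>z\<in>D. \<psi>t z < 0) \<and> (\<forall>z\<in>K. \<psi>t z = ereal (\<psi> z))"
  shows "hoelder_on_ereal D (omega_alpha a K D \<psi>) \<longleftrightarrow>
    (\<exists>C \<gamma> V. C > 0 \<and> 0 < \<gamma> \<and> \<gamma> \<le> 1 \<and> open V \<and> K \<subseteq> V \<and>
       (\<forall>z\<in>V \<inter> D. \<forall>w\<in>K. dist z w = infdist z K \<longrightarrow>
          \<bar>omega_alpha a K D \<psi> z - ereal (\<psi> w)\<bar> \<le> ereal (C * (infdist z K) powr \<gamma>)))"
proof -
  obtain A \<mu> \<Lambda> Lip \<Omega> \<rho> r L\<rho> M\<rho> \<kappa> \<beta> where "regular_domain A \<mu> \<Lambda> Lip \<Omega> a D K \<psi> \<rho> r L\<rho> M\<rho> \<kappa> \<beta>"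
    using regular_domain_exists[OF assms(1,3,4,5) hoelder_on_imp_continuous_on[OF assms(6)]] by blast
  then interpret R: regular_domain A \<mu> \<Lambda> Lip \<Omega> a D K \<psi> \<rho> r L\<rho> M\<rho> \<kappa> \<beta> .
  obtain \<psi>t where \<psi>t: "\<psi>t \<in> U_class a K D \<psi>" "\<And>z. z \<in> K \<Longrightarrow> \<psi>t z = ereal (\<psi> z)"
    using assms(8) by (auto simp: U_class_def)
  have \<omega>K: "R.om w = \<psi> w" if w: "w \<in> K" for w
  proof -
    have wD: "w \<in> D" using w assms(5) by blast
    have "omega_alpha a K D \<psi> w \<le> ereal (\<psi> w)" unfolding omega_alpha_def using w by (intro SUP_least) (auto simp: U_class_def)
    then show ?thesis using R.class_le_om[OF \<psi>t(1) wD] \<psi>t(2)[OF w] R.\<omega>_bounds(3)[OF wD] by simp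
  qed
  have hoelder_iff: "hoelder_on_ereal D (omega_alpha a K D \<psi>) \<longleftrightarrow> hoelder_on D R.om"
  proof -
    have "\<bar>omega_alpha a K D \<psi> z\<bar> \<noteq> \<infinity>" if "z \<in> D" for z
      using R.\<omega>_bounds(1,2)[OF that] by (cases "omega_alpha a K D \<psi> z") auto
    then show ?thesis by (simp add: hoelder_on_ereal_def R.om_def[abs_def])
  qed
  show ?thesis
  proof
    assume "hoelder_on_ereal D (omega_alpha a K D \<psi>)"
    then obtain C \<gamma> where C: "0 < C" "0 < \<gamma>" "\<gamma> \<le> 1" "\<And>z w. z \<in> D \<Longrightarrow> w \<in> D \<Longrightarrow> \<bar>R.om z - R.om w\<bar> \<le> C * dist z w powr \<gamma>"
      unfolding hoelder_iff by (auto simp: hoelder_on_def)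
    \<comment> \<open>Both points lie in D and their distance is the distance to K, so the estimate
      holds on all of D and V may be the whole space.\<close>
    have "\<bar>omega_alpha a K D \<psi> z - ereal (\<psi> w)\<bar> \<le> ereal (C * infdist z K powr \<gamma>)"
      if "z \<in> D" "w \<in> K" "dist z w = infdist z K" for z w
    proof -
      have "w \<in> D" using that(2) assms(5) by blast
      then show ?thesis using C(4)[OF that(1), of w] \<omega>K[OF that(2)] R.\<omega>_bounds(3)[OF that(1)] that(3) by simp
    qed
    then show "\<exists>C \<gamma> V. C > 0 \<and> 0 < \<gamma> \<and> \<gamma> \<le> 1 \<and> open V \<and> K \<subseteq> V \<and>
       (\<forall>z\<in>V \<inter> D. \<forall>w\<in>K. dist z w = infdist z K \<longrightarrow>
          \<bar>omega_alpha a K D \<psi> z - ereal (\<psi> w)\<bar> \<le> ereal (C * (infdist z K) powr \<gamma>))"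
      using C(1-3) by (intro exI[of _ C] exI[of _ \<gamma>] exI[of _ UNIV]) auto
  next
    assume "\<exists>C \<gamma> V. C > 0 \<and> 0 < \<gamma> \<and> \<gamma> \<le> 1 \<and> open V \<and> K \<subseteq> V \<and>
       (\<forall>z\<in>V \<inter> D. \<forall>w\<in>K. dist z w = infdist z K \<longrightarrow>
          \<bar>omega_alpha a K D \<psi> z - ereal (\<psi> w)\<bar> \<le> ereal (C * (infdist z K) powr \<gamma>))"
    then obtain C \<gamma> V where V: "open V" "K \<subseteq> V" "0 < C" "0 < \<gamma>" "\<gamma> \<le> 1"
      "\<And>z w. z \<in> V \<inter> D \<Longrightarrow> w \<in> K \<Longrightarrow> dist z w = infdist z K \<Longrightarrow>
          \<bar>omega_alpha a K D \<psi> z - ereal (\<psi> w)\<bar> \<le> ereal (C * infdist z K powr \<gamma>)"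
      by blast
    show "hoelder_on_ereal D (omega_alpha a K D \<psi>)"
      unfolding hoelder_iff by (rule R.hoelder_of_boundary_estimate[OF assms(6) V])
  qed
qed

end
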